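(* Let $\Phi\in\mathcal{G}_0$ and suppose the composition-differentiation operator $D_\Phi f=f'\circ\Phi$ is bounded on $\mathcal{H}^2$. Then for every $\delta>0$ there is a constant $C=C(\delta)$ such that $$\frac{M_\Phi(w)}{(\Re(w)-\frac12)^3}<C$$ for every $w\in\mathbb{C}_{1/2}$ not lying in the open disk $\mathbb{D}(\Phi(+\infty),\delta)$ of center $\Phi(+\infty)$ and radius $\delta$. In particular, if $D_\Phi$ is compact on $\mathcal{H}^2$, then $\lim_{\Re(w)\to\frac12^+}M_\Phi(w)/(\Re(w)-\frac12)^3=0$.
   Context: $\mathbb{C}_\theta=\{s:\Re s>\theta\}$. $\mathcal{H}^2$ is the Hilbert space of Dirichlet series $f(s)=\sum_{n\ge1}a_nn^{-s}$ with $\|f\|_{\mathcal{H}^2}^2=\sum_n|a_n|^2<\infty$. $\mathcal{G}_0$ is the class of maps $\Phi(s)=\sum_{n\ge1}c_nn^{-s}$ where the series converges uniformly in $\mathbb{C}_\epsilon$ for every $\epsilon>0$ and $\Phi(\mathbb{C}_0)\subset\mathbb{C}_{1/2}$; $\Phi(+\infty)=c_1$. For $w\in\mathbb{C}_{1/2}$, $w\neq\Phi(+\infty)$, the mean counting function is $$M_\Phi(w)=\lim_{\sigma\to0^+}\lim_{T\to\infty}\frac{\pi}{T}\sum_{\substack{s\in\Phi^{-1}(\{w\})\\ |\Im s|<T,\ \sigma<\Re s<\infty}}\Re(s).$$ *)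

theory Defs
  imports "HOL-Analysis.Analysis"
begin

text \<open>Coefficient sequences are indexed by n \<ge> 1; the value at index 0 is ignored.
  An element of H^2 is represented by its coefficient sequence.\<close>

definition h2 :: "(nat \<Rightarrow> complex) \<Rightarrow> bool" where
  "h2 a \<longleftrightarrow> summable (\<lambda>n. (cmod (a (Suc n)))\<^sup>2)"

definition h2norm :: "(nat \<Rightarrow> complex) \<Rightarrow> real" where
  "h2norm a = sqrt (\<Sum>n. (cmod (a (Suc n)))\<^sup>2)"

definition dirichlet :: "(nat \<Rightarrow> complex) \<Rightarrow> complex \<Rightarrow> complex" where
  "dirichlet a s = (\<Sum>n. a (Suc n) * of_nat (Suc n) powr (- s))"

text \<open>Class G_0 with coefficient sequence c (so that Phi(+infinity) = c 1).\<close>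
definition G0 :: "(complex \<Rightarrow> complex) \<Rightarrow> (nat \<Rightarrow> complex) \<Rightarrow> bool" where
  "G0 \<Phi> c \<longleftrightarrow>
     (\<forall>\<epsilon>>0. uniform_limit {s. Re s > \<epsilon>}
        (\<lambda>N s. \<Sum>n<N. c (Suc n) * of_nat (Suc n) powr (- s)) \<Phi> sequentially) \<and>
     (\<forall>s. Re s > 0 \<longrightarrow> Re (\<Phi> s) > 1/2)"

definition DPhi_image :: "(complex \<Rightarrow> complex) \<Rightarrow> (nat \<Rightarrow> complex) \<Rightarrow> (nat \<Rightarrow> complex) \<Rightarrow> bool" where
  "DPhi_image \<Phi> a b \<longleftrightarrow> h2 b \<and>
     (\<forall>s. Re s > 1/2 \<longrightarrow> dirichlet b s = deriv (dirichlet a) (\<Phi> s))"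

definition DPhi_bounded :: "(complex \<Rightarrow> complex) \<Rightarrow> bool" where
  "DPhi_bounded \<Phi> \<longleftrightarrow>
     (\<exists>C. \<forall>a. h2 a \<longrightarrow> (\<exists>b. DPhi_image \<Phi> a b \<and> h2norm b \<le> C * h2norm a))"

definition DPhi_compact :: "(complex \<Rightarrow> complex) \<Rightarrow> bool" where
  "DPhi_compact \<Phi> \<longleftrightarrow> DPhi_bounded \<Phi> \<and>
     (\<forall>(A::nat \<Rightarrow> nat \<Rightarrow> complex) B. (\<forall>k. h2 (A k) \<and> h2norm (A k) \<le> 1 \<and> DPhi_image \<Phi> (A k) (B k)) \<longrightarrow>
        (\<exists>r g. strict_mono r \<and> h2 g \<and>
           (\<lambda>k. h2norm (\<lambda>n. B (r k) n - g n)) \<longlonglongrightarrow> 0))"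

definition mean_counting :: "(complex \<Rightarrow> complex) \<Rightarrow> complex \<Rightarrow> real" where
  "mean_counting \<Phi> w =
     Lim (at_right 0) (\<lambda>\<sigma>::real.
       Lim at_top (\<lambda>T::real. pi / T *
         (\<Sum>s\<in>{s. \<Phi> s = w \<and> \<bar>Im s\<bar> < T \<and> \<sigma> < Re s}. Re s)))"

end

theory Submission
  imports Defs "HOL-Complex_Analysis.Complex_Analysis" "HOL-Probability.Probability" "HOL-Real_Asymp.Real_Asymp"
begin

text \<open>Both limits defining \<open>mean_counting\<close> have to be shown to exist, since \<open>Lim\<close> is unspecified otherwise.
  Smoothing the zero count with a tent function in \<open>Im s\<close> turns the inner one into a time average along the
  Kronecker flow of a function on the infinite torus. Zeros on the line \<open>Re s = \<sigma>\<close> make that function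
  discontinuous, but only on a null set, so Weyl equidistribution still applies.

  For the bound, let \<open>f\<close> be a normalised block of the reproducing kernel at \<open>w\<close> with frequencies from \<open>N\<close> to
  \<open>N\<^sup>2\<close>, \<open>ln N\<close> being about \<open>1 / (Re w - 1/2)\<close>, and put \<open>E s = f' (\<Phi> s) / f' w\<close>. Every solution of
  \<open>\<Phi> s = w\<close> is a zero of \<open>1 - E\<^sup>2\<close>. Jensen's inequality in the half plane, averaged over vertical
  translations, bounds the mean counting function by a multiple of the mean square of \<open>E\<close>, which is at most
  the square of \<open>\<parallel>D f\<parallel> / \<bar>f' w\<bar>\<close>, and \<open>\<bar>f' w\<bar>\<^sup>-\<^sup>2\<close> is of order \<open>(Re w - 1/2) ^ 3\<close>. The exponent 2 on \<open>E\<close> is what makes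
  \<open>ln \<bar>1 - E\<^sup>2\<bar>\<close> at the base point quadratic in \<open>E\<close>. When \<open>D\<close> is compact, \<open>\<parallel>D f\<parallel>\<close> tends to 0 because \<open>f\<close> tends
  weakly to 0. For \<open>w\<close> far from the line \<open>Re w = 1/2\<close> the Blaschke quotient
  \<open>(\<Phi> - w) / (\<Phi> + cnj w - 1)\<close> in place of \<open>1 - E\<^sup>2\<close> gives a bound linear in \<open>Re w - 1/2\<close>.\<close>

section \<open>Zeros of holomorphic functions\<close>

text \<open>The defining sum runs over distinct solutions, so the torus function also jumps where
  solutions merge. What is holomorphic, in one torus coordinate at a time, is a discriminant built
  from power sums of zeros. It replaces analytic geometry in infinitely many variables: exceptional
  sets are shown to be null coordinate by coordinate, through Fubini.

  In the bound, the obstacle is that the image series is identified with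
  \<open>f' (\<Phi> s)\<close> only on \<open>Re s > 1/2\<close>, while the circles of Jensen's
  inequality come close to \<open>Re s = 0\<close>. On every half plane
  \<open>Re s \<ge> \<epsilon>\<close> the composite is a uniform limit of Dirichlet polynomials
  whose coefficients can be compared with the image on \<open>Re s = 1\<close>; so the mean square
  over any vertical line in \<open>Re s > 0\<close> is still controlled by the norm of the image.
  Since only an upper bound for the count is wanted, a one-sided Jensen inequality with the mean of
  the modulus suffices, and no logarithm is integrated.\<close>

lemma norm_le_circle_mean:
  assumes q: "q holomorphic_on ball 0 R" and r: "0 < r" "r < R"
  shows "norm (q 0) \<le> integral {0..1} (\<lambda>t. norm (q (of_real r * cis (2*pi*t))))"
proof -
  have sub: "cball 0 r \<subseteq> ball (0::complex) R" using r by auto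
  have cont: "continuous_on (cball 0 r) q"
    using holomorphic_on_imp_continuous_on[OF q] sub continuous_on_subset by blast
  have "((\<lambda>u. q u / (u - 0)) has_contour_integral (2 * of_real pi * \<i> * q 0)) (circlepath 0 r)"
    by (rule Cauchy_integral_circlepath) (use cont q r sub in \<open>auto intro: holomorphic_on_subset\<close>)
  hence "((\<lambda>x. q (circlepath 0 r x) / (circlepath 0 r x) * (vector_derivative (circlepath 0 r) (at x within {0..1}))) has_integral
          (2 * of_real pi * \<i> * q 0)) {0..1}"
    by (simp add: has_contour_integral_def)
  hence "((\<lambda>x. 2 * of_real pi * \<i> * q (of_real r * cis (2*pi*x))) has_integral (2 * of_real pi * \<i> * q 0)) {0..1}"
  proof (rule has_integral_eq[rotated])
    fix x :: real assume x: "x \<in> {0..1}"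
    show "q (circlepath 0 r x) / circlepath 0 r x * vector_derivative (circlepath 0 r) (at x within {0..1}) =
        2 * complex_of_real pi * \<i> * q (complex_of_real r * cis (2 * pi * x))"
      using x r by (simp add: vector_derivative_circlepath01) (simp add: circlepath cis_conv_exp algebra_simps)
  qed
  hence "((\<lambda>x. inverse (2 * of_real pi * \<i>) * (2 * of_real pi * \<i> * q (of_real r * cis (2*pi*x)))) has_integral
         inverse (2 * of_real pi * \<i>) * (2 * of_real pi * \<i> * q 0)) {0..1}"
    by (rule has_integral_mult_right)
  hence I: "((\<lambda>x. q (of_real r * cis (2*pi*x))) has_integral q 0) {0..1}"
    by (simp add: field_simps)
  have c: "continuous_on {0..1} (\<lambda>t. q (of_real r * cis (2*pi*t)))"
    by (rule continuous_on_compose2[OF cont]) (use r in \<open>auto intro!: continuous_intros simp: norm_mult\<close>)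
  have "norm (integral {0..1} (\<lambda>x. q (of_real r * cis (2*pi*x)))) \<le> integral {0..1} (\<lambda>t. norm (q (of_real r * cis (2*pi*t))))"
    by (rule integral_norm_bound_integral) (use c in \<open>auto intro!: integrable_continuous_real continuous_intros\<close>)
  thus ?thesis using I by (simp add: integral_unique)
qed

text \<open>Trading the factor \<open>z - a\<close> of a zero for
  \<open>(r^2 - cnj a * z) / r\<close> keeps the modulus on \<open>norm z = r\<close> and multiplies
  the modulus at 0 by \<open>r / norm a\<close>; when all zeros are traded, the mean value property
  remains. Bounding by the mean of \<open>norm q\<close> rather than of its logarithm allows zeros
  on the circle.\<close>

lemma jensen_prod:
  assumes "finite S" "q holomorphic_on ball 0 R" "0 < r" "r < R" "S \<subseteq> ball 0 r - {0}" "\<And>z. z \<in> S \<Longrightarrow> q z = 0"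
  shows "norm (q 0) * (\<Prod>z\<in>S. r / norm z) \<le> integral {0..1} (\<lambda>t. norm (q (of_real r * cis (2*pi*t))))"
  using assms
proof (induction S arbitrary: q rule: finite_induct)
  case empty
  then show ?case using norm_le_circle_mean[of q R r] by simp
next
  case (insert a S)
  define q1 where "q1 = (\<lambda>z. if z = a then deriv q a else (q z - q a) / (z - a))"
  have q1: "q1 holomorphic_on ball 0 R"
    unfolding q1_def by (rule pole_lemma_open) (use insert in auto)
  have qa: "q a = 0" and a: "a \<noteq> 0" "norm a < r" using insert.prems by auto
  have qq: "q z = (z - a) * q1 z" for z by (auto simp: q1_def qa)
  define q2 where "q2 = (\<lambda>z. q1 z * ((of_real r)^2 - cnj a * z) / of_real r)"
  have q2: "q2 holomorphic_on ball 0 R"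
    unfolding q2_def using \<open>0 < r\<close> by (intro holomorphic_intros q1) auto
  have eq: "norm (q2 z) = norm (q z)" if "norm z = r" for z
  proof -
    have "(of_real r)^2 = z * cnj z" using complex_norm_square[of z] that by simp
    hence "(of_real r)^2 - cnj a * z = z * cnj (z - a)" by (simp add: algebra_simps)
    hence "norm ((of_real r)^2 - cnj a * z) = r * norm (z - a)"
      by (simp only: norm_mult that complex_mod_cnj)
    thus ?thesis using insert.prems(2) by (simp add: q2_def qq norm_mult norm_divide)
  qed
  have "norm (q2 0) * (\<Prod>z\<in>S. r / norm z) \<le> integral {0..1} (\<lambda>t. norm (q2 (of_real r * cis (2*pi*t))))"
  proof (rule insert.IH)
    show "q2 z = 0" if "z \<in> S" for z
      using insert.prems(5)[of z] insert.hyps that qq[of z] by (auto simp: q2_def)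
  qed (use insert q2 in auto)
  also have "\<dots> = integral {0..1} (\<lambda>t. norm (q (of_real r * cis (2*pi*t))))"
    using insert.prems(2) by (intro integral_cong eq) (auto simp: norm_mult)
  also have "norm (q2 0) = norm (q 0) * (r / norm a)"
    using insert.prems(2) a by (simp add: q2_def qq[of 0] norm_mult norm_divide power2_eq_square)
  finally show ?case using insert.hyps by (simp add: mult.assoc)
qed

text \<open>Joint continuity makes \<open>h x\<close> uniformly close to \<open>h x0\<close> on a
  compact disc, and Cauchy's inequality turns this into closeness of the derivatives on a smaller
  disc.\<close>

lemma deriv_param_continuous:
  fixes h :: "'a::metric_space \<Rightarrow> complex \<Rightarrow> complex"
  assumes c: "continuous_on (X \<times> V) (\<lambda>(x,s). h x s)" and V: "open V" and hol: "\<And>x. x \<in> X \<Longrightarrow> h x holomorphic_on V"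
  shows "continuous_on (X \<times> V) (\<lambda>(x,s). deriv (h x) s)"
  unfolding continuous_on_iff
proof (intro ballI allI impI, clarify)
  fix x0 s0 and e :: real assume x0: "x0 \<in> X" and s0: "s0 \<in> V" and e: "e > 0"
  obtain r0 where r0: "r0 > 0" "cball s0 r0 \<subseteq> V" using V s0 open_contains_cball by blast
  define r where "r = r0/2"
  have r: "r > 0" "r0 = 2*r" using r0 by (auto simp: r_def)
  have sub: "cball s r \<subseteq> cball s0 r0" if "dist s s0 \<le> r" for s
    using that r by (smt (verit, best) dist_commute dist_triangle mem_cball subset_iff)
  obtain X0 where X0: "x0 \<in> X0" "open X0" "\<forall>x\<in>X0 \<inter> X. \<forall>t\<in>cball s0 r0. dist (h x t) (h x0 t) \<le> e*r/2"
  proof (rule continuous_on_prod_compactE[of X "cball s0 r0" "\<lambda>(x,s). h x s" x0 "e*r/2"])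
    show "continuous_on (X \<times> cball s0 r0) (\<lambda>(x, s). h x s)" using c r0 by (rule_tac continuous_on_subset) auto
  qed (use x0 e r in auto)
  obtain d1 where d1: "d1 > 0" "ball x0 d1 \<subseteq> X0" using X0 open_contains_ball by blast
  have "continuous_on V (deriv (h x0))"
    using holomorphic_deriv[OF hol[OF x0] V] holomorphic_on_imp_continuous_on by blast
  then obtain d2 where d2: "d2 > 0" "\<forall>s\<in>V. dist s s0 < d2 \<longrightarrow> dist (deriv (h x0) s) (deriv (h x0) s0) < e/2"
    using s0 e unfolding continuous_on_iff by (meson half_gt_zero)
  define d where "d = min r (min d1 d2)"
  have "d > 0" using d1 d2 r by (auto simp: d_def)
  moreover have "dist (case y of (x, s) \<Rightarrow> deriv (h x) s) (deriv (h x0) s0) < e"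
    if y: "y \<in> X \<times> V" "dist y (x0,s0) < d" for y
  proof -
    obtain x s where xs: "y = (x,s)" by fastforce
    have dx: "dist x x0 < d" "dist s s0 < d"
      using y dist_fst_le[of y "(x0,s0)"] dist_snd_le[of y "(x0,s0)"] by (auto simp: xs)
    have xX: "x \<in> X" "s \<in> V" using y xs by auto
    have sb: "cball s r \<subseteq> V" using sub[of s] dx r0 by (auto simp: d_def)
    have "x \<in> X0" using dx d1 by (auto simp: d_def dist_commute)
    have hd: "(\<lambda>t. h x t - h x0 t) holomorphic_on V" by (intro holomorphic_intros hol xX x0)
    have "norm ((deriv ^^ 1) (\<lambda>t. h x t - h x0 t) s) \<le> fact 1 * (e*r/2) / r ^ 1"
    proof (rule Cauchy_inequality)
      show "(\<lambda>t. h x t - h x0 t) holomorphic_on ball s r"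
        using hd sb ball_subset_cball holomorphic_on_subset by blast
      show "continuous_on (cball s r) (\<lambda>t. h x t - h x0 t)"
        using hd sb holomorphic_on_imp_continuous_on continuous_on_subset by blast
      show "cmod (h x t - h x0 t) \<le> e*r/2" if "cmod (s - t) = r" for t
      proof -
        have "t \<in> cball s0 r0" using sub[of s] dx that by (auto simp: d_def dist_norm)
        thus ?thesis using X0(3) \<open>x \<in> X0\<close> xX by (auto simp: dist_norm)
      qed
    qed (use r in auto)
    moreover have "deriv (\<lambda>t. h x t - h x0 t) s = deriv (h x) s - deriv (h x0) s"
      using hol[OF xX(1)] hol[OF x0] xX V by (intro deriv_diff) (auto simp: holomorphic_on_imp_differentiable_at)
    ultimately have "dist (deriv (h x) s) (deriv (h x0) s) \<le> e/2"
      using r by (simp add: dist_norm field_simps)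
    moreover have "dist (deriv (h x0) s) (deriv (h x0) s0) < e/2" using d2 xX dx by (auto simp: d_def)
    ultimately have "dist (deriv (h x) s) (deriv (h x0) s0) < e"
      using dist_triangle[of "deriv (h x) s" "deriv (h x0) s0" "deriv (h x0) s"] by linarith
    thus ?thesis by (simp add: xs)
  qed
  ultimately show "\<exists>d>0. \<forall>x'\<in>X \<times> V. dist x' (x0, s0) < d \<longrightarrow>
             dist (case x' of (x, s) \<Rightarrow> deriv (h x) s) (deriv (h x0) s0) < e" by blast
qed

lemma contour_integral_circlepath_eq:
  assumes "r > 0"
  shows "contour_integral (circlepath z r) f =
    integral {0..1} (\<lambda>t. f (z + of_real r * cis (2*pi*t)) * (2 * of_real pi * \<i> * of_real r * cis (2*pi*t)))"
  unfolding contour_integral_integral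
  by (rule integral_cong) (simp add: vector_derivative_circlepath, simp add: circlepath cis_conv_exp algebra_simps)

lemma continuous_param_circle:
  fixes k :: "'a::metric_space \<Rightarrow> complex \<Rightarrow> complex"
  assumes r: "0 < r" and c: "continuous_on (X \<times> sphere z r) (\<lambda>(x,s). k x s)"
  shows "continuous_on X (\<lambda>x. contour_integral (circlepath z r) (k x))"
proof -
  have "continuous_on X (\<lambda>x. integral (cbox 0 1) (\<lambda>t. k x (z + of_real r * cis (2*pi*t)) * (2 * of_real pi * \<i> * of_real r * cis (2*pi*t))))"
  proof (rule integral_continuous_on_param)
    have "continuous_on (X \<times> cbox 0 1) (\<lambda>p. (\<lambda>(x,s). k x s) (fst p, z + of_real r * cis (2*pi * snd p)))"
      by (rule continuous_on_compose2[OF c]) (use r in \<open>auto intro!: continuous_intros simp: dist_norm norm_mult\<close>)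
    thus "continuous_on (X \<times> cbox 0 1) (\<lambda>(x, t). k x (z + of_real r * cis (2*pi*t)) * (2 * of_real pi * \<i> * of_real r * cis (2*pi*t)))"
      unfolding split_def fst_conv snd_conv by (intro continuous_intros)
  qed
  thus ?thesis using r by (simp add: contour_integral_circlepath_eq)
qed

text \<open>Differentiation under the integral. The continuity of the derivative that it requires is
  \<open>deriv_param_continuous\<close> with the roles of parameter and variable exchanged.\<close>

lemma holomorphic_param_circle:
  fixes k :: "complex \<Rightarrow> complex \<Rightarrow> complex"
  assumes r: "0 < r" and W: "open W" "convex W" and c: "continuous_on (W \<times> sphere z r) (\<lambda>(x,s). k x s)"
    and hol: "\<And>s. s \<in> sphere z r \<Longrightarrow> (\<lambda>x. k x s) holomorphic_on W"
  shows "(\<lambda>x. contour_integral (circlepath z r) (k x)) holomorphic_on W"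
proof -
  let ?p = "\<lambda>t. z + of_real r * cis (2*pi*t)"
  let ?w = "\<lambda>t. (2 * of_real pi * \<i> * of_real r * cis (2*pi*t))"
  have ps: "?p t \<in> sphere z r" for t using r by (auto simp: dist_norm norm_mult)
  have "continuous_on (sphere z r \<times> W) (\<lambda>p. (\<lambda>(x,s). k x s) (snd p, fst p))"
    by (rule continuous_on_compose2[OF c]) (auto intro!: continuous_intros)
  hence "continuous_on (sphere z r \<times> W) (\<lambda>(s,x). k x s)" by (simp add: split_def)
  hence cd: "continuous_on (sphere z r \<times> W) (\<lambda>(s,x). deriv (\<lambda>x. k x s) x)"
    by (rule deriv_param_continuous) (use W hol in auto)
  have "(\<lambda>x. integral (cbox 0 1) (\<lambda>t. k x (?p t) * ?w t)) holomorphic_on W"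
  proof (rule leibniz_rule_holomorphic)
    show "((\<lambda>x. k x (?p t) * ?w t) has_field_derivative deriv (\<lambda>x. k x (?p t)) x * ?w t) (at x within W)"
      if "x \<in> W" for x t
    proof -
      have "((\<lambda>x. k x (?p t)) has_field_derivative deriv (\<lambda>x. k x (?p t)) x) (at x)"
        using holomorphic_derivI[OF hol[OF ps] W(1) that] .
      thus ?thesis by (intro DERIV_cmult_right) (rule has_field_derivative_at_within)
    qed
    show "(\<lambda>t. k x (?p t) * ?w t) integrable_on cbox 0 1" if "x \<in> W" for x
    proof (rule integrable_continuous, intro continuous_intros)
      have "continuous_on (cbox 0 1) (\<lambda>t. (\<lambda>(x,s). k x s) (x, ?p t))"
        by (rule continuous_on_compose2[OF c]) (use that ps in \<open>auto intro!: continuous_intros\<close>)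
      thus "continuous_on (cbox 0 1) (\<lambda>t. k x (?p t))" by simp
    qed
    have "continuous_on (W \<times> cbox 0 1) (\<lambda>p. (\<lambda>(s,x). deriv (\<lambda>x. k x s) x) (?p (snd p), fst p))"
      by (rule continuous_on_compose2[OF cd]) (use ps in \<open>auto intro!: continuous_intros\<close>)
    thus "continuous_on (W \<times> cbox (0::real) 1) (\<lambda>(x, t). deriv (\<lambda>x. k x (?p t)) x * ?w t)"
      unfolding split_def fst_conv snd_conv by (intro continuous_intros)
  qed (use W in auto)
  thus ?thesis using r by (simp add: contour_integral_circlepath_eq)
qed

section \<open>Zeros in a disc: argument principle and discriminant\<close>

lemma cball_subset_open_enlarge:
  fixes z :: complex
  assumes "open V" "cball z r \<subseteq> V" "0 \<le> r"
  obtains R where "r < R" "ball z R \<subseteq> V"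
proof -
  obtain d where d: "d > 0" "\<And>x y. x \<in> cball z r \<Longrightarrow> y \<in> - V \<Longrightarrow> d \<le> dist x y"
  proof -
    have "cball z r \<inter> - V = {}" using assms by blast
    thus ?thesis using separate_compact_closed[OF compact_cball, of "- V" z r] assms(1) that by blast
  qed
  have "ball z (r + d) \<subseteq> V"
  proof
    fix s assume s: "s \<in> ball z (r+d)"
    show "s \<in> V"
    proof (rule ccontr)
      assume sV: "s \<notin> V"
      define D where "D = dist z s"
      have D: "D > r" using sV assms by (force simp: D_def)
      define t where "t = z + (r / D) *\<^sub>R (s - z)"
      have "norm (s - z) = D" by (simp add: D_def dist_norm norm_minus_commute)
      hence tz: "t \<in> cball z r" using D assms(3) by (simp add: t_def dist_norm)
      have "s - t = (1 - r / D) *\<^sub>R (s - z)" by (simp add: t_def algebra_simps)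
      hence "dist t s = \<bar>1 - r / D\<bar> * D"
        using \<open>norm (s - z) = D\<close> by (simp add: dist_norm norm_minus_commute[of t])
      also have "\<dots> = D - r" using D assms(3) by (simp add: field_simps)
      finally have "dist t s < d" using s by (simp add: D_def)
      thus False using d(2)[OF tz] sV by force
    qed
  qed
  thus ?thesis using that[of "r + d"] d(1) by auto
qed

lemma finite_zeros_cball:
  assumes "h holomorphic_on V" "open V" "cball z r \<subseteq> V" "s0 \<in> cball z r" "h s0 \<noteq> 0"
  shows "finite {s \<in> cball z r. h s = 0}"
proof -
  have r: "r \<ge> 0" using assms(4) zero_le_dist[of z s0] by (auto simp del: zero_le_dist)
  obtain R where R: "r < R" "ball z R \<subseteq> V" using cball_subset_open_enlarge assms r by metis
  have "\<not> s islimpt {s \<in> cball z r. h s = 0}" if s: "s \<in> cball z r" for s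
  proof
    assume l: "s islimpt {s \<in> cball z r. h s = 0}"
    have "h s0 = 0"
    proof (rule analytic_continuation[of h "ball z R" "{s \<in> cball z r. h s = 0}" s s0])
      show "h holomorphic_on ball z R" using assms R holomorphic_on_subset by blast
    qed (use assms R s l in auto)
    thus False using assms by simp
  qed
  from finite_not_islimpt_in_compact[OF compact_cball this]
  have "finite (cball z r \<inter> {s \<in> cball z r. h s = 0})" .
  moreover have "cball z r \<inter> {s \<in> cball z r. h s = 0} = {s \<in> cball z r. h s = 0}" by auto
  ultimately show ?thesis by simp
qed

text \<open>Argument principle with weight \<open>s ^ e\<close>. Power sums of the zeros become
  contour integrals over a circle free of zeros, and in this form they depend holomorphically on a
  parameter.\<close>

lemma zeros_power_sum:
  assumes h: "h holomorphic_on V" and V: "open V" "cball z r \<subseteq> V" and r: "0 < r"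
    and nz: "\<And>s. s \<in> sphere z r \<Longrightarrow> h s \<noteq> 0"
  shows "contour_integral (circlepath z r) (\<lambda>s. deriv h s * s ^ e / h s) =
     2 * of_real pi * \<i> * (\<Sum>p\<in>{s\<in>ball z r. h s = 0}. p ^ e * of_int (zorder h p))"
proof -
  obtain R where R: "r < R" "ball z R \<subseteq> V" using cball_subset_open_enlarge[OF V] r by auto
  \<comment> \<open>A radius strictly between \<open>r\<close> and \<open>R\<close>: the zeros in
    \<open>cball z R'\<close> are finitely many by compactness, and those outside
    \<open>cball z r\<close> drop out with winding number 0.\<close>
  define R' where "R' = (r + R) / 2"
  have R': "r < R'" "R' < R" using R by (auto simp: R'_def field_simps)
  have s0: "z + of_real r \<in> sphere z r" using r by (auto simp: dist_norm)
  define pz where "pz = {w \<in> ball z R'. h w = 0 \<or> w \<in> {}}"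
  have "finite {s \<in> cball z R'. h s = 0}"
    by (rule finite_zeros_cball[OF h V(1), where ?s0.0 = "z + of_real r"])
       (use R R' s0 nz r in \<open>auto simp: dist_norm\<close>)
  hence fin: "finite pz" unfolding pz_def by (rule rev_finite_subset) auto
  have "contour_integral (circlepath z r) (\<lambda>s. deriv h s * s ^ e / h s) =
      2 * pi * \<i> * (\<Sum>p\<in>pz. winding_number (circlepath z r) p * p ^ e * zorder h p)"
    unfolding pz_def
  proof (rule argument_principle)
    show "h holomorphic_on ball z R' - {}" proof -
      have "ball z R' \<subseteq> V" using R R' by (meson less_imp_le order_trans subset_ball)
      thus ?thesis using h holomorphic_on_subset by auto
    qed
    show "path_image (circlepath z r) \<subseteq> ball z R' - {w \<in> ball z R'. h w = 0 \<or> w \<in> {}}"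
      using r R' nz by auto
    show "\<forall>w. w \<notin> ball z R' \<longrightarrow> winding_number (circlepath z r) w = 0"
    proof (intro allI impI)
      fix w assume w: "w \<notin> ball z R'"
      show "winding_number (circlepath z r) w = 0"
        by (rule winding_number_zero_outside[of _ "cball z r"]) (use w R' r in auto)
    qed
    show "finite {w \<in> ball z R'. h w = 0 \<or> w \<in> {}}" using fin by (simp add: pz_def)
  qed (auto intro!: holomorphic_intros)
  also have "(\<Sum>p\<in>pz. winding_number (circlepath z r) p * p ^ e * zorder h p) =
     (\<Sum>p\<in>{s\<in>ball z r. h s = 0}. p ^ e * of_int (zorder h p))"
  proof (rule sum.mono_neutral_cong_right[OF fin])
    show "{s \<in> ball z r. h s = 0} \<subseteq> pz" using R' by (auto simp: pz_def)
    show "\<forall>p\<in>pz - {s \<in> ball z r. h s = 0}. winding_number (circlepath z r) p * p ^ e * of_int (zorder h p) = 0"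
    proof
      fix p assume p: "p \<in> pz - {s \<in> ball z r. h s = 0}"
      hence "dist z p \<noteq> r" using nz by (auto simp: pz_def)
      hence "p \<notin> cball z r" using p by (auto simp: pz_def)
      hence "winding_number (circlepath z r) p = 0"
        by (intro winding_number_zero_outside[of _ "cball z r"]) (use r in auto)
      thus "winding_number (circlepath z r) p * p ^ e * of_int (zorder h p) = 0" by simp
    qed
    show "winding_number (circlepath z r) p * p ^ e * of_int (zorder h p) = p ^ e * of_int (zorder h p)"
      if "p \<in> {s \<in> ball z r. h s = 0}" for p
      using that by (subst winding_number_circlepath) (auto simp: dist_norm norm_minus_commute)
  qed
  finally show ?thesis by simp
qed

lemma zorder_zero_pos:
  assumes h: "h holomorphic_on V" and V: "open V" "cball z r \<subseteq> V"
    and nz: "\<And>s. s \<in> sphere z r \<Longrightarrow> h s \<noteq> 0" and p: "p \<in> ball z r" "h p = 0"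
  shows "zorder h p > 0"
proof -
  have r: "r > 0" using p(1) by (metis dist_not_less_zero dual_order.strict_trans2 mem_ball not_le)
  have "h analytic_on {p}" using h V p by (intro analytic_at[THEN iffD2] exI[of _ V]) (auto simp: subset_iff)
  moreover have "\<exists>\<^sub>F w in at p. h w \<noteq> 0"
  proof (rule ccontr)
    assume "\<not> ?thesis"
    hence "\<forall>\<^sub>F w in at p. h w = 0" by (simp add: frequently_def)
    then obtain d where d: "d > 0" "\<And>w. w \<noteq> p \<Longrightarrow> dist w p < d \<Longrightarrow> h w = 0"
      by (auto simp: eventually_at)
    obtain R where R: "r < R" "ball z R \<subseteq> V" using cball_subset_open_enlarge[OF V] r by auto
    have "h (z + of_real r) = 0"
    proof (rule analytic_continuation_open[of "ball p d \<inter> ball z R" "ball z R" h "\<lambda>_. 0"])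
      have "p \<in> ball p d \<inter> ball z R" using p d R by auto
      thus "ball p d \<inter> ball z R \<noteq> {}" by blast
      show "h holomorphic_on ball z R" using h R holomorphic_on_subset by blast
      show "h w = 0" if "w \<in> ball p d \<inter> ball z R" for w
        using d(2)[of w] that p by (cases "w = p") (auto simp: dist_commute)
    qed (use R r in \<open>auto simp: dist_norm\<close>)
    thus False using nz[of "z + of_real r"] r by (auto simp: dist_norm)
  qed
  ultimately show ?thesis using p zorder_pos_iff' by blast
qed

text \<open>The function \<open>g\<close> is a weighted discriminant: the sum over all \<open>R\<close>-tuples of zeros of the product of
  the differences. It is a polynomial in the power sums of the zeros, hence holomorphic.\<close>

lemma discriminant_holomorphic:
  fixes h :: "complex \<Rightarrow> complex \<Rightarrow> complex"
  assumes W: "open W" "convex W" and V: "open V" "cball z r \<subseteq> V" and r: "0 < r"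
    and c: "continuous_on (W \<times> V) (\<lambda>(x,s). h x s)"
    and hol1: "\<And>s. s \<in> V \<Longrightarrow> (\<lambda>x. h x s) holomorphic_on W"
    and hol2: "\<And>x. x \<in> W \<Longrightarrow> h x holomorphic_on V"
    and nz: "\<And>x s. x \<in> W \<Longrightarrow> s \<in> sphere z r \<Longrightarrow> h x s \<noteq> 0"
  obtains g where "g holomorphic_on W"
    "\<And>x. x \<in> W \<Longrightarrow> card {s\<in>ball z r. h x s = 0} < R \<Longrightarrow> g x = 0"
    "\<And>x. x \<in> W \<Longrightarrow> card {s\<in>ball z r. h x s = 0} = R \<Longrightarrow> g x \<noteq> 0"
proof -
  define Z where "Z = (\<lambda>x. {s\<in>ball z r. h x s = 0})"
  define m where "m = (\<lambda>x p. of_int (zorder (h x) p) :: complex)"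
  have finZ: "finite (Z x)" if "x \<in> W" for x
  proof -
    have "finite {s \<in> cball z r. h x s = 0}"
      by (rule finite_zeros_cball[OF hol2[OF that] V, where ?s0.0 = "z + of_real r"])
         (use r nz[OF that, of "z + of_real r"] in \<open>auto simp: dist_norm\<close>)
    thus ?thesis unfolding Z_def by (rule rev_finite_subset) auto
  qed
  have sV: "sphere z r \<subseteq> V" using V by auto
  have cd: "continuous_on (W \<times> V) (\<lambda>(x,s). deriv (h x) s)" by (rule deriv_param_continuous[OF c V(1) hol2])
  \<comment> \<open>Cauchy's formula writes the derivative in \<open>s\<close> as a contour
    integral, and that integral is holomorphic in the parameter.\<close>
  have hold: "(\<lambda>x. deriv (h x) s) holomorphic_on W" if s: "s \<in> V" for s
  proof -
    obtain d where d: "d > 0" "cball s d \<subseteq> V" using V s open_contains_cball by blast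
    have eq: "deriv (h x) s = 1 / (2 * of_real pi * \<i>) * contour_integral (circlepath s d) (\<lambda>u. h x u / (u - s)\<^sup>2)"
      if x: "x \<in> W" for x
    proof (rule DERIV_imp_deriv, rule Cauchy_derivative_integral_circlepath)
      have "h x holomorphic_on cball s d" using hol2[OF x] d holomorphic_on_subset by blast
      thus "continuous_on (cball s d) (h x)" "h x holomorphic_on ball s d"
        using holomorphic_on_imp_continuous_on holomorphic_on_subset ball_subset_cball by blast+
    qed (use d in auto)
    have "(\<lambda>x. contour_integral (circlepath s d) (\<lambda>u. h x u / (u - s)\<^sup>2)) holomorphic_on W"
    proof (rule holomorphic_param_circle[OF _ W])
      have "continuous_on (W \<times> sphere s d) (\<lambda>(x,u). h x u)"
        using c by (rule continuous_on_subset) (use d in auto)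
      thus "continuous_on (W \<times> sphere s d) (\<lambda>(x,u). h x u / (u - s)\<^sup>2)"
        unfolding split_def using d by (intro continuous_intros) auto
      show "(\<lambda>x. h x u / (u - s)\<^sup>2) holomorphic_on W" if "u \<in> sphere s d" for u
        using that d by (intro holomorphic_intros hol1) auto
    qed (use d in auto)
    hence "(\<lambda>x. 1 / (2 * of_real pi * \<i>) * contour_integral (circlepath s d) (\<lambda>u. h x u / (u - s)\<^sup>2)) holomorphic_on W"
      by (rule holomorphic_on_mult[OF holomorphic_on_const])
    thus ?thesis by (rule holomorphic_transform) (simp add: eq)
  qed
  \<comment> \<open>Zeros are weighted by multiplicity, since it is this power sum that equals a
    contour integral.\<close>
  define P where "P = (\<lambda>e x. \<Sum>p\<in>Z x. p ^ e * m x p)"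
  have Phol: "P e holomorphic_on W" for e
  proof -
    have "(\<lambda>x. contour_integral (circlepath z r) (\<lambda>s. deriv (h x) s * s ^ e / h x s)) holomorphic_on W"
    proof (rule holomorphic_param_circle[OF r W])
      have 1: "continuous_on (W \<times> sphere z r) (\<lambda>(x,u). h x u)"
        using c by (rule continuous_on_subset) (use sV in auto)
      have 2: "continuous_on (W \<times> sphere z r) (\<lambda>(x,u). deriv (h x) u)"
        using cd by (rule continuous_on_subset) (use sV in auto)
      show "continuous_on (W \<times> sphere z r) (\<lambda>(x,s). deriv (h x) s * s ^ e / h x s)"
        using 1 2 nz unfolding split_def by (intro continuous_intros) auto
      show "(\<lambda>x. deriv (h x) s * s ^ e / h x s) holomorphic_on W" if "s \<in> sphere z r" for s
        using that sV nz by (intro holomorphic_intros hol1 hold) auto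
    qed
    hence "(\<lambda>x. 1 / (2 * of_real pi * \<i>) * contour_integral (circlepath z r) (\<lambda>s. deriv (h x) s * s ^ e / h x s)) holomorphic_on W"
      by (rule holomorphic_on_mult[OF holomorphic_on_const])
    thus ?thesis
    proof (rule holomorphic_transform)
      fix x assume x: "x \<in> W"
      show "1 / (2 * of_real pi * \<i>) * contour_integral (circlepath z r) (\<lambda>s. deriv (h x) s * s ^ e / h x s) = P e x"
        using zeros_power_sum[OF hol2[OF x] V r, of e] nz[OF x] by (simp add: P_def Z_def m_def)
    qed
  qed
  \<comment> \<open>The extra exponents \<open>e\<close> make the property \<open>Q\<close> stable under multiplication by a coordinate.\<close>
  define Q where "Q = (\<lambda>H. \<forall>e. (\<lambda>x. \<Sum>y\<in>PiE {..<R} (\<lambda>_. Z x). (\<Prod>i<R. y i ^ e i * m x (y i)) * H y) holomorphic_on W)"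
  have Q1: "Q (\<lambda>_. 1)"
    unfolding Q_def
  proof
    fix e :: "nat \<Rightarrow> nat"
    have "(\<lambda>x. \<Prod>i<R. P (e i) x) holomorphic_on W" by (intro holomorphic_intros Phol)
    thus "(\<lambda>x. \<Sum>y\<in>PiE {..<R} (\<lambda>_. Z x). (\<Prod>i<R. y i ^ e i * m x (y i)) * 1) holomorphic_on W"
      by (rule holomorphic_transform) (simp add: P_def prod_sum_PiE finZ)
  qed
  have Qmul: "Q (\<lambda>y. y k * H y)" if H: "Q H" and k: "k < R" for H k
    unfolding Q_def
  proof
    fix e :: "nat \<Rightarrow> nat"
    have eq: "(\<Prod>i<R. y i ^ (e(k := Suc (e k))) i * m x (y i)) = y k * (\<Prod>i<R. y i ^ e i * m x (y i))" for x y
    proof -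
      have "(\<Prod>i<R. y i ^ (e(k := Suc (e k))) i * m x (y i)) =
         (y k ^ Suc (e k) * m x (y k)) * (\<Prod>i\<in>{..<R}-{k}. y i ^ (e(k := Suc (e k))) i * m x (y i))"
        using k by (subst prod.remove[of _ k]) auto
      also have "(\<Prod>i\<in>{..<R}-{k}. y i ^ (e(k := Suc (e k))) i * m x (y i)) = (\<Prod>i\<in>{..<R}-{k}. y i ^ e i * m x (y i))"
        by (rule prod.cong) auto
      also have "(y k ^ Suc (e k) * m x (y k)) * \<dots> = y k * (\<Prod>i<R. y i ^ e i * m x (y i))"
        using k by (subst (2) prod.remove[of _ k]) auto
      finally show ?thesis .
    qed
    have "(\<lambda>x. \<Sum>y\<in>PiE {..<R} (\<lambda>_. Z x). (\<Prod>i<R. y i ^ (e(k := Suc (e k))) i * m x (y i)) * H y) holomorphic_on W"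
      using H unfolding Q_def by blast
    thus "(\<lambda>x. \<Sum>y\<in>PiE {..<R} (\<lambda>_. Z x). (\<Prod>i<R. y i ^ e i * m x (y i)) * (y k * H y)) holomorphic_on W"
      unfolding eq by (simp add: mult_ac)
  qed
  have Qdiff: "Q (\<lambda>y. G y - H y)" if "Q G" "Q H" for G H
    using that unfolding Q_def
    by (auto simp: right_diff_distrib sum_subtractf intro!: holomorphic_on_diff)
  define D where "D = (\<lambda>A (y :: nat \<Rightarrow> complex). \<Prod>(i,j)\<in>A. y i - y j)"
  have QD: "Q (D A)" if "finite A" "A \<subseteq> {..<R} \<times> {..<R}" for A
    using that
  proof (induction rule: finite_induct)
    case empty
    then show ?case using Q1 by (simp add: D_def)
  next
    case (insert a A)
    obtain i j where a: "a = (i,j)" by fastforce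
    have "D (insert a A) = (\<lambda>y. y i * D A y - y j * D A y)"
      using insert.hyps by (auto simp: D_def a algebra_simps fun_eq_iff)
    thus ?case using insert a by (auto intro!: Qdiff Qmul)
  qed
  \<comment> \<open>Both \<open>(i,j)\<close> and \<open>(j,i)\<close> occur, so \<open>D A\<close>
    is invariant under permutations of the tuple and every enumeration of the zeros contributes the
    same number.\<close>
  define A where "A = {(i,j). i < R \<and> j < R \<and> i \<noteq> j}"
  have finA: "finite A" and subA: "A \<subseteq> {..<R} \<times> {..<R}"
    by (auto simp: A_def intro: finite_subset[of _ "{..<R} \<times> {..<R}"])
  define g where "g = (\<lambda>x. \<Sum>y\<in>PiE {..<R} (\<lambda>_. Z x). (\<Prod>i<R. m x (y i)) * D A y)"
  from QD[OF finA subA, unfolded Q_def, rule_format, of "\<lambda>_. 0"]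
  have ghol: "g holomorphic_on W" by (simp add: g_def)
  have D0: "D A y = 0" if ni: "\<not> inj_on y {..<R}" for y
  proof -
    obtain i j where "i < R" "j < R" "i \<noteq> j" "y i = y j" using ni unfolding inj_on_def by blast
    hence "(i,j) \<in> A" "(case (i,j) of (i,j) \<Rightarrow> y i - y j) = 0" by (auto simp: A_def)
    thus ?thesis unfolding D_def using finA prod_zero by blast
  qed
  show ?thesis
  proof (rule that[OF ghol])
    fix x assume x: "x \<in> W" "card {s\<in>ball z r. h x s = 0} < R"
    have "D A y = 0" if y: "y \<in> PiE {..<R} (\<lambda>_. Z x)" for y
    proof (rule D0)
      show "\<not> inj_on y {..<R}"
      proof
        assume "inj_on y {..<R}"
        hence "card {..<R} \<le> card (Z x)" by (rule card_inj_on_le) (use y finZ[OF x(1)] in auto)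
        thus False using x by (simp add: Z_def)
      qed
    qed
    thus "g x = 0" by (simp add: g_def)
  next
    fix x assume x: "x \<in> W" "card {s\<in>ball z r. h x s = 0} = R"
    define I where "I = {y \<in> PiE {..<R} (\<lambda>_. Z x). inj_on y {..<R}}"
    \<comment> \<open>The common contribution of all injective tuples. It is nonzero because
      multiplicities of zeros are positive and the differences are taken between distinct
      zeros.\<close>
    define C where "C = (\<Prod>p\<in>Z x. m x p) * (\<Prod>(p,q)\<in>{(p,q). p \<in> Z x \<and> q \<in> Z x \<and> p \<noteq> q}. p - q)"
    have cZ: "card (Z x) = R" using x by (simp add: Z_def)
    have finP: "finite (PiE {..<R} (\<lambda>_. Z x))" using finZ[OF x(1)] by (intro finite_PiE) auto
    hence finI: "finite I" by (simp add: I_def)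
    have "g x = (\<Sum>y\<in>I. (\<Prod>i<R. m x (y i)) * D A y)"
      unfolding g_def by (rule sum.mono_neutral_right[OF finP]) (auto simp: I_def D0)
    also have "\<dots> = (\<Sum>y\<in>I. C)"
    proof (rule sum.cong[OF refl])
      fix y assume y: "y \<in> I"
      have inj: "inj_on y {..<R}" and "y ` {..<R} \<subseteq> Z x" using y by (auto simp: I_def)
      moreover have "card (y ` {..<R}) = R" using inj by (simp add: card_image)
      ultimately have im: "y ` {..<R} = Z x" using finZ[OF x(1)] cZ by (metis card_subset_eq)
      hence bij: "bij_betw y {..<R} (Z x)" using inj by (simp add: bij_betw_def)
      have 1: "(\<Prod>i<R. m x (y i)) = (\<Prod>p\<in>Z x. m x p)" using bij by (rule prod.reindex_bij_betw)
      have "bij_betw (map_prod y y) A {(p,q). p \<in> Z x \<and> q \<in> Z x \<and> p \<noteq> q}"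
        unfolding bij_betw_def
      proof
        show "inj_on (map_prod y y) A" using inj by (auto simp: inj_on_def A_def)
        show "map_prod y y ` A = {(p,q). p \<in> Z x \<and> q \<in> Z x \<and> p \<noteq> q}"
        proof safe
          fix p q assume pq: "p \<in> Z x" "q \<in> Z x" "p \<noteq> q"
          then obtain i j where "i < R" "j < R" "p = y i" "q = y j" using im by blast
          hence "(i,j) \<in> A" "(p,q) = map_prod y y (i,j)" using pq by (auto simp: A_def)
          thus "(p,q) \<in> map_prod y y ` A" by blast
        qed (use im inj in \<open>auto simp: A_def inj_on_def\<close>)
      qed
      from prod.reindex_bij_betw[OF this, of "\<lambda>(p,q). p - q"]
      have "D A y = (\<Prod>(p,q)\<in>{(p,q). p \<in> Z x \<and> q \<in> Z x \<and> p \<noteq> q}. p - q)"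
        by (simp add: D_def split_def)
      thus "(\<Prod>i<R. m x (y i)) * D A y = C" by (simp add: C_def 1)
    qed
    also have "\<dots> = of_nat (card I) * C" by simp
    finally have gx: "g x = of_nat (card I) * C" .
    obtain b where b: "bij_betw b {..<R} (Z x)"
      using ex_bij_betw_nat_finite[OF finZ[OF x(1)]] cZ by (auto simp: atLeast0LessThan)
    have "restrict b {..<R} \<in> I"
      using b by (auto simp: I_def bij_betw_def inj_on_restrict_eq)
    hence "card I \<noteq> 0" using finI by auto
    moreover have "C \<noteq> 0"
    proof -
      have "m x p \<noteq> 0" if "p \<in> Z x" for p
        using zorder_zero_pos[OF hol2[OF x(1)] V nz[OF x(1)], of p] that by (auto simp: m_def Z_def)
      moreover have "finite {(p,q). p \<in> Z x \<and> q \<in> Z x \<and> p \<noteq> q}"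
        by (rule finite_subset[of _ "Z x \<times> Z x"]) (use finZ[OF x(1)] in auto)
      ultimately show ?thesis using finZ[OF x(1)] by (auto simp: C_def)
    qed
    ultimately show "g x \<noteq> 0" by (simp add: gx)
  qed
qed

section \<open>The Bohr lift\<close>

lemma tendsto_fun_coordinatewise:
  fixes f :: "'b \<Rightarrow> 'a \<Rightarrow> 'c::topological_space"
  assumes "\<And>i. ((\<lambda>x. f x i) \<longlongrightarrow> l i) F"
  shows "(f \<longlongrightarrow> l) F"
proof -
  have "limitin (product_topology (\<lambda>_. euclidean) UNIV) f l F"
    unfolding limitin_componentwise using assms by auto
  thus ?thesis by (simp add: euclidean_product_topology)
qed

section \<open>Primes, monomials and partial sums\<close>

definition pr :: "nat \<Rightarrow> nat" where "pr i = enumerate {p. prime p} i"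

definition ix :: "nat \<Rightarrow> nat" where "ix p = inv pr p"

lemma strict_mono_pr: "strict_mono pr"
  unfolding pr_def using primes_infinite by (rule strict_mono_enumerate)

lemma prime_pr [simp]: "prime (pr i)"
  using enumerate_in_set[OF primes_infinite, of i] by (simp add: pr_def)

lemma inj_pr: "inj pr"
  using strict_mono_pr by (rule strict_mono_imp_inj_on)

lemma ix_pr [simp]: "ix (pr i) = i"
  by (simp add: ix_def inj_pr)

lemma pr_ix: "prime p \<Longrightarrow> pr (ix p) = p"
proof -
  assume "prime p"
  hence "p \<in> range pr" unfolding pr_def using range_enumerate[OF primes_infinite] by simp
  thus ?thesis unfolding ix_def by (rule f_inv_into_f)
qed

lemma pr_ge_2: "pr i \<ge> 2" by (rule prime_ge_2_nat) simp

lemma pr_pos [simp]: "pr i > 0" using pr_ge_2[of i] by linarith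

lemma pr_ge_1 [simp]: "Suc 0 \<le> pr i" using pr_pos[of i] by linarith

lemma pr_gt: "i < pr i"
proof (induction i)
  case (Suc i)
  thus ?case using strict_mono_pr[THEN strict_monoD, of i "Suc i"] by linarith
qed simp

text \<open>The Bohr correspondence: \<open>z i\<close> stands for the variable attached to the \<open>i\<close>-th prime, and \<open>mon z n\<close>
  is the monomial that becomes \<open>n powr -s\<close> at \<open>z i = pr i powr -s\<close>.\<close>

definition mon :: "(nat \<Rightarrow> complex) \<Rightarrow> nat \<Rightarrow> complex" where
  "mon z n = prod_mset (image_mset (\<lambda>p. z (ix p)) (prime_factorization n))"

lemma mon_1 [simp]: "mon z (Suc 0) = 1" by (simp add: mon_def)

lemma mon_mult: "a > 0 \<Longrightarrow> b > 0 \<Longrightarrow> mon z (a * b) = mon z a * mon z b"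
  by (simp add: mon_def prime_factorization_mult)

lemma mon_times: "mon (\<lambda>i. u i * v i) n = mon u n * mon v n"
  by (simp add: mon_def prod_mset.distrib)

lemma mon_pr [simp]: "mon z (pr i) = z i"
  by (simp add: mon_def prime_factorization_prime)

lemma mon_prod: "mon z n = (\<Prod>p\<in>prime_factors n. z (ix p) ^ count (prime_factorization n) p)"
  by (simp add: mon_def image_prod_mset_multiplicity)

lemma mon_multiplicative:
  assumes "f 1 = 1" "\<And>a b. a > 0 \<Longrightarrow> b > 0 \<Longrightarrow> f (a * b) = f a * f b" "n > 0"
  shows "mon (\<lambda>i. f (pr i)) n = f n"
proof -
  have *: "prod_mset (image_mset f M) = f (prod_mset M)" if "\<And>p. p \<in># M \<Longrightarrow> p > 0" for M :: "nat multiset"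
    using that
  proof (induction M)
    case (add x M)
    have "prod_mset M > 0" using add.prems by (intro Nat.gr0I) auto
    thus ?case using add assms(2)[of x "prod_mset M"] by simp
  qed (use assms in simp)
  have "mon (\<lambda>i. f (pr i)) n = prod_mset (image_mset f (prime_factorization n))"
    unfolding mon_def by (intro arg_cong[where f = prod_mset] image_mset_cong) (auto simp: pr_ix in_prime_factors_imp_prime)
  also have "\<dots> = f (prod_mset (prime_factorization n))"
    by (rule *) (use in_prime_factors_imp_prime prime_gt_0_nat in blast)
  finally show ?thesis using assms(3) by (simp add: prod_mset_prime_factorization_nat)
qed

lemma mon_powr: "n > 0 \<Longrightarrow> mon (\<lambda>i. of_nat (pr i) powr s) n = of_nat n powr s"
proof (rule mon_multiplicative)
  have *: "of_nat a powr s = exp (s * of_real (ln (real a)))" if "a > 0" for a :: nat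
    using that by (simp add: powr_def Ln_of_nat)
  show "of_nat (a * b) powr s = of_nat a powr s * of_nat b powr s" if "a > 0" "b > 0" for a b :: nat
    using that unfolding *[OF that(1)] *[OF that(2)]
    by (subst *) (auto simp: ln_mult exp_add[symmetric] algebra_simps)
qed auto

lemma norm_mon: "norm (mon z n) = (\<Prod>p\<in>prime_factors n. norm (z (ix p)) ^ count (prime_factorization n) p)"
  by (simp add: mon_prod prod_norm[symmetric] norm_power)

lemma norm_mon_unimodular: "(\<And>i. norm (z i) = 1) \<Longrightarrow> norm (mon z n) = 1"
  by (simp add: norm_mon)

lemma continuous_mon: "continuous_on A (\<lambda>z. mon z n)"
  unfolding mon_prod
  by (intro continuous_intros continuous_on_subset[OF continuous_on_product_coordinates subset_UNIV])

lemma holomorphic_mon_upd: "(\<lambda>x. mon (z(j := x)) n) holomorphic_on A"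
  unfolding mon_prod
proof (intro holomorphic_intros)
  fix p
  show "(\<lambda>x. (z(j := x)) (ix p)) holomorphic_on A" by (cases "ix p = j") auto
qed

text \<open>The prime with index \<open>i\<close> exceeds \<open>i\<close>, so every prime factor of
  \<open>n\<close> has index below \<open>n\<close>.\<close>

lemma mon_cong: "n > 0 \<Longrightarrow> (\<And>i. i < n \<Longrightarrow> z i = z' i) \<Longrightarrow> mon z n = mon z' n"
  unfolding mon_prod
proof (intro prod.cong refl)
  fix p assume n: "n > 0" and *: "\<And>i. i < n \<Longrightarrow> z i = z' i" and p: "p \<in> prime_factors n"
  have "prime p" "p dvd n" using p by auto
  hence "ix p < n" using pr_gt[of "ix p"] pr_ix[of p] n dvd_imp_le[of p n] by auto
  thus "z (ix p) ^ count (prime_factorization n) p = z' (ix p) ^ count (prime_factorization n) p"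
    using * by simp
qed

definition psum :: "(nat \<Rightarrow> complex) \<Rightarrow> nat \<Rightarrow> (nat \<Rightarrow> complex) \<Rightarrow> complex" where
  "psum a N z = (\<Sum>n<N. a (Suc n) * mon z (Suc n))"

lemma continuous_psum: "continuous_on A (psum a N)"
  unfolding psum_def by (intro continuous_intros continuous_mon)

lemma holomorphic_psum_upd: "(\<lambda>x. psum a N (z(j := x))) holomorphic_on A"
  unfolding psum_def by (intro holomorphic_intros holomorphic_mon_upd)

lemma psum_cong: "(\<And>i. i < N \<Longrightarrow> z i = z' i) \<Longrightarrow> psum a N z = psum a N z'"
  unfolding psum_def by (intro sum.cong refl arg_cong2[where f = times] mon_cong) auto

definition prs :: "complex \<Rightarrow> nat \<Rightarrow> complex" where "prs s i = of_nat (pr i) powr (- s)"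

lemma psum_prs: "psum a N (prs s) = (\<Sum>n<N. a (Suc n) * of_nat (Suc n) powr (- s))"
  unfolding psum_def prs_def by (intro sum.cong refl) (subst mon_powr, auto)

lemma norm_prs: "norm (prs s i) = real (pr i) powr (- Re s)"
  by (simp add: prs_def norm_powr_real_powr)

definition pdisc :: "real \<Rightarrow> (nat \<Rightarrow> complex) set" where
  "pdisc \<epsilon> = {z. \<forall>i. norm (z i) \<le> real (pr i) powr (- \<epsilon>)}"

text \<open>Maximum principle, one variable at a time, moves a point of the polydisc to the distinguished boundary.\<close>

lemma psum_max_torus:
  assumes "z \<in> pdisc \<epsilon>"
  shows "\<exists>z'. (\<forall>i<k. norm (z' i) = real (pr i) powr (- \<epsilon>)) \<and> z' \<in> pdisc \<epsilon> \<and> norm (psum a N z) \<le> norm (psum a N z')"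
proof (induction k)
  case 0
  show ?case using assms by auto
next
  case (Suc k)
  then obtain y where y: "\<forall>i<k. norm (y i) = real (pr i) powr (- \<epsilon>)" "y \<in> pdisc \<epsilon>"
    "norm (psum a N z) \<le> norm (psum a N y)" by blast
  define \<rho> where "\<rho> = real (pr k) powr (- \<epsilon>)"
  have \<rho>: "\<rho> > 0" by (simp add: \<rho>_def)
  define f where "f = (\<lambda>x. psum a N (y(k := x)))"
  have f: "f holomorphic_on A" for A unfolding f_def by (rule holomorphic_psum_upd)
  have fc: "continuous_on A f" for A using f holomorphic_on_imp_continuous_on by blast
  have "\<exists>x\<in>sphere 0 \<rho>. \<forall>x'\<in>sphere 0 \<rho>. norm (f x') \<le> norm (f x)"
    by (rule continuous_attains_sup) (use \<rho> fc in \<open>auto intro!: continuous_intros\<close>)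
  then obtain x where x: "norm x = \<rho>" "\<And>x'. norm x' = \<rho> \<Longrightarrow> norm (f x') \<le> norm (f x)" by auto
  have "norm (f (y k)) \<le> norm (f x)"
    by (rule maximum_modulus_frontier[of f "cball 0 \<rho>"])
       (use f fc x \<rho> y(2) in \<open>auto simp: pdisc_def \<rho>_def\<close>)
  hence "norm (psum a N y) \<le> norm (psum a N (y(k := x)))" by (simp add: f_def)
  hence "norm (psum a N z) \<le> norm (psum a N (y(k := x)))" using y(3) by linarith
  moreover have "y(k := x) \<in> pdisc \<epsilon>" using y x by (auto simp: pdisc_def \<rho>_def)
  moreover have "\<forall>i<Suc k. norm ((y(k := x)) i) = real (pr i) powr (- \<epsilon>)" using y x by (auto simp: \<rho>_def less_Suc_eq)
  ultimately show ?case by blast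
qed

text \<open>Unique factorisation: with positive and negative coefficients separated, a relation says
  that two products of prime powers agree, and a prime occurring in one would have to divide the
  other. This excludes a positive coefficient; passing to \<open>- u\<close> excludes a negative
  one.\<close>

lemma ln_pr_independent:
  assumes fin: "finite I" and s: "(\<Sum>i\<in>I. real_of_int (u i) * ln (real (pr i))) = 0" and j: "j \<in> I"
  shows "u j = 0"
proof -
  have *: "u j \<le> 0" if s: "(\<Sum>i\<in>I. real_of_int (u i) * ln (real (pr i))) = 0" and j: "j \<in> I" for u :: "nat \<Rightarrow> int" and j
  proof (rule ccontr)
    assume uj: "\<not> u j \<le> 0"
    define A where "A = (\<Prod>i\<in>I. pr i ^ nat (u i))"
    define B where "B = (\<Prod>i\<in>I. pr i ^ nat (- u i))"
    have pos: "A > 0" "B > 0" by (auto simp: A_def B_def intro!: prod_pos)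
    have "ln (real A) = (\<Sum>i\<in>I. real (nat (u i)) * ln (real (pr i)))"
      unfolding A_def of_nat_prod by (subst ln_prod) (auto simp: fin ln_realpow)
    moreover have "ln (real B) = (\<Sum>i\<in>I. real (nat (- u i)) * ln (real (pr i)))"
      unfolding B_def of_nat_prod by (subst ln_prod) (auto simp: fin ln_realpow)
    ultimately have "ln (real A) - ln (real B) = (\<Sum>i\<in>I. (real (nat (u i)) - real (nat (- u i))) * ln (real (pr i)))"
      by (simp add: sum_subtractf algebra_simps)
    also have "\<dots> = (\<Sum>i\<in>I. real_of_int (u i) * ln (real (pr i)))"
      by (intro sum.cong refl arg_cong2[where f = times]) auto
    finally have "ln (real A) = ln (real B)" using s by simp
    hence AB: "A = B" using pos by simp
    have "pr j dvd pr j ^ nat (u j)" using uj by (intro dvd_power) auto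
    also have "\<dots> dvd A" unfolding A_def using fin j by (rule dvd_prodI)
    finally have "pr j dvd B" using AB by simp
    then obtain i where i: "i \<in> I" "pr j dvd pr i ^ nat (- u i)"
      unfolding B_def using fin by (auto simp: prime_dvd_prod_iff)
    hence "nat (- u i) \<noteq> 0" using prime_pr[of j] by (intro notI) (auto simp del: prime_pr)
    have "pr j dvd pr i" using i(2) prime_dvd_power[OF prime_pr] by blast
    hence "pr j = pr i" by (simp add: primes_dvd_imp_eq)
    hence "i = j" using inj_pr by (auto dest: injD)
    thus False using uj \<open>nat (- u i) \<noteq> 0\<close> by auto
  qed
  have "u j \<le> 0" using * s j by blast
  moreover have "- u j \<le> 0"
    by (rule *[of "\<lambda>i. - u i"]) (use s j in \<open>auto simp: sum_negf\<close>)
  ultimately show ?thesis by simp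
qed

text \<open>Kronecker's approximation theorem for the numbers \<open>ln (pr i) / (2 * pi)\<close>,
  whose independence over the integers is \<open>ln_pr_independent\<close>.\<close>

lemma kronecker_primes:
  assumes "\<epsilon> > 0" "\<And>i. i < k \<Longrightarrow> norm (x i) = 1"
  shows "\<exists>t. \<forall>i<k. norm (of_nat (pr i) powr (- \<i> * of_real t) - x i) < \<epsilon>"
proof -
  define \<theta> where "\<theta> = (\<lambda>i. ln (real (pr i)) / (2 * pi))"
  have inj: "inj \<theta>"
    using inj_pr by (auto simp: inj_def \<theta>_def)
  \<comment> \<open>The reals as a module over the integers, the setting in which Kronecker's
    theorem expresses independence.\<close>
  interpret M: module "\<lambda>r x. real_of_int r * x"
    by (simp add: Modules.module.intro distrib_left mult.commute)
  have indep: "M.independent (\<theta> ` {..<k})"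
  proof
    assume "M.dependent (\<theta> ` {..<k})"
    then obtain T u v where T: "finite T" "T \<subseteq> \<theta> ` {..<k}" "(\<Sum>v\<in>T. real_of_int (u v) * v) = 0" "v \<in> T" "u v \<noteq> 0"
      unfolding M.dependent_explicit by blast
    then obtain I where I: "I \<subseteq> {..<k}" "T = \<theta> ` I" by (meson subset_image_iff)
    have finI: "finite I" using I finite_subset by blast
    have "(\<Sum>i\<in>I. real_of_int (u (\<theta> i)) * \<theta> i) = 0"
      using T(3) inj unfolding I(2) by (subst (asm) sum.reindex) (auto intro: inj_on_subset)
    moreover have "(\<Sum>i\<in>I. real_of_int (u (\<theta> i)) * \<theta> i) = (\<Sum>i\<in>I. real_of_int (u (\<theta> i)) * ln (real (pr i))) / (2 * pi)"
      by (simp add: \<theta>_def sum_divide_distrib)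
    ultimately have "(\<Sum>i\<in>I. real_of_int (u (\<theta> i)) * ln (real (pr i))) = 0" by simp
    from ln_pr_independent[OF finI this] show False using T I by auto
  qed
  \<comment> \<open>The sign is reversed because \<open>pr i powr (- \<i> * t)\<close> has argument
    \<open>- t * ln (pr i)\<close>.\<close>
  define \<alpha> where "\<alpha> = (\<lambda>i. - Arg (x i) / (2 * pi))"
  obtain t h where th: "\<And>i. i < k \<Longrightarrow> \<bar>t * \<theta> i - of_int (h i) - \<alpha> i\<bar> < \<epsilon> / (2 * pi)"
    using Kronecker_thm_1[OF indep, of "\<epsilon> / (2 * pi)" \<alpha>] inj assms(1)
    by (metis divide_pos_pos inj_on_subset mult_pos_pos pi_gt_zero subset_UNIV zero_less_numeral)
  have "norm (of_nat (pr i) powr (- \<i> * of_real t) - x i) < \<epsilon>" if i: "i < k" for i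
  proof -
    define d where "d = t * \<theta> i - of_int (h i) - \<alpha> i"
    have d: "\<bar>d\<bar> < \<epsilon> / (2 * pi)" using th[OF i] by (simp add: d_def)
    have x: "x i = cis (Arg (x i))" using assms(2)[OF i] rcis_cmod_Arg[of "x i"] by (simp add: rcis_def)
    have "of_nat (pr i) powr (- \<i> * of_real t) = cis (- (t * ln (real (pr i))))"
      by (simp add: powr_def Ln_of_nat cis_conv_exp algebra_simps)
    also have "t * ln (real (pr i)) = 2 * pi * (d + of_int (h i) + \<alpha> i)"
      by (simp add: d_def \<theta>_def)
    also have "cis (- (2 * pi * (d + of_int (h i) + \<alpha> i))) = cis (Arg (x i)) * cis (- (2 * pi * d)) * cis (2 * pi * of_int (- h i))"
      unfolding cis_mult by (rule arg_cong[where f = cis]) (simp add: \<alpha>_def algebra_simps)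
    also have "cis (2 * pi * of_int (- h i)) = 1" by (rule cis_multiple_2pi) simp
    finally have "norm (of_nat (pr i) powr (- \<i> * of_real t) - x i) = norm (cis (Arg (x i)) * (cis (- (2 * pi * d)) - 1))"
      using x by (simp add: right_diff_distrib)
    also have "\<dots> = norm (cis (- (2 * pi * d)) - 1)" by (simp add: norm_mult)
    also have "\<dots> \<le> \<bar>2 * pi * d\<bar>"
      using dist_exp_i_1[of "- (2 * pi * d)"] abs_sin_x_le_abs_x[of "- (2 * pi * d) / 2"] by (simp add: cis_conv_exp)
    also have "\<dots> < \<epsilon>" using d by (simp add: abs_mult field_simps)
    finally show ?thesis .
  qed
  thus ?thesis by blast
qed

text \<open>Bohr's principle. By the maximum principle the bound need only be checked where the
  first \<open>N\<close> coordinates, the only ones that \<open>psum a N\<close> sees, have maximal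
  modulus; there the points coming from the line \<open>Re s = \<epsilon>\<close> are dense by
  Kronecker's theorem.\<close>

lemma psum_bound_pdisc:
  assumes S: "\<And>t. norm (psum a N (prs (Complex \<epsilon> t))) \<le> S" and z: "z \<in> pdisc \<epsilon>"
  shows "norm (psum a N z) \<le> S"
proof -
  obtain y where y: "\<forall>i<N. norm (y i) = real (pr i) powr (- \<epsilon>)" "norm (psum a N z) \<le> norm (psum a N y)"
    using psum_max_torus[OF z, of N a N] by blast
  have pw: "of_nat (pr i) powr (- \<i> * of_real t) * of_real (real (pr i) powr (- \<epsilon>)) = prs (Complex \<epsilon> t) i" for i t
  proof -
    have "of_real (real (pr i) powr (- \<epsilon>)) = (of_nat (pr i) powr (- of_real \<epsilon>) :: complex)"
      using powr_of_real[of "real (pr i)" "-\<epsilon>"] by simp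
    thus ?thesis
      unfolding prs_def Complex_eq by (simp add: powr_add[symmetric] algebra_simps)
  qed
  have "\<exists>t. \<forall>i<N. norm (of_nat (pr i) powr (- \<i> * of_real t) - y i / of_real (real (pr i) powr (- \<epsilon>))) < 1 / real (Suc m)" for m
    by (rule kronecker_primes) (use y in \<open>auto simp: norm_divide\<close>)
  then obtain t where t: "\<And>m i. i < N \<Longrightarrow> norm (of_nat (pr i) powr (- \<i> * of_real (t m)) - y i / of_real (real (pr i) powr (- \<epsilon>))) < 1 / real (Suc m)"
    by metis
  \<comment> \<open>Beyond the first \<open>N\<close> coordinates \<open>x m\<close> copies
    \<open>y\<close>. This gives convergence in the product topology and does not affect
    \<open>psum\<close>.\<close>
  define x where "x = (\<lambda>m i. if i < N then prs (Complex \<epsilon> (t m)) i else y i)"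
  have "(x \<longlongrightarrow> y) sequentially"
  proof (rule tendsto_fun_coordinatewise)
    fix i
    show "((\<lambda>m. x m i) \<longlongrightarrow> y i) sequentially"
    proof (cases "i < N")
      case True
      have "((\<lambda>m. of_nat (pr i) powr (- \<i> * of_real (t m)) - y i / of_real (real (pr i) powr (- \<epsilon>))) \<longlongrightarrow> 0) sequentially"
      proof (rule Lim_null_comparison)
        show "\<forall>\<^sub>F m in sequentially. norm (of_nat (pr i) powr (- \<i> * of_real (t m)) - y i / of_real (real (pr i) powr (- \<epsilon>))) \<le> 1 / real (Suc m)"
          using t[OF True] by (intro always_eventually) (auto intro: less_imp_le)
      qed (rule LIMSEQ_Suc[OF lim_1_over_n])
      from tendsto_mult[OF this tendsto_const[of "of_real (real (pr i) powr (- \<epsilon>))"]]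
      have "((\<lambda>m. prs (Complex \<epsilon> (t m)) i - y i) \<longlongrightarrow> 0) sequentially"
        unfolding left_diff_distrib pw by simp
      thus ?thesis using True by (simp add: x_def LIM_zero_iff)
    qed (simp add: x_def)
  qed
  moreover have "isCont (psum a N) y"
    using continuous_psum[of UNIV] by (simp add: continuous_on_eq_continuous_at)
  ultimately have "((\<lambda>m. psum a N (x m)) \<longlongrightarrow> psum a N y) sequentially"
    by (rule isCont_tendsto_compose[rotated])
  moreover have "norm (psum a N (x m)) \<le> S" for m
  proof -
    have "psum a N (x m) = psum a N (prs (Complex \<epsilon> (t m)))" by (rule psum_cong) (simp add: x_def)
    thus ?thesis using S by simp
  qed
  ultimately have "norm (psum a N y) \<le> S" by (intro Lim_norm_ubound[of sequentially]) auto
  thus ?thesis using y by linarith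
qed

definition bohr :: "(nat \<Rightarrow> complex) \<Rightarrow> (nat \<Rightarrow> complex) \<Rightarrow> complex" where
  "bohr c z = lim (\<lambda>N. psum c N z)"

text \<open>A difference of partial sums is again a Dirichlet polynomial, so
  \<open>psum_bound_pdisc\<close> carries the uniform Cauchy property from the half plane over to
  the polydisc.\<close>

lemma bohr_uniform_limit:
  assumes G: "G0 \<Phi> c" and e: "\<epsilon> > 0"
  shows "uniform_limit (pdisc \<epsilon>) (psum c) (bohr c) sequentially"
proof -
  \<comment> \<open>With \<open>\<epsilon>/2\<close> the line \<open>Re s = \<epsilon>\<close> lies
    inside the open half plane of uniform convergence.\<close>
  have "uniform_limit {s. Re s > \<epsilon>/2} (\<lambda>N s. psum c N (prs s)) \<Phi> sequentially"
    using G[unfolded G0_def, THEN conjunct1, rule_format, of "\<epsilon>/2"] e by (simp only: psum_prs half_gt_zero)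
  hence U: "uniformly_Cauchy_on {s. Re s > \<epsilon>/2} (\<lambda>N s. psum c N (prs s))"
    by (intro uniformly_convergent_Cauchy) (auto simp: uniformly_convergent_on_def)
  have "uniformly_Cauchy_on (pdisc \<epsilon>) (psum c)"
    unfolding uniformly_Cauchy_on_def
  proof (intro allI impI)
    fix e :: real assume "e > 0"
    then obtain M where M: "\<And>s m n. Re s > \<epsilon>/2 \<Longrightarrow> m \<ge> M \<Longrightarrow> n \<ge> M \<Longrightarrow> dist (psum c m (prs s)) (psum c n (prs s)) < e / 2"
      using U unfolding uniformly_Cauchy_on_def by (metis half_gt_zero mem_Collect_eq)
    have *: "dist (psum c m z) (psum c n z) < e" if mn: "m \<ge> M" "n \<ge> m" and z: "z \<in> pdisc \<epsilon>" for m n z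
    proof -
      \<comment> \<open>Coefficients up to index \<open>m\<close> are erased. Since
        \<open>psum\<close> reads \<open>c (Suc k)\<close>, the terms with \<open>k \<ge> m\<close>
        are exactly those with coefficient index above \<open>m\<close>.\<close>
      define b where "b = (\<lambda>k. if k \<le> m then 0 else c k)"
      have b: "psum c n x - psum c m x = psum b n x" for x
      proof -
        have "psum c n x = psum c m x + (\<Sum>k\<in>{m..<n}. c (Suc k) * mon x (Suc k))"
          unfolding psum_def using mn by (subst sum.atLeastLessThan_concat[symmetric, of 0 m n, unfolded atLeast0LessThan]) auto
        also have "(\<Sum>k\<in>{m..<n}. c (Suc k) * mon x (Suc k)) = (\<Sum>k<n. b (Suc k) * mon x (Suc k))"
          by (rule sum.mono_neutral_cong_left) (auto simp: b_def)
        finally show ?thesis by (simp add: psum_def)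
      qed
      have "norm (psum b n z) \<le> e / 2"
      proof (rule psum_bound_pdisc[OF _ z])
        fix t
        have "Re (Complex \<epsilon> t) > \<epsilon>/2" using e by simp
        from M[OF this, of n m] mn show "norm (psum b n (prs (Complex \<epsilon> t))) \<le> e / 2"
          by (simp add: b[symmetric] dist_norm)
      qed
      thus ?thesis using \<open>e > 0\<close> by (simp add: b[symmetric] dist_norm norm_minus_commute)
    qed
    have "dist (psum c m z) (psum c n z) < e" if "m \<ge> M" "n \<ge> M" "z \<in> pdisc \<epsilon>" for m n z
      using *[of m n z] *[of n m z] that by (cases "m \<le> n") (auto simp: dist_commute)
    thus "\<exists>M. \<forall>x\<in>pdisc \<epsilon>. \<forall>m\<ge>M. \<forall>n\<ge>M. dist (psum c m x) (psum c n x) < e" by blast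
  qed
  hence "uniformly_convergent_on (pdisc \<epsilon>) (psum c)" by (rule Cauchy_uniformly_convergent)
  then obtain l where l: "uniform_limit (pdisc \<epsilon>) (psum c) l sequentially" by (auto simp: uniformly_convergent_on_def)
  have "bohr c z = l z" if "z \<in> pdisc \<epsilon>" for z
    unfolding bohr_def using tendsto_uniform_limitI[OF l that] by (rule limI)
  thus ?thesis using l by (subst uniform_limit_cong'[of _ "psum c" "psum c" _ l]) auto
qed

lemma continuous_bohr:
  assumes "G0 \<Phi> c" "\<epsilon> > 0"
  shows "continuous_on (pdisc \<epsilon>) (bohr c)"
  by (rule uniform_limit_theorem[OF _ bohr_uniform_limit[OF assms]]) (auto intro!: always_eventually continuous_psum)

lemma prs_pdisc: "Re s \<ge> \<epsilon> \<Longrightarrow> prs s \<in> pdisc \<epsilon>"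
  using pr_ge_2 by (auto simp: pdisc_def norm_prs intro!: powr_mono)

lemma bohr_prs:
  assumes G: "G0 \<Phi> c" and s: "Re s > 0"
  shows "bohr c (prs s) = \<Phi> s"
proof -
  have "uniform_limit {s'. Re s' > Re s / 2} (\<lambda>N s. psum c N (prs s)) \<Phi> sequentially"
    using G[unfolded G0_def, THEN conjunct1, rule_format, of "Re s / 2"] s by (simp only: psum_prs half_gt_zero)
  hence "(\<lambda>N. psum c N (prs s)) \<longlonglongrightarrow> \<Phi> s" by (rule tendsto_uniform_limitI) (use s in auto)
  thus ?thesis unfolding bohr_def by (rule limI)
qed

lemma bohr_0: "bohr c (\<lambda>_. 0) = c 1"
proof -
  have "psum c N (\<lambda>_. 0) = c 1" if "N > 0" for N
  proof -
    have z: "mon (\<lambda>_. 0) (Suc n) = 0" if "n > 0" for n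
    proof -
      have "prime_factors (Suc n) \<noteq> {}" using that by (simp add: prime_factorization_empty_iff)
      thus ?thesis unfolding mon_prod by (intro prod_zero) (auto simp: ex_in_conv[symmetric] power_0_left)
    qed
    have "psum c N (\<lambda>_. 0) = (\<Sum>n\<in>{0}. c (Suc n) * mon (\<lambda>_. 0) (Suc n))"
      unfolding psum_def using that z by (intro sum.mono_neutral_right) auto
    thus ?thesis by simp
  qed
  hence "(\<lambda>N. psum c N (\<lambda>_. 0)) \<longlonglongrightarrow> c 1"
    by (intro tendsto_eventually eventually_sequentiallyI[of 1]) auto
  thus ?thesis unfolding bohr_def by (rule limI)
qed

lemma holomorphic_bohr_upd:
  assumes G: "G0 \<Phi> c" and e: "\<epsilon> > 0" and z: "z \<in> pdisc \<epsilon>"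
  shows "(\<lambda>x. bohr c (z(j := x))) holomorphic_on ball 0 (real (pr j) powr (- \<epsilon>))"
proof (rule holomorphic_uniform_sequence[OF open_ball])
  show "(\<lambda>x. psum c n (z(j := x))) holomorphic_on ball 0 (real (pr j) powr (- \<epsilon>))" for n
    by (rule holomorphic_psum_upd)
  fix x assume "x \<in> ball (0::complex) (real (pr j) powr (- \<epsilon>))"
  then obtain d where d: "d > 0" "cball x d \<subseteq> ball 0 (real (pr j) powr (- \<epsilon>))"
    using open_contains_cball open_ball by blast
  have "uniform_limit (cball x d) (\<lambda>n x. psum c n (z(j := x))) (\<lambda>x. bohr c (z(j := x))) sequentially"
  proof (rule uniform_limit_compose'[OF bohr_uniform_limit[OF G e]])
    show "(\<lambda>x. z(j := x)) \<in> cball x d \<rightarrow> pdisc \<epsilon>" using d z by (force simp: pdisc_def)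
  qed
  thus "\<exists>d>0. cball x d \<subseteq> ball 0 (real (pr j) powr - \<epsilon>) \<and>
         uniform_limit (cball x d) (\<lambda>n x. psum c n (z(j := x))) (\<lambda>x. bohr c (z(j := x))) sequentially"
    using d by blast
qed

section \<open>Vertical limit functions\<close>

text \<open>\<open>twist c \<omega>\<close> is the vertical limit function \<open>\<Sum>n. c n * \<omega> n * n powr -s\<close>.\<close>

definition twist :: "(nat \<Rightarrow> complex) \<Rightarrow> (nat \<Rightarrow> complex) \<Rightarrow> complex \<Rightarrow> complex" where
  "twist c \<omega> s = bohr c (\<lambda>i. \<omega> i * prs s i)"

definition torus :: "(nat \<Rightarrow> complex) set" where "torus = {\<omega>. \<forall>i. norm (\<omega> i) = 1}"

definition flow :: "real \<Rightarrow> nat \<Rightarrow> complex" where "flow t = prs (\<i> * of_real t)"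

lemma flow_torus [simp]: "flow t \<in> torus"
  by (simp add: torus_def flow_def norm_prs)

lemma twist_flow:
  assumes G: "G0 \<Phi> c" and s: "Re s > 0"
  shows "twist c (flow t) s = \<Phi> (s + \<i> * of_real t)"
proof -
  have "(\<lambda>i. flow t i * prs s i) = prs (s + \<i> * of_real t)"
    by (auto simp: flow_def prs_def powr_add[symmetric] fun_eq_iff algebra_simps)
  thus ?thesis unfolding twist_def using bohr_prs[OF G, of "s + \<i> * of_real t"] s by simp
qed

lemma torus_prs_pdisc: "\<omega> \<in> torus \<Longrightarrow> Re s \<ge> \<epsilon> \<Longrightarrow> (\<lambda>i. \<omega> i * prs s i) \<in> pdisc \<epsilon>"
  using prs_pdisc[of \<epsilon> s] by (auto simp: torus_def pdisc_def norm_mult)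

lemma continuous_prs: "continuous_on A (\<lambda>s. prs s i)"
  unfolding prs_def using pr_pos[of i] by (intro continuous_intros) (auto simp del: pr_pos)

lemma holomorphic_psum_prs: "(\<lambda>s. psum c N (\<lambda>i. \<omega> i * prs s i)) holomorphic_on A"
  unfolding psum_def mon_times prs_def
  by (subst mon_powr) (auto intro!: holomorphic_intros)

lemma holomorphic_twist:
  assumes G: "G0 \<Phi> c" and e: "\<epsilon> > 0" and V: "open V"
    and \<omega>: "\<And>s. s \<in> V \<Longrightarrow> (\<lambda>i. \<omega> i * prs s i) \<in> pdisc \<epsilon>"
  shows "twist c \<omega> holomorphic_on V"
proof (rule holomorphic_uniform_sequence[OF V])
  show "(\<lambda>s. psum c n (\<lambda>i. \<omega> i * prs s i)) holomorphic_on V" for n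
    by (rule holomorphic_psum_prs)
  fix x assume "x \<in> V"
  then obtain d where d: "d > 0" "cball x d \<subseteq> V" using V open_contains_cball by blast
  have "uniform_limit (cball x d) (\<lambda>n s. psum c n (\<lambda>i. \<omega> i * prs s i)) (twist c \<omega>) sequentially"
    unfolding twist_def
    by (rule uniform_limit_compose'[OF bohr_uniform_limit[OF G e]]) (use d \<omega> in auto)
  thus "\<exists>d>0. cball x d \<subseteq> V \<and>
         uniform_limit (cball x d) (\<lambda>n s. psum c n (\<lambda>i. \<omega> i * prs s i)) (twist c \<omega>) sequentially"
    using d by blast
qed

text \<open>Both the coefficients \<open>\<kappa>\<close> and the point \<open>l\<close> may move:
  this covers the torus together with a half plane as well as the complex extension of a single
  coordinate.\<close>

lemma continuous_twist:
  fixes X :: "'a::topological_space set"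
  assumes G: "G0 \<Phi> c" and e: "\<epsilon> > 0" and k: "\<And>i. continuous_on X (\<lambda>x. \<kappa> x i)" and l: "continuous_on X l"
    and \<omega>: "\<And>x. x \<in> X \<Longrightarrow> (\<lambda>i. \<kappa> x i * prs (l x) i) \<in> pdisc \<epsilon>"
  shows "continuous_on X (\<lambda>x. twist c (\<kappa> x) (l x))"
  unfolding twist_def
proof (rule continuous_on_compose2[OF continuous_bohr[OF G e]])
  show "continuous_on X (\<lambda>x i. \<kappa> x i * prs (l x) i)"
    by (intro continuous_on_coordinatewise_then_product continuous_intros k
          continuous_on_compose2[OF continuous_prs[of UNIV] l]) auto
qed (use \<omega> in auto)

lemma continuous_twist_torus:
  assumes G: "G0 \<Phi> c" and e: "\<epsilon> > 0"
  shows "continuous_on (torus \<times> {s. Re s \<ge> \<epsilon>}) (\<lambda>(\<omega>,s). twist c \<omega> s)"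
  unfolding split_def
  by (rule continuous_twist[OF G e])
     (auto intro!: continuous_intros continuous_on_product_then_coordinatewise[OF continuous_on_fst[OF continuous_on_id]] torus_prs_pdisc)

text \<open>As \<open>Re s\<close> grows, \<open>\<lambda>i. \<omega> i * prs s i\<close> tends to
  the origin in every coordinate, whatever \<open>\<omega>\<close> is, and \<open>bohr c\<close> is
  continuous there with value \<open>c 1\<close>. A sequence of counterexamples stays in
  \<open>pdisc 1\<close>, so continuity on this one set contradicts it.\<close>

lemma twist_near_infinity:
  assumes G: "G0 \<Phi> c" and e: "e > 0"
  obtains b where "b > 0" "\<And>\<omega> s. \<omega> \<in> torus \<Longrightarrow> Re s \<ge> b \<Longrightarrow> norm (twist c \<omega> s - c 1) < e"
proof (rule ccontr)
  assume neg: "\<not> thesis"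
  note that' = that
  have "\<exists>\<omega> s. \<omega> \<in> torus \<and> Re s \<ge> real (Suc n) \<and> norm (twist c \<omega> s - c 1) \<ge> e" for n
  proof (rule ccontr)
    assume "\<not> ?thesis"
    hence "norm (twist c \<omega> s - c 1) < e" if "\<omega> \<in> torus" "Re s \<ge> real (Suc n)" for \<omega> s
      using that by (meson not_le)
    thus False using that'[of "real (Suc n)"] neg by simp
  qed
  then obtain \<omega> s where \<omega>s: "\<And>n. \<omega> n \<in> torus" "\<And>n. Re (s n) \<ge> real (Suc n)" "\<And>n. norm (twist c (\<omega> n) (s n) - c 1) \<ge> e"
    by metis
  define x where "x = (\<lambda>n i. \<omega> n i * prs (s n) i)"
  have x1: "x n \<in> pdisc 1" for n
    unfolding x_def using \<omega>s(1)[of n] \<omega>s(2)[of n] by (intro torus_prs_pdisc) auto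
  have "(x \<longlongrightarrow> (\<lambda>_. 0)) sequentially"
  proof (rule tendsto_fun_coordinatewise)
    fix i
    have "norm (x n i) \<le> (1/2) ^ n" for n
    proof -
      have "norm (x n i) = real (pr i) powr (- Re (s n))"
        using \<omega>s(1)[of n] by (simp add: x_def norm_mult norm_prs torus_def)
      also have "\<dots> \<le> real (pr i) powr (- real n)"
        using pr_ge_2[of i] \<omega>s(2)[of n] by (intro powr_mono) auto
      also have "\<dots> = (1 / real (pr i)) ^ n"
        by (simp add: powr_minus powr_realpow power_one_over inverse_eq_divide)
      also have "\<dots> \<le> (1/2) ^ n" using pr_ge_2[of i] by (intro power_mono) (auto simp: field_simps)
      finally show ?thesis .
    qed
    thus "((\<lambda>n. x n i) \<longlongrightarrow> 0) sequentially"
      by (intro Lim_null_comparison[OF always_eventually LIMSEQ_realpow_zero[of "1/2"]]) auto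
  qed
  moreover have "(\<lambda>_. 0) \<in> pdisc 1" by (simp add: pdisc_def)
  ultimately have "((\<lambda>n. bohr c (x n)) \<longlongrightarrow> bohr c (\<lambda>_. 0)) sequentially"
    using x1 by (intro continuous_on_tendsto_compose[OF continuous_bohr[OF G zero_less_one]]) auto
  hence "(\<lambda>n. norm (bohr c (x n) - c 1)) \<longlonglongrightarrow> 0"
    by (simp add: bohr_0 LIM_zero tendsto_norm_zero)
  hence "e \<le> 0"
    by (rule tendsto_lowerbound) (use \<omega>s(3) in \<open>auto simp: twist_def x_def\<close>)
  thus False using e by simp
qed

section \<open>Equidistribution of the Kronecker flow\<close>

text \<open>Normalised arc length, as a measure on the whole complex plane: its products then live
  on the Borel sets of \<open>nat \<Rightarrow> complex\<close>, and lying on the circle becomes an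
  almost everywhere statement.\<close>

definition circ :: "complex measure" where
  "circ = distr (restrict_space lborel {0..1}) borel (\<lambda>t. cis (2 * pi * t))"

lemma sets_circ [simp, measurable_cong]: "sets circ = sets borel"
  and space_circ [simp]: "space circ = UNIV"
  by (simp_all add: circ_def)

lemma measurable_cis_restrict [measurable]: "(\<lambda>t. cis (2 * pi * t)) \<in> restrict_space lborel {0..1} \<rightarrow>\<^sub>M borel"
proof -
  have "(\<lambda>t. cis (2 * pi * t)) \<in> borel_measurable borel" by (intro borel_measurable_continuous_onI continuous_intros)
  thus ?thesis by (intro measurable_restrict_space1) simp
qed

lemma prob_space_circ: "prob_space circ"
  unfolding circ_def
proof (rule prob_space.prob_space_distr[OF prob_spaceI measurable_cis_restrict])
  show "emeasure (restrict_space lborel {0..1::real}) (space (restrict_space lborel {0..1})) = 1"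
    by (simp add: space_restrict_space emeasure_restrict_space)
qed

lemma integral_circ:
  fixes f :: "complex \<Rightarrow> complex"
  assumes "continuous_on UNIV f"
  shows "integral\<^sup>L circ f = integral {0..1} (\<lambda>t. f (cis (2 * pi * t)))"
proof -
  have c: "continuous_on A (\<lambda>t. f (cis (2 * pi * t)))" for A
    by (rule continuous_on_compose2[OF assms]) (auto intro!: continuous_intros)
  have "integral\<^sup>L circ f = integral\<^sup>L (restrict_space lborel {0..1}) (\<lambda>t. f (cis (2 * pi * t)))"
    unfolding circ_def by (rule integral_distr[OF measurable_cis_restrict borel_measurable_continuous_onI[OF assms]])
  also have "\<dots> = set_lebesgue_integral lborel {0..1} (\<lambda>t. f (cis (2 * pi * t)))"
    by (subst integral_restrict_space) (auto simp: set_lebesgue_integral_def)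
  also have "\<dots> = integral {0..1} (\<lambda>t. f (cis (2 * pi * t)))"
    by (intro set_borel_integral_eq_integral(2) borel_integrable_atLeastAtMost' c)
  finally show ?thesis .
qed

lemma integral_circ_power:
  assumes "a \<noteq> b"
  shows "integral\<^sup>L circ (\<lambda>x. x ^ a * cnj x ^ b) = 0"
proof -
  define k where "k = real a - real b"
  have k: "k \<noteq> 0" using assms by (simp add: k_def)
  have "integral\<^sup>L circ (\<lambda>x. x ^ a * cnj x ^ b) = integral {0..1} (\<lambda>t. cis (2 * pi * t) ^ a * cnj (cis (2 * pi * t)) ^ b)"
    by (rule integral_circ) (intro continuous_intros)
  also have "\<dots> = integral {0..1} (\<lambda>t. exp ((2 * pi * k * \<i>) * of_real t))"
  proof (rule integral_cong)
    fix t :: real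
    have "cis (2 * pi * t) ^ a * cnj (cis (2 * pi * t)) ^ b = cis (real a * (2 * pi * t) + real b * (- (2 * pi * t)))"
      by (simp only: cis_cnj Complex.DeMoivre cis_mult)
    also have "real a * (2 * pi * t) + real b * (- (2 * pi * t)) = 2 * pi * k * t" by (simp add: k_def algebra_simps)
    finally show "cis (2 * pi * t) ^ a * cnj (cis (2 * pi * t)) ^ b = exp ((2 * pi * k * \<i>) * of_real t)"
      by (simp add: cis_conv_exp mult_ac)
  qed
  also have "\<dots> = 0"
  proof (rule integral_unique)
    have "((\<lambda>t. exp ((2 * pi * k * \<i>) * of_real t)) has_integral
       (exp ((2 * pi * k * \<i>) * of_real 1) / (2 * pi * k * \<i>) - exp ((2 * pi * k * \<i>) * of_real 0) / (2 * pi * k * \<i>))) {0..1}"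
    proof (rule fundamental_theorem_of_calculus)
      fix x :: real
      have "((\<lambda>t. exp ((2 * pi * k * \<i>) * t) / (2 * pi * k * \<i>)) has_field_derivative exp ((2 * pi * k * \<i>) * of_real x)) (at (of_real x))"
        using k by (auto intro!: derivative_eq_intros)
      thus "((\<lambda>t. exp ((2 * pi * k * \<i>) * of_real t) / (2 * pi * k * \<i>)) has_vector_derivative
             exp ((2 * pi * k * \<i>) * of_real x)) (at x within {0..1})"
        using has_vector_derivative_real_field has_vector_derivative_at_within by blast
    qed auto
    moreover have "exp (2 * pi * k * \<i>) = 1"
      unfolding k_def using exp_integer_2pi[of "of_int (int a - int b)"] by (simp add: algebra_simps)
    ultimately show "((\<lambda>t. exp ((2 * pi * k * \<i>) * of_real t)) has_integral 0) {0..1}" by simp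
  qed
  finally show ?thesis .
qed

lemma emeasure_circ_countable:
  assumes "countable A" shows "emeasure circ A = 0"
proof -
  have [measurable]: "A \<in> sets borel" by (rule sets.countable) (use assms in auto)
  have "countable {t \<in> {0..1}. cis (2 * pi * t) = z}" for z
  proof (cases "\<exists>t0. cis (2 * pi * t0) = z")
    case True
    then obtain t0 where t0: "cis (2 * pi * t0) = z" by blast
    have "{t \<in> {0..1}. cis (2 * pi * t) = z} \<subseteq> range (\<lambda>n::int. t0 + of_int n)"
    proof safe
      fix t assume "z = cis (2 * pi * t)"
      hence "cis (2 * pi * (t - t0)) = 1" using t0 by (simp add: right_diff_distrib cis_divide[symmetric])
      hence "cos (2 * pi * (t - t0)) = 1" by (simp add: complex_eq_iff)
      then obtain n :: int where "2 * pi * (t - t0) = of_int n * 2 * pi" by (auto simp: cos_one_2pi_int)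
      thus "t \<in> range (\<lambda>n::int. t0 + of_int n)" by (intro image_eqI[of _ _ n]) auto
    qed
    thus ?thesis by (rule countable_subset) simp
  next
    case False
    hence "{t \<in> {0..1}. cis (2 * pi * t) = z} = {}" by auto
    thus ?thesis by (simp only: countable_empty)
  qed
  hence "countable (\<Union>z\<in>A. {t \<in> {0..1}. cis (2 * pi * t) = z})" using assms by (rule countable_UN[rotated])
  moreover have "(\<Union>z\<in>A. {t \<in> {0..1}. cis (2 * pi * t) = z}) = (\<lambda>t. cis (2 * pi * t)) -` A \<inter> {0..1}" by auto
  ultimately have "countable ((\<lambda>t. cis (2 * pi * t)) -` A \<inter> {0..1})" by simp
  hence "emeasure lborel ((\<lambda>t. cis (2 * pi * t)) -` A \<inter> {0..1}) = 0" by (rule emeasure_lborel_countable)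
  thus ?thesis unfolding circ_def
    by (subst emeasure_distr) (auto simp: space_restrict_space emeasure_restrict_space)
qed

lemma AE_circ: "AE x in circ. norm x = 1"
  unfolding circ_def by (subst AE_distr_iff) (auto intro!: measurable_cis_restrict)

definition haar :: "(nat \<Rightarrow> complex) measure" where "haar = PiM UNIV (\<lambda>_. circ)"

lemma sets_haar [simp, measurable_cong]: "sets haar = sets borel"
proof -
  have "sets haar = sets (PiM UNIV (\<lambda>_::nat. borel :: complex measure))"
    unfolding haar_def by (rule sets_PiM_cong) auto
  thus ?thesis by (simp add: sets_PiM_equal_borel)
qed

lemma space_haar [simp]: "space haar = UNIV"
  by (simp add: haar_def space_PiM)

lemma prob_space_haar: "prob_space haar"
  unfolding haar_def by (rule prob_space_PiM) (rule prob_space_circ)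

lemma AE_haar: "AE \<omega> in haar. \<omega> \<in> torus"
  unfolding torus_def mem_Collect_eq AE_all_countable
proof
  fix i
  show "AE \<omega> in haar. norm (\<omega> i) = 1"
    unfolding haar_def by (rule AE_PiM_component[where P = "\<lambda>x. norm x = 1"]) (auto simp: AE_circ prob_space_circ)
qed

text \<open>Resampling one coordinate independently preserves a product measure. This is the form in
  which Fubini's theorem is applied to the coordinate \<open>j\<close>.\<close>

lemma distr_haar_upd: "distr (circ \<Otimes>\<^sub>M haar) haar (\<lambda>(x, X). X(j := x)) = haar"
  using distr_pair_PiM_eq_PiM[of UNIV "\<lambda>_. circ" j] by (simp add: haar_def prob_space_circ)

lemma measurable_upd [measurable]: "(\<lambda>(x, X). X(j := x)) \<in> circ \<Otimes>\<^sub>M haar \<rightarrow>\<^sub>M haar"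
  unfolding haar_def split_def by (rule measurable_fun_upd[where J = UNIV]) auto

lemma pair_sigma_finite_circ_haar: "pair_sigma_finite circ haar"
proof -
  interpret circ: prob_space circ by (rule prob_space_circ)
  interpret haar: prob_space haar by (rule prob_space_haar)
  show ?thesis ..
qed

text \<open>After resampling coordinate \<open>j\<close>, the measure of \<open>W\<close> is an
  average of the measures of its slices, and \<open>circ\<close> has no atoms. Only base points on
  the torus matter, because the torus has full measure.\<close>

lemma null_haar_slices:
  assumes W: "W \<in> sets borel" and s: "\<And>X. X \<in> torus \<Longrightarrow> countable {x \<in> sphere 0 1. X(j := x) \<in> W}"
  shows "W \<in> null_sets haar"
proof -
  interpret pair_sigma_finite circ haar by (rule pair_sigma_finite_circ_haar)
  have [measurable]: "W \<in> sets haar" using W by simp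
  let ?V = "(\<lambda>(x, X). X(j := x)) -` W \<inter> space (circ \<Otimes>\<^sub>M haar)"
  have V: "?V \<in> sets (circ \<Otimes>\<^sub>M haar)" by measurable
  have "emeasure haar W = emeasure (distr (circ \<Otimes>\<^sub>M haar) haar (\<lambda>(x, X). X(j := x))) W" by (simp add: distr_haar_upd)
  also have "\<dots> = emeasure (circ \<Otimes>\<^sub>M haar) ?V" by (rule emeasure_distr) measurable
  also have "\<dots> = (\<integral>\<^sup>+X. emeasure circ ((\<lambda>x. (x, X)) -` ?V) \<partial>haar)" by (rule emeasure_pair_measure_alt2[OF V])
  also have "\<dots> = (\<integral>\<^sup>+X. 0 \<partial>haar)"
  proof (rule nn_integral_cong_AE, use AE_haar in eventually_elim)
    case (elim X)
    have m: "(\<lambda>x. (x, X)) -` ?V \<in> sets circ" using V by (rule sets_Pair2)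
    have "emeasure circ ((\<lambda>x. (x, X)) -` ?V) = emeasure circ ((\<lambda>x. (x, X)) -` ?V \<inter> sphere 0 1)"
      by (rule emeasure_eq_AE) (use AE_circ m in auto)
    also have "(\<lambda>x. (x, X)) -` ?V \<inter> sphere 0 1 = {x \<in> sphere 0 1. X(j := x) \<in> W}" by (auto simp: space_pair_measure)
    also have "emeasure circ \<dots> = 0" using s[OF elim] by (rule emeasure_circ_countable)
    finally show ?case .
  qed
  finally show ?thesis using W by (simp add: null_sets_def)
qed

section \<open>Time averages and trigonometric polynomials\<close>

definition avg :: "(real \<Rightarrow> real) \<Rightarrow> real \<Rightarrow> real" where
  "avg g T = integral {-T..T} g / (2 * T)"

definition cavg :: "(real \<Rightarrow> complex) \<Rightarrow> real \<Rightarrow> complex" where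
  "cavg g T = integral {-T..T} g / (2 * of_real T)"

text \<open>On the torus, the character attached to the positive rational \<open>a / b\<close>;
  along the flow it is the exponential with frequency \<open>ln (b / a)\<close>.\<close>

definition trig :: "nat \<Rightarrow> nat \<Rightarrow> (nat \<Rightarrow> complex) \<Rightarrow> complex" where
  "trig a b \<omega> = mon \<omega> a * cnj (mon \<omega> b)"

inductive tpoly :: "((nat \<Rightarrow> complex) \<Rightarrow> complex) \<Rightarrow> bool" where
  trig: "a > 0 \<Longrightarrow> b > 0 \<Longrightarrow> tpoly (\<lambda>\<omega>. k * trig a b \<omega>)"
| add: "tpoly f \<Longrightarrow> tpoly g \<Longrightarrow> tpoly (\<lambda>\<omega>. f \<omega> + g \<omega>)"

lemma tpoly_cnj: "tpoly f \<Longrightarrow> tpoly (\<lambda>\<omega>. cnj (f \<omega>))"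
proof (induction rule: tpoly.induct)
  case (trig a b k)
  have "tpoly (\<lambda>\<omega>. cnj k * trig b a \<omega>)" using trig by (intro tpoly.trig)
  thus ?case by (simp add: trig_def mult_ac)
qed (auto intro: tpoly.add)

lemma tpoly_mult: "tpoly f \<Longrightarrow> tpoly g \<Longrightarrow> tpoly (\<lambda>\<omega>. f \<omega> * g \<omega>)"
proof (induction f rule: tpoly.induct)
  case (trig a b k)
  from trig(3) show ?case
  proof (induction g rule: tpoly.induct)
    case (trig a' b' k')
    have "tpoly (\<lambda>\<omega>. (k * k') * trig (a * a') (b * b') \<omega>)" using trig \<open>a > 0\<close> \<open>b > 0\<close> by (intro tpoly.trig) auto
    thus ?case using trig \<open>a > 0\<close> \<open>b > 0\<close> by (simp add: trig_def mon_mult mult_ac)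
  qed (auto simp: distrib_left intro: tpoly.add)
qed (auto simp: distrib_right intro: tpoly.add)

lemma tpoly_continuous: "tpoly f \<Longrightarrow> continuous_on A f"
  by (induction rule: tpoly.induct) (auto simp: trig_def intro!: continuous_intros continuous_mon)

lemma tpoly_bounded: "tpoly f \<Longrightarrow> \<exists>B. \<forall>\<omega>\<in>torus. norm (f \<omega>) \<le> B"
proof (induction rule: tpoly.induct)
  case (trig a b k)
  show ?case by (rule exI[of _ "norm k"]) (auto simp: trig_def norm_mult torus_def norm_mon_unimodular)
next
  case (add f g)
  then obtain B C where "\<forall>\<omega>\<in>torus. norm (f \<omega>) \<le> B" "\<forall>\<omega>\<in>torus. norm (g \<omega>) \<le> C" by blast
  thus ?case by (intro exI[of _ "B + C"]) (auto intro: norm_triangle_mono)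
qed

lemma integrable_haar_bounded:
  fixes f :: "(nat \<Rightarrow> complex) \<Rightarrow> 'b::{banach, second_countable_topology}"
  assumes "continuous_on UNIV f" "\<And>\<omega>. \<omega> \<in> torus \<Longrightarrow> norm (f \<omega>) \<le> B"
  shows "integrable haar f"
proof -
  interpret haar: prob_space haar by (rule prob_space_haar)
  have "f \<in> borel_measurable haar"
    using borel_measurable_continuous_onI[OF assms(1)] by (simp cong: measurable_cong_sets)
  thus ?thesis
    by (rule haar.integrable_const_bound[where B = B, rotated]) (use AE_haar assms in \<open>auto elim: eventually_mono\<close>)
qed

lemma continuous_flow: "continuous_on A flow"
  unfolding flow_def
  by (intro continuous_on_coordinatewise_then_product continuous_on_compose2[OF continuous_prs[of UNIV]])
     (auto intro!: continuous_intros)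

lemma trig_flow:
  assumes "a > 0" "b > 0"
  shows "trig a b (flow t) = exp (\<i> * of_real (ln (real b / real a) * t))"
proof -
  have "mon (flow t) n = exp (- \<i> * of_real (ln (real n) * t))" if "n > 0" for n
    unfolding flow_def prs_def using that by (subst mon_powr) (auto simp: powr_def Ln_of_nat mult_ac)
  thus ?thesis using assms by (simp add: trig_def exp_cnj exp_add[symmetric] ln_div algebra_simps)
qed

lemma cavg_exp_le:
  assumes "\<theta> \<noteq> 0" "T > 0"
  shows "norm (cavg (\<lambda>t. exp (\<i> * of_real (\<theta> * t))) T) \<le> 1 / (T * \<bar>\<theta>\<bar>)"
proof -
  let ?F = "\<lambda>t. exp (\<i> * of_real (\<theta> * t)) / (\<i> * of_real \<theta>)"
  have "((\<lambda>t. exp (\<i> * of_real (\<theta> * t))) has_integral (?F T - ?F (- T))) {-T..T}"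
  proof (rule fundamental_theorem_of_calculus)
    fix x :: real
    have "((\<lambda>t. exp (\<i> * of_real \<theta> * t) / (\<i> * of_real \<theta>)) has_field_derivative exp (\<i> * of_real \<theta> * of_real x)) (at (of_real x))"
      using assms by (auto intro!: derivative_eq_intros)
    hence "((\<lambda>t. exp (\<i> * of_real \<theta> * of_real t) / (\<i> * of_real \<theta>)) has_vector_derivative exp (\<i> * of_real \<theta> * of_real x)) (at x within {-T..T})"
      using has_vector_derivative_real_field has_vector_derivative_at_within by blast
    thus "(?F has_vector_derivative exp (\<i> * of_real (\<theta> * x))) (at x within {-T..T})" by (simp add: mult.assoc)
  qed (use assms in auto)
  hence "integral {-T..T} (\<lambda>t. exp (\<i> * of_real (\<theta> * t))) = ?F T - ?F (- T)" by (rule integral_unique)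
  hence "norm (integral {-T..T} (\<lambda>t. exp (\<i> * of_real (\<theta> * t)))) = norm (?F T - ?F (- T))" by (simp only:)
  also have "\<dots> \<le> norm (?F T) + norm (?F (- T))" by (rule norm_triangle_ineq4)
  also have "\<dots> = 1 / \<bar>\<theta>\<bar> + 1 / \<bar>\<theta>\<bar>"
    by (intro arg_cong2[where f = "(+)"]) (simp_all add: norm_divide norm_mult)
  finally have "norm (integral {-T..T} (\<lambda>t. exp (\<i> * of_real (\<theta> * t)))) \<le> 2 / \<bar>\<theta>\<bar>" by simp
  thus ?thesis unfolding cavg_def norm_divide using assms by (simp add: norm_mult field_simps)
qed

lemma cavg_exp:
  assumes "\<theta> \<noteq> 0"
  shows "(cavg (\<lambda>t. exp (\<i> * of_real (\<theta> * t))) \<longlongrightarrow> 0) at_top"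
proof (rule Lim_null_comparison)
  show "\<forall>\<^sub>F T in at_top. norm (cavg (\<lambda>t. exp (\<i> * of_real (\<theta> * t))) T) \<le> 1 / (T * \<bar>\<theta>\<bar>)"
    using eventually_gt_at_top[of 0] by eventually_elim (rule cavg_exp_le[OF assms])
  show "((\<lambda>T. 1 / (T * \<bar>\<theta>\<bar>)) \<longlongrightarrow> 0) at_top" using assms by real_asymp
qed

lemma measurable_trig [measurable]: "trig a b \<in> borel_measurable haar"
proof -
  have "continuous_on UNIV (trig a b)" unfolding trig_def by (intro continuous_intros continuous_mon)
  from borel_measurable_continuous_onI[OF this] show ?thesis by (simp cong: measurable_cong_sets)
qed

text \<open>Some prime divides \<open>a\<close> and \<open>b\<close> to different powers.
  Integrating over its coordinate first leaves \<open>x ^ k * cnj x ^ l\<close> with distinct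
  exponents, times a factor constant in \<open>x\<close>, and this integral vanishes.\<close>

lemma integral_trig:
  assumes "a > 0" "b > 0" "a \<noteq> b"
  shows "integral\<^sup>L haar (trig a b) = 0"
proof -
  interpret pair_sigma_finite circ haar by (rule pair_sigma_finite_circ_haar)
  interpret circ: prob_space circ by (rule prob_space_circ)
  interpret haar: prob_space haar by (rule prob_space_haar)
  interpret P: pair_prob_space circ haar ..
  obtain p where p: "prime p" "multiplicity p a \<noteq> multiplicity p b"
    using multiplicity_eq_nat[of a b] assms by blast
  define j where "j = ix p"
  have pj: "p = pr j" using p by (simp add: j_def pr_ix)
  \<comment> \<open>Putting 1 into coordinate \<open>j\<close> removes the prime \<open>p\<close>
    from the monomial, which separates the dependence on \<open>x\<close>.\<close>
  have spl: "mon (X(j := x)) n = x ^ multiplicity p n * mon (X(j := 1)) n" if n: "n > 0" for x X n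
  proof (cases "p \<in> prime_factors n")
    case True
    have ne: "q \<in> prime_factors n - {p} \<Longrightarrow> ix q \<noteq> j" for q
      using pr_ix[of q] in_prime_factors_imp_prime[of q n] by (auto simp: pj)
    have "mon (X(j := y)) n = y ^ multiplicity p n * (\<Prod>q\<in>prime_factors n - {p}. X (ix q) ^ count (prime_factorization n) q)" for y
      unfolding mon_prod using True p ne
      by (subst prod.remove[of _ p]) (auto simp: j_def count_prime_factorization intro!: arg_cong2[where f = times] prod.cong)
    from this[of x] this[of 1] show ?thesis by simp
  next
    case False
    hence "multiplicity p n = 0" using p n by (simp add: prime_factors_multiplicity)
    moreover have "mon (X(j := x)) n = mon (X(j := 1)) n"
      unfolding mon_prod
    proof (intro prod.cong refl)
      fix q assume "q \<in> prime_factors n"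
      hence "ix q \<noteq> j" using False pr_ix[of q] in_prime_factors_imp_prime[of q n] by (auto simp: pj)
      thus "(X(j := x)) (ix q) ^ count (prime_factorization n) q = (X(j := 1)) (ix q) ^ count (prime_factorization n) q" by simp
    qed
    ultimately show ?thesis by simp
  qed
  have AEP: "AE z in circ \<Otimes>\<^sub>M haar. norm (trig a b ((\<lambda>(x, X). X(j := x)) z)) \<le> 1"
  proof -
    have "AE X in distr (circ \<Otimes>\<^sub>M haar) haar (\<lambda>(x, X). X(j := x)). norm (trig a b X) \<le> 1"
      unfolding distr_haar_upd using AE_haar
      by eventually_elim (simp add: trig_def norm_mult torus_def norm_mon_unimodular)
    from AE_distrD[OF measurable_upd this] show ?thesis .
  qed
  have mt: "(\<lambda>z. trig a b ((\<lambda>(x, X). X(j := x)) z)) \<in> borel_measurable (circ \<Otimes>\<^sub>M haar)"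
    by (rule measurable_compose[OF measurable_upd measurable_trig])
  have int: "integrable (circ \<Otimes>\<^sub>M haar) (\<lambda>z. trig a b ((\<lambda>(x, X). X(j := x)) z))"
    by (rule P.integrable_const_bound[OF AEP mt])
  hence int: "integrable (circ \<Otimes>\<^sub>M haar) (\<lambda>(x, X). trig a b (X(j := x)))"
    by (simp only: split_def)
  have "integral\<^sup>L haar (trig a b) = integral\<^sup>L (distr (circ \<Otimes>\<^sub>M haar) haar (\<lambda>(x, X). X(j := x))) (trig a b)"
    by (simp only: distr_haar_upd)
  also have "\<dots> = integral\<^sup>L (circ \<Otimes>\<^sub>M haar) (\<lambda>z. trig a b ((\<lambda>(x, X). X(j := x)) z))"
    by (rule integral_distr[OF measurable_upd measurable_trig])
  also have "\<dots> = integral\<^sup>L (circ \<Otimes>\<^sub>M haar) (\<lambda>(x, X). trig a b (X(j := x)))"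
    by (simp only: split_def)
  also have "\<dots> = (\<integral>X. (\<integral>x. trig a b (X(j := x)) \<partial>circ) \<partial>haar)"
    by (rule integral_snd[OF int, symmetric])
  also have "(\<lambda>X. \<integral>x. trig a b (X(j := x)) \<partial>circ) = (\<lambda>X. 0)"
  proof
    fix X
    have "(\<integral>x. trig a b (X(j := x)) \<partial>circ) =
       (\<integral>x. (x ^ multiplicity p a * cnj x ^ multiplicity p b) * (mon (X(j := 1)) a * cnj (mon (X(j := 1)) b)) \<partial>circ)"
    proof (rule Bochner_Integration.integral_cong[OF refl])
      fix x
      show "trig a b (X(j := x)) = (x ^ multiplicity p a * cnj x ^ multiplicity p b) * (mon (X(j := 1)) a * cnj (mon (X(j := 1)) b))"
        unfolding trig_def spl[OF assms(1), of X x] spl[OF assms(2), of X x]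
        by (simp only: complex_cnj_mult complex_cnj_power mult_ac)
    qed
    also have "\<dots> = 0" using integral_circ_power[OF p(2)] by simp
    finally show "(\<integral>x. trig a b (X(j := x)) \<partial>circ) = 0" .
  qed
  finally show ?thesis by simp
qed

lemma tpoly_equidistributed: "tpoly f \<Longrightarrow> (cavg (\<lambda>t. f (flow t)) \<longlongrightarrow> integral\<^sup>L haar f) at_top"
proof (induction rule: tpoly.induct)
  case (trig a b k)
  interpret haar: prob_space haar by (rule prob_space_haar)
  have eq: "cavg (\<lambda>t. k * trig a b (flow t)) = (\<lambda>T. k * cavg (\<lambda>t. trig a b (flow t)) T)"
    by (simp add: cavg_def fun_eq_iff)
  have "(cavg (\<lambda>t. trig a b (flow t)) \<longlongrightarrow> integral\<^sup>L haar (trig a b)) at_top"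
  proof (cases "a = b")
    case True
    have "integral\<^sup>L haar (trig a b) = integral\<^sup>L haar (\<lambda>_. 1)"
    proof (rule integral_cong_AE)
      show "trig a b \<in> borel_measurable haar"
        by (rule measurable_trig)
      show "AE \<omega> in haar. trig a b \<omega> = 1" using AE_haar
      proof eventually_elim
        case (elim \<omega>)
        hence "norm (mon \<omega> b) = 1" by (simp add: torus_def norm_mon_unimodular)
        thus ?case using True by (simp add: trig_def complex_norm_square[symmetric])
      qed
    qed auto
    hence "integral\<^sup>L haar (trig a b) = 1" by (simp add: haar.prob_space[simplified])
    moreover have "\<forall>\<^sub>F T in at_top. cavg (\<lambda>t. trig a b (flow t)) T = 1"
      using eventually_gt_at_top[of 0]
      by eventually_elim (use True trig in \<open>simp add: cavg_def trig_flow scaleR_conv_of_real\<close>)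
    ultimately show ?thesis by (auto intro: tendsto_eventually)
  next
    case False
    hence "ln (real b / real a) \<noteq> 0" using trig by (auto simp: field_simps)
    from cavg_exp[OF this] show ?thesis using trig False by (simp add: integral_trig trig_flow)
  qed
  thus ?case unfolding eq by (simp add: tendsto_mult_left)
next
  case (add f g)
  have "(\<lambda>t. h (flow t)) integrable_on {-T..T}" if "tpoly h" for h T
    by (intro integrable_continuous_real continuous_on_compose2[OF tpoly_continuous[OF that] continuous_flow]) auto
  hence eq: "cavg (\<lambda>t. f (flow t) + g (flow t)) = (\<lambda>T. cavg (\<lambda>t. f (flow t)) T + cavg (\<lambda>t. g (flow t)) T)"
    using add.hyps by (simp add: cavg_def Henstock_Kurzweil_Integration.integral_add add_divide_distrib fun_eq_iff)
  have "integrable haar h" if "tpoly h" for h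
    using tpoly_bounded[OF that] tpoly_continuous[OF that] integrable_haar_bounded by blast
  hence "integral\<^sup>L haar (\<lambda>\<omega>. f \<omega> + g \<omega>) = integral\<^sup>L haar f + integral\<^sup>L haar g"
    using add.hyps by (intro Bochner_Integration.integral_add) auto
  thus ?case unfolding eq using add.IH by (auto intro: tendsto_add)
qed

lemma compact_torus: "compact torus"
proof -
  have "torus = PiE UNIV (\<lambda>_. sphere 0 1)" by (auto simp: torus_def PiE_def Pi_def)
  thus ?thesis
    using compactin_PiE[of "\<lambda>_::nat. euclidean :: complex topology" UNIV "\<lambda>_. sphere 0 1"]
    by (simp add: euclidean_product_topology)
qed

lemma avg_diff_le:
  assumes T: "T > 0" and f: "f integrable_on {-T..T}" and g: "g integrable_on {-T..T}" and e: "\<And>t. \<bar>f t - g t\<bar> \<le> e"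
  shows "\<bar>avg f T - avg g T\<bar> \<le> e"
proof -
  have i: "(\<lambda>t. f t - g t) integrable_on {-T..T}" by (rule Henstock_Kurzweil_Integration.integrable_diff[OF f g])
  have "norm (integral {-T..T} (\<lambda>t. f t - g t)) \<le> integral {-T..T} (\<lambda>t. e)"
    by (rule integral_norm_bound_integral) (use i e in auto)
  hence "\<bar>integral {-T..T} f - integral {-T..T} g\<bar> \<le> e * (2 * T)"
    using T by (simp add: Henstock_Kurzweil_Integration.integral_diff[OF f g] mult_ac)
  thus ?thesis using T by (simp add: avg_def diff_divide_distrib[symmetric] field_simps)
qed

lemma Re_cavg: "f integrable_on {-T..T} \<Longrightarrow> Re (cavg f T) = avg (\<lambda>t. Re (f t)) T"
proof -
  assume "f integrable_on {-T..T}"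
  hence "((\<lambda>t. Re (f t)) has_integral Re (integral {-T..T} f)) {-T..T}"
    by (intro has_integral_Re) auto
  hence "integral {-T..T} (\<lambda>t. Re (f t)) = Re (integral {-T..T} f)" by (rule integral_unique)
  moreover have "cavg f T = integral {-T..T} f / of_real (2 * T)" by (simp add: cavg_def)
  ultimately show ?thesis by (simp only: avg_def Re_divide_of_real)
qed

text \<open>Orthogonality of the characters and the Stone-Weierstrass theorem.\<close>

lemma equidistributed:
  fixes \<phi> :: "(nat \<Rightarrow> complex) \<Rightarrow> real"
  assumes c: "continuous_on UNIV \<phi>"
  shows "(avg (\<lambda>t. \<phi> (flow t)) \<longlongrightarrow> integral\<^sup>L haar \<phi>) at_top"
proof (rule tendstoI)
  fix e :: real assume e: "e > 0"
  interpret haar: prob_space haar by (rule prob_space_haar)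
  \<comment> \<open>Real parts, because the Stone-Weierstrass theorem is applied to a ring of real
    functions.\<close>
  define R where "R = {\<lambda>\<omega>. Re (f \<omega>) | f. tpoly f}"
  interpret SW: function_ring_on R torus
  proof
    show "compact torus" by (rule compact_torus)
    show "continuous_on torus f" if "f \<in> R" for f
      using that tpoly_continuous by (auto simp: R_def intro!: continuous_intros)
    show "(\<lambda>x. f x + g x) \<in> R" if "f \<in> R" "g \<in> R" for f g
    proof -
      obtain a b where ab: "tpoly a" "tpoly b" "f = (\<lambda>x. Re (a x))" "g = (\<lambda>x. Re (b x))" using \<open>f \<in> R\<close> \<open>g \<in> R\<close> by (auto simp: R_def)
      thus ?thesis unfolding R_def by (intro CollectI exI[of _ "\<lambda>x. a x + b x"]) (auto intro: tpoly.add)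
    qed
    have mk: "tpoly (\<lambda>x. k * f x)" if "tpoly f" for k f
      using tpoly_mult[OF tpoly.trig[of 1 1 k] that] by (simp add: trig_def)
    show "(\<lambda>x. f x * g x) \<in> R" if "f \<in> R" "g \<in> R" for f g
    proof -
      obtain a b where ab: "tpoly a" "tpoly b" "f = (\<lambda>x. Re (a x))" "g = (\<lambda>x. Re (b x))" using \<open>f \<in> R\<close> \<open>g \<in> R\<close> by (auto simp: R_def)
      \<comment> \<open>Closure under products:
        \<open>Re a * Re b = Re (a * b + a * cnj b) / 2\<close>.\<close>
      have "tpoly (\<lambda>x. (1/2) * (a x * b x + a x * cnj (b x)))"
        using ab by (intro mk tpoly.add tpoly_mult tpoly_cnj)
      moreover have "(\<lambda>x. f x * g x) = (\<lambda>x. Re ((1/2) * (a x * b x + a x * cnj (b x))))"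
        by (simp add: ab fun_eq_iff)
      ultimately show ?thesis unfolding R_def
        by (intro CollectI exI[of _ "\<lambda>x. (1/2) * (a x * b x + a x * cnj (b x))"] conjI)
    qed
    show "(\<lambda>_. c) \<in> R" for c
      unfolding R_def using tpoly.trig[of 1 1 "of_real c"] by (intro CollectI exI[of _ "\<lambda>_. of_real c"]) (simp add: trig_def)
    show "\<exists>f\<in>R. f x \<noteq> f y" if xy: "x \<in> torus" "y \<in> torus" "x \<noteq> y" for x y
    proof -
      obtain i where i: "x i \<noteq> y i" using xy(3) by (auto simp: fun_eq_iff)
      have t: "tpoly (\<lambda>\<omega>. k * \<omega> i)" for k
        using tpoly.trig[of "pr i" 1 k] by (simp add: trig_def)
      have Rk: "(\<lambda>\<omega>. Re (k * \<omega> i)) \<in> R" for k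
        unfolding R_def by (intro CollectI exI[of _ "\<lambda>\<omega>. k * \<omega> i"] conjI refl t)
      show ?thesis
      proof (cases "Re (x i) = Re (y i)")
        case True
        thus ?thesis using i by (intro bexI[OF _ Rk[of \<i>]]) (simp add: complex_eq_iff)
      next
        case False
        thus ?thesis by (intro bexI[OF _ Rk[of 1]]) simp
      qed
    qed
  qed
  have "\<exists>g\<in>R. \<forall>x\<in>torus. \<bar>\<phi> x - g x\<bar> < e/4"
    by (rule SW.Stone_Weierstrass_basic) (use c e in \<open>auto intro: continuous_on_subset\<close>)
  then obtain f where f: "tpoly f" "\<And>x. x \<in> torus \<Longrightarrow> \<bar>\<phi> x - Re (f x)\<bar> < e/4" by (auto simp: R_def)
  obtain B where B: "\<And>\<omega>. \<omega> \<in> torus \<Longrightarrow> norm (f \<omega>) \<le> B" using tpoly_bounded[OF f(1)] by blast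
  have intf: "integrable haar f" using B tpoly_continuous[OF f(1)] integrable_haar_bounded by blast
  have int\<phi>: "integrable haar \<phi>"
  proof (rule integrable_haar_bounded[OF c])
    fix \<omega> assume w: "\<omega> \<in> torus"
    show "norm (\<phi> \<omega>) \<le> B + e"
      using f(2)[OF w] B[OF w] abs_Re_le_cmod[of "f \<omega>"] e unfolding real_norm_def by linarith
  qed
  have "\<bar>integral\<^sup>L haar \<phi> - integral\<^sup>L haar (\<lambda>x. Re (f x))\<bar> = \<bar>integral\<^sup>L haar (\<lambda>x. \<phi> x - Re (f x))\<bar>"
    using intf int\<phi> by (simp add: Bochner_Integration.integral_diff)
  also have "\<dots> \<le> integral\<^sup>L haar (\<lambda>x. \<bar>\<phi> x - Re (f x)\<bar>)" by (rule integral_abs_bound)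
  also have "\<dots> \<le> integral\<^sup>L haar (\<lambda>x. e / 4)"
    by (rule integral_mono_AE) (use AE_haar f(2) intf int\<phi> in \<open>auto elim!: eventually_mono intro: less_imp_le\<close>)
  also have "\<dots> = e/4" using haar.prob_space by simp
  finally have I: "\<bar>integral\<^sup>L haar \<phi> - Re (integral\<^sup>L haar f)\<bar> \<le> e/4" using intf by simp
  have "(cavg (\<lambda>t. f (flow t)) \<longlongrightarrow> integral\<^sup>L haar f) at_top" by (rule tpoly_equidistributed[OF f(1)])
  from tendstoD[OF this, of "e/4"] e
  have ev: "\<forall>\<^sub>F T in at_top. dist (cavg (\<lambda>t. f (flow t)) T) (integral\<^sup>L haar f) < e/4" by simp
  show "\<forall>\<^sub>F T in at_top. dist (avg (\<lambda>t. \<phi> (flow t)) T) (integral\<^sup>L haar \<phi>) < e"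
    using ev eventually_gt_at_top[of 0]
  proof eventually_elim
    case (elim T)
    have i1: "(\<lambda>t. f (flow t)) integrable_on {-T..T}"
      by (intro integrable_continuous_real continuous_on_compose2[OF tpoly_continuous[OF f(1)] continuous_flow]) auto
    have i2: "(\<lambda>t. \<phi> (flow t)) integrable_on {-T..T}"
      by (intro integrable_continuous_real continuous_on_compose2[OF c continuous_flow]) auto
    have "continuous_on UNIV (\<lambda>t. Re (f (flow t)))"
      by (intro continuous_intros continuous_on_compose2[OF tpoly_continuous[OF f(1)] continuous_flow]) auto
    hence i3: "(\<lambda>t. Re (f (flow t))) integrable_on {-T..T}"
      by (intro integrable_continuous_real) (auto intro: continuous_on_subset)
    have "\<bar>avg (\<lambda>t. \<phi> (flow t)) T - avg (\<lambda>t. Re (f (flow t))) T\<bar> \<le> e/4"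
      by (rule avg_diff_le) (use elim i2 i3 f(2) in \<open>auto intro: less_imp_le\<close>)
    moreover have "\<bar>Re (cavg (\<lambda>t. f (flow t)) T) - Re (integral\<^sup>L haar f)\<bar> < e/4"
      using elim(1) abs_Re_le_cmod[of "cavg (\<lambda>t. f (flow t)) T - integral\<^sup>L haar f"] by (simp add: dist_norm)
    ultimately show ?case using I e unfolding Re_cavg[OF i1] dist_real_def by linarith
  qed
qed

text \<open>Lipschitz minorants; they increase to \<open>\<nu>\<close> wherever \<open>\<nu>\<close> is continuous.\<close>

definition lipmin :: "((nat \<Rightarrow> complex) \<Rightarrow> real) \<Rightarrow> nat \<Rightarrow> (nat \<Rightarrow> complex) \<Rightarrow> real" where
  "lipmin \<nu> k \<omega> = (INF \<omega>'\<in>torus. \<nu> \<omega>' + real k * dist \<omega> \<omega>')"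

context
  fixes \<nu> :: "(nat \<Rightarrow> complex) \<Rightarrow> real" and B :: real
  assumes bnd0: "\<forall>\<omega>\<in>torus. \<bar>\<nu> \<omega>\<bar> \<le> B"
begin

lemmas bnd = bnd0[rule_format]

lemma lipmin_bdd: "bdd_below ((\<lambda>\<omega>'. \<nu> \<omega>' + real k * dist \<omega> \<omega>') ` torus)"
proof (rule bdd_belowI2[where m = "- B"])
  fix \<omega>' assume "\<omega>' \<in> torus"
  from bnd[OF this] show "- B \<le> \<nu> \<omega>' + real k * dist \<omega> \<omega>'"
  proof -
    have "0 \<le> real k * dist \<omega> \<omega>'" by simp
    thus ?thesis using bnd[OF \<open>\<omega>' \<in> torus\<close>] by linarith
  qed
qed

lemma lipmin_le: "\<omega>' \<in> torus \<Longrightarrow> lipmin \<nu> k \<omega> \<le> \<nu> \<omega>' + real k * dist \<omega> \<omega>'"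
  unfolding lipmin_def by (rule cINF_lower[OF lipmin_bdd])

lemma lipmin_ge: "(\<And>\<omega>'. \<omega>' \<in> torus \<Longrightarrow> x \<le> \<nu> \<omega>' + real k * dist \<omega> \<omega>') \<Longrightarrow> x \<le> lipmin \<nu> k \<omega>"
  unfolding lipmin_def by (rule cINF_greatest) (use flow_torus in blast)+

lemma lipmin_le_self: "\<omega> \<in> torus \<Longrightarrow> lipmin \<nu> k \<omega> \<le> \<nu> \<omega>"
  using lipmin_le[of \<omega> k \<omega>] by simp

lemma lipmin_ge_B: "- B \<le> lipmin \<nu> k \<omega>"
proof (rule lipmin_ge)
  fix \<omega>' assume "\<omega>' \<in> torus"
  from bnd[OF this] show "- B \<le> \<nu> \<omega>' + real k * dist \<omega> \<omega>'"
  proof -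
    have "0 \<le> real k * dist \<omega> \<omega>'" by simp
    thus ?thesis using bnd[OF \<open>\<omega>' \<in> torus\<close>] by linarith
  qed
qed

lemma lipmin_norm: "\<omega> \<in> torus \<Longrightarrow> norm (lipmin \<nu> k \<omega>) \<le> B"
  using lipmin_ge_B[of k \<omega>] lipmin_le_self[of \<omega> k] bnd[of \<omega>] by simp

lemma lipmin_mono: "lipmin \<nu> k \<omega> \<le> lipmin \<nu> (Suc k) \<omega>"
proof (rule lipmin_ge)
  fix \<omega>' assume "\<omega>' \<in> torus"
  from lipmin_le[OF this, of k \<omega>] show "lipmin \<nu> k \<omega> \<le> \<nu> \<omega>' + real (Suc k) * dist \<omega> \<omega>'"
    using zero_le_dist[of \<omega> \<omega>'] unfolding of_nat_Suc distrib_right by linarith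
qed

lemma lipmin_lipschitz: "lipmin \<nu> k \<omega> \<le> lipmin \<nu> k \<omega>2 + real k * dist \<omega> \<omega>2"
proof -
  have "lipmin \<nu> k \<omega> - real k * dist \<omega> \<omega>2 \<le> lipmin \<nu> k \<omega>2"
  proof (rule lipmin_ge)
    fix \<omega>' assume "\<omega>' \<in> torus"
    from lipmin_le[OF this, of k \<omega>] have "lipmin \<nu> k \<omega> \<le> \<nu> \<omega>' + real k * dist \<omega> \<omega>'" .
    also have "\<dots> \<le> \<nu> \<omega>' + real k * (dist \<omega> \<omega>2 + dist \<omega>2 \<omega>')"
      by (intro add_left_mono mult_left_mono dist_triangle) auto
    finally show "lipmin \<nu> k \<omega> - real k * dist \<omega> \<omega>2 \<le> \<nu> \<omega>' + real k * dist \<omega>2 \<omega>'" by (simp add: algebra_simps)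
  qed
  thus ?thesis by simp
qed

lemma lipmin_continuous: "continuous_on A (lipmin \<nu> k)"
proof -
  have "(real k)-lipschitz_on UNIV (lipmin \<nu> k)"
  proof (rule lipschitz_onI)
    fix x y :: "nat \<Rightarrow> complex"
    show "dist (lipmin \<nu> k x) (lipmin \<nu> k y) \<le> real k * dist x y"
      using lipmin_lipschitz[of k x y] lipmin_lipschitz[of k y x] by (simp add: dist_real_def dist_commute abs_le_iff)
  qed simp
  thus ?thesis using lipschitz_on_continuous_on continuous_on_subset by blast
qed

text \<open>Points near \<open>\<omega>\<close> have nearly the same value by continuity; for
  distant points the penalty \<open>k * dist\<close> eventually outweighs the largest possible
  variation \<open>2 * B\<close>.\<close>

lemma lipmin_tendsto:
  assumes w: "\<omega> \<in> torus" and c: "continuous (at \<omega> within torus) \<nu>"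
  shows "(\<lambda>k. lipmin \<nu> k \<omega>) \<longlonglongrightarrow> \<nu> \<omega>"
proof (rule LIMSEQ_I)
  fix e :: real assume e: "e > 0"
  obtain d where d: "d > 0" "\<And>\<omega>'. \<omega>' \<in> torus \<Longrightarrow> dist \<omega>' \<omega> < d \<Longrightarrow> dist (\<nu> \<omega>') (\<nu> \<omega>) < e/2"
    using c e unfolding continuous_within_eps_delta by (metis half_gt_zero)
  obtain K :: nat where K: "real K > 2 * B / d" using reals_Archimedean2 by blast
  have "norm (lipmin \<nu> k \<omega> - \<nu> \<omega>) < e" if k: "k \<ge> K" for k
  proof -
    have "\<nu> \<omega> - e/2 \<le> lipmin \<nu> k \<omega>"
    proof (rule lipmin_ge)
      fix \<omega>' assume w': "\<omega>' \<in> torus"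
      have nn: "0 \<le> real k * dist \<omega> \<omega>'" by simp
      show "\<nu> \<omega> - e/2 \<le> \<nu> \<omega>' + real k * dist \<omega> \<omega>'"
      proof (cases "dist \<omega>' \<omega> < d")
        case True
        have "\<bar>\<nu> \<omega>' - \<nu> \<omega>\<bar> < e/2" using d(2)[OF w' True] by (simp add: dist_real_def)
        thus ?thesis using nn by linarith
      next
        case False
        have "2 * B \<le> real k * d" 
        proof -
          have "2 * B / d \<le> real k" using K k by simp
          thus ?thesis using d(1) by (simp add: field_simps)
        qed
        also have "\<dots> \<le> real k * dist \<omega> \<omega>'" using False by (intro mult_left_mono) (auto simp: dist_commute)
        finally show ?thesis using bnd[OF w] bnd[OF w'] e by linarith
      qed
    qed
    thus ?thesis using lipmin_le_self[OF w, of k] e by simp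
  qed
  thus "\<exists>K. \<forall>k\<ge>K. norm (lipmin \<nu> k \<omega> - \<nu> \<omega>) < e" by blast
qed

end

lemma avg_mono:
  assumes "T > 0" "f integrable_on {-T..T}" "g integrable_on {-T..T}" "\<And>t. f t \<le> g t"
  shows "avg f T \<le> avg g T"
  unfolding avg_def using assms by (intro divide_right_mono Henstock_Kurzweil_Integration.integral_le) auto

text \<open>Weyl's criterion for functions whose discontinuities form a null set: Lipschitz
  minorants and majorants are equidistributed, and dominated convergence makes their integrals meet.
  The limit is read off from the minorants, so that no integral of \<open>\<nu>\<close> over the
  torus is formed.\<close>

lemma avg_flow_convergent:
  fixes \<nu> :: "(nat \<Rightarrow> complex) \<Rightarrow> real"
  assumes bnd: "\<And>\<omega>. \<omega> \<in> torus \<Longrightarrow> \<bar>\<nu> \<omega>\<bar> \<le> B" and N: "N \<in> null_sets haar"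
    and cont: "\<And>\<omega>. \<omega> \<in> torus - N \<Longrightarrow> continuous (at \<omega> within torus) \<nu>"
    and int: "\<And>T. (\<lambda>t. \<nu> (flow t)) integrable_on {-T..T}"
  shows "\<exists>L. (avg (\<lambda>t. \<nu> (flow t)) \<longlongrightarrow> L) at_top"
proof -
  interpret haar: prob_space haar by (rule prob_space_haar)
  define lo where "lo = lipmin \<nu>"
  define hi where "hi = (\<lambda>k \<omega>. - lipmin (\<lambda>\<omega>. - \<nu> \<omega>) k \<omega>)"
  have bnd0: "\<forall>\<omega>\<in>torus. \<bar>\<nu> \<omega>\<bar> \<le> B" and bnd': "\<forall>\<omega>\<in>torus. \<bar>- \<nu> \<omega>\<bar> \<le> B" using bnd by auto
  have clo: "continuous_on UNIV (lo k)" for k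
    unfolding lo_def by (rule lipmin_continuous[OF bnd0])
  have chi: "continuous_on UNIV (hi k)" for k
    unfolding hi_def by (rule continuous_on_minus[OF lipmin_continuous[OF bnd']])
  have ilo: "integrable haar (lo k)" for k
    by (rule integrable_haar_bounded[OF clo, where B = B]) (simp add: lo_def lipmin_norm[OF bnd0] del: real_norm_def)
  have ihi: "integrable haar (hi k)" for k
    by (rule integrable_haar_bounded[OF chi, where B = B]) (use lipmin_norm[OF bnd'] in \<open>simp add: hi_def\<close>)
  have "(\<lambda>k. integral\<^sup>L haar (\<lambda>\<omega>. hi k \<omega> - lo k \<omega>)) \<longlonglongrightarrow> integral\<^sup>L haar (\<lambda>\<omega>. 0)"
  proof (rule integral_dominated_convergence[where w = "\<lambda>_. 2 * B"])
    show "AE \<omega> in haar. (\<lambda>k. hi k \<omega> - lo k \<omega>) \<longlonglongrightarrow> 0"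
      using AE_haar AE_not_in[OF N]
    proof eventually_elim
      case (elim \<omega>)
      hence c: "continuous (at \<omega> within torus) \<nu>" using cont by auto
      have c': "continuous (at \<omega> within torus) (\<lambda>\<omega>. - \<nu> \<omega>)" using c by (rule continuous_minus)
      have "(\<lambda>k. hi k \<omega> - lo k \<omega>) \<longlonglongrightarrow> - (- \<nu> \<omega>) - \<nu> \<omega>"
        unfolding hi_def lo_def
        by (intro tendsto_intros lipmin_tendsto[OF bnd0 elim(1) c] lipmin_tendsto[OF bnd' elim(1) c'])
      thus ?case by simp
    qed
    show "AE \<omega> in haar. norm (hi k \<omega> - lo k \<omega>) \<le> 2 * B" for k
      using AE_haar
    proof eventually_elim
      case (elim \<omega>)
      show ?case using lipmin_norm[OF bnd0 elim, of k] lipmin_norm[OF bnd' elim, of k] by (simp add: hi_def lo_def)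
    qed
  qed (use ilo ihi in auto)
  hence d0: "(\<lambda>k. integral\<^sup>L haar (hi k) - integral\<^sup>L haar (lo k)) \<longlonglongrightarrow> 0"
    using ilo ihi by (simp add: Bochner_Integration.integral_diff)
  have inc: "incseq (\<lambda>k. integral\<^sup>L haar (lo k))"
    unfolding incseq_Suc_iff lo_def using lipmin_mono[OF bnd0] ilo[unfolded lo_def] by (auto intro!: integral_mono)
  have ub: "integral\<^sup>L haar (lo k) \<le> B" for k
  proof -
    have "integral\<^sup>L haar (lo k) \<le> integral\<^sup>L haar (\<lambda>_. B)"
    proof (rule integral_mono_AE[OF ilo], simp)
      show "AE \<omega> in haar. lo k \<omega> \<le> B" using AE_haar
        by eventually_elim (use lipmin_norm[OF bnd0] in \<open>auto simp: lo_def abs_le_iff\<close>)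
    qed
    thus ?thesis using haar.prob_space by simp
  qed
  obtain L where L: "(\<lambda>k. integral\<^sup>L haar (lo k)) \<longlonglongrightarrow> L"
    by (rule incseq_convergent[OF inc allI[OF ub]])
  have H: "(\<lambda>k. integral\<^sup>L haar (hi k)) \<longlonglongrightarrow> L" using tendsto_add[OF d0 L] by simp
  have "(avg (\<lambda>t. \<nu> (flow t)) \<longlongrightarrow> L) at_top"
  proof (rule tendstoI)
    fix e :: real assume e: "e > 0"
    have "\<forall>\<^sub>F k in sequentially. dist (integral\<^sup>L haar (lo k)) L < e/2 \<and> dist (integral\<^sup>L haar (hi k)) L < e/2"
      using tendstoD[OF L half_gt_zero[OF e]] tendstoD[OF H half_gt_zero[OF e]] by (simp add: eventually_conj)
    then obtain k where k: "dist (integral\<^sup>L haar (lo k)) L < e/2" "dist (integral\<^sup>L haar (hi k)) L < e/2"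
      using eventually_happens'[OF sequentially_bot] by blast
    show "\<forall>\<^sub>F T in at_top. dist (avg (\<lambda>t. \<nu> (flow t)) T) L < e"
      using tendstoD[OF equidistributed[OF clo[of k]] half_gt_zero[OF e]] tendstoD[OF equidistributed[OF chi[of k]] half_gt_zero[OF e]]
        eventually_gt_at_top[of 0]
    proof eventually_elim
      case (elim T)
      have i: "(\<lambda>t. lo k (flow t)) integrable_on {-T..T}" "(\<lambda>t. hi k (flow t)) integrable_on {-T..T}"
        by (auto intro!: integrable_continuous_real continuous_on_compose2[OF clo continuous_flow] continuous_on_compose2[OF chi continuous_flow])
      have "avg (\<lambda>t. lo k (flow t)) T \<le> avg (\<lambda>t. \<nu> (flow t)) T"
        by (rule avg_mono) (use elim i int lipmin_le_self[OF bnd0] in \<open>auto simp: lo_def\<close>)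
      moreover have "avg (\<lambda>t. \<nu> (flow t)) T \<le> avg (\<lambda>t. hi k (flow t)) T"
      proof (rule avg_mono)
        show "\<nu> (flow t) \<le> hi k (flow t)" for t
          using lipmin_le_self[OF bnd' flow_torus, of k t] by (simp add: hi_def)
      qed (use elim i int in auto)
      moreover have "dist (avg (\<lambda>t. lo k (flow t)) T) (integral\<^sup>L haar (lo k)) < e/2"
        "dist (avg (\<lambda>t. hi k (flow t)) T) (integral\<^sup>L haar (hi k)) < e/2" using elim e by auto
      ultimately show ?case using k unfolding dist_real_def abs_less_iff by linarith
    qed
  qed
  thus ?thesis by blast
qed

section \<open>Zeros of almost periodic families\<close>

lemma separation_radius:
  fixes A :: "complex set"
  assumes "finite A" "open B" "A \<subseteq> B"
  obtains d where "d > 0" "\<And>p. p \<in> A \<Longrightarrow> cball p d \<subseteq> B"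
    "\<And>p q. p \<in> A \<Longrightarrow> q \<in> A \<Longrightarrow> p \<noteq> q \<Longrightarrow> cball p d \<inter> cball q d = {}"
proof -
  have "\<exists>d>0. cball p d \<subseteq> B \<and> (\<forall>q\<in>A. q \<noteq> p \<longrightarrow> d \<le> dist p q)" if p: "p \<in> A" for p
  proof -
    obtain d1 where "d1 > 0" "cball p d1 \<subseteq> B" using assms p open_contains_cball by blast
    moreover obtain d2 where "d2 > 0" "\<forall>q\<in>A. q \<noteq> p \<longrightarrow> d2 \<le> dist p q"
      using finite_set_avoid[OF assms(1), of p] by blast
    ultimately show ?thesis
      by (intro exI[of _ "min d1 d2"]) (auto simp: subset_iff)
  qed
  then obtain d where d: "\<And>p. p \<in> A \<Longrightarrow> d p > 0" "\<And>p. p \<in> A \<Longrightarrow> cball p (d p) \<subseteq> B"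
    "\<And>p q. p \<in> A \<Longrightarrow> q \<in> A \<Longrightarrow> q \<noteq> p \<Longrightarrow> d p \<le> dist p q" by metis
  \<comment> \<open>With centres at least \<open>3 * e\<close> apart, closed discs of radius
    \<open>e\<close> are disjoint.\<close>
  define e where "e = Min (insert 1 (d ` A)) / 3"
  have fin: "finite (insert 1 (d ` A))" using assms by simp
  have e: "e > 0" using fin d(1) by (auto simp: e_def Min_gr_iff)
  have le: "3 * e \<le> d p" if "p \<in> A" for p using fin that by (auto simp: e_def intro!: Min_le)
  show ?thesis
  proof (rule that[OF e])
    fix p assume "p \<in> A"
    thus "cball p e \<subseteq> B" using d(2)[of p] le[of p] e by (auto simp: subset_iff)
  next
    fix p q assume pq: "p \<in> A" "q \<in> A" "p \<noteq> q"
    have "dist p q \<ge> 3 * e" using d(3)[of p q] le[of p] pq by auto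
    have "False" if x: "dist p x \<le> e" "dist q x \<le> e" for x
      using dist_triangle[of p q x] x \<open>dist p q \<ge> 3 * e\<close> e by (simp add: dist_commute)
    thus "cball p e \<inter> cball q e = {}" by (auto simp: disjoint_iff)
  qed
qed

text \<open>Holomorphy in the torus variable is asked for one coordinate at a time and only near
  unimodular values, with an extension that may depend on the point and on the coordinate. Products,
  reflections and Bohr lifts all provide this, and the argument on slices uses nothing more.\<close>

locale analytic_family =
  fixes h :: "(nat \<Rightarrow> complex) \<Rightarrow> complex \<Rightarrow> complex" and V :: "complex set"
  assumes open_V: "open V"
    and cont: "continuous_on (torus \<times> V) (\<lambda>(\<xi>,s). h \<xi> s)"
    and hol: "\<xi> \<in> torus \<Longrightarrow> h \<xi> holomorphic_on V"
    and ext: "\<xi> \<in> torus \<Longrightarrow> norm \<zeta> = 1 \<Longrightarrow>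
      \<exists>e>0. \<exists>H. continuous_on (ball \<zeta> e \<times> V) (\<lambda>(x,s). H x s) \<and>
        (\<forall>s\<in>V. (\<lambda>x. H x s) holomorphic_on ball \<zeta> e) \<and> (\<forall>x\<in>ball \<zeta> e. H x holomorphic_on V) \<and>
        (\<forall>x\<in>ball \<zeta> e. norm x = 1 \<longrightarrow> (\<forall>s\<in>V. H x s = h (\<xi>(j := x)) s))"
begin

lemma nonzero_stable:
  assumes w: "\<xi>1 \<in> torus" and K: "compact K" "K \<subseteq> V" and nz: "\<And>s. s \<in> K \<Longrightarrow> h \<xi>1 s \<noteq> 0"
  obtains U where "open U" "\<xi>1 \<in> U" "\<And>\<xi> s. \<xi> \<in> U \<inter> torus \<Longrightarrow> s \<in> K \<Longrightarrow> h \<xi> s \<noteq> 0"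
proof (cases "K = {}")
  case True
  thus ?thesis using that[of UNIV] by auto
next
  case False
  have c: "continuous_on K (h \<xi>1)"
    using holomorphic_on_imp_continuous_on[OF hol[OF w]] K continuous_on_subset by blast
  have "\<exists>s\<in>K. \<forall>t\<in>K. norm (h \<xi>1 s) \<le> norm (h \<xi>1 t)"
    by (rule continuous_attains_inf) (use K False c in \<open>auto intro!: continuous_intros\<close>)
  then obtain s0 where s0: "s0 \<in> K" "\<And>t. t \<in> K \<Longrightarrow> norm (h \<xi>1 s0) \<le> norm (h \<xi>1 t)" by blast
  define m where "m = norm (h \<xi>1 s0)"
  have m: "m > 0" using nz[OF s0(1)] by (simp add: m_def)
  obtain U where U: "\<xi>1 \<in> U" "open U" "\<forall>\<xi>\<in>U \<inter> torus. \<forall>t\<in>K. dist (h \<xi> t) (h \<xi>1 t) \<le> m / 2"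
  proof (rule continuous_on_prod_compactE[of torus K "\<lambda>(\<xi>,s). h \<xi> s" \<xi>1 "m/2"])
    show "continuous_on (torus \<times> K) (\<lambda>(\<xi>, s). h \<xi> s)" using cont K by (rule_tac continuous_on_subset) auto
  qed (use w m K in auto)
  show ?thesis
  proof (rule that[OF U(2,1)])
    fix \<xi> s assume "\<xi> \<in> U \<inter> torus" "s \<in> K"
    hence "dist (h \<xi> s) (h \<xi>1 s) \<le> m / 2" "m \<le> norm (h \<xi>1 s)" using U s0 by (auto simp: m_def)
    thus "h \<xi> s \<noteq> 0" using m by (auto simp: dist_norm)
  qed
qed

text \<open>Hurwitz's theorem through the maximum principle: were \<open>h \<xi>\<close> free of
  zeros in the disc, \<open>1 / h \<xi>\<close> would have modulus at most
  \<open>3 / (2 * m)\<close> at the centre \<open>p\<close>, although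
  \<open>norm (h \<xi> p) \<le> m / 3\<close>.\<close>

lemma hurwitz_zero:
  assumes w: "\<xi>1 \<in> torus" and p: "cball p \<rho> \<subseteq> V" "\<rho> > 0" "h \<xi>1 p = 0" and nz: "\<And>s. s \<in> sphere p \<rho> \<Longrightarrow> h \<xi>1 s \<noteq> 0"
  obtains U where "open U" "\<xi>1 \<in> U" "\<And>\<xi>. \<xi> \<in> U \<inter> torus \<Longrightarrow> \<exists>s\<in>ball p \<rho>. h \<xi> s = 0"
proof -
  have c: "continuous_on (sphere p \<rho>) (h \<xi>1)"
    using holomorphic_on_imp_continuous_on[OF hol[OF w]] p continuous_on_subset sphere_cball by blast
  have "\<exists>s\<in>sphere p \<rho>. \<forall>t\<in>sphere p \<rho>. norm (h \<xi>1 s) \<le> norm (h \<xi>1 t)"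
    by (rule continuous_attains_inf) (use p c in \<open>auto intro!: continuous_intros\<close>)
  then obtain s0 where s0: "s0 \<in> sphere p \<rho>" "\<And>t. t \<in> sphere p \<rho> \<Longrightarrow> norm (h \<xi>1 s0) \<le> norm (h \<xi>1 t)" by blast
  define m where "m = norm (h \<xi>1 s0)"
  have m: "m > 0" using nz[OF s0(1)] by (simp add: m_def)
  obtain U where U: "\<xi>1 \<in> U" "open U" "\<forall>\<xi>\<in>U \<inter> torus. \<forall>t\<in>cball p \<rho>. dist (h \<xi> t) (h \<xi>1 t) \<le> m / 3"
  proof (rule continuous_on_prod_compactE[of torus "cball p \<rho>" "\<lambda>(\<xi>,s). h \<xi> s" \<xi>1 "m/3"])
    show "continuous_on (torus \<times> cball p \<rho>) (\<lambda>(\<xi>, s). h \<xi> s)" using cont p by (rule_tac continuous_on_subset) auto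
  qed (use w m in auto)
  show ?thesis
  proof (rule that[OF U(2,1)], rule ccontr)
    fix \<xi> assume w2: "\<xi> \<in> U \<inter> torus" and no: "\<not> (\<exists>s\<in>ball p \<rho>. h \<xi> s = 0)"
    have big: "norm (h \<xi> s) \<ge> 2 * m / 3" if "s \<in> sphere p \<rho>" for s
    proof -
      have "dist (h \<xi> s) (h \<xi>1 s) \<le> m / 3" using U w2 that by auto
      moreover have "m \<le> norm (h \<xi>1 s)" using s0 that by (auto simp: m_def)
      ultimately show ?thesis using norm_triangle_ineq2[of "h \<xi>1 s" "h \<xi> s"] by (simp add: dist_norm norm_minus_commute)
    qed
    have nz2: "h \<xi> s \<noteq> 0" if "s \<in> cball p \<rho>" for s
    proof (cases "s \<in> ball p \<rho>")
      case False
      hence "s \<in> sphere p \<rho>" using that by auto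
      thus ?thesis using big[of s] m by auto
    qed (use no in auto)
    have hw: "h \<xi> holomorphic_on cball p \<rho>" using hol[of \<xi>] w2 p holomorphic_on_subset by blast
    hence inv: "(\<lambda>s. 1 / h \<xi> s) holomorphic_on cball p \<rho>" by (intro holomorphic_intros nz2)
    have "norm (1 / h \<xi> p) \<le> 1 / (2 * m / 3)"
    proof (rule maximum_modulus_frontier[of "\<lambda>s. 1 / h \<xi> s" "cball p \<rho>"])
      show "(\<lambda>s. 1 / h \<xi> s) holomorphic_on interior (cball p \<rho>)" using inv holomorphic_on_subset interior_subset by blast
      show "continuous_on (closure (cball p \<rho>)) (\<lambda>s. 1 / h \<xi> s)" using inv holomorphic_on_imp_continuous_on by simp
      show "norm (1 / h \<xi> s) \<le> 1 / (2 * m / 3)" if "s \<in> frontier (cball p \<rho>)" for s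
        using big[of s] that m p unfolding norm_divide by (intro frac_le) auto
    qed (use p in auto)
    moreover have "norm (h \<xi> p) \<le> m / 3" using U(3)[rule_format, of \<xi> p] w2 p by (auto simp: dist_norm)
    moreover have "norm (h \<xi> p) > 0" using nz2[of p] p by auto
    ultimately show False using m by (simp add: norm_divide field_simps)
  qed
qed

lemma zeros_finite:
  assumes "\<xi> \<in> torus" "cball z r \<subseteq> V" "0 < r" "\<And>s. s \<in> sphere z r \<Longrightarrow> h \<xi> s \<noteq> 0"
  shows "finite {s \<in> ball z r. h \<xi> s = 0}"
proof -
  have "finite {s \<in> cball z r. h \<xi> s = 0}"
    by (rule finite_zeros_cball[OF hol[OF assms(1)] open_V assms(2), where ?s0.0 = "z + of_real r"])
       (use assms in \<open>auto simp: dist_norm\<close>)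
  thus ?thesis by (rule rev_finite_subset) auto
qed

text \<open>Each zero of \<open>h \<xi>1\<close> leaves a zero of \<open>h \<xi>\<close> in its own
  small disc, and these discs are disjoint. Distinct zeros can split under a perturbation but not
  disappear; the opposite inequality can fail at multiple zeros.\<close>

lemma zeros_lower_semicontinuous:
  assumes w: "\<xi>1 \<in> torus" and z: "cball z r \<subseteq> V" "0 < r" and nz: "\<And>s. s \<in> sphere z r \<Longrightarrow> h \<xi>1 s \<noteq> 0"
  obtains U where "open U" "\<xi>1 \<in> U"
    "\<And>\<xi>. \<xi> \<in> U \<inter> torus \<Longrightarrow> (\<And>s. s \<in> sphere z r \<Longrightarrow> h \<xi> s \<noteq> 0) \<Longrightarrow>
      card {s \<in> ball z r. h \<xi>1 s = 0} \<le> card {s \<in> ball z r. h \<xi> s = 0}"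
proof -
  let ?Z = "\<lambda>\<xi>. {s \<in> ball z r. h \<xi> s = 0}"
  have fin: "finite (?Z \<xi>1)" by (rule zeros_finite) (use assms in auto)
  obtain d where d: "d > 0" "\<And>p. p \<in> ?Z \<xi>1 \<Longrightarrow> cball p d \<subseteq> ball z r"
    "\<And>p q. p \<in> ?Z \<xi>1 \<Longrightarrow> q \<in> ?Z \<xi>1 \<Longrightarrow> p \<noteq> q \<Longrightarrow> cball p d \<inter> cball q d = {}"
  proof -
    have "?Z \<xi>1 \<subseteq> ball z r" by blast
    from separation_radius[OF fin open_ball this] that show ?thesis by blast
  qed
  have "\<exists>U. open U \<and> \<xi>1 \<in> U \<and> (\<forall>\<xi>\<in>U \<inter> torus. \<exists>s\<in>ball p d. h \<xi> s = 0)" if p: "p \<in> ?Z \<xi>1" for p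
  proof -
    have nzp: "h \<xi>1 s \<noteq> 0" if s: "s \<in> sphere p d" for s
    proof
      assume "h \<xi>1 s = 0"
      moreover have "s \<in> cball p d" using s by simp
      ultimately have "s \<in> ?Z \<xi>1" using d(2)[OF p] by blast
      moreover have "s \<noteq> p" using s d(1) by auto
      ultimately have "cball p d \<inter> cball s d = {}" using d(3)[of p s] p by blast
      thus False using s d(1) by (auto simp: disjoint_iff)
    qed
    have "cball p d \<subseteq> V" using d(2)[OF p] z ball_subset_cball by blast
    moreover have "h \<xi>1 p = 0" using p by simp
    ultimately obtain U where "open U" "\<xi>1 \<in> U" "\<And>\<xi>. \<xi> \<in> U \<inter> torus \<Longrightarrow> \<exists>s\<in>ball p d. h \<xi> s = 0"
      using hurwitz_zero[OF w _ d(1) _ nzp] by blast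
    thus ?thesis by blast
  qed
  hence "\<forall>p\<in>?Z \<xi>1. \<exists>U. open U \<and> \<xi>1 \<in> U \<and> (\<forall>\<xi>\<in>U \<inter> torus. \<exists>s\<in>ball p d. h \<xi> s = 0)" by (rule ballI)
  from bchoice[OF this] obtain U where U: "\<forall>p\<in>?Z \<xi>1. open (U p) \<and> \<xi>1 \<in> U p \<and> (\<forall>\<xi>\<in>U p \<inter> torus. \<exists>s\<in>ball p d. h \<xi> s = 0)" ..
  show ?thesis
  proof (rule that[of "\<Inter>p\<in>?Z \<xi>1. U p"])
    show "open (\<Inter>p\<in>?Z \<xi>1. U p)" using U fin by (intro open_INT) auto
    show "\<xi>1 \<in> (\<Inter>p\<in>?Z \<xi>1. U p)" using U by auto
    fix \<xi> assume w2: "\<xi> \<in> (\<Inter>p\<in>?Z \<xi>1. U p) \<inter> torus" and nz2: "\<And>s. s \<in> sphere z r \<Longrightarrow> h \<xi> s \<noteq> 0"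
    have "\<exists>s\<in>ball p d. h \<xi> s = 0" if p: "p \<in> ?Z \<xi>1" for p
    proof -
      have "\<xi> \<in> U p \<inter> torus" using w2 p by blast
      thus ?thesis using U p by blast
    qed
    hence "\<forall>p\<in>?Z \<xi>1. \<exists>s. s \<in> ball p d \<and> h \<xi> s = 0" by blast
    from bchoice[OF this] obtain f where f': "\<forall>p\<in>?Z \<xi>1. f p \<in> ball p d \<and> h \<xi> (f p) = 0" ..
    note f = f'[rule_format]
    have inj: "inj_on f (?Z \<xi>1)"
    proof (rule inj_onI, rule ccontr)
      fix p q assume pq: "p \<in> ?Z \<xi>1" "q \<in> ?Z \<xi>1" "f p = f q" "p \<noteq> q"
      have "f p \<in> cball p d" "f p \<in> cball q d" using f[OF pq(1)] f[OF pq(2)] pq(3) by auto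
      thus False using d(3)[OF pq(1,2,4)] by blast
    qed
    show "card (?Z \<xi>1) \<le> card (?Z \<xi>)"
    proof (rule card_inj_on_le[OF inj])
      show "finite (?Z \<xi>)" by (rule zeros_finite) (use w2 z nz2 in auto)
      show "f ` ?Z \<xi>1 \<subseteq> ?Z \<xi>"
      proof
        fix y assume "y \<in> f ` ?Z \<xi>1"
        then obtain p where p: "p \<in> ?Z \<xi>1" "y = f p" by blast
        have "f p \<in> cball p d" using f[OF p(1)] by auto
        thus "y \<in> ?Z \<xi>" using f[OF p(1)] d(2)[OF p(1)] p(2) by blast
      qed
    qed
  qed
qed

text \<open>The number of zeros with multiplicity is a contour integral that depends continuously on
  \<open>\<xi>\<close>, and it dominates the number of distinct zeros.\<close>

lemma zeros_bounded:
  assumes w: "\<xi>1 \<in> torus" and z: "cball z r \<subseteq> V" "0 < r" and nz: "\<And>s. s \<in> sphere z r \<Longrightarrow> h \<xi>1 s \<noteq> 0"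
  obtains U K where "open U" "\<xi>1 \<in> U" "\<And>\<xi> s. \<xi> \<in> U \<inter> torus \<Longrightarrow> s \<in> sphere z r \<Longrightarrow> h \<xi> s \<noteq> 0"
    "\<And>\<xi>. \<xi> \<in> U \<inter> torus \<Longrightarrow> card {s \<in> ball z r. h \<xi> s = 0} \<le> K"
proof -
  have sV: "sphere z r \<subseteq> V" using z by auto
  obtain U where U: "open U" "\<xi>1 \<in> U" "\<And>\<xi> s. \<xi> \<in> U \<inter> torus \<Longrightarrow> s \<in> sphere z r \<Longrightarrow> h \<xi> s \<noteq> 0"
    using nonzero_stable[OF w compact_sphere sV nz] by metis
  define P where "P = (\<lambda>\<xi>. contour_integral (circlepath z r) (\<lambda>s. deriv (h \<xi>) s / h \<xi> s) / (2 * of_real pi * \<i>))"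
  have "continuous_on (U \<inter> torus) P"
    unfolding P_def
  proof (intro continuous_intros continuous_param_circle z)
    have sub: "(U \<inter> torus) \<times> sphere z r \<subseteq> torus \<times> V" using sV by auto
    have 1: "continuous_on ((U \<inter> torus) \<times> sphere z r) (\<lambda>(\<xi>,s). h \<xi> s)" by (rule continuous_on_subset[OF cont sub])
    have 2: "continuous_on ((U \<inter> torus) \<times> sphere z r) (\<lambda>(\<xi>,s). deriv (h \<xi>) s)"
      by (rule continuous_on_subset[OF deriv_param_continuous[OF cont open_V hol] sub])
    show "continuous_on ((U \<inter> torus) \<times> sphere z r) (\<lambda>(\<xi>,s). deriv (h \<xi>) s / h \<xi> s)"
      using 1 2 U(3) unfolding split_def by (intro continuous_intros) auto
  qed auto
  hence "\<exists>d>0. \<forall>\<xi>\<in>U \<inter> torus. dist \<xi> \<xi>1 < d \<longrightarrow> dist (P \<xi>) (P \<xi>1) < 1"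
    using U(2) w unfolding continuous_on_iff by (metis IntI zero_less_one)
  then obtain d where d: "d > 0" "\<And>\<xi>. \<xi> \<in> U \<inter> torus \<Longrightarrow> dist \<xi> \<xi>1 < d \<Longrightarrow> dist (P \<xi>) (P \<xi>1) < 1" by blast
  define K where "K = nat \<lceil>norm (P \<xi>1) + 1\<rceil>"
  show ?thesis
  proof (rule that[of "U \<inter> ball \<xi>1 d" K])
    show "open (U \<inter> ball \<xi>1 d)" "\<xi>1 \<in> U \<inter> ball \<xi>1 d" using U d by auto
    show "h \<xi> s \<noteq> 0" if "\<xi> \<in> U \<inter> ball \<xi>1 d \<inter> torus" "s \<in> sphere z r" for \<xi> s using U(3)[of \<xi> s] that by auto
    fix \<xi> assume w2: "\<xi> \<in> U \<inter> ball \<xi>1 d \<inter> torus"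
    hence wt: "\<xi> \<in> torus" and nz2: "\<And>s. s \<in> sphere z r \<Longrightarrow> h \<xi> s \<noteq> 0" using U(3)[of \<xi>] by auto
    let ?Z = "{s \<in> ball z r. h \<xi> s = 0}"
    have "P \<xi> = (\<Sum>p\<in>?Z. of_int (zorder (h \<xi>) p))"
      using zeros_power_sum[OF hol[OF wt] open_V z nz2, of 0] by (simp add: P_def)
    hence "real (card ?Z) \<le> Re (P \<xi>)"
    proof -
      assume P: "P \<xi> = (\<Sum>p\<in>?Z. of_int (zorder (h \<xi>) p))"
      have "real (card ?Z) = (\<Sum>p\<in>?Z. 1)" by simp
      also have "\<dots> \<le> (\<Sum>p\<in>?Z. real_of_int (zorder (h \<xi>) p))"
        using zorder_zero_pos[OF hol[OF wt] open_V z(1) nz2] by (intro sum_mono) force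
      finally show ?thesis using P by simp
    qed
    also have "\<dots> \<le> norm (P \<xi>)" by (rule complex_Re_le_cmod)
    also have "\<dots> \<le> norm (P \<xi>1) + 1"
    proof -
      have "dist (P \<xi>) (P \<xi>1) < 1" using d(2)[of \<xi>] w2 by (auto simp: dist_commute)
      thus ?thesis using norm_triangle_ineq2[of "P \<xi>" "P \<xi>1"] by (simp add: dist_norm)
    qed
    finally show "card ?Z \<le> K" unfolding K_def by linarith
  qed
qed

text \<open>Near every angle the discriminant for the count \<open>R\<close> either vanishes
  identically or is nonzero except possibly at that angle. The arc is thus covered by two disjoint
  relatively open sets, and connectedness leaves only one of them. In the second case the exceptions
  are isolated, hence finitely many by compactness.\<close>

lemma slice_dichotomy:
  assumes w: "\<xi> \<in> torus" and z: "cball z r \<subseteq> V" "0 < r" and I: "lo < (hi::real)"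
    and nz: "\<And>\<alpha> s. \<alpha> \<in> {lo..hi} \<Longrightarrow> s \<in> sphere z r \<Longrightarrow> h (\<xi>(j := cis \<alpha>)) s \<noteq> 0"
    and le: "\<And>\<alpha>. \<alpha> \<in> {lo..hi} \<Longrightarrow> card {s \<in> ball z r. h (\<xi>(j := cis \<alpha>)) s = 0} \<le> R"
  shows "(\<forall>\<alpha>\<in>{lo..hi}. card {s \<in> ball z r. h (\<xi>(j := cis \<alpha>)) s = 0} < R) \<or>
     finite {\<alpha> \<in> {lo..hi}. card {s \<in> ball z r. h (\<xi>(j := cis \<alpha>)) s = 0} < R}"
proof -
  define n where "n = (\<lambda>\<alpha>. card {s \<in> ball z r. h (\<xi>(j := cis \<alpha>)) s = 0})"
  define A1 where "A1 = {\<alpha>0\<in>{lo..hi}. \<exists>d>0. \<forall>\<alpha>\<in>{lo..hi}. dist \<alpha> \<alpha>0 < d \<longrightarrow> n \<alpha> < R}"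
  define A2 where "A2 = {\<alpha>0\<in>{lo..hi}. \<exists>d>0. \<forall>\<alpha>\<in>{lo..hi}. dist \<alpha> \<alpha>0 < d \<longrightarrow> \<alpha> \<noteq> \<alpha>0 \<longrightarrow> n \<alpha> = R}"
  have sV: "sphere z r \<subseteq> V" using z by auto
  have cover: "\<alpha>0 \<in> A1 \<union> A2" if a0: "\<alpha>0 \<in> {lo..hi}" for \<alpha>0
  proof -
    obtain e H where e: "e > 0" and H: "continuous_on (ball (cis \<alpha>0) e \<times> V) (\<lambda>(x,s). H x s)"
        "\<And>s. s \<in> V \<Longrightarrow> (\<lambda>x. H x s) holomorphic_on ball (cis \<alpha>0) e"
        "\<And>x. x \<in> ball (cis \<alpha>0) e \<Longrightarrow> H x holomorphic_on V"
        "\<And>x s. x \<in> ball (cis \<alpha>0) e \<Longrightarrow> norm x = 1 \<Longrightarrow> s \<in> V \<Longrightarrow> H x s = h (\<xi>(j := x)) s"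
      using ext[OF w, of "cis \<alpha>0" j] by auto
    have nz0: "H (cis \<alpha>0) s \<noteq> 0" if "s \<in> sphere z r" for s
      using H(4)[of "cis \<alpha>0" s] nz[OF a0 that] e that sV by auto
    have c: "continuous_on (sphere z r) (H (cis \<alpha>0))"
      using holomorphic_on_imp_continuous_on[OF H(3)] e sV continuous_on_subset by (metis centre_in_ball)
    have "\<exists>s\<in>sphere z r. \<forall>t\<in>sphere z r. norm (H (cis \<alpha>0) s) \<le> norm (H (cis \<alpha>0) t)"
      by (rule continuous_attains_inf) (use z c in \<open>auto intro!: continuous_intros\<close>)
    then obtain s0 where s0: "s0 \<in> sphere z r" "\<And>t. t \<in> sphere z r \<Longrightarrow> norm (H (cis \<alpha>0) s0) \<le> norm (H (cis \<alpha>0) t)" by blast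
    define m where "m = norm (H (cis \<alpha>0) s0)"
    have m: "m > 0" using nz0[OF s0(1)] by (simp add: m_def)
    obtain X where X: "cis \<alpha>0 \<in> X" "open X" "\<forall>x\<in>X \<inter> ball (cis \<alpha>0) e. \<forall>t\<in>sphere z r. dist (H x t) (H (cis \<alpha>0) t) \<le> m / 2"
    proof (rule continuous_on_prod_compactE[of "ball (cis \<alpha>0) e" "sphere z r" "\<lambda>(x,s). H x s" "cis \<alpha>0" "m/2"])
      show "continuous_on (ball (cis \<alpha>0) e \<times> sphere z r) (\<lambda>(x, s). H x s)" using H(1) sV by (rule_tac continuous_on_subset) auto
    qed (use e m in auto)
    obtain e1 where e1: "e1 > 0" "ball (cis \<alpha>0) e1 \<subseteq> X \<inter> ball (cis \<alpha>0) e"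
      using X e open_contains_ball[of "X \<inter> ball (cis \<alpha>0) e"] by (metis IntI centre_in_ball open_Int open_ball)
    define W where "W = ball (cis \<alpha>0) e1"
    have WW: "W \<subseteq> ball (cis \<alpha>0) e" "W \<subseteq> X" using e1 by (auto simp: W_def)
    have nzW: "H x s \<noteq> 0" if "x \<in> W" "s \<in> sphere z r" for x s
    proof -
      have "dist (H x s) (H (cis \<alpha>0) s) \<le> m / 2" using X(3) that WW by blast
      moreover have "m \<le> norm (H (cis \<alpha>0) s)" using s0 that by (auto simp: m_def)
      ultimately show ?thesis using m by (auto simp: dist_norm)
    qed
    obtain g where g: "g holomorphic_on W"
      "\<And>x. x \<in> W \<Longrightarrow> card {s\<in>ball z r. H x s = 0} < R \<Longrightarrow> g x = 0"
      "\<And>x. x \<in> W \<Longrightarrow> card {s\<in>ball z r. H x s = 0} = R \<Longrightarrow> g x \<noteq> 0"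
    proof (rule discriminant_holomorphic[of W V z r H R])
      show "continuous_on (W \<times> V) (\<lambda>(x, s). H x s)" using H(1) WW by (rule_tac continuous_on_subset) auto
      show "(\<lambda>x. H x s) holomorphic_on W" if "s \<in> V" for s using H(2)[OF that] WW holomorphic_on_subset by blast
      show "H x holomorphic_on V" if "x \<in> W" for x using H(3) that WW by blast
    qed (use open_V z nzW in \<open>auto simp: W_def\<close>)
    have ng: "n \<alpha> = R \<longleftrightarrow> g (cis \<alpha>) \<noteq> 0" if a: "\<alpha> \<in> {lo..hi}" "cis \<alpha> \<in> W" for \<alpha>
    proof -
      have "{s\<in>ball z r. H (cis \<alpha>) s = 0} = {s \<in> ball z r. h (\<xi>(j := cis \<alpha>)) s = 0}"
        using H(4)[of "cis \<alpha>"] WW a(2) z by (auto simp: subset_iff)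
      hence eq: "card {s\<in>ball z r. H (cis \<alpha>) s = 0} = n \<alpha>" by (simp add: n_def)
      moreover have "n \<alpha> \<le> R" using le[OF a(1)] by (simp add: n_def)
      ultimately show ?thesis using g(2,3)[OF a(2)] by fastforce
    qed
    have "\<exists>\<rho>>0. ball (cis \<alpha>0) \<rho> \<subseteq> W \<and> ((\<forall>x\<in>ball (cis \<alpha>0) \<rho>. g x = 0) \<or> (\<forall>x\<in>ball (cis \<alpha>0) \<rho>. x \<noteq> cis \<alpha>0 \<longrightarrow> g x \<noteq> 0))"
    proof (cases "\<forall>x\<in>W. g x = 0")
      case True
      thus ?thesis using e1 by (intro exI[of _ e1]) (auto simp: W_def)
    next
      case False
      then obtain b where b: "b \<in> W" "g b \<noteq> 0" by blast
      show ?thesis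
      proof (cases "g (cis \<alpha>0) = 0")
        case True
        obtain \<rho> where "0 < \<rho>" "ball (cis \<alpha>0) \<rho> \<subseteq> W" "\<And>x. x \<in> ball (cis \<alpha>0) \<rho> - {cis \<alpha>0} \<Longrightarrow> g x \<noteq> 0"
          by (rule isolated_zeros[OF g(1), of "cis \<alpha>0" b]) (use True b e1 in \<open>auto simp: W_def\<close>)
        thus ?thesis by blast
      next
        case False
        have "continuous_on W g" using g(1) holomorphic_on_imp_continuous_on by blast
        then obtain d where "d > 0" "\<And>x. x \<in> W \<Longrightarrow> dist x (cis \<alpha>0) < d \<Longrightarrow> dist (g x) (g (cis \<alpha>0)) < norm (g (cis \<alpha>0))"
          using False e1 unfolding continuous_on_iff W_def by (metis centre_in_ball zero_less_norm_iff)
        hence "g x \<noteq> 0" if "x \<in> W" "dist x (cis \<alpha>0) < d" for x using that by (force simp: dist_norm)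
        thus ?thesis using \<open>d > 0\<close> e1 by (intro exI[of _ "min d e1"]) (auto simp: W_def dist_commute)
      qed
    qed
    then obtain \<rho> where \<rho>: "\<rho> > 0" "ball (cis \<alpha>0) \<rho> \<subseteq> W" and dich: "(\<forall>x\<in>ball (cis \<alpha>0) \<rho>. g x = 0) \<or> (\<forall>x\<in>ball (cis \<alpha>0) \<rho>. x \<noteq> cis \<alpha>0 \<longrightarrow> g x \<noteq> 0)"
      by blast
    have "continuous_on UNIV cis" by (intro continuous_intros)
    then obtain d where d: "d > 0" "\<And>\<alpha>. dist \<alpha> \<alpha>0 < d \<Longrightarrow> dist (cis \<alpha>) (cis \<alpha>0) < \<rho>"
      using \<rho>(1) unfolding continuous_on_iff by (metis UNIV_I)
    have inW: "cis \<alpha> \<in> ball (cis \<alpha>0) \<rho>" if "dist \<alpha> \<alpha>0 < d" for \<alpha> using d(2)[OF that] by (simp add: dist_commute)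
    from dich show ?thesis
    proof
      assume "\<forall>x\<in>ball (cis \<alpha>0) \<rho>. g x = 0"
      hence "n \<alpha> < R" if "\<alpha> \<in> {lo..hi}" "dist \<alpha> \<alpha>0 < d" for \<alpha>
        using ng[of \<alpha>] le[of \<alpha>] inW[of \<alpha>] that \<rho>(2) by (auto simp: n_def le_less subset_iff)
      thus ?thesis using d(1) a0 by (auto simp: A1_def)
    next
      assume *: "\<forall>x\<in>ball (cis \<alpha>0) \<rho>. x \<noteq> cis \<alpha>0 \<longrightarrow> g x \<noteq> 0"
      \<comment> \<open>Distance below 1 keeps the angle from coming round to the same point of the
        circle, so \<open>cis \<alpha> \<noteq> cis \<alpha>0\<close>.\<close>
      have "n \<alpha> = R" if "\<alpha> \<in> {lo..hi}" "dist \<alpha> \<alpha>0 < min d 1" "\<alpha> \<noteq> \<alpha>0" for \<alpha>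
      proof -
        have "cis \<alpha> \<noteq> cis \<alpha>0"
        proof
          assume "cis \<alpha> = cis \<alpha>0"
          hence "cis (\<alpha> - \<alpha>0) = 1" by (simp add: cis_divide[symmetric])
          hence "cos (\<alpha> - \<alpha>0) = 1" by (simp add: complex_eq_iff)
          then obtain k :: int where k: "\<alpha> - \<alpha>0 = of_int k * 2 * pi" by (auto simp: cos_one_2pi_int)
          have "k \<noteq> 0" using k that(3) by auto
          hence "\<bar>of_int k * 2 * pi\<bar> \<ge> 1 * 2 * pi" unfolding abs_mult by (intro mult_mono) auto
          thus False using that(2) k pi_gt3 by (simp add: dist_real_def)
        qed
        thus ?thesis using ng[of \<alpha>] * inW[of \<alpha>] that \<rho>(2) by (auto simp: subset_iff)
      qed
      thus ?thesis using d(1) a0 by (auto simp: A2_def intro!: exI[of _ "min d 1"])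
    qed
  qed
  have op1: "openin (top_of_set {lo..hi}) A1"
    unfolding openin_euclidean_subtopology_iff
  proof (intro conjI ballI)
    fix a assume "a \<in> A1"
    then obtain d where d: "d > 0" "\<forall>\<alpha>\<in>{lo..hi}. dist \<alpha> a < d \<longrightarrow> n \<alpha> < R" by (auto simp: A1_def)
    have "b \<in> A1" if b: "b \<in> {lo..hi}" "dist b a < d" for b
    proof -
      have "n \<alpha> < R" if "\<alpha> \<in> {lo..hi}" "dist \<alpha> b < d - dist b a" for \<alpha>
      proof -
        have "dist \<alpha> a < d" using that(2) dist_triangle[of \<alpha> a b] by linarith
        thus ?thesis using d that(1) by blast
      qed
      thus ?thesis unfolding A1_def using b
        by (intro CollectI conjI exI[of _ "d - dist b a"]) auto
    qed
    thus "\<exists>e>0. \<forall>x'\<in>{lo..hi}. dist x' a < e \<longrightarrow> x' \<in> A1" using d(1) by blast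
  qed (auto simp: A1_def)
  have op2: "openin (top_of_set {lo..hi}) A2"
    unfolding openin_euclidean_subtopology_iff
  proof (intro conjI ballI)
    fix a assume "a \<in> A2"
    then obtain d where d: "d > 0" "\<forall>\<alpha>\<in>{lo..hi}. dist \<alpha> a < d \<longrightarrow> \<alpha> \<noteq> a \<longrightarrow> n \<alpha> = R" by (auto simp: A2_def)
    have "b \<in> A2" if b: "b \<in> {lo..hi}" "dist b a < d" for b
    proof (cases "b = a")
      case True
      thus ?thesis using b d by (auto simp: A2_def)
    next
      case False
      have "n \<alpha> = R" if "\<alpha> \<in> {lo..hi}" "dist \<alpha> b < min (d - dist b a) (dist b a)" for \<alpha>
      proof -
        have "dist \<alpha> a < d" "\<alpha> \<noteq> a" using that(2) dist_triangle[of \<alpha> a b] by (auto simp: dist_commute)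
        thus ?thesis using d that(1) by blast
      qed
      thus ?thesis unfolding A2_def using b False
        by (intro CollectI conjI exI[of _ "min (d - dist b a) (dist b a)"]) auto
    qed
    thus "\<exists>e>0. \<forall>x'\<in>{lo..hi}. dist x' a < e \<longrightarrow> x' \<in> A2" using d(1) by blast
  qed (auto simp: A2_def)
  have disj: "A1 \<inter> A2 = {}"
  proof (rule ccontr)
    assume "A1 \<inter> A2 \<noteq> {}"
    then obtain a d1 d2 where a: "a \<in> {lo..hi}" "d1 > 0" "d2 > 0" "\<forall>\<alpha>\<in>{lo..hi}. dist \<alpha> a < d1 \<longrightarrow> n \<alpha> < R"
       "\<forall>\<alpha>\<in>{lo..hi}. dist \<alpha> a < d2 \<longrightarrow> \<alpha> \<noteq> a \<longrightarrow> n \<alpha> = R" by (auto simp: A1_def A2_def)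
    have "\<exists>b\<in>{lo..hi}. b \<noteq> a \<and> dist b a < min d1 d2"
    proof (cases "a < hi")
      case True
      thus ?thesis using a by (intro bexI[of _ "a + min (min d1 d2 / 2) (hi - a)"]) (auto simp: dist_real_def min_def)
    next
      case False
      hence "lo < a" using a I by auto
      thus ?thesis using a by (intro bexI[of _ "a - min (min d1 d2 / 2) (a - lo)"]) (auto simp: dist_real_def min_def)
    qed
    thus False using a by force
  qed
  have "connected {lo..hi}" by simp
  moreover have "{lo..hi} \<subseteq> A1 \<union> A2" using cover by blast
  ultimately have "A1 = {} \<or> A2 = {}"
    unfolding connected_openin using op1 op2 disj by metis
  thus ?thesis
  proof
    assume "A2 = {}"
    hence "n \<alpha> < R" if "\<alpha> \<in> {lo..hi}" for \<alpha> using cover[OF that] by (auto simp: A1_def)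
    thus ?thesis by (auto simp: n_def)
  next
    assume "A1 = {}"
    have "\<not> a islimpt {\<alpha> \<in> {lo..hi}. n \<alpha> < R}" if a: "a \<in> {lo..hi}" for a
    proof -
      have "a \<in> A2" using cover[OF a] \<open>A1 = {}\<close> by auto
      then obtain d where d: "d > 0" "\<forall>\<alpha>\<in>{lo..hi}. dist \<alpha> a < d \<longrightarrow> \<alpha> \<noteq> a \<longrightarrow> n \<alpha> = R" by (auto simp: A2_def)
      thus ?thesis unfolding islimpt_approachable by force
    qed
    from finite_not_islimpt_in_compact[OF compact_Icc this]
    have "finite ({lo..hi} \<inter> {\<alpha> \<in> {lo..hi}. n \<alpha> < R})" .
    moreover have "{lo..hi} \<inter> {\<alpha> \<in> {lo..hi}. n \<alpha> < R} = {\<alpha> \<in> {lo..hi}. n \<alpha> < R}" by auto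
    ultimately show ?thesis by (simp add: n_def)
  qed
qed

end

lemma norm_cis_diff_le: "norm (cis a - cis b) \<le> \<bar>a - b\<bar>"
proof -
  have "cis a - cis b = cis b * (cis (a - b) - 1)" by (simp add: cis_mult right_diff_distrib)
  hence "norm (cis a - cis b) = norm (cis (a - b) - 1)" by (simp add: norm_mult)
  also have "\<dots> \<le> \<bar>a - b\<bar>"
    using dist_exp_i_1[of "a - b"] abs_sin_x_le_abs_x[of "(a - b) / 2"] by (simp add: cis_conv_exp)
  finally show ?thesis .
qed

text \<open>Dividing by \<open>cis a\<close> moves the question to the point 1, away from the branch
  cut of \<open>Arg\<close>.\<close>

lemma arc_nhds:
  assumes "\<delta> > 0"
  obtains \<eta> where "\<eta> > 0" "\<And>\<zeta>. norm \<zeta> = 1 \<Longrightarrow> dist \<zeta> (cis a) < \<eta> \<Longrightarrow> \<zeta> \<in> cis ` {a - \<delta>..a + \<delta>}"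
proof -
  have "isCont Arg 1" by (rule continuous_at_Arg) simp
  then obtain \<eta> where \<eta>: "\<eta> > 0" "\<And>x. dist x 1 < \<eta> \<Longrightarrow> dist (Arg x) (Arg 1) < \<delta>"
    using assms unfolding continuous_at_eps_delta by blast
  show ?thesis
  proof (rule that[OF \<eta>(1)])
    fix \<zeta> assume z: "norm \<zeta> = 1" "dist \<zeta> (cis a) < \<eta>"
    define x where "x = \<zeta> / cis a"
    have n: "norm x = 1" using z by (simp add: x_def norm_divide)
    have zx: "\<zeta> = cis a * x" by (simp add: x_def)
    have "dist \<zeta> (cis a) = norm (cis a * (x - 1))" by (simp add: dist_norm zx right_diff_distrib)
    hence "dist x 1 < \<eta>" using z(2) by (simp add: norm_mult dist_norm)
    from \<eta>(2)[OF this] have A: "\<bar>Arg x\<bar> < \<delta>" by (simp add: dist_real_def)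
    have "x = cis (Arg x)" using rcis_cmod_Arg[of x] n by (simp add: rcis_def)
    hence "\<zeta> = cis (a + Arg x)" using zx by (metis cis_mult)
    thus "\<zeta> \<in> cis ` {a - \<delta>..a + \<delta>}" using A by (intro image_eqI[of _ _ "a + Arg x"]) auto
  qed
qed

context analytic_family
begin

text \<open>Off a null set, the number of distinct zeros in a disc is locally maximal. On a box around \<open>\<xi>0\<close> with
  maximum \<open>R\<close>, let \<open>E m\<close> be the set of points with fewer than \<open>R\<close> zeros whatever their first \<open>m\<close>
  coordinates. Each \<open>E m - E (Suc m)\<close> is null, and the \<open>E m\<close> have empty intersection.\<close>

lemma generic_zeros:
  assumes w: "\<xi>0 \<in> torus" and z: "cball z r \<subseteq> V" "0 < r" and nz: "\<And>s. s \<in> sphere z r \<Longrightarrow> h \<xi>0 s \<noteq> 0"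
  obtains U N R where "open U" "\<xi>0 \<in> U" "N \<in> null_sets haar"
    "\<And>\<xi> s. \<xi> \<in> U \<inter> torus \<Longrightarrow> s \<in> sphere z r \<Longrightarrow> h \<xi> s \<noteq> 0"
    "\<And>\<xi>. \<xi> \<in> U \<inter> torus \<Longrightarrow> card {s \<in> ball z r. h \<xi> s = 0} \<le> R"
    "\<And>\<xi>. \<xi> \<in> U \<inter> torus - N \<Longrightarrow> card {s \<in> ball z r. h \<xi> s = 0} = R"
proof -
  define n where "n = (\<lambda>\<xi>. card {s \<in> ball z r. h \<xi> s = 0})"
  obtain O1 K where O1: "open O1" "\<xi>0 \<in> O1" "\<And>\<xi> s. \<xi> \<in> O1 \<inter> torus \<Longrightarrow> s \<in> sphere z r \<Longrightarrow> h \<xi> s \<noteq> 0"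
    "\<And>\<xi>. \<xi> \<in> O1 \<inter> torus \<Longrightarrow> n \<xi> \<le> K"
    using zeros_bounded[OF w z nz] unfolding n_def by blast
  define \<alpha> where "\<alpha> = (\<lambda>i. Arg (\<xi>0 i))"
  have \<xi>0: "\<xi>0 i = cis (\<alpha> i)" for i
    using rcis_cmod_Arg[of "\<xi>0 i"] w by (simp add: rcis_def torus_def \<alpha>_def)
  \<comment> \<open>A box with arcs of half-width \<open>1 / real (Suc d)\<close> in the first
    \<open>d\<close> coordinates and full circles elsewhere. As \<open>d\<close> grows, every
    coordinate is eventually pinned to that of \<open>\<xi>0\<close>, so some box fits into
    \<open>O1\<close>.\<close>
  define lo hi where "lo = (\<lambda>d i. if i < d then \<alpha> i - 1 / real (Suc d) else 0)"
    and "hi = (\<lambda>d i. if i < d then \<alpha> i + 1 / real (Suc d) else 2 * pi)"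
  define B where "B = (\<lambda>d. {\<xi>. \<forall>i. \<xi> i \<in> cis ` {lo d i..hi d i}})"
  have "\<exists>d. B d \<subseteq> O1"
  proof (rule ccontr)
    assume "\<not> (\<exists>d. B d \<subseteq> O1)"
    hence "\<forall>d. \<exists>x. x \<in> B d \<and> x \<notin> O1" by blast
    from choice[OF this] obtain x where x: "\<forall>d. x d \<in> B d \<and> x d \<notin> O1" ..
    have "(x \<longlongrightarrow> \<xi>0) sequentially"
    proof (rule tendsto_fun_coordinatewise)
      fix i
      have "((\<lambda>d. x d i - \<xi>0 i) \<longlongrightarrow> 0) sequentially"
      proof (rule Lim_null_comparison)
        show "\<forall>\<^sub>F d in sequentially. norm (x d i - \<xi>0 i) \<le> 1 / real (Suc d)"
          using eventually_gt_at_top[of i]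
        proof eventually_elim
          case (elim d)
          have "x d i \<in> cis ` {lo d i..hi d i}" using x by (simp add: B_def)
          then obtain b where b: "x d i = cis b" "b \<in> {lo d i..hi d i}" by blast
          have "\<bar>b - \<alpha> i\<bar> \<le> 1 / real (Suc d)" using b(2) elim by (auto simp: lo_def hi_def abs_le_iff)
          thus ?case using norm_cis_diff_le[of b "\<alpha> i"] unfolding b(1) \<xi>0 by linarith
        qed
      qed (rule LIMSEQ_Suc[OF lim_1_over_n])
      thus "((\<lambda>d. x d i) \<longlongrightarrow> \<xi>0 i) sequentially" by (rule LIM_zero_cancel)
    qed
    from topological_tendstoD[OF this O1(1,2)] have "\<forall>\<^sub>F d in sequentially. x d \<in> O1" .
    thus False using x by simp
  qed
  then obtain d where d: "B d \<subseteq> O1" ..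
  define l u where "l = lo d" and "u = hi d"
  define S where "S = (\<lambda>i. cis ` {l i..u i})"
  define U where "U = {\<xi>. \<forall>i. \<xi> i \<in> S i}"
  have UB: "U = B d" by (simp add: U_def B_def S_def l_def u_def)
  have lu: "l i < u i" for i by (auto simp: l_def u_def lo_def hi_def intro: less_trans[of _ "\<alpha> i"])
  have UT: "U \<subseteq> torus"
  proof
    fix \<xi> assume x: "\<xi> \<in> U"
    have "norm (\<xi> i) = 1" for i
    proof -
      have "\<xi> i \<in> S i" using x unfolding U_def by blast
      then obtain t where "\<xi> i = cis t" unfolding S_def by blast
      thus ?thesis by simp
    qed
    thus "\<xi> \<in> torus" by (simp add: torus_def)
  qed
  have UO: "\<xi> \<in> O1 \<inter> torus" if "\<xi> \<in> U" for \<xi> using that UT UB d by auto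
  have clU: "closed U"
  proof -
    have "closed (S i)" for i
      unfolding S_def by (intro compact_imp_closed compact_continuous_image continuous_intros compact_Icc)
    hence "closed ((\<lambda>\<xi>. \<xi> i) -` S i)" for i
      by (intro closed_vimage continuous_on_product_coordinates)
    hence "closed (\<Inter>i. (\<lambda>\<xi>. \<xi> i) -` S i)" by (intro closed_INT) auto
    moreover have "(\<Inter>i. (\<lambda>\<xi>. \<xi> i) -` S i) = U" by (auto simp: U_def)
    ultimately show ?thesis by simp
  qed
  have U0: "\<xi>0 \<in> U"
    unfolding U_def
  proof (intro CollectI allI)
    fix i
    show "\<xi>0 i \<in> S i"
    proof (cases "i < d")
      case True
      thus ?thesis unfolding S_def \<xi>0 by (intro imageI) (simp add: l_def u_def lo_def hi_def)
    next
      case False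
      obtain t where "0 \<le> t" "t < 2*pi" "\<xi>0 i = Complex (cos t) (sin t)"
        using complex_unimodular_polar[of "\<xi>0 i"] w by (auto simp: torus_def)
      thus ?thesis using False unfolding S_def by (intro image_eqI[of _ _ t]) (auto simp: cis.ctr l_def u_def lo_def hi_def)
    qed
  qed
  have "\<exists>\<xi>s. \<xi>s \<in> U \<and> (\<forall>\<xi>. \<xi> \<in> U \<longrightarrow> n \<xi> \<le> n \<xi>s)"
    by (rule ex_has_greatest_nat[of _ \<xi>0 _ "Suc K"]) (use U0 O1(4) UO in \<open>auto simp: less_Suc_eq_le\<close>)
  then obtain \<xi>s where s: "\<xi>s \<in> U" "\<And>\<xi>. \<xi> \<in> U \<Longrightarrow> n \<xi> \<le> n \<xi>s" by blast
  define R where "R = n \<xi>s"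
  \<comment> \<open>An open set of the whole space that agrees on \<open>U\<close> with the points
    of maximal count. Lower semicontinuity provides the agreement, and openness makes the sets
    \<open>E m\<close> Borel.\<close>
  define P where "P = \<Union>{X. open X \<and> (\<forall>\<xi>\<in>X \<inter> U. R \<le> n \<xi>)}"
  have opP: "open P" by (auto simp: P_def)
  have Piff: "\<xi> \<in> P \<longleftrightarrow> R \<le> n \<xi>" if x: "\<xi> \<in> U" for \<xi>
  proof
    assume "\<xi> \<in> P" thus "R \<le> n \<xi>" using x by (auto simp: P_def)
  next
    assume R: "R \<le> n \<xi>"
    have xt: "\<xi> \<in> torus" and nzx: "\<And>s. s \<in> sphere z r \<Longrightarrow> h \<xi> s \<noteq> 0" using UO[OF x] O1(3) by auto
    obtain X where X: "open X" "\<xi> \<in> X" "\<And>y. y \<in> X \<inter> torus \<Longrightarrow> (\<And>s. s \<in> sphere z r \<Longrightarrow> h y s \<noteq> 0) \<Longrightarrow> n \<xi> \<le> n y"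
      using zeros_lower_semicontinuous[OF xt z nzx] unfolding n_def by blast
    have "R \<le> n y" if "y \<in> X \<inter> U" for y
      using X(3)[of y] O1(3)[of y] UO[of y] that R by fastforce
    thus "\<xi> \<in> P" using X(1,2) by (auto simp: P_def)
  qed
  define mg where "mg = (\<lambda>m (v :: nat \<Rightarrow> complex) \<xi> i. if i < m then v i else \<xi> i)"
  have mgU: "mg m v \<xi> \<in> U" if "v \<in> U" "\<xi> \<in> U" for m v \<xi> using that by (auto simp: mg_def U_def)
  have mgc: "continuous_on UNIV (mg m v)" for m v
  proof (rule continuous_on_coordinatewise_then_product)
    fix i show "continuous_on UNIV (\<lambda>\<xi>. mg m v \<xi> i)" by (cases "i < m") (simp_all add: mg_def)
  qed
  define E where "E = (\<lambda>m. U - (\<Union>v\<in>U. mg m v -` P))"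
  have Eborel: "E m \<in> sets borel" for m
    unfolding E_def using clU opP mgc by (intro sets.Diff borel_closed borel_open open_UN ballI open_vimage) auto
  have null: "E m - E (Suc m) \<in> null_sets haar" for m
  proof (rule null_haar_slices[where j = m])
    show "E m - E (Suc m) \<in> sets borel" using Eborel by auto
    fix X assume X: "X \<in> torus"
    show "countable {x \<in> sphere 0 1. X(m := x) \<in> E m - E (Suc m)}"
    proof (cases "\<exists>x0. X(m := x0) \<in> E m - E (Suc m)")
      case False
      hence "{x \<in> sphere 0 1. X(m := x) \<in> E m - E (Suc m)} = {}" by auto
      thus ?thesis by (simp only: countable_empty)
    next
      case True
      then obtain x0 where x0: "X(m := x0) \<in> E m" "X(m := x0) \<notin> E (Suc m)" by auto
      \<comment> \<open>Outside \<open>E (Suc m)\<close>, some choice \<open>v\<close> of the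
        coordinates up to \<open>m\<close> gives the maximal count. Hence the slice through
        \<open>Y\<close> in coordinate \<open>m\<close> is not deficient throughout, and only
        finitely many deficient angles remain.\<close>
      then obtain v where v: "v \<in> U" "mg (Suc m) v (X(m := x0)) \<in> P" by (auto simp: E_def)
      have x0U: "X(m := x0) \<in> U" using x0 by (auto simp: E_def)
      define Y where "Y = mg m v (X(m := x0))"
      have YU: "Y \<in> U" using mgU[OF v(1) x0U] by (simp add: Y_def)
      have YmU: "Y(m := y) \<in> U" if "y \<in> S m" for y using YU that by (auto simp: U_def)
      have "v m \<in> S m" using v(1) by (simp add: U_def)
      then obtain b where b: "v m = cis b" "b \<in> {l m..u m}" by (auto simp: S_def)
      have eq: "mg (Suc m) v (X(m := x0)) = Y(m := cis b)"
        by (auto simp: mg_def Y_def fun_eq_iff b(1)[symmetric])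
      have "R \<le> n (Y(m := cis b))" using Piff[OF YmU[of "cis b"]] v(2) b by (auto simp: eq S_def)
      hence nall: "\<not> (\<forall>a\<in>{l m..u m}. n (Y(m := cis a)) < R)" using b(2) by (meson not_le)
      have "(\<forall>a\<in>{l m..u m}. n (Y(m := cis a)) < R) \<or> finite {a \<in> {l m..u m}. n (Y(m := cis a)) < R}"
        unfolding n_def
      proof (rule slice_dichotomy)
        show "Y \<in> torus" using YU UT by auto
        fix a assume a: "a \<in> {l m..u m}"
        hence aU: "Y(m := cis a) \<in> U" by (intro YmU) (simp add: S_def)
        show "h (Y(m := cis a)) s \<noteq> 0" if "s \<in> sphere z r" for s
          by (rule O1(3)[OF UO[OF aU] that])
        show "card {s \<in> ball z r. h (Y(m := cis a)) s = 0} \<le> R"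
          using s(2)[OF aU] by (simp add: n_def R_def)
      qed (use z lu in auto)
      hence fin: "finite {a \<in> {l m..u m}. n (Y(m := cis a)) < R}" using nall by blast
      have "{x \<in> sphere 0 1. X(m := x) \<in> E m - E (Suc m)} \<subseteq> cis ` {a \<in> {l m..u m}. n (Y(m := cis a)) < R}"
      proof
        fix x assume "x \<in> {x \<in> sphere 0 1. X(m := x) \<in> E m - E (Suc m)}"
        hence xE: "X(m := x) \<in> E m" by auto
        hence xU: "X(m := x) \<in> U" and nP: "mg m v (X(m := x)) \<notin> P" using v(1) by (auto simp: E_def)
        have "(X(m := x)) m \<in> S m" using xU unfolding U_def by blast
        then obtain a where a: "x = cis a" "a \<in> {l m..u m}" by (auto simp: S_def)
        have "mg m v (X(m := x)) = Y(m := x)" by (auto simp: mg_def Y_def fun_eq_iff)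
        hence "Y(m := x) \<notin> P" "Y(m := x) \<in> U" using nP mgU[OF v(1) xU, of m] by auto
        hence "n (Y(m := cis a)) < R" using Piff a(1) by auto
        thus "x \<in> cis ` {a \<in> {l m..u m}. n (Y(m := cis a)) < R}" using a by blast
      qed
      thus ?thesis by (rule countable_subset[OF _ countable_finite[OF finite_imageI[OF fin]]])
    qed
  qed
  have inter: "\<exists>m. \<xi> \<notin> E m" for \<xi>
  proof (rule ccontr)
    assume a: "\<not> (\<exists>m. \<xi> \<notin> E m)"
    \<comment> \<open>Copying more and more coordinates of the maximal point \<open>\<xi>s\<close>
      converges to \<open>\<xi>s\<close>, so \<open>\<xi>\<close> has to leave \<open>E m\<close>
      for some \<open>m\<close>.\<close>
    have "((\<lambda>m. mg m \<xi>s \<xi>) \<longlongrightarrow> \<xi>s) sequentially"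
    proof (rule tendsto_fun_coordinatewise)
      fix i
      have "\<forall>\<^sub>F m in sequentially. mg m \<xi>s \<xi> i = \<xi>s i"
        using eventually_gt_at_top[of i] by eventually_elim (simp add: mg_def)
      thus "((\<lambda>m. mg m \<xi>s \<xi> i) \<longlongrightarrow> \<xi>s i) sequentially" by (rule tendsto_eventually)
    qed
    moreover have "\<xi>s \<in> P" using Piff[OF s(1)] by (simp add: R_def)
    ultimately have "\<forall>\<^sub>F m in sequentially. mg m \<xi>s \<xi> \<in> P" using topological_tendstoD[OF _ opP] by blast
    then obtain m where "mg m \<xi>s \<xi> \<in> P" using eventually_happens'[OF sequentially_bot] by blast
    moreover have "\<xi> \<in> E m" using a by blast
    ultimately show False using s(1) by (auto simp: E_def)
  qed
  have "E 0 \<subseteq> (\<Union>m. E m - E (Suc m))"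
  proof
    fix \<xi> assume x: "\<xi> \<in> E 0"
    define k where "k = (LEAST k. \<xi> \<notin> E k)"
    have k: "\<xi> \<notin> E k" using inter[of \<xi>] unfolding k_def by (rule LeastI_ex)
    hence "k \<noteq> 0" using x by (intro notI) simp
    then obtain m where m: "k = Suc m" using not0_implies_Suc by blast
    have "\<xi> \<in> E m" using not_less_Least[of m "\<lambda>k. \<xi> \<notin> E k"] m by (auto simp: k_def)
    thus "\<xi> \<in> (\<Union>m. E m - E (Suc m))" using k m by blast
  qed
  moreover have "(\<Union>m. E m - E (Suc m)) \<in> null_sets haar" using null by (intro null_sets_UN) auto
  ultimately have N: "E 0 \<in> null_sets haar" using Eborel[of 0] by (intro null_sets_subset[of _ _ "E 0"]) auto
  \<comment> \<open>On torus points \<open>U\<close> restricts only the first \<open>d\<close>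
    coordinates, so it contains all torus points in some open neighbourhood of
    \<open>\<xi>0\<close>.\<close>
  have "\<forall>i. \<exists>\<eta>>0. \<forall>\<zeta>. norm \<zeta> = 1 \<longrightarrow> dist \<zeta> (\<xi>0 i) < \<eta> \<longrightarrow> i < d \<longrightarrow> \<zeta> \<in> S i"
  proof
    fix i
    obtain \<eta> where "\<eta> > 0" "\<And>\<zeta>. norm \<zeta> = 1 \<Longrightarrow> dist \<zeta> (cis (\<alpha> i)) < \<eta> \<Longrightarrow> \<zeta> \<in> cis ` {\<alpha> i - 1 / real (Suc d)..\<alpha> i + 1 / real (Suc d)}"
      using arc_nhds[of "1 / real (Suc d)" "\<alpha> i"] by auto
    thus "\<exists>\<eta>>0. \<forall>\<zeta>. norm \<zeta> = 1 \<longrightarrow> dist \<zeta> (\<xi>0 i) < \<eta> \<longrightarrow> i < d \<longrightarrow> \<zeta> \<in> S i"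
      by (intro exI[of _ \<eta>]) (auto simp: \<xi>0 S_def l_def u_def lo_def hi_def)
  qed
  from choice[OF this] obtain \<eta> where \<eta>: "\<forall>i. \<eta> i > 0 \<and> (\<forall>\<zeta>. norm \<zeta> = 1 \<longrightarrow> dist \<zeta> (\<xi>0 i) < \<eta> i \<longrightarrow> i < d \<longrightarrow> \<zeta> \<in> S i)" ..
  define X where "X = (\<Inter>i<d. (\<lambda>\<xi>. \<xi> i) -` ball (\<xi>0 i) (\<eta> i))"
  have opX: "open X"
    unfolding X_def by (intro open_INT ballI open_vimage continuous_on_product_coordinates) auto
  have X0: "\<xi>0 \<in> X" using \<eta> by (auto simp: X_def)
  have XU: "\<xi> \<in> U" if x: "\<xi> \<in> X \<inter> torus" for \<xi>
    unfolding U_def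
  proof (intro CollectI allI)
    fix i
    have ni: "norm (\<xi> i) = 1" using x by (simp add: torus_def)
    show "\<xi> i \<in> S i"
    proof (cases "i < d")
      case True
      hence "dist (\<xi> i) (\<xi>0 i) < \<eta> i" using x by (auto simp: X_def dist_commute)
      thus ?thesis using \<eta> ni True by blast
    next
      case False
      obtain t where "0 \<le> t" "t < 2*pi" "\<xi> i = Complex (cos t) (sin t)"
        using complex_unimodular_polar[OF ni] by blast
      thus ?thesis using False unfolding S_def by (intro image_eqI[of _ _ t]) (auto simp: cis.ctr l_def u_def lo_def hi_def)
    qed
  qed
  show ?thesis
  proof (rule that[OF opX X0 N, of R])
    fix \<xi> assume x: "\<xi> \<in> X \<inter> torus"
    show "h \<xi> t \<noteq> 0" if "t \<in> sphere z r" for t by (rule O1(3)[OF UO[OF XU[OF x]] that])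
    show "card {s \<in> ball z r. h \<xi> s = 0} \<le> R" using s(2)[OF XU[OF x]] by (simp add: n_def R_def)
  next
    fix \<xi> assume x: "\<xi> \<in> X \<inter> torus - E 0"
    hence xU: "\<xi> \<in> U" using XU by blast
    then obtain v where v: "v \<in> U" "mg 0 v \<xi> \<in> P" using x by (auto simp: E_def)
    have "mg 0 v \<xi> = \<xi>" by (simp add: mg_def)
    hence "R \<le> n \<xi>" using v Piff[OF xU] by simp
    moreover have "n \<xi> \<le> R" using s(2)[OF xU] by (simp add: R_def)
    ultimately show "card {s \<in> ball z r. h \<xi> s = 0} = R" by (simp add: n_def)
  qed
qed

end

lemma eventually_at_torus:
  assumes "open U" "\<xi>1 \<in> U"
  shows "\<forall>\<^sub>F \<xi> in at \<xi>1 within torus. \<xi> \<in> U \<inter> torus"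
  using assms unfolding eventually_at_topological by blast

text \<open>At a generic point the distinct zeros move continuously. Zeros on the line \<open>Re s = \<sigma>\<close> of a family that is symmetric
  under reflection in this line cannot leave the line, because they would have to split.\<close>

lemma zero_sum_continuous:
  fixes G :: "complex \<Rightarrow> real"
  assumes h: "analytic_family h V" and f: "analytic_family f V"
    and sub: "\<And>\<xi> s. \<xi> \<in> torus \<Longrightarrow> s \<in> V \<Longrightarrow> f \<xi> s = 0 \<Longrightarrow> h \<xi> s = 0"
    and w: "\<xi>1 \<in> torus" "open U" "\<xi>1 \<in> U" and z: "cball z r \<subseteq> V" "0 < r"
    and nz: "\<And>\<xi> s. \<xi> \<in> U \<inter> torus \<Longrightarrow> s \<in> sphere z r \<Longrightarrow> h \<xi> s \<noteq> 0"
    and le: "\<And>\<xi>. \<xi> \<in> U \<inter> torus \<Longrightarrow> card {s \<in> ball z r. h \<xi> s = 0} \<le> R"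
    and R: "card {s \<in> ball z r. h \<xi>1 s = 0} = R"
    and G: "\<And>p. Re p \<noteq> \<sigma> \<Longrightarrow> isCont G p" "\<And>p. Re p = \<sigma> \<Longrightarrow> G p = 0"
    and sym: "(\<forall>p\<in>ball z r. Re p \<noteq> \<sigma>) \<or>
       Re z = \<sigma> \<and> (\<forall>\<xi>\<in>torus. \<forall>p\<in>ball z r. h \<xi> p = 0 \<longrightarrow> h \<xi> (of_real (2 * \<sigma>) - cnj p) = 0)"
  shows "continuous (at \<xi>1 within torus) (\<lambda>\<xi>. \<Sum>p\<in>{s \<in> ball z r. f \<xi> s = 0}. G p)"
proof -
  interpret h: analytic_family h V by fact
  interpret f: analytic_family f V by fact
  let ?F = "at \<xi>1 within torus"
  define Zh Zf where "Zh = (\<lambda>\<xi>. {s \<in> ball z r. h \<xi> s = 0})" and "Zf = (\<lambda>\<xi>. {s \<in> ball z r. f \<xi> s = 0})"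
  have bV: "ball z r \<subseteq> V" using z by auto
  have Zsub: "Zf \<xi> \<subseteq> Zh \<xi>" if "\<xi> \<in> torus" for \<xi> using sub[OF that] bV by (auto simp: Zf_def Zh_def)
  have w1: "\<xi>1 \<in> U \<inter> torus" using w by auto
  have finh: "finite (Zh \<xi>)" if "\<xi> \<in> U \<inter> torus" for \<xi>
    unfolding Zh_def by (rule h.zeros_finite) (use that z nz in auto)
  define A where "A = Zh \<xi>1"
  have finA: "finite A" and cA: "card A = R" and Ab: "A \<subseteq> ball z r" using finh[OF w1] R by (auto simp: A_def Zh_def)
  obtain d where d: "d > 0" "\<And>p. p \<in> A \<Longrightarrow> cball p d \<subseteq> ball z r"
    "\<And>p q. p \<in> A \<Longrightarrow> q \<in> A \<Longrightarrow> p \<noteq> q \<Longrightarrow> cball p d \<inter> cball q d = {}"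
    using separation_radius[OF finA open_ball Ab] by blast
  have only: "h \<xi>1 s \<noteq> 0" if "p \<in> A" "s \<in> cball p d" "s \<noteq> p" for p s
  proof
    assume "h \<xi>1 s = 0"
    hence "s \<in> A" using d(2)[OF that(1)] that(2) by (auto simp: A_def Zh_def)
    from d(3)[OF that(1) this] that d(1) show False by auto
  qed
  \<comment> \<open>Hurwitz gives at least one zero of \<open>h \<xi>\<close> near each
    \<open>p\<close>, and there are at most \<open>R = card A\<close> in all: so exactly one in each
    disc and none elsewhere.\<close>
  have key: "\<forall>\<^sub>F \<xi> in ?F. \<xi> \<in> U \<inter> torus \<and> Zh \<xi> \<subseteq> (\<Union>p\<in>A. ball p d) \<and> (\<forall>p\<in>A. \<exists>s\<in>ball p e. Zh \<xi> \<inter> ball p d = {s})"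
    if e: "0 < e" "e \<le> d" for e
  proof -
    have "\<forall>\<^sub>F \<xi> in ?F. \<exists>s\<in>ball p e. h \<xi> s = 0" if p: "p \<in> A" for p
    proof -
      have "cball p e \<subseteq> V" using d(2)[OF p] e bV by (meson order_trans subset_cball)
      moreover have "h \<xi>1 p = 0" using p by (simp add: A_def Zh_def)
      moreover have "h \<xi>1 s \<noteq> 0" if "s \<in> sphere p e" for s using only[OF p, of s] that e by auto
      ultimately obtain X where X: "open X" "\<xi>1 \<in> X" "\<And>\<xi>. \<xi> \<in> X \<inter> torus \<Longrightarrow> \<exists>s\<in>ball p e. h \<xi> s = 0"
        using h.hurwitz_zero[OF w(1) _ e(1)] by blast
      show ?thesis using eventually_at_torus[OF X(1,2)] by eventually_elim (use X(3) in blast)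
    qed
    hence "\<forall>\<^sub>F \<xi> in ?F. \<forall>p\<in>A. \<exists>s\<in>ball p e. h \<xi> s = 0" using finA by (simp add: eventually_ball_finite_distrib)
    with eventually_at_torus[OF w(2,3)] show ?thesis
    proof eventually_elim
      case (elim \<xi>)
      from bchoice[OF elim(2)[unfolded Bex_def]] obtain g where g: "\<forall>p\<in>A. g p \<in> ball p e \<and> h \<xi> (g p) = 0" ..
      have gd: "g p \<in> ball p d" if "p \<in> A" for p using g that e by fastforce
      have gZ: "g p \<in> Zh \<xi>" if "p \<in> A" for p
        using gd[OF that] d(2)[OF that] g that by (auto simp: Zh_def subset_iff)
      have inj: "inj_on g A"
      proof (rule inj_onI, rule ccontr)
        fix p q assume pq: "p \<in> A" "q \<in> A" "g p = g q" "p \<noteq> q"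
        have "g p \<in> cball p d" "g p \<in> cball q d" using gd[OF pq(1)] gd[OF pq(2)] pq(3) by auto
        thus False using d(3)[OF pq(1,2,4)] by blast
      qed
      have "g ` A = Zh \<xi>"
      proof (rule card_seteq)
        show "finite (Zh \<xi>)" by (rule finh[OF elim(1)])
        show "g ` A \<subseteq> Zh \<xi>" using gZ by blast
        show "card (Zh \<xi>) \<le> card (g ` A)" using le[OF elim(1)] card_image[OF inj] cA by (simp add: Zh_def)
      qed
      have 1: "Zh \<xi> \<subseteq> (\<Union>p\<in>A. ball p d)"
      proof
        fix y assume "y \<in> Zh \<xi>"
        then obtain p where "p \<in> A" "y = g p" using \<open>g ` A = Zh \<xi>\<close> by blast
        thus "y \<in> (\<Union>p\<in>A. ball p d)" using gd by blast
      qed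
      have 2: "Zh \<xi> \<inter> ball p d = {g p}" if p: "p \<in> A" for p
      proof
        show "{g p} \<subseteq> Zh \<xi> \<inter> ball p d" using gZ[OF p] gd[OF p] by blast
        show "Zh \<xi> \<inter> ball p d \<subseteq> {g p}"
        proof
          fix y assume y: "y \<in> Zh \<xi> \<inter> ball p d"
          then obtain q where q: "q \<in> A" "y = g q" using \<open>g ` A = Zh \<xi>\<close> by blast
          have "y \<in> cball p d" "y \<in> cball q d" using y gd[OF q(1)] q(2) by auto
          hence "p = q" using d(3)[OF p q(1)] by blast
          thus "y \<in> {g p}" using q by simp
        qed
      qed
      show ?case using elim(1) 1 2 g by blast
    qed
  qed
  define c where "c = (\<lambda>p \<xi>. \<Sum>q\<in>Zf \<xi> \<inter> ball p d. G q)"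
  have tend: "(c p \<longlongrightarrow> c p \<xi>1) ?F" if p: "p \<in> A" for p
  proof -
    have pb: "p \<in> ball z r" using p Ab by blast
    have Zf1: "Zf \<xi>1 \<inter> ball p d \<subseteq> {p}"
    proof
      fix s assume s: "s \<in> Zf \<xi>1 \<inter> ball p d"
      hence "h \<xi>1 s = 0" using Zsub[OF w(1)] by (auto simp: Zh_def)
      thus "s \<in> {p}" using only[OF p, of s] s by fastforce
    qed
    consider "f \<xi>1 p \<noteq> 0" | "f \<xi>1 p = 0" "Re p \<noteq> \<sigma>" | "f \<xi>1 p = 0" "Re p = \<sigma>" by blast
    thus ?thesis
    proof cases
      \<comment> \<open>The auxiliary function may vanish at \<open>p\<close> although
        \<open>f\<close> does not. The single zero of \<open>h \<xi>\<close> near \<open>p\<close>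
        then stays in a disc where \<open>f \<xi>\<close> is nonzero.\<close>
      case 1
      have "continuous_on (ball z r) (f \<xi>1)"
        using f.hol[OF w(1)] bV holomorphic_on_imp_continuous_on continuous_on_subset by blast
      then obtain e0 where e0: "e0 > 0" "\<And>s. s \<in> ball z r \<Longrightarrow> dist s p < e0 \<Longrightarrow> dist (f \<xi>1 s) (f \<xi>1 p) < norm (f \<xi>1 p)"
        using 1 pb unfolding continuous_on_iff by (metis zero_less_norm_iff)
      define e where "e = min d (e0 / 2)"
      have e: "0 < e" "e \<le> d" using d(1) e0(1) by (auto simp: e_def)
      have sb: "cball p e \<subseteq> ball z r" using d(2)[OF p] e by (meson order_trans subset_cball)
      have nf: "f \<xi>1 s \<noteq> 0" if s: "s \<in> cball p e" for s
      proof -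
        have "dist s p < e0" using s e0(1) by (auto simp: e_def dist_commute)
        from e0(2)[OF _ this] s sb show ?thesis by (auto simp: dist_norm)
      qed
      obtain X where X: "open X" "\<xi>1 \<in> X" "\<And>\<xi> s. \<xi> \<in> X \<inter> torus \<Longrightarrow> s \<in> cball p e \<Longrightarrow> f \<xi> s \<noteq> 0"
        using f.nonzero_stable[OF w(1) compact_cball _ nf] sb bV by (metis order_trans)
      have "\<forall>\<^sub>F \<xi> in ?F. c p \<xi> = c p \<xi>1"
        using eventually_at_torus[OF X(1,2)] key[OF e]
      proof eventually_elim
        case (elim \<xi>)
        obtain s where s: "s \<in> ball p e" "Zh \<xi> \<inter> ball p d = {s}" using elim(2) p by blast
        have "Zf \<xi> \<inter> ball p d = {}"
        proof (rule ccontr)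
          assume "Zf \<xi> \<inter> ball p d \<noteq> {}"
          then obtain q where q: "q \<in> Zf \<xi>" "q \<in> ball p d" by blast
          hence "q = s" using Zsub[of \<xi>] elim(1) s(2) by blast
          hence "q \<in> cball p e" using s(1) by auto
          thus False using X(3)[of \<xi> q] elim(1) q(1) by (auto simp: Zf_def)
        qed
        moreover have "Zf \<xi>1 \<inter> ball p d = {}" using Zf1 1 by (auto simp: Zf_def)
        ultimately show ?case by (simp add: c_def)
      qed
      thus ?thesis by (rule tendsto_eventually)
    next
      case 2
      have Z1: "Zf \<xi>1 \<inter> ball p d = {p}" using Zf1 2 pb d(1) by (auto simp: Zf_def)
      show ?thesis
      proof (rule tendstoI)
        fix \<epsilon> :: real assume \<epsilon>: "\<epsilon> > 0"
        obtain e0 where e0: "e0 > 0" "\<And>s. dist s p < e0 \<Longrightarrow> dist (G s) (G p) < \<epsilon>"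
          using G(1)[OF 2(2)] \<epsilon> unfolding continuous_at_eps_delta by blast
        define e where "e = min d e0"
        have e: "0 < e" "e \<le> d" "e \<le> e0" using d(1) e0(1) by (auto simp: e_def)
        have sb: "cball p e \<subseteq> ball z r" using d(2)[OF p] e by (meson order_trans subset_cball)
        have nf: "f \<xi>1 s \<noteq> 0" if s: "s \<in> sphere p e" for s
        proof
          assume "f \<xi>1 s = 0"
          moreover have "s \<in> V" using s sb bV sphere_cball by blast
          ultimately have "h \<xi>1 s = 0" using sub[OF w(1)] by blast
          thus False using only[OF p, of s] s e by auto
        qed
        have "cball p e \<subseteq> V" using sb bV by blast
        then obtain X where X: "open X" "\<xi>1 \<in> X" "\<And>\<xi>. \<xi> \<in> X \<inter> torus \<Longrightarrow> \<exists>s\<in>ball p e. f \<xi> s = 0"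
          using f.hurwitz_zero[OF w(1) _ e(1) 2(1) nf] by blast
        show "\<forall>\<^sub>F \<xi> in ?F. dist (c p \<xi>) (c p \<xi>1) < \<epsilon>"
          using eventually_at_torus[OF X(1,2)] key[OF e(1,2)]
        proof eventually_elim
          case (elim \<xi>)
          obtain s where s: "s \<in> ball p e" "Zh \<xi> \<inter> ball p d = {s}" using elim(2) p by blast
          obtain q where q: "q \<in> ball p e" "f \<xi> q = 0" using X(3) elim(1) by blast
          have "q \<in> Zf \<xi> \<inter> ball p d" using q sb e(2) by (auto simp: Zf_def subset_iff)
          moreover have "Zf \<xi> \<inter> ball p d \<subseteq> {s}" using Zsub[of \<xi>] elim(1) s(2) by blast
          ultimately have "Zf \<xi> \<inter> ball p d = {s}" by blast
          hence "c p \<xi> = G s" by (simp add: c_def)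
          moreover have "c p \<xi>1 = G p" by (simp add: c_def Z1)
          moreover have "dist s p < e0" using s(1) e(3) by (simp add: dist_commute)
          ultimately show ?case using e0(2) by simp
        qed
      qed
    next
      case 3
      have c1: "c p \<xi>1 = 0" unfolding c_def using Zf1 G(2)[OF 3(2)] by (intro sum.neutral) blast
      have zs: "Re z = \<sigma>" and sy: "\<And>\<xi> q. \<xi> \<in> torus \<Longrightarrow> q \<in> ball z r \<Longrightarrow> h \<xi> q = 0 \<Longrightarrow> h \<xi> (of_real (2 * \<sigma>) - cnj q) = 0"
        using sym pb 3(2) by blast+
      have "\<forall>\<^sub>F \<xi> in ?F. c p \<xi> = 0"
        using key[OF d(1) order_refl]
      proof eventually_elim
        case (elim \<xi>)
        obtain s where s: "Zh \<xi> \<inter> ball p d = {s}" using elim p by blast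
        define s' where "s' = of_real (2 * \<sigma>) - cnj s"
        have sZ: "s \<in> ball z r" "h \<xi> s = 0" "s \<in> ball p d" using s by (auto simp: Zh_def)
        have refl: "dist y s' = dist y s" if "Re y = \<sigma>" for y
        proof -
          have "y - s' = - cnj (y - s)" using that by (simp add: s'_def complex_eq_iff)
          thus ?thesis by (simp add: dist_norm del: complex_cnj_diff)
        qed
        have "h \<xi> s' = 0" using sy[of \<xi> s] elim sZ by (simp add: s'_def)
        hence "s' \<in> Zh \<xi> \<inter> ball p d" using sZ refl[OF zs] refl[OF 3(2)] by (simp add: Zh_def)
        hence "s' = s" using s by blast
        hence "Re s = \<sigma>" by (simp add: s'_def complex_eq_iff)
        hence "G s = 0" by (rule G(2))
        moreover have "Zf \<xi> \<inter> ball p d \<subseteq> {s}" using Zsub[of \<xi>] elim s by blast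
        ultimately show ?case unfolding c_def by (intro sum.neutral) blast
      qed
      thus ?thesis unfolding c1 by (rule tendsto_eventually)
    qed
  qed
  have split: "(\<Sum>q\<in>Zf \<xi>. G q) = (\<Sum>p\<in>A. c p \<xi>)" if x: "\<xi> \<in> U \<inter> torus" "Zh \<xi> \<subseteq> (\<Union>p\<in>A. ball p d)" for \<xi>
  proof -
    have fz: "finite (Zf \<xi>)" using finh[OF x(1)] Zsub[of \<xi>] x(1) finite_subset by blast
    have "Zf \<xi> = (\<Union>p\<in>A. Zf \<xi> \<inter> ball p d)" using x(2) Zsub[of \<xi>] x(1) by blast
    hence "(\<Sum>q\<in>Zf \<xi>. G q) = (\<Sum>q\<in>(\<Union>p\<in>A. Zf \<xi> \<inter> ball p d). G q)" by simp
    also have "\<dots> = (\<Sum>p\<in>A. c p \<xi>)"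
      unfolding c_def
    proof (rule sum.UNION_disjoint[OF finA])
      show "\<forall>p\<in>A. finite (Zf \<xi> \<inter> ball p d)" using fz by blast
      show "\<forall>p\<in>A. \<forall>q\<in>A. p \<noteq> q \<longrightarrow> Zf \<xi> \<inter> ball p d \<inter> (Zf \<xi> \<inter> ball q d) = {}"
      proof (intro ballI impI)
        fix p q assume pq: "p \<in> A" "q \<in> A" "p \<noteq> q"
        have "ball p d \<inter> ball q d = {}" using d(3)[OF pq] ball_subset_cball by blast
        thus "Zf \<xi> \<inter> ball p d \<inter> (Zf \<xi> \<inter> ball q d) = {}" by blast
      qed
    qed
    finally show ?thesis .
  qed
  have "((\<lambda>\<xi>. \<Sum>p\<in>A. c p \<xi>) \<longlongrightarrow> (\<Sum>p\<in>A. c p \<xi>1)) ?F" by (intro tendsto_sum tend)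
  moreover have "(\<Sum>p\<in>A. c p \<xi>1) = (\<Sum>q\<in>Zf \<xi>1. G q)"
    by (rule split[symmetric, OF w1]) (use d(1) in \<open>auto simp: A_def\<close>)
  moreover have "\<forall>\<^sub>F \<xi> in ?F. (\<Sum>p\<in>A. c p \<xi>) = (\<Sum>q\<in>Zf \<xi>. G q)"
    using key[OF d(1) order_refl] by eventually_elim (use split in auto)
  ultimately have "((\<lambda>\<xi>. \<Sum>q\<in>Zf \<xi>. G q) \<longlongrightarrow> (\<Sum>q\<in>Zf \<xi>1. G q)) ?F"
    using tendsto_cong by fastforce
  thus ?thesis by (simp add: continuous_within Zf_def)
qed

section \<open>Operations on analytic families\<close>

lemma analytic_family_subset:
  assumes "analytic_family h V" "open V'" "V' \<subseteq> V"
  shows "analytic_family h V'"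
proof -
  interpret analytic_family h V by fact
  show ?thesis
  proof
    show "open V'" by fact
    show "continuous_on (torus \<times> V') (\<lambda>(\<xi>,s). h \<xi> s)" using cont by (rule continuous_on_subset) (use assms in auto)
    show "h \<xi> holomorphic_on V'" if "\<xi> \<in> torus" for \<xi> using hol[OF that] assms(3) holomorphic_on_subset by blast
    fix \<xi> :: "nat \<Rightarrow> complex" and \<zeta> :: complex and j :: nat assume a: "\<xi> \<in> torus" "norm \<zeta> = 1"
    from ext[OF a, of j] obtain e H where H: "e > 0" "continuous_on (ball \<zeta> e \<times> V) (\<lambda>(x,s). H x s)"
        "\<forall>s\<in>V. (\<lambda>x. H x s) holomorphic_on ball \<zeta> e" "\<forall>x\<in>ball \<zeta> e. H x holomorphic_on V"
        "\<forall>x\<in>ball \<zeta> e. norm x = 1 \<longrightarrow> (\<forall>s\<in>V. H x s = h (\<xi>(j := x)) s)" by blast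
    show "\<exists>e>0. \<exists>H. continuous_on (ball \<zeta> e \<times> V') (\<lambda>(x,s). H x s) \<and>
        (\<forall>s\<in>V'. (\<lambda>x. H x s) holomorphic_on ball \<zeta> e) \<and> (\<forall>x\<in>ball \<zeta> e. H x holomorphic_on V') \<and>
        (\<forall>x\<in>ball \<zeta> e. norm x = 1 \<longrightarrow> (\<forall>s\<in>V'. H x s = h (\<xi>(j := x)) s))"
    proof (intro exI[of _ e] exI[of _ H] conjI)
      show "continuous_on (ball \<zeta> e \<times> V') (\<lambda>(x,s). H x s)" using H(2) by (rule continuous_on_subset) (use assms in auto)
      show "\<forall>x\<in>ball \<zeta> e. H x holomorphic_on V'" using H(4) assms(3) holomorphic_on_subset by blast
    qed (use H assms(3) in auto)
  qed
qed

lemma analytic_family_mult: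
  assumes "analytic_family f V" "analytic_family g V"
  shows "analytic_family (\<lambda>\<xi> s. f \<xi> s * g \<xi> s) V"
proof -
  interpret f: analytic_family f V by fact
  interpret g: analytic_family g V by fact
  show ?thesis
  proof
    show "open V" by (rule f.open_V)
    show "continuous_on (torus \<times> V) (\<lambda>(\<xi>,s). f \<xi> s * g \<xi> s)"
      using f.cont g.cont unfolding split_def by (rule continuous_on_mult)
    show "(\<lambda>s. f \<xi> s * g \<xi> s) holomorphic_on V" if "\<xi> \<in> torus" for \<xi>
      using f.hol[OF that] g.hol[OF that] by (rule holomorphic_on_mult)
    fix \<xi> :: "nat \<Rightarrow> complex" and \<zeta> :: complex and j :: nat assume a: "\<xi> \<in> torus" "norm \<zeta> = 1"
    from f.ext[OF a, of j] obtain e H where H: "e > 0" "continuous_on (ball \<zeta> e \<times> V) (\<lambda>(x,s). H x s)"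
        "\<forall>s\<in>V. (\<lambda>x. H x s) holomorphic_on ball \<zeta> e" "\<forall>x\<in>ball \<zeta> e. H x holomorphic_on V"
        "\<forall>x\<in>ball \<zeta> e. norm x = 1 \<longrightarrow> (\<forall>s\<in>V. H x s = f (\<xi>(j := x)) s)" by blast
    from g.ext[OF a, of j] obtain e2 H2 where H2: "e2 > 0" "continuous_on (ball \<zeta> e2 \<times> V) (\<lambda>(x,s). H2 x s)"
        "\<forall>s\<in>V. (\<lambda>x. H2 x s) holomorphic_on ball \<zeta> e2" "\<forall>x\<in>ball \<zeta> e2. H2 x holomorphic_on V"
        "\<forall>x\<in>ball \<zeta> e2. norm x = 1 \<longrightarrow> (\<forall>s\<in>V. H2 x s = g (\<xi>(j := x)) s)" by blast
    have sb: "ball \<zeta> (min e e2) \<subseteq> ball \<zeta> e" "ball \<zeta> (min e e2) \<subseteq> ball \<zeta> e2" by auto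
    show "\<exists>e>0. \<exists>H. continuous_on (ball \<zeta> e \<times> V) (\<lambda>(x,s). H x s) \<and>
        (\<forall>s\<in>V. (\<lambda>x. H x s) holomorphic_on ball \<zeta> e) \<and> (\<forall>x\<in>ball \<zeta> e. H x holomorphic_on V) \<and>
        (\<forall>x\<in>ball \<zeta> e. norm x = 1 \<longrightarrow> (\<forall>s\<in>V. H x s = f (\<xi>(j := x)) s * g (\<xi>(j := x)) s))"
    proof (intro exI[of _ "min e e2"] exI[of _ "\<lambda>x s. H x s * H2 x s"] conjI)
      have "continuous_on (ball \<zeta> (min e e2) \<times> V) (\<lambda>(x,s). H x s)" "continuous_on (ball \<zeta> (min e e2) \<times> V) (\<lambda>(x,s). H2 x s)"
        using continuous_on_subset[OF H(2)] continuous_on_subset[OF H2(2)] sb by (auto simp: subset_iff)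
      thus "continuous_on (ball \<zeta> (min e e2) \<times> V) (\<lambda>(x,s). H x s * H2 x s)"
        unfolding split_def by (rule continuous_on_mult)
      show "\<forall>s\<in>V. (\<lambda>x. H x s * H2 x s) holomorphic_on ball \<zeta> (min e e2)"
      proof
        fix s assume s: "s \<in> V"
        have "(\<lambda>x. H x s) holomorphic_on ball \<zeta> (min e e2)" using H(3) s sb(1) holomorphic_on_subset by blast
        moreover have "(\<lambda>x. H2 x s) holomorphic_on ball \<zeta> (min e e2)" using H2(3) s sb(2) holomorphic_on_subset by blast
        ultimately show "(\<lambda>x. H x s * H2 x s) holomorphic_on ball \<zeta> (min e e2)" by (rule holomorphic_on_mult)
      qed
      show "\<forall>x\<in>ball \<zeta> (min e e2). (\<lambda>s. H x s * H2 x s) holomorphic_on V"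
        using H(4) H2(4) by (auto intro!: holomorphic_on_mult)
    qed (use H H2 in auto)
  qed
qed

text \<open>The reflection \<open>s \<mapsto> 2 \<sigma> - cnj s\<close> of a family extends to complex \<open>\<xi> j\<close> because \<open>1 / cnj x = x\<close> on the unit circle.\<close>

lemma analytic_family_reflect:
  assumes f: "analytic_family f {s. Re s > \<theta>}"
  shows "analytic_family (\<lambda>\<xi> s. cnj (f \<xi> (of_real (2 * \<sigma>) - cnj s))) {s. Re s < 2 * \<sigma> - \<theta>}"
proof -
  define V where "V = {s. Re s > \<theta>}"
  define V' where "V' = {s. Re s < 2 * \<sigma> - \<theta>}"
  interpret f: analytic_family f V using f by (simp add: V_def)
  define \<rho> where "\<rho> = (\<lambda>s. of_real (2 * \<sigma>) - cnj s)"
  have \<rho>V: "\<rho> s \<in> V" if "s \<in> V'" for s using that by (simp add: \<rho>_def V_def V'_def)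
  have \<rho>c: "continuous_on A \<rho>" for A unfolding \<rho>_def by (intro continuous_intros)
  have opV': "open V'" unfolding V'_def by (rule open_halfspace_Re_lt)
  have cc: "(\<lambda>s. cnj (g (\<rho> s))) holomorphic_on V'" if g: "g holomorphic_on V" for g
  proof -
    have "(\<lambda>s. g (of_real (2 * \<sigma>) - s)) holomorphic_on cnj ` V'"
      by (rule holomorphic_on_compose_gen[OF _ g, unfolded o_def])
         (auto simp: V_def V'_def intro!: holomorphic_intros)
    from holomorphic_on_compose_cnj_cnj[OF this opV'] show ?thesis by (simp add: o_def \<rho>_def)
  qed
  have "analytic_family (\<lambda>\<xi> s. cnj (f \<xi> (\<rho> s))) V'"
  proof
    show "open V'" by (rule opV')
    have "continuous_on (torus \<times> V') (\<lambda>p. (\<lambda>(\<xi>,s). f \<xi> s) (fst p, \<rho> (snd p)))"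
      by (rule continuous_on_compose2[OF f.cont])
         (auto intro!: continuous_intros continuous_on_compose2[OF \<rho>c[of UNIV]] \<rho>V
             continuous_on_product_then_coordinatewise[OF continuous_on_fst[OF continuous_on_id]])
    thus "continuous_on (torus \<times> V') (\<lambda>(\<xi>,s). cnj (f \<xi> (\<rho> s)))"
      unfolding split_def fst_conv snd_conv by (intro continuous_intros)
    show "(\<lambda>s. cnj (f \<xi> (\<rho> s))) holomorphic_on V'" if "\<xi> \<in> torus" for \<xi> by (rule cc[OF f.hol[OF that]])
    fix \<xi> :: "nat \<Rightarrow> complex" and \<zeta> :: complex and j :: nat assume a: "\<xi> \<in> torus" "norm \<zeta> = 1"
    from f.ext[OF a, of j] obtain e H where H: "e > 0" "continuous_on (ball \<zeta> e \<times> V) (\<lambda>(x,s). H x s)"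
        "\<forall>s\<in>V. (\<lambda>x. H x s) holomorphic_on ball \<zeta> e" "\<forall>x\<in>ball \<zeta> e. H x holomorphic_on V"
        "\<forall>x\<in>ball \<zeta> e. norm x = 1 \<longrightarrow> (\<forall>s\<in>V. H x s = f (\<xi>(j := x)) s)" by blast
    have inv: "1 / cnj x = x" if "norm x = 1" for x :: complex
    proof -
      have "x * cnj x = 1" using that complex_norm_square[of x] by simp
      moreover have "cnj x \<noteq> 0" using that by auto
      ultimately show ?thesis by (simp add: divide_eq_eq)
    qed
    have "isCont (\<lambda>x. 1 / cnj x) \<zeta>" using a(2) by (intro continuous_intros) auto
    then obtain d where d: "d > 0" "\<And>x. dist x \<zeta> < d \<Longrightarrow> dist (1 / cnj x) (1 / cnj \<zeta>) < e"
      using H(1) unfolding continuous_at_eps_delta by blast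
    \<comment> \<open>The first entry keeps \<open>1 / cnj x\<close> in the given ball; the second
      excludes \<open>x = 0\<close>.\<close>
    define e' where "e' = min d (1/2)"
    have e': "e' > 0" using d by (simp add: e'_def)
    have nz: "x \<noteq> 0" if "x \<in> ball \<zeta> e'" for x using that a(2) by (auto simp: e'_def dist_norm)
    have im: "1 / cnj x \<in> ball \<zeta> e" if "x \<in> ball \<zeta> e'" for x
      using d(2)[of x] that inv[OF a(2)] by (simp add: e'_def dist_commute)
    show "\<exists>e>0. \<exists>H. continuous_on (ball \<zeta> e \<times> V') (\<lambda>(x,s). H x s) \<and>
        (\<forall>s\<in>V'. (\<lambda>x. H x s) holomorphic_on ball \<zeta> e) \<and> (\<forall>x\<in>ball \<zeta> e. H x holomorphic_on V') \<and>
        (\<forall>x\<in>ball \<zeta> e. norm x = 1 \<longrightarrow> (\<forall>s\<in>V'. H x s = cnj (f (\<xi>(j := x)) (\<rho> s))))"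
    proof (intro exI[of _ e'] exI[of _ "\<lambda>x s. cnj (H (1 / cnj x) (\<rho> s))"] conjI ballI impI e')
      have "continuous_on (ball \<zeta> e' \<times> V') (\<lambda>p. (\<lambda>(x,s). H x s) (1 / cnj (fst p), \<rho> (snd p)))"
      proof (rule continuous_on_compose2[OF H(2)])
        show "continuous_on (ball \<zeta> e' \<times> V') (\<lambda>p. (1 / cnj (fst p), \<rho> (snd p)))"
          using nz by (intro continuous_intros continuous_on_compose2[OF \<rho>c[of UNIV]]) auto
        show "(\<lambda>p. (1 / cnj (fst p), \<rho> (snd p))) ` (ball \<zeta> e' \<times> V') \<subseteq> ball \<zeta> e \<times> V"
          using im \<rho>V by (auto simp del: mem_ball)
      qed
      thus "continuous_on (ball \<zeta> e' \<times> V') (\<lambda>(x,s). cnj (H (1 / cnj x) (\<rho> s)))"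
        unfolding split_def fst_conv snd_conv by (intro continuous_intros)
      show "(\<lambda>x. cnj (H (1 / cnj x) (\<rho> s))) holomorphic_on ball \<zeta> e'" if s: "s \<in> V'" for s
      proof -
        have H3: "(\<lambda>x. H x (\<rho> s)) holomorphic_on ball \<zeta> e" using H(3) \<rho>V[OF s] by blast
        have "(\<lambda>y. H (1 / y) (\<rho> s)) holomorphic_on cnj ` ball \<zeta> e'"
          by (rule holomorphic_on_compose_gen[OF _ H3, unfolded o_def])
             (use nz im in \<open>auto simp del: mem_ball intro!: holomorphic_intros\<close>)
        from holomorphic_on_compose_cnj_cnj[OF this open_ball] show ?thesis by (simp add: o_def)
      qed
      show "(\<lambda>s. cnj (H (1 / cnj x) (\<rho> s))) holomorphic_on V'" if "x \<in> ball \<zeta> e'" for x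
        by (rule cc) (use H(4) im[OF that] in blast)
      show "cnj (H (1 / cnj x) (\<rho> s)) = cnj (f (\<xi>(j := x)) (\<rho> s))" if "x \<in> ball \<zeta> e'" "norm x = 1" "s \<in> V'" for x s
        using H(5) im[OF that(1)] that(2) \<rho>V[OF that(3)] inv[OF that(2)] by simp
    qed
  qed
  thus ?thesis by (simp add: V'_def \<rho>_def)
qed

text \<open>On \<open>Re s > \<theta>\<close> the coordinate \<open>prs s j\<close> has a factor
  \<open>pr j powr (- \<theta>/2)\<close> to spare, so its unimodular coefficient can be moved off
  the circle while the point stays in \<open>pdisc (\<theta>/2)\<close>.\<close>

lemma analytic_family_twist:
  assumes G: "G0 \<Phi> c" and th: "\<theta> > 0"
  shows "analytic_family (\<lambda>\<xi> s. twist c \<xi> s - w) {s. Re s > \<theta>}"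
proof
  show "open {s. Re s > \<theta>}" by (rule open_halfspace_Re_gt)
  have "continuous_on (torus \<times> {s. Re s > \<theta>}) (\<lambda>(\<xi>,s). twist c \<xi> s)"
    by (rule continuous_on_subset[OF continuous_twist_torus[OF G th]]) auto
  thus "continuous_on (torus \<times> {s. Re s > \<theta>}) (\<lambda>(\<xi>,s). twist c \<xi> s - w)"
    unfolding split_def by (intro continuous_intros)
  show "(\<lambda>s. twist c \<xi> s - w) holomorphic_on {s. Re s > \<theta>}" if "\<xi> \<in> torus" for \<xi>
    by (intro holomorphic_intros holomorphic_twist[OF G th] open_halfspace_Re_gt torus_prs_pdisc[OF that]) auto
  fix \<xi> :: "nat \<Rightarrow> complex" and \<zeta> :: complex and j :: nat assume a: "\<xi> \<in> torus" "norm \<zeta> = 1"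
  \<comment> \<open>All primes are at least 2, so this radius serves every coordinate
    \<open>j\<close>.\<close>
  define e where "e = 2 powr (\<theta>/2) - 1"
  have e: "e > 0" using th by (simp add: e_def)
  have th2: "\<theta>/2 > 0" using th by simp
  have xb: "norm x < real (pr j) powr (\<theta>/2)" if "x \<in> ball \<zeta> e" for x
  proof -
    have "norm x \<le> norm \<zeta> + dist \<zeta> x" using norm_triangle_ineq2[of x \<zeta>] by (simp add: dist_norm norm_minus_commute)
    also have "\<dots> < 2 powr (\<theta>/2)" using that a(2) by (simp add: e_def)
    also have "\<dots> \<le> real (pr j) powr (\<theta>/2)" using pr_ge_2[of j] th by (intro powr_mono2) auto
    finally show ?thesis .
  qed
  have xs: "norm (x * prs s j) < real (pr j) powr (- (\<theta>/2))" if "x \<in> ball \<zeta> e" "Re s > \<theta>" for x s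
  proof -
    have "norm (x * prs s j) = norm x * real (pr j) powr (- Re s)" by (simp add: norm_mult norm_prs)
    also have "\<dots> < real (pr j) powr (\<theta>/2) * real (pr j) powr (- Re s)"
      using xb[OF that(1)] by (intro mult_strict_right_mono) auto
    also have "\<dots> = real (pr j) powr (\<theta>/2 - Re s)" by (simp add: powr_add[symmetric])
    also have "\<dots> \<le> real (pr j) powr (- (\<theta>/2))" using that(2) pr_ge_2[of j] by (intro powr_mono) auto
    finally show ?thesis .
  qed
  have base: "(\<lambda>i. \<xi> i * prs s i) \<in> pdisc (\<theta>/2)" if "Re s > \<theta>" for s
    using that th by (intro torus_prs_pdisc[OF a(1)]) auto
  have pd: "(\<lambda>i. (\<xi>(j := x)) i * prs s i) \<in> pdisc (\<theta>/2)" if "x \<in> ball \<zeta> e" "Re s > \<theta>" for x s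
    using base[OF that(2)] xs[OF that] by (auto simp: pdisc_def)
  show "\<exists>e>0. \<exists>H. continuous_on (ball \<zeta> e \<times> {s. Re s > \<theta>}) (\<lambda>(x,s). H x s) \<and>
      (\<forall>s\<in>{s. Re s > \<theta>}. (\<lambda>x. H x s) holomorphic_on ball \<zeta> e) \<and> (\<forall>x\<in>ball \<zeta> e. H x holomorphic_on {s. Re s > \<theta>}) \<and>
      (\<forall>x\<in>ball \<zeta> e. norm x = 1 \<longrightarrow> (\<forall>s\<in>{s. Re s > \<theta>}. H x s = twist c (\<xi>(j := x)) s - w))"
  proof (intro exI[of _ e] exI[of _ "\<lambda>x s. twist c (\<xi>(j := x)) s - w"] conjI ballI e)
    have "continuous_on (ball \<zeta> e \<times> {s. Re s > \<theta>}) (\<lambda>p. twist c (\<xi>(j := fst p)) (snd p))"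
    proof (rule continuous_twist[OF G th2])
      show "continuous_on (ball \<zeta> e \<times> {s. Re s > \<theta>}) (\<lambda>p. (\<xi>(j := fst p)) i)" for i
        by (cases "i = j") (auto intro!: continuous_intros)
    qed (use pd in \<open>auto intro!: continuous_intros\<close>)
    thus "continuous_on (ball \<zeta> e \<times> {s. Re s > \<theta>}) (\<lambda>(x,s). twist c (\<xi>(j := x)) s - w)"
      unfolding split_def by (intro continuous_intros)
    show "(\<lambda>s. twist c (\<xi>(j := x)) s - w) holomorphic_on {s. Re s > \<theta>}" if "x \<in> ball \<zeta> e" for x
      by (intro holomorphic_intros holomorphic_twist[OF G th2] open_halfspace_Re_gt pd[OF that]) auto
    fix s assume "s \<in> {s. Re s > \<theta>}"
    hence s: "Re s > \<theta>" by simp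
    have eq: "twist c (\<xi>(j := x)) s = bohr c ((\<lambda>i. \<xi> i * prs s i)(j := x * prs s j))" for x
      unfolding twist_def by (rule arg_cong[where f = "bohr c"]) auto
    have "(\<lambda>x. bohr c ((\<lambda>i. \<xi> i * prs s i)(j := x * prs s j))) holomorphic_on ball \<zeta> e"
      by (rule holomorphic_on_compose_gen[OF _ holomorphic_bohr_upd[OF G th2 base[OF s]], unfolded o_def])
         (use xs s in \<open>auto intro!: holomorphic_intros\<close>)
    thus "(\<lambda>x. twist c (\<xi>(j := x)) s - w) holomorphic_on ball \<zeta> e"
      unfolding eq by (intro holomorphic_intros)
  qed auto
qed

section \<open>The mean counting function as a time average\<close>

text \<open>Smoothing kernel for the ordinate. It is continuous, so zeros enter and leave the window
  \<open>\<bar>Im s\<bar> < 1\<close> without a jump, and its translates have integral 1, so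
  integration over time counts each zero once.\<close>

definition tent :: "real \<Rightarrow> real" where "tent t = max 0 (1 - \<bar>t\<bar>)"

definition zero_weight :: "real \<Rightarrow> complex \<Rightarrow> real" where
  "zero_weight \<sigma> s = (if Re s > \<sigma> then Re s * tent (Im s) else 0)"

definition zero_count :: "(nat \<Rightarrow> complex) \<Rightarrow> complex \<Rightarrow> real \<Rightarrow> (nat \<Rightarrow> complex) \<Rightarrow> real" where
  "zero_count c w \<sigma> \<xi> = (\<Sum>s\<in>{s. Re s > \<sigma> \<and> \<bar>Im s\<bar> < 1 \<and> twist c \<xi> s = w}. zero_weight \<sigma> s)"

lemma isCont_zero_weight:
  assumes "Re p \<noteq> \<sigma>" shows "isCont (zero_weight \<sigma>) p"
proof (cases "Re p > \<sigma>")
  case True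
  have "\<forall>\<^sub>F s in nhds p. Re s > \<sigma>"
    using True by (intro eventually_nhds_in_open[of "{s. Re s > \<sigma>}", simplified] open_halfspace_Re_gt) 
  hence ev: "\<forall>\<^sub>F s in nhds p. zero_weight \<sigma> s = Re s * tent (Im s)" by eventually_elim (simp add: zero_weight_def)
  have "isCont (\<lambda>s. Re s * tent (Im s)) p" unfolding tent_def by (intro continuous_intros linear_continuous_at bounded_linear_Re bounded_linear_Im)
  thus ?thesis by (simp add: isCont_cong[OF ev])
next
  case False
  hence "Re p < \<sigma>" using assms by auto
  hence "\<forall>\<^sub>F s in nhds p. Re s < \<sigma>"
    by (intro eventually_nhds_in_open[of "{s. Re s < \<sigma>}", simplified] open_halfspace_Re_lt) 
  hence ev: "\<forall>\<^sub>F s in nhds p. zero_weight \<sigma> s = 0" by eventually_elim (simp add: zero_weight_def)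
  have "isCont (\<lambda>s. 0 :: real) p" by simp
  thus ?thesis by (simp add: isCont_cong[OF ev])
qed

text \<open>Around a zero on the line \<open>Re s = \<sigma>\<close> the auxiliary family is \<open>f\<close> times its reflection, otherwise it is \<open>f\<close>.\<close>

lemma local_family:
  assumes G: "G0 \<Phi> c" and \<sigma>: "\<sigma> > 0" and x: "\<xi>0 \<in> torus" and s0: "Re s0 \<ge> \<sigma>"
    and r1: "r1 > 0" "\<forall>s\<in>cball s0 r1. s \<noteq> s0 \<longrightarrow> Re s > \<sigma> / 2 \<longrightarrow> twist c \<xi>0 s \<noteq> w"
  obtains r0 h V where "r0 > 0" "analytic_family h V" "analytic_family (\<lambda>\<xi> s. twist c \<xi> s - w) V" "cball s0 r0 \<subseteq> V"
    "V \<subseteq> {s. Re s > \<sigma> / 2}"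
    "\<And>r s. 0 < r \<Longrightarrow> r \<le> r0 \<Longrightarrow> s \<in> sphere s0 r \<Longrightarrow> h \<xi>0 s \<noteq> 0"
    "\<And>\<xi> s. twist c \<xi> s - w = 0 \<Longrightarrow> h \<xi> s = 0"
    "(\<forall>p\<in>ball s0 r0. Re p \<noteq> \<sigma>) \<or> Re s0 = \<sigma> \<and> (\<forall>\<xi> p. h \<xi> p = 0 \<longrightarrow> h \<xi> (of_real (2 * \<sigma>) - cnj p) = 0)"
proof -
  define f where "f = (\<lambda>\<xi> s. twist c \<xi> s - w)"
  have s2: "\<sigma> / 2 > 0" using \<sigma> by simp
  have fam: "analytic_family f {s. Re s > \<sigma>/2}" unfolding f_def by (rule analytic_family_twist[OF G s2])
  have Re_near: "\<bar>Re s - Re s0\<bar> \<le> r" if "s \<in> cball s0 r" for s r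
    using that abs_Re_le_cmod[of "s - s0"] by (simp add: dist_norm norm_minus_commute)
  show ?thesis
  proof (cases "Re s0 = \<sigma>")
    case False
    define r0 where "r0 = min r1 ((Re s0 - \<sigma>) / 2)"
    have "Re s0 > \<sigma>" using False s0 by simp
    moreover have "r0 \<le> (Re s0 - \<sigma>) / 2" unfolding r0_def by (rule min.cobounded2)
    ultimately have r0: "r0 > 0" "r0 \<le> r1" "r0 < Re s0 - \<sigma>" using r1(1) by (simp_all add: r0_def)
    show ?thesis
    proof (rule that[OF r0(1) fam fam[unfolded f_def]])
      show "cball s0 r0 \<subseteq> {s. Re s > \<sigma>/2}" using Re_near[of _ r0] r0 \<sigma> by fastforce
      show "f \<xi>0 s \<noteq> 0" if "0 < r" "r \<le> r0" "s \<in> sphere s0 r" for r s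
      proof -
        have "s \<in> cball s0 r1" "s \<noteq> s0" using that r0 by auto
        moreover have "Re s > \<sigma>/2" using Re_near[of s r] that r0 \<sigma> by auto
        ultimately show ?thesis using r1(2) by (simp add: f_def)
      qed
      have "Re p \<noteq> \<sigma>" if "p \<in> ball s0 r0" for p using Re_near[of p r0] that r0 by auto
      hence "\<forall>p\<in>ball s0 r0. Re p \<noteq> \<sigma>" by blast
      thus "(\<forall>p\<in>ball s0 r0. Re p \<noteq> \<sigma>) \<or> Re s0 = \<sigma> \<and> (\<forall>\<xi> p. f \<xi> p = 0 \<longrightarrow> f \<xi> (of_real (2 * \<sigma>) - cnj p) = 0)" ..
    qed (auto simp: f_def)
  next
    case True
    define h where "h = (\<lambda>\<xi> s. f \<xi> s * cnj (f \<xi> (of_real (2 * \<sigma>) - cnj s)))"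
    define V where "V = {s. Re s > \<sigma>/2} \<inter> {s. Re s < 2 * \<sigma> - \<sigma>/2}"
    have opV: "open V" unfolding V_def by (intro open_Int open_halfspace_Re_gt open_halfspace_Re_lt)
    have fV: "analytic_family f V" by (rule analytic_family_subset[OF fam opV]) (auto simp: V_def)
    have hV: "analytic_family h V"
      unfolding h_def
      by (intro analytic_family_mult fV analytic_family_subset[OF analytic_family_reflect[OF fam] opV]) (auto simp: V_def)
    \<comment> \<open>A quarter of \<open>\<sigma>\<close> keeps the disc inside the strip
      \<open>V\<close> around the line, where both \<open>f\<close> and its reflection are
      defined.\<close>
    define r0 where "r0 = min r1 (\<sigma> / 4)"
    have r0: "r0 > 0" "r0 \<le> r1" "r0 \<le> \<sigma> / 4" using \<sigma> r1 by (auto simp: r0_def)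
    have inv: "of_real (2 * \<sigma>) - cnj (of_real (2 * \<sigma>) - cnj s) = s" for s by (simp add: complex_eq_iff)
    show ?thesis
    proof (rule that[OF r0(1) hV fV[unfolded f_def]])
      show "cball s0 r0 \<subseteq> V" using Re_near[of _ r0] r0 \<sigma> True by (fastforce simp: V_def)
      show "h \<xi>0 s \<noteq> 0" if s: "0 < r" "r \<le> r0" "s \<in> sphere s0 r" for r s
      proof -
        have *: "f \<xi>0 t \<noteq> 0" if "t \<in> sphere s0 r" for t
        proof -
          have "t \<in> cball s0 r1" "t \<noteq> s0" using that s r0 by auto
          moreover have "Re t > \<sigma>/2" using Re_near[of t r] that s r0 \<sigma> True by auto
          ultimately show ?thesis using r1(2) by (simp add: f_def)
        qed
        have "s0 - (of_real (2 * \<sigma>) - cnj s) = - cnj (s0 - s)" using True by (simp add: complex_eq_iff)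
        hence "of_real (2 * \<sigma>) - cnj s \<in> sphere s0 r" using s(3) by (simp add: dist_norm del: complex_cnj_diff)
        thus ?thesis using *[OF s(3)] * by (simp add: h_def)
      qed
      have "h \<xi> p = 0 \<longrightarrow> h \<xi> (of_real (2 * \<sigma>) - cnj p) = 0" for \<xi> p
        unfolding h_def inv by auto
      thus "(\<forall>p\<in>ball s0 r0. Re p \<noteq> \<sigma>) \<or> Re s0 = \<sigma> \<and> (\<forall>\<xi> p. h \<xi> p = 0 \<longrightarrow> h \<xi> (of_real (2 * \<sigma>) - cnj p) = 0)"
        using True by blast
    qed (auto simp: V_def h_def f_def)
  qed
qed

text \<open>By the identity theorem an accumulation point would force the value \<open>w\<close> on
  the whole half plane, against the limit \<open>c 1 \<noteq> w\<close> at infinity.\<close>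

lemma twist_zeros_isolated:
  assumes G: "G0 \<Phi> c" and w: "w \<noteq> c 1" and th: "\<theta> > 0" and x: "\<xi> \<in> torus" and s: "Re s > \<theta>"
  shows "\<not> s islimpt {s. Re s > \<theta> \<and> twist c \<xi> s = w}"
proof
  assume l: "s islimpt {s. Re s > \<theta> \<and> twist c \<xi> s = w}"
  obtain b where b: "b > 0" "\<And>\<xi> s. \<xi> \<in> torus \<Longrightarrow> Re s \<ge> b \<Longrightarrow> norm (twist c \<xi> s - c 1) < norm (w - c 1)"
    using twist_near_infinity[OF G, of "norm (w - c 1)"] w by auto
  have "analytic_family (\<lambda>\<xi> s. twist c \<xi> s - w) {s. Re s > \<theta>}" by (rule analytic_family_twist[OF G th])
  hence hol: "(\<lambda>s. twist c \<xi> s - w) holomorphic_on {s. Re s > \<theta>}" using x by (rule analytic_family.hol)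
  have "twist c \<xi> (of_real (b + \<theta>)) - w = 0"
    by (rule analytic_continuation[OF hol, of "{s. Re s > \<theta> \<and> twist c \<xi> s = w}" s])
       (use l s b th in \<open>auto simp: open_halfspace_Re_gt intro!: convex_connected convex_halfspace_Re_gt\<close>)
  moreover have "norm (twist c \<xi> (of_real (b + \<theta>)) - c 1) < norm (w - c 1)" by (rule b(2)[OF x]) (use th in simp)
  ultimately show False by simp
qed

lemma finite_twist_zeros:
  assumes G: "G0 \<Phi> c" and w: "w \<noteq> c 1" and th: "\<theta> > 0" and x: "\<xi> \<in> torus" and K: "compact K" "K \<subseteq> {s. Re s > \<theta>}"
  shows "finite {s \<in> K. twist c \<xi> s = w}"
proof -
  have "finite (K \<inter> {s. Re s > \<theta> \<and> twist c \<xi> s = w})"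
    by (rule finite_not_islimpt_in_compact[OF K(1) twist_zeros_isolated[OF G w th x]]) (use K in auto)
  thus ?thesis by (rule rev_finite_subset) (use K in auto)
qed

text \<open>A compact rectangle contains every zero that can count. It consists of discs around its
  finitely many zeros for \<open>\<xi>0\<close>, to which local families and generic counts apply,
  and of a compact remainder that stays free of zeros near \<open>\<xi>0\<close>.\<close>

lemma zero_count_local:
  assumes G: "G0 \<Phi> c" and \<sigma>: "\<sigma> > 0" and w: "w \<noteq> c 1" and x0: "\<xi>0 \<in> torus"
  shows "\<exists>U N B. open U \<and> \<xi>0 \<in> U \<and> N \<in> null_sets haar \<and> (\<forall>\<xi>\<in>U \<inter> torus. \<bar>zero_count c w \<sigma> \<xi>\<bar> \<le> B) \<and>
    (\<forall>\<xi>\<in>U \<inter> torus - N. continuous (at \<xi> within torus) (zero_count c w \<sigma>))"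
proof -
  obtain b0 where b0: "b0 > 0" "\<And>\<xi> s. \<xi> \<in> torus \<Longrightarrow> Re s \<ge> b0 \<Longrightarrow> norm (twist c \<xi> s - c 1) < norm (w - c 1)"
    using twist_near_infinity[OF G, of "norm (w - c 1)"] w by auto
  define b where "b = max b0 \<sigma>"
  have b: "b > 0" "b \<ge> \<sigma>" and nob: "\<And>\<xi> s. \<xi> \<in> torus \<Longrightarrow> twist c \<xi> s = w \<Longrightarrow> Re s < b"
    using b0 by (force simp: b_def not_le[symmetric])+
  have s2: "\<sigma> / 2 > 0" using \<sigma> by simp
  define K where "K = cbox (Complex \<sigma> (-1)) (Complex b 1)"
  have K: "compact K" unfolding K_def by (rule compact_cbox)
  have Kiff: "s \<in> K \<longleftrightarrow> \<sigma> \<le> Re s \<and> Re s \<le> b \<and> \<bar>Im s\<bar> \<le> 1" for s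
    by (auto simp: K_def in_cbox_complex_iff)
  have KV: "K \<subseteq> {s. Re s > \<sigma> / 2}" using \<sigma> by (auto simp: Kiff)
  define Z0 where "Z0 = {s \<in> K. twist c \<xi>0 s = w}"
  have finZ0: "finite Z0" unfolding Z0_def by (rule finite_twist_zeros[OF G w s2 x0 K KV])
  obtain d where d: "d > 0" "\<And>p q. p \<in> Z0 \<Longrightarrow> q \<in> Z0 \<Longrightarrow> p \<noteq> q \<Longrightarrow> cball p d \<inter> cball q d = {}"
    using separation_radius[OF finZ0 open_UNIV] by auto
  have ex: "\<exists>r h V U N R. 0 < r \<and> r \<le> d \<and> analytic_family h V \<and> analytic_family (\<lambda>\<xi> s. twist c \<xi> s - w) V \<and> cball p r \<subseteq> V \<and> V \<subseteq> {s. Re s > \<sigma> / 2} \<and>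
     open U \<and> \<xi>0 \<in> U \<and> N \<in> null_sets haar \<and> (\<forall>\<xi>\<in>U \<inter> torus. \<forall>s\<in>sphere p r. h \<xi> s \<noteq> 0) \<and>
     (\<forall>\<xi>\<in>U \<inter> torus. card {s \<in> ball p r. h \<xi> s = 0} \<le> R) \<and> (\<forall>\<xi>\<in>U \<inter> torus - N. card {s \<in> ball p r. h \<xi> s = 0} = R) \<and>
     (\<forall>\<xi> s. twist c \<xi> s - w = 0 \<longrightarrow> h \<xi> s = 0) \<and>
     ((\<forall>q\<in>ball p r. Re q \<noteq> \<sigma>) \<or> Re p = \<sigma> \<and> (\<forall>\<xi>\<in>torus. \<forall>q\<in>ball p r. h \<xi> q = 0 \<longrightarrow> h \<xi> (of_real (2 * \<sigma>) - cnj q) = 0))"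
    if p: "p \<in> Z0" for p
  proof -
    have pK: "p \<in> K" and pw: "twist c \<xi>0 p = w" using p by (auto simp: Z0_def)
    have "\<not> p islimpt {s. Re s > \<sigma> / 2 \<and> twist c \<xi>0 s = w}"
      by (rule twist_zeros_isolated[OF G w s2 x0]) (use pK KV in auto)
    then obtain e where e: "e > 0" "\<And>s. Re s > \<sigma> / 2 \<Longrightarrow> twist c \<xi>0 s = w \<Longrightarrow> s \<noteq> p \<Longrightarrow> \<not> dist s p < e"
      unfolding islimpt_approachable by blast
    have "e / 2 > 0" using e by simp
    have iso: "\<forall>s\<in>cball p (e/2). s \<noteq> p \<longrightarrow> Re s > \<sigma>/2 \<longrightarrow> twist c \<xi>0 s \<noteq> w"
      using e(2) e(1) by (fastforce simp: dist_commute)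
    have "Re p \<ge> \<sigma>" using pK by (simp add: Kiff)
    obtain r0 h V where r0: "r0 > 0" "analytic_family h V" "analytic_family (\<lambda>\<xi> s. twist c \<xi> s - w) V" "cball p r0 \<subseteq> V"
      "V \<subseteq> {s. Re s > \<sigma> / 2}" "\<And>r s. 0 < r \<Longrightarrow> r \<le> r0 \<Longrightarrow> s \<in> sphere p r \<Longrightarrow> h \<xi>0 s \<noteq> 0"
      "\<And>\<xi> s. twist c \<xi> s - w = 0 \<Longrightarrow> h \<xi> s = 0"
      "(\<forall>q\<in>ball p r0. Re q \<noteq> \<sigma>) \<or> Re p = \<sigma> \<and> (\<forall>\<xi> q. h \<xi> q = 0 \<longrightarrow> h \<xi> (of_real (2 * \<sigma>) - cnj q) = 0)"
      by (rule local_family[OF G \<sigma> x0 \<open>Re p \<ge> \<sigma>\<close> \<open>e / 2 > 0\<close> iso], rule that)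
    define r where "r = min r0 d"
    have r: "0 < r" "r \<le> r0" "r \<le> d" using r0(1) d(1) by (auto simp: r_def)
    have cr: "cball p r \<subseteq> V" using r0(4) r(2) by auto
    obtain U N R where U: "open U" "\<xi>0 \<in> U" "N \<in> null_sets haar"
      "\<And>\<xi> s. \<xi> \<in> U \<inter> torus \<Longrightarrow> s \<in> sphere p r \<Longrightarrow> h \<xi> s \<noteq> 0"
      "\<And>\<xi>. \<xi> \<in> U \<inter> torus \<Longrightarrow> card {s \<in> ball p r. h \<xi> s = 0} \<le> R"
      "\<And>\<xi>. \<xi> \<in> U \<inter> torus - N \<Longrightarrow> card {s \<in> ball p r. h \<xi> s = 0} = R"
      by (rule analytic_family.generic_zeros[OF r0(2) x0 cr r(1)], rule r0(6)[OF r(1,2)], assumption, rule that)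
    have sy: "(\<forall>q\<in>ball p r. Re q \<noteq> \<sigma>) \<or> Re p = \<sigma> \<and> (\<forall>\<xi>\<in>torus. \<forall>q\<in>ball p r. h \<xi> q = 0 \<longrightarrow> h \<xi> (of_real (2 * \<sigma>) - cnj q) = 0)"
      using r0(8) r(2) by auto
    show ?thesis
      by (rule exI[of _ r], rule exI[of _ h], rule exI[of _ V], rule exI[of _ U], rule exI[of _ N], rule exI[of _ R])
         (intro conjI r r0 cr U sy ballI allI impI; (fact | use U(4,5,6) r0(7) in blast))
  qed
  define Q where "Q = (\<lambda>p (r,h,V,U,N,R). 0 < r \<and> r \<le> d \<and> analytic_family h V \<and> analytic_family (\<lambda>\<xi> s. twist c \<xi> s - w) V \<and> cball p r \<subseteq> V \<and> V \<subseteq> {s. Re s > \<sigma> / 2} \<and>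
     open U \<and> \<xi>0 \<in> U \<and> N \<in> null_sets haar \<and> (\<forall>\<xi>\<in>U \<inter> torus. \<forall>s\<in>sphere p r. h \<xi> s \<noteq> 0) \<and>
     (\<forall>\<xi>\<in>U \<inter> torus. card {s \<in> ball p r. h \<xi> s = 0} \<le> R) \<and> (\<forall>\<xi>\<in>U \<inter> torus - N. card {s \<in> ball p r. h \<xi> s = 0} = R) \<and>
     (\<forall>\<xi> s. twist c \<xi> s - w = 0 \<longrightarrow> h \<xi> s = 0) \<and>
     ((\<forall>q\<in>ball p r. Re q \<noteq> \<sigma>) \<or> Re p = \<sigma> \<and> (\<forall>\<xi>\<in>torus. \<forall>q\<in>ball p r. h \<xi> q = 0 \<longrightarrow> h \<xi> (of_real (2 * \<sigma>) - cnj q) = 0)))"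
  have "\<forall>p\<in>Z0. \<exists>y. Q p y"
  proof
    fix p assume "p \<in> Z0"
    from ex[OF this] obtain r h V U N R where "Q p (r,h,V,U,N,R)" unfolding Q_def prod.case by (elim exE)
    thus "\<exists>y. Q p y" ..
  qed
  from bchoice[OF this] obtain y where y: "\<forall>p\<in>Z0. Q p (y p)" ..
  define r h V U N R where "r = (\<lambda>p. fst (y p))" and "h = (\<lambda>p. fst (snd (y p)))" and "V = (\<lambda>p. fst (snd (snd (y p))))"
    and "U = (\<lambda>p. fst (snd (snd (snd (y p)))))" and "N = (\<lambda>p. fst (snd (snd (snd (snd (y p))))))" and "R = (\<lambda>p. snd (snd (snd (snd (snd (y p))))))"
  have "\<forall>p\<in>Z0. Q p (r p, h p, V p, U p, N p, R p)" using y by (simp add: r_def h_def V_def U_def N_def R_def)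
  note Qp = bspec[OF this, unfolded Q_def prod.case]
  define K' where "K' = K - (\<Union>p\<in>Z0. ball p (r p))"
  have K': "compact K'" unfolding K'_def by (intro compact_diff K open_UN ballI open_ball)
  have K'V: "K' \<subseteq> {s. Re s > \<sigma> / 2}" using KV by (auto simp: K'_def)
  have "twist c \<xi>0 s - w \<noteq> 0" if s: "s \<in> K'" for s
  proof
    assume "twist c \<xi>0 s - w = 0"
    hence "s \<in> Z0" using s by (auto simp: Z0_def K'_def)
    moreover have "s \<in> ball s (r s)" using Qp[OF \<open>s \<in> Z0\<close>] by simp
    ultimately show False using s by (auto simp: K'_def simp del: mem_ball)
  qed
  then obtain U' where U': "open U'" "\<xi>0 \<in> U'" "\<And>\<xi> s. \<xi> \<in> U' \<inter> torus \<Longrightarrow> s \<in> K' \<Longrightarrow> twist c \<xi> s - w \<noteq> 0"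
    using analytic_family.nonzero_stable[OF analytic_family_twist[OF G s2, of w] x0 K' K'V] by blast
  define UU where "UU = U' \<inter> (\<Inter>p\<in>Z0. U p)"
  define NN where "NN = (\<Union>p\<in>Z0. N p)"
  have opUU: "open UU" unfolding UU_def using U'(1) finZ0 Qp by (intro open_Int open_INT) auto
  have xUU: "\<xi>0 \<in> UU" unfolding UU_def using U'(2) Qp by auto
  have NN: "NN \<in> null_sets haar" unfolding NN_def using finZ0 Qp by (intro null_sets_UN' countable_finite) auto
  define S where "S = (\<lambda>p \<xi>. {s \<in> ball p (r p). twist c \<xi> s - w = 0})"
  have Sh: "S p \<xi> \<subseteq> {s \<in> ball p (r p). h p \<xi> s = 0}" if "p \<in> Z0" for p \<xi> using Qp[OF that] by (auto simp: S_def)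
  have hfin: "finite {s \<in> ball p (r p). h p \<xi> s = 0}" if "p \<in> Z0" "\<xi> \<in> UU \<inter> torus" for p \<xi>
  proof (rule analytic_family.zeros_finite)
    show "analytic_family (h p) (V p)" "cball p (r p) \<subseteq> V p" "0 < r p" using Qp[OF that(1)] by auto
    show "\<xi> \<in> torus" using that by simp
    show "h p \<xi> s \<noteq> 0" if "s \<in> sphere p (r p)" for s using Qp[OF \<open>p \<in> Z0\<close>] \<open>\<xi> \<in> UU \<inter> torus\<close> that \<open>p \<in> Z0\<close> by (auto simp: UU_def)
  qed
  have Sfin: "finite (S p \<xi>)" if "p \<in> Z0" "\<xi> \<in> UU \<inter> torus" for p \<xi> by (rule finite_subset[OF Sh[OF that(1)] hfin[OF that]])
  have eq: "zero_count c w \<sigma> \<xi> = (\<Sum>p\<in>Z0. \<Sum>s\<in>S p \<xi>. zero_weight \<sigma> s)" if x: "\<xi> \<in> UU \<inter> torus" for \<xi>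
  proof -
    have "zero_count c w \<sigma> \<xi> = (\<Sum>s\<in>(\<Union>p\<in>Z0. S p \<xi>). zero_weight \<sigma> s)"
      unfolding zero_count_def
    proof (rule sum.mono_neutral_left)
      show "finite (\<Union>p\<in>Z0. S p \<xi>)" using finZ0 Sfin x by blast
      show "{s. \<sigma> < Re s \<and> \<bar>Im s\<bar> < 1 \<and> twist c \<xi> s = w} \<subseteq> (\<Union>p\<in>Z0. S p \<xi>)"
      proof
        fix s assume "s \<in> {s. \<sigma> < Re s \<and> \<bar>Im s\<bar> < 1 \<and> twist c \<xi> s = w}"
        hence s: "\<sigma> < Re s" "\<bar>Im s\<bar> < 1" "twist c \<xi> s = w" by auto
        have "s \<in> K" using s nob[of \<xi> s] x by (simp add: Kiff)
        moreover have "s \<notin> K'" using U'(3)[of \<xi> s] s x by (auto simp: UU_def)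
        ultimately show "s \<in> (\<Union>p\<in>Z0. S p \<xi>)" using s by (auto simp: K'_def S_def)
      qed
      \<comment> \<open>The discs may reach beyond the window or across the line
        \<open>Re s = \<sigma>\<close>; zeros there have weight 0.\<close>
      show "\<forall>s\<in>(\<Union>p\<in>Z0. S p \<xi>) - {s. \<sigma> < Re s \<and> \<bar>Im s\<bar> < 1 \<and> twist c \<xi> s = w}. zero_weight \<sigma> s = 0"
        by (auto simp: S_def zero_weight_def tent_def)
    qed
    also have "\<dots> = (\<Sum>p\<in>Z0. \<Sum>s\<in>S p \<xi>. zero_weight \<sigma> s)"
    proof (rule sum.UNION_disjoint[OF finZ0])
      show "\<forall>p\<in>Z0. finite (S p \<xi>)" using Sfin x by blast
      show "\<forall>p\<in>Z0. \<forall>q\<in>Z0. p \<noteq> q \<longrightarrow> S p \<xi> \<inter> S q \<xi> = {}"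
      proof (intro ballI impI)
        fix p q assume pq: "p \<in> Z0" "q \<in> Z0" "p \<noteq> q"
        have "S p \<xi> \<subseteq> cball p d" "S q \<xi> \<subseteq> cball q d" using Qp[OF pq(1)] Qp[OF pq(2)] by (auto simp: S_def)
        thus "S p \<xi> \<inter> S q \<xi> = {}" using d(2)[OF pq] by blast
      qed
    qed
    finally show ?thesis .
  qed
  have bound: "\<bar>zero_count c w \<sigma> \<xi>\<bar> \<le> (\<Sum>p\<in>Z0. real (R p) * b)" if x: "\<xi> \<in> UU \<inter> torus" for \<xi>
  proof -
    have "\<bar>\<Sum>s\<in>S p \<xi>. zero_weight \<sigma> s\<bar> \<le> real (R p) * b" if p: "p \<in> Z0" for p
    proof -
      have "\<bar>\<Sum>s\<in>S p \<xi>. zero_weight \<sigma> s\<bar> \<le> (\<Sum>s\<in>S p \<xi>. b)"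
      proof (rule order_trans[OF sum_abs sum_mono])
        fix s assume s: "s \<in> S p \<xi>"
        have "Re s < b" using nob[of \<xi> s] s x by (auto simp: S_def)
        moreover have "tent (Im s) \<le> 1" "tent (Im s) \<ge> 0" by (auto simp: tent_def)
        ultimately show "\<bar>zero_weight \<sigma> s\<bar> \<le> b"
          using \<sigma> b mult_mono[of "Re s" b "tent (Im s)" 1] by (auto simp: zero_weight_def abs_mult)
      qed
      also have "\<dots> = real (card (S p \<xi>)) * b" by simp
      also have "card (S p \<xi>) \<le> card {s \<in> ball p (r p). h p \<xi> s = 0}" by (rule card_mono[OF hfin[OF p x] Sh[OF p]])
      also have "\<dots> \<le> R p" using Qp[OF p] x p by (auto simp: UU_def)
      finally show ?thesis using b by simp
    qed
    thus ?thesis unfolding eq[OF x] by (rule order_trans[OF sum_abs sum_mono])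
  qed
  have cont: "continuous (at \<xi>1 within torus) (zero_count c w \<sigma>)" if x: "\<xi>1 \<in> UU \<inter> torus - NN" for \<xi>1
  proof -
    have "continuous (at \<xi>1 within torus) (\<lambda>\<xi>. \<Sum>s\<in>S p \<xi>. zero_weight \<sigma> s)" if p: "p \<in> Z0" for p
      unfolding S_def
    proof (rule zero_sum_continuous[where V = "V p" and h = "h p" and U = "U p" and R = "R p" and \<sigma> = \<sigma>])
      note q = Qp[OF p]
      show "analytic_family (h p) (V p)" "analytic_family (\<lambda>\<xi> s. twist c \<xi> s - w) (V p)" "cball p (r p) \<subseteq> V p" "0 < r p" "open (U p)"
        using q by auto
      show "h p \<xi> s = 0" if "twist c \<xi> s - w = 0" for \<xi> s using q that by blast
      show "\<xi>1 \<in> torus" "\<xi>1 \<in> U p" using x p by (auto simp: UU_def)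
      show "h p \<xi> s \<noteq> 0" if "\<xi> \<in> U p \<inter> torus" "s \<in> sphere p (r p)" for \<xi> s using q that by blast
      show "card {s \<in> ball p (r p). h p \<xi> s = 0} \<le> R p" if "\<xi> \<in> U p \<inter> torus" for \<xi> using q that by blast
      have "\<xi>1 \<in> U p \<inter> torus - N p" using x p by (auto simp: UU_def NN_def)
      thus "card {s \<in> ball p (r p). h p \<xi>1 s = 0} = R p" using q by blast
      show "(\<forall>q\<in>ball p (r p). Re q \<noteq> \<sigma>) \<or> Re p = \<sigma> \<and> (\<forall>\<xi>\<in>torus. \<forall>q\<in>ball p (r p). h p \<xi> q = 0 \<longrightarrow> h p \<xi> (of_real (2 * \<sigma>) - cnj q) = 0)"
        using q by blast
      show "isCont (zero_weight \<sigma>) s" if "Re s \<noteq> \<sigma>" for s using that by (rule isCont_zero_weight)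
      show "zero_weight \<sigma> s = 0" if "Re s = \<sigma>" for s using that by (simp add: zero_weight_def)
    qed
    hence "((\<lambda>\<xi>. \<Sum>p\<in>Z0. \<Sum>s\<in>S p \<xi>. zero_weight \<sigma> s) \<longlongrightarrow> (\<Sum>p\<in>Z0. \<Sum>s\<in>S p \<xi>1. zero_weight \<sigma> s)) (at \<xi>1 within torus)"
      by (intro tendsto_sum) (simp add: continuous_within)
    moreover have "\<forall>\<^sub>F \<xi> in at \<xi>1 within torus. (\<Sum>p\<in>Z0. \<Sum>s\<in>S p \<xi>. zero_weight \<sigma> s) = zero_count c w \<sigma> \<xi>"
    proof -
      have "\<xi>1 \<in> UU" using x by blast
      from eventually_at_torus[OF opUU this] show ?thesis by eventually_elim (simp add: eq)
    qed
    ultimately have "(zero_count c w \<sigma> \<longlongrightarrow> (\<Sum>p\<in>Z0. \<Sum>s\<in>S p \<xi>1. zero_weight \<sigma> s)) (at \<xi>1 within torus)"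
      by (rule Lim_transform_eventually)
    thus ?thesis using eq[of \<xi>1] x by (simp add: continuous_within)
  qed
  show ?thesis
    by (intro exI[of _ UU] exI[of _ NN] exI[of _ "\<Sum>p\<in>Z0. real (R p) * b"] conjI ballI opUU xUU NN bound cont)
qed

text \<open>Compactness of the torus leaves finitely many local null sets and local bounds.\<close>

lemma zero_count_ae_continuous:
  assumes G: "G0 \<Phi> c" and \<sigma>: "\<sigma> > 0" and w: "w \<noteq> c 1"
  obtains N B where "N \<in> null_sets haar" "\<And>\<xi>. \<xi> \<in> torus \<Longrightarrow> \<bar>zero_count c w \<sigma> \<xi>\<bar> \<le> B"
    "\<And>\<xi>. \<xi> \<in> torus - N \<Longrightarrow> continuous (at \<xi> within torus) (zero_count c w \<sigma>)"
proof -
  define Q where "Q = (\<lambda>\<xi>0 (U,N,B). open U \<and> \<xi>0 \<in> U \<and> N \<in> null_sets haar \<and> (\<forall>\<xi>\<in>U \<inter> torus. \<bar>zero_count c w \<sigma> \<xi>\<bar> \<le> B) \<and>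
    (\<forall>\<xi>\<in>U \<inter> torus - N. continuous (at \<xi> within torus) (zero_count c w \<sigma>)))"
  have "\<forall>\<xi>0\<in>torus. \<exists>y. Q \<xi>0 y"
  proof
    fix \<xi>0 assume "\<xi>0 \<in> torus"
    from zero_count_local[OF G \<sigma> w this] obtain U N B where "Q \<xi>0 (U,N,B)" unfolding Q_def prod.case by (elim exE)
    thus "\<exists>y. Q \<xi>0 y" ..
  qed
  from bchoice[OF this] obtain y where y: "\<forall>\<xi>0\<in>torus. Q \<xi>0 (y \<xi>0)" ..
  define U N B where "U = (\<lambda>p. fst (y p))" and "N = (\<lambda>p. fst (snd (y p)))" and "B = (\<lambda>p. snd (snd (y p)))"
  have "\<forall>p\<in>torus. Q p (U p, N p, B p)" using y by (simp add: U_def N_def B_def)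
  note Qp = bspec[OF this, unfolded Q_def prod.case]
  obtain T where T: "T \<subseteq> torus" "finite T" "torus \<subseteq> (\<Union>p\<in>T. U p)"
  proof (rule compactE_image[OF compact_torus, of torus U])
    show "open (U p)" if "p \<in> torus" for p using Qp[OF that] by blast
    show "torus \<subseteq> (\<Union>p\<in>torus. U p)" using Qp by blast
  qed
  have TQ: "p \<in> torus" if "p \<in> T" for p using T that by blast
  show ?thesis
  proof (rule that[of "\<Union>p\<in>T. N p" "\<Sum>p\<in>T. \<bar>B p\<bar>"])
    show "(\<Union>p\<in>T. N p) \<in> null_sets haar"
      using T(2) Qp[OF TQ] by (intro null_sets_UN' countable_finite) auto
    fix \<xi> assume x: "\<xi> \<in> torus"
    then obtain p where p: "p \<in> T" "\<xi> \<in> U p" using T by blast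
    have "\<bar>zero_count c w \<sigma> \<xi>\<bar> \<le> B p" using Qp[OF TQ[OF p(1)]] p x by blast
    also have "\<dots> \<le> \<bar>B p\<bar>" by simp
    also have "\<dots> \<le> (\<Sum>p\<in>T. \<bar>B p\<bar>)" using T(2) p(1) by (intro member_le_sum) auto
    finally show "\<bar>zero_count c w \<sigma> \<xi>\<bar> \<le> (\<Sum>p\<in>T. \<bar>B p\<bar>)" .
  next
    fix \<xi> assume x: "\<xi> \<in> torus - (\<Union>p\<in>T. N p)"
    then obtain p where p: "p \<in> T" "\<xi> \<in> U p" using T by blast
    thus "continuous (at \<xi> within torus) (zero_count c w \<sigma>)" using Qp[OF TQ[OF p(1)]] x by blast
  qed
qed

section \<open>From smoothed averages back to sums over boxes\<close>

lemma tent_nonneg: "tent t \<ge> 0" and tent_le_1: "tent t \<le> 1" and tent_eq_0: "\<bar>t\<bar> \<ge> 1 \<Longrightarrow> tent t = 0"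
  by (auto simp: tent_def)

lemma continuous_tent: "continuous_on A f \<Longrightarrow> continuous_on A (\<lambda>t. tent (f t))"
  unfolding tent_def by (intro continuous_intros)

lemma integrable_tent: "(\<lambda>t. tent (y - t)) integrable_on {a..b}"
  by (intro integrable_continuous_real continuous_tent continuous_intros)

lemma has_integral_tent: "((\<lambda>t. tent (y - t)) has_integral 1) {y-1..y+1}"
proof -
  define F where "F = (\<lambda>t. (t - y) - (t - y) * \<bar>t - y\<bar> / 2)"
  have "((\<lambda>t. tent (y - t)) has_integral (F (y+1) - F (y-1))) {y-1..y+1}"
  proof (rule fundamental_theorem_of_calculus_interior_strong[of "{y}"])
    show "continuous_on {y-1..y+1} F" unfolding F_def by (intro continuous_intros) auto
    fix x assume x: "x \<in> {y-1<..<y+1} - {y}"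
    show "(F has_vector_derivative tent (y - x)) (at x)"
    proof (cases "x > y")
      case True
      have "((\<lambda>t. (t - y) - (t - y) * (t - y) / 2) has_real_derivative tent (y - x)) (at x)"
        using x True by (auto intro!: derivative_eq_intros simp: tent_def field_simps)
      moreover have ev: "\<forall>\<^sub>F t in nhds x. F t = (t - y) - (t - y) * (t - y) / 2"
        using eventually_nhds_in_open[of "{y<..}" x] True by (auto simp: F_def elim!: eventually_mono)
      ultimately have "(F has_real_derivative tent (y - x)) (at x)" by (simp add: DERIV_cong_ev[OF refl ev refl])
      thus ?thesis by (simp add: has_real_derivative_iff_has_vector_derivative)
    next
      case False
      hence xy: "x < y" using x by auto
      have "((\<lambda>t. (t - y) + (t - y) * (t - y) / 2) has_real_derivative tent (y - x)) (at x)"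
        using x xy by (auto intro!: derivative_eq_intros simp: tent_def field_simps)
      moreover have ev: "\<forall>\<^sub>F t in nhds x. F t = (t - y) + (t - y) * (t - y) / 2"
        using eventually_nhds_in_open[of "{..<y}" x] xy
        by (auto simp: F_def algebra_simps add_divide_distrib diff_divide_distrib elim!: eventually_mono)
      ultimately have "(F has_real_derivative tent (y - x)) (at x)" by (simp add: DERIV_cong_ev[OF refl ev refl])
      thus ?thesis by (simp add: has_real_derivative_iff_has_vector_derivative)
    qed
  qed auto
  thus ?thesis by (simp add: F_def)
qed

lemma integral_tent_superset:
  assumes "{y-1..y+1} \<subseteq> {a..b}" shows "integral {a..b} (\<lambda>t. tent (y - t)) = 1"
  by (rule integral_unique, rule has_integral_on_superset[OF has_integral_tent]) (use assms in \<open>auto intro!: tent_eq_0 simp: abs_if\<close>)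

lemma integral_tent_le: "integral {-T..T} (\<lambda>t. tent (y - t)) \<le> 1"
proof -
  define b where "b = max T (\<bar>y\<bar> + 1)"
  have "integral {-T..T} (\<lambda>t. tent (y - t)) \<le> integral {-b..b} (\<lambda>t. tent (y - t))"
    by (rule integral_subset_le) (auto simp: b_def intro!: integrable_tent tent_nonneg)
  also have "\<dots> = 1" by (rule integral_tent_superset) (auto simp: b_def)
  finally show ?thesis .
qed

lemma integral_tent_eq_1: "\<bar>y\<bar> \<le> T - 1 \<Longrightarrow> integral {-T..T} (\<lambda>t. tent (y - t)) = 1"
  by (rule integral_tent_superset) auto

definition box_zeros :: "(complex \<Rightarrow> complex) \<Rightarrow> complex \<Rightarrow> real \<Rightarrow> real \<Rightarrow> complex set" where
  "box_zeros \<Phi> w \<sigma> T = {s. \<Phi> s = w \<and> \<bar>Im s\<bar> < T \<and> \<sigma> < Re s}"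

lemma zeros_Re_bounded:
  assumes G: "G0 \<Phi> c" and d: "\<delta> > 0"
  obtains b where "b > 0" "\<And>s. Re s \<ge> b \<Longrightarrow> norm (\<Phi> s - c 1) < \<delta>"
proof -
  obtain b where b: "b > 0" "\<And>\<xi> s. \<xi> \<in> torus \<Longrightarrow> Re s \<ge> b \<Longrightarrow> norm (twist c \<xi> s - c 1) < \<delta>"
    using twist_near_infinity[OF G d] by blast
  show ?thesis
  proof (rule that[OF b(1)])
    fix s assume s: "Re s \<ge> b"
    hence "Re s > 0" using b(1) by linarith
    from twist_flow[OF G this, of 0] b(2)[OF flow_torus[of 0] s] show "norm (\<Phi> s - c 1) < \<delta>" by simp
  qed
qed

lemma finite_box_zeros:
  assumes G: "G0 \<Phi> c" and \<sigma>: "\<sigma> > 0" and w: "w \<noteq> c 1"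
  shows "finite (box_zeros \<Phi> w \<sigma> T)"
proof -
  obtain b where b: "b > 0" "\<And>s. Re s \<ge> b \<Longrightarrow> norm (\<Phi> s - c 1) < norm (w - c 1)"
    using zeros_Re_bounded[OF G, of "norm (w - c 1)"] w by auto
  have s2: "\<sigma>/2 > 0" using \<sigma> by simp
  let ?K = "cbox (Complex \<sigma> (-T)) (Complex b T)"
  have "finite {s \<in> ?K. twist c (flow 0) s = w}"
    by (rule finite_twist_zeros[OF G w s2 flow_torus compact_cbox]) (use \<sigma> in \<open>auto simp: in_cbox_complex_iff\<close>)
  moreover have "box_zeros \<Phi> w \<sigma> T \<subseteq> {s \<in> ?K. twist c (flow 0) s = w}"
  proof
    fix s assume "s \<in> box_zeros \<Phi> w \<sigma> T"
    hence s: "\<Phi> s = w" "\<bar>Im s\<bar> < T" "\<sigma> < Re s" by (auto simp: box_zeros_def)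
    have "Re s < b" using b(2)[of s] s(1) by force
    thus "s \<in> {s \<in> ?K. twist c (flow 0) s = w}"
      using s twist_flow[OF G, of s 0] \<sigma> by (auto simp: in_cbox_complex_iff)
  qed
  ultimately show ?thesis by (rule rev_finite_subset)
qed

text \<open>Translation by \<open>\<i> * t\<close> matches the zeros of
  \<open>twist c (flow t)\<close> with those of \<open>\<Phi>\<close>. Any box containing the
  translated window will do, so one finite index set works for all \<open>t\<close> in an
  interval.\<close>

lemma zero_count_flow:
  assumes G: "G0 \<Phi> c" and \<sigma>: "\<sigma> > 0" and w: "w \<noteq> c 1" and t: "\<bar>t\<bar> + 1 \<le> T"
  shows "zero_count c w \<sigma> (flow t) = (\<Sum>s\<in>box_zeros \<Phi> w \<sigma> T. Re s * tent (Im s - t))"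
proof -
  define A where "A = {s. Re s > \<sigma> \<and> \<bar>Im s\<bar> < 1 \<and> twist c (flow t) s = w}"
  define B where "B = {s. \<Phi> s = w \<and> \<bar>Im s - t\<bar> < 1 \<and> \<sigma> < Re s}"
  have bij: "bij_betw (\<lambda>s. s + \<i> * of_real t) A B"
  proof (rule bij_betw_byWitness[where f' = "\<lambda>s. s - \<i> * of_real t"])
    show "(\<lambda>s. s + \<i> * of_real t) ` A \<subseteq> B" using \<sigma> by (auto simp: A_def B_def twist_flow[OF G])
    show "(\<lambda>s. s - \<i> * of_real t) ` B \<subseteq> A" using \<sigma> by (auto simp: A_def B_def twist_flow[OF G])
  qed auto
  have "zero_count c w \<sigma> (flow t) = (\<Sum>s\<in>A. Re (s + \<i> * of_real t) * tent (Im (s + \<i> * of_real t) - t))"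
    unfolding zero_count_def A_def by (intro sum.cong refl) (simp add: zero_weight_def)
  also have "\<dots> = (\<Sum>s\<in>B. Re s * tent (Im s - t))"
    by (rule sum.reindex_bij_betw[OF bij])
  also have "\<dots> = (\<Sum>s\<in>box_zeros \<Phi> w \<sigma> T. Re s * tent (Im s - t))"
    by (rule sum.mono_neutral_left[OF finite_box_zeros[OF G \<sigma> w]])
       (use t in \<open>auto simp: B_def box_zeros_def intro!: tent_eq_0\<close>)
  finally show ?thesis .
qed

lemma integrable_zero_count:
  assumes G: "G0 \<Phi> c" and \<sigma>: "\<sigma> > 0" and w: "w \<noteq> c 1"
  shows "(\<lambda>t. zero_count c w \<sigma> (flow t)) integrable_on {-T..T}"
    and "integral {-T..T} (\<lambda>t. zero_count c w \<sigma> (flow t)) =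
       (\<Sum>s\<in>box_zeros \<Phi> w \<sigma> (T + 1). Re s * integral {-T..T} (\<lambda>t. tent (Im s - t)))"
proof -
  have eq: "zero_count c w \<sigma> (flow t) = (\<Sum>s\<in>box_zeros \<Phi> w \<sigma> (T + 1). Re s * tent (Im s - t))" if "t \<in> {-T..T}" for t
    by (rule zero_count_flow[OF G \<sigma> w]) (use that in auto)
  have i: "(\<lambda>t. \<Sum>s\<in>box_zeros \<Phi> w \<sigma> (T + 1). Re s * tent (Im s - t)) integrable_on {-T..T}"
    by (intro integrable_continuous_real continuous_intros continuous_tent)
  show "(\<lambda>t. zero_count c w \<sigma> (flow t)) integrable_on {-T..T}"
    by (rule integrable_eq[OF i]) (simp add: eq)
  have "integral {-T..T} (\<lambda>t. zero_count c w \<sigma> (flow t)) = integral {-T..T} (\<lambda>t. \<Sum>s\<in>box_zeros \<Phi> w \<sigma> (T + 1). Re s * tent (Im s - t))"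
    by (rule Henstock_Kurzweil_Integration.integral_cong) (rule eq)
  also have "\<dots> = (\<Sum>s\<in>box_zeros \<Phi> w \<sigma> (T + 1). integral {-T..T} (\<lambda>t. Re s * tent (Im s - t)))"
    by (rule Henstock_Kurzweil_Integration.integral_sum[OF finite_box_zeros[OF G \<sigma> w]])
       (intro integrable_continuous_real continuous_intros continuous_tent)
  finally show "integral {-T..T} (\<lambda>t. zero_count c w \<sigma> (flow t)) =
       (\<Sum>s\<in>box_zeros \<Phi> w \<sigma> (T + 1). Re s * integral {-T..T} (\<lambda>t. tent (Im s - t)))" by simp
qed

text \<open>No \<open>\<sigma>\<close> is excluded, even if zeros of positive density lie on \<open>Re s = \<sigma>\<close>.\<close>

lemma inner_limit:
  assumes G: "G0 \<Phi> c" and \<sigma>: "\<sigma> > 0" and w: "w \<noteq> c 1"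
  obtains L where "(avg (\<lambda>t. zero_count c w \<sigma> (flow t)) \<longlongrightarrow> L) at_top"
    "((\<lambda>T. pi / T * (\<Sum>s\<in>box_zeros \<Phi> w \<sigma> T. Re s)) \<longlongrightarrow> 2 * pi * L) at_top"
proof -
  obtain N B where NB: "N \<in> null_sets haar" "\<And>\<xi>. \<xi> \<in> torus \<Longrightarrow> \<bar>zero_count c w \<sigma> \<xi>\<bar> \<le> B"
    "\<And>\<xi>. \<xi> \<in> torus - N \<Longrightarrow> continuous (at \<xi> within torus) (zero_count c w \<sigma>)"
    using zero_count_ae_continuous[OF G \<sigma> w] by metis
  have "\<exists>L. (avg (\<lambda>t. zero_count c w \<sigma> (flow t)) \<longlongrightarrow> L) at_top"
    by (rule avg_flow_convergent[of _ B N]) (use NB integrable_zero_count[OF G \<sigma> w] in auto)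
  then obtain L where L: "(avg (\<lambda>t. zero_count c w \<sigma> (flow t)) \<longlongrightarrow> L) at_top" by blast
  define I where "I = (\<lambda>T. integral {-T..T} (\<lambda>t. zero_count c w \<sigma> (flow t)))"
  define S where "S = (\<lambda>T. \<Sum>s\<in>box_zeros \<Phi> w \<sigma> T. Re s)"
  have mono: "box_zeros \<Phi> w \<sigma> T \<subseteq> box_zeros \<Phi> w \<sigma> T'" if "T \<le> T'" for T T' using that by (auto simp: box_zeros_def)
  have Rep: "Re s \<ge> 0" if "s \<in> box_zeros \<Phi> w \<sigma> T" for s T using that \<sigma> by (auto simp: box_zeros_def)
  have tint: "0 \<le> integral {-T..T} (\<lambda>t. tent (y - t))" for y T
    by (rule Henstock_Kurzweil_Integration.integral_nonneg) (auto intro: integrable_tent tent_nonneg)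
  \<comment> \<open>A zero contributes its full weight if its ordinate has modulus at most
    \<open>T - 1\<close>, and nothing beyond \<open>T + 1\<close>. So the smoothed integral lies
    between the sums over the boxes of heights \<open>T - 1\<close> and
    \<open>T + 1\<close>.\<close>
  have up: "I T \<le> S (T + 1)" for T
    unfolding I_def S_def integrable_zero_count(2)[OF G \<sigma> w]
    using mult_left_mono[OF integral_tent_le Rep] by (intro sum_mono) fastforce
  have low: "S (T - 1) \<le> I T" for T
  proof -
    have "S (T - 1) = (\<Sum>s\<in>box_zeros \<Phi> w \<sigma> (T - 1). Re s * integral {-T..T} (\<lambda>t. tent (Im s - t)))"
      unfolding S_def by (intro sum.cong refl, subst integral_tent_eq_1) (auto simp: box_zeros_def)
    also have "\<dots> \<le> I T"
      unfolding I_def integrable_zero_count(2)[OF G \<sigma> w]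
      by (rule sum_mono2[OF finite_box_zeros[OF G \<sigma> w] mono]) (use Rep tint in \<open>auto intro!: mult_nonneg_nonneg\<close>)
    finally show ?thesis .
  qed
  have eq: "2 * pi * (a / T * (J / (2 * a))) = pi / T * J" if "a \<noteq> 0" for a T J :: real
    using that by simp
  have "((\<lambda>T. pi / T * S T) \<longlongrightarrow> 2 * pi * L) at_top"
  proof (rule tendsto_sandwich)
    show "\<forall>\<^sub>F T in at_top. 2 * pi * ((T - 1) / T * avg (\<lambda>t. zero_count c w \<sigma> (flow t)) (T - 1)) \<le> pi / T * S T"
      using eventually_gt_at_top[of 1]
    proof eventually_elim
      case (elim T)
      have "I (T - 1) \<le> S T" using up[of "T - 1"] by simp
      hence "pi / T * I (T - 1) \<le> pi / T * S T" using elim by (intro mult_left_mono) auto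
      moreover have "2 * pi * ((T - 1) / T * avg (\<lambda>t. zero_count c w \<sigma> (flow t)) (T - 1)) = pi / T * I (T - 1)"
        unfolding avg_def I_def by (rule eq) (use elim in simp)
      ultimately show ?case by (simp only:)
    qed
    show "\<forall>\<^sub>F T in at_top. pi / T * S T \<le> 2 * pi * ((T + 1) / T * avg (\<lambda>t. zero_count c w \<sigma> (flow t)) (T + 1))"
      using eventually_gt_at_top[of 1]
    proof eventually_elim
      case (elim T)
      have "S T \<le> I (T + 1)" using low[of "T + 1"] by simp
      hence "pi / T * S T \<le> pi / T * I (T + 1)" using elim by (intro mult_left_mono) auto
      moreover have "2 * pi * ((T + 1) / T * avg (\<lambda>t. zero_count c w \<sigma> (flow t)) (T + 1)) = pi / T * I (T + 1)"
        unfolding avg_def I_def by (rule eq) (use elim in simp)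
      ultimately show ?case by (simp only:)
    qed
    have f1: "filterlim (\<lambda>T::real. T - 1) at_top at_top" and f2: "filterlim (\<lambda>T::real. T + 1) at_top at_top" by real_asymp+
    have l1: "((\<lambda>T::real. (T - 1) / T) \<longlongrightarrow> 1) at_top" and l2: "((\<lambda>T::real. (T + 1) / T) \<longlongrightarrow> 1) at_top" by real_asymp+
    show "((\<lambda>T. 2 * pi * ((T - 1) / T * avg (\<lambda>t. zero_count c w \<sigma> (flow t)) (T - 1))) \<longlongrightarrow> 2 * pi * L) at_top"
      using tendsto_mult_left[OF tendsto_mult[OF l1 filterlim_compose[OF L f1]], of "2 * pi"] by simp
    show "((\<lambda>T. 2 * pi * ((T + 1) / T * avg (\<lambda>t. zero_count c w \<sigma> (flow t)) (T + 1))) \<longlongrightarrow> 2 * pi * L) at_top"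
      using tendsto_mult_left[OF tendsto_mult[OF l2 filterlim_compose[OF L f2]], of "2 * pi"] by simp
  qed
  thus ?thesis using that[OF L] by (simp add: S_def)
qed

text \<open>The inner limit decreases in \<open>\<sigma>\<close>, so the outer limit exists as soon as the inner ones are bounded.\<close>

lemma mean_counting_bounds:
  assumes G: "G0 \<Phi> c" and w: "w \<noteq> c 1" 
    and bd: "\<And>\<sigma> L. \<sigma> > 0 \<Longrightarrow> (avg (\<lambda>t. zero_count c w \<sigma> (flow t)) \<longlongrightarrow> L) at_top \<Longrightarrow> 2 * pi * L \<le> K"
  shows "0 \<le> mean_counting \<Phi> w" "mean_counting \<Phi> w \<le> K"
proof -
  define M where "M = (\<lambda>\<sigma>. Lim at_top (\<lambda>T::real. pi / T * (\<Sum>s\<in>box_zeros \<Phi> w \<sigma> T. Re s)))"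
  have M: "((\<lambda>T. pi / T * (\<Sum>s\<in>box_zeros \<Phi> w \<sigma> T. Re s)) \<longlongrightarrow> M \<sigma>) at_top" "M \<sigma> \<le> K" "0 \<le> M \<sigma>" if \<sigma>: "\<sigma> > 0" for \<sigma>
  proof -
    obtain L where L: "(avg (\<lambda>t. zero_count c w \<sigma> (flow t)) \<longlongrightarrow> L) at_top"
      "((\<lambda>T. pi / T * (\<Sum>s\<in>box_zeros \<Phi> w \<sigma> T. Re s)) \<longlongrightarrow> 2 * pi * L) at_top" by (rule inner_limit[OF G \<sigma> w])
    have "M \<sigma> = 2 * pi * L" unfolding M_def by (rule tendsto_Lim[OF _ L(2)]) simp
    thus 1: "((\<lambda>T. pi / T * (\<Sum>s\<in>box_zeros \<Phi> w \<sigma> T. Re s)) \<longlongrightarrow> M \<sigma>) at_top" "M \<sigma> \<le> K"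
      using L(2) bd[OF \<sigma> L(1)] by simp_all
    have "\<forall>\<^sub>F T in at_top. 0 \<le> pi / T * (\<Sum>s\<in>box_zeros \<Phi> w \<sigma> T. Re s)"
      using eventually_gt_at_top[of 0]
    proof eventually_elim
      case (elim T)
      have "0 \<le> (\<Sum>s\<in>box_zeros \<Phi> w \<sigma> T. Re s)" by (rule sum_nonneg) (use \<sigma> in \<open>auto simp: box_zeros_def\<close>)
      thus ?case using elim by simp
    qed
    thus "0 \<le> M \<sigma>" using tendsto_lowerbound[OF 1(1)] by simp
  qed
  have mono: "M \<sigma>' \<le> M \<sigma>" if "0 < \<sigma>" "\<sigma> \<le> \<sigma>'" for \<sigma> \<sigma>'
  proof (rule tendsto_le[OF _ M(1) M(1)])
    show "\<forall>\<^sub>F T in at_top. pi / T * (\<Sum>s\<in>box_zeros \<Phi> w \<sigma>' T. Re s) \<le> pi / T * (\<Sum>s\<in>box_zeros \<Phi> w \<sigma> T. Re s)"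
      using eventually_gt_at_top[of 0]
    proof eventually_elim
      case (elim T)
      have "(\<Sum>s\<in>box_zeros \<Phi> w \<sigma>' T. Re s) \<le> (\<Sum>s\<in>box_zeros \<Phi> w \<sigma> T. Re s)"
        by (rule sum_mono2[OF finite_box_zeros[OF G that(1) w]]) (use that in \<open>auto simp: box_zeros_def\<close>)
      thus ?case using elim by (intro mult_left_mono) auto
    qed
  qed (use that in auto)
  define S where "S = (SUP \<sigma>\<in>{0<..}. M \<sigma>)"
  have bdd: "bdd_above (M ` {0<..})" using M(2) by (intro bdd_aboveI2[where M = K]) auto
  have le: "M \<sigma> \<le> S" if "\<sigma> > 0" for \<sigma> unfolding S_def by (rule cSUP_upper[OF _ bdd]) (use that in auto)
  have "(M \<longlongrightarrow> S) (at_right 0)"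
  proof (rule tendstoI)
    fix e :: real assume e: "e > 0"
    have "\<exists>\<sigma>\<in>{0<..}. S - e < M \<sigma>"
      unfolding S_def by (rule less_cSUP_iff[OF _ bdd, THEN iffD1]) (use e in auto)
    then obtain \<sigma>0 where \<sigma>0: "\<sigma>0 > 0" "S - e < M \<sigma>0" by auto
    have "\<forall>\<^sub>F \<sigma> in at_right 0. \<sigma> \<in> {0<..<\<sigma>0}" using eventually_at_right_real[OF \<sigma>0(1)] .
    thus "\<forall>\<^sub>F \<sigma> in at_right 0. dist (M \<sigma>) S < e"
    proof eventually_elim
      case (elim \<sigma>)
      thus ?case using mono[of \<sigma> \<sigma>0] le[of \<sigma>] \<sigma>0 e by (auto simp: dist_real_def abs_less_iff)
    qed
  qed
  hence "Lim (at_right 0) M = S" by (rule tendsto_Lim[rotated]) simp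
  hence MS: "mean_counting \<Phi> w = S" unfolding mean_counting_def M_def box_zeros_def by simp
  have "0 \<le> M 1" by (rule M(3)) simp
  thus "0 \<le> mean_counting \<Phi> w" using le[of 1] by (simp add: MS)
  show "mean_counting \<Phi> w \<le> K" unfolding MS S_def by (rule cSUP_least) (use M(2) in auto)
qed

section \<open>Mean squares of Dirichlet series\<close>

text \<open>The coefficient with index \<open>n\<close> belongs to the frequency
  \<open>Suc n\<close>; with \<open>\<alpha> n = b (Suc n)\<close> this is a partial sum of
  \<open>dirichlet b\<close>.\<close>

definition dpoly :: "nat \<Rightarrow> (nat \<Rightarrow> complex) \<Rightarrow> complex \<Rightarrow> complex" where
  "dpoly K \<alpha> s = (\<Sum>n<K. \<alpha> n * of_nat (Suc n) powr (- s))"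

lemma norm_Suc_powr: "norm (of_nat (Suc n) powr (- s) :: complex) = real (Suc n) powr (- Re s)"
  using norm_powr_real_powr[of "of_nat (Suc n)" "- s"] by simp

lemma norm_Suc_powr_le_1: "Re s \<ge> 0 \<Longrightarrow> norm (of_nat (Suc n) powr (- s) :: complex) \<le> 1"
  unfolding norm_Suc_powr using powr_mono[of "- Re s" 0 "real (Suc n)"] by simp

lemma dpoly_bounded: "Re s \<ge> 0 \<Longrightarrow> norm (dpoly K \<alpha> s) \<le> (\<Sum>n<K. norm (\<alpha> n))"
  unfolding dpoly_def
proof (rule order_trans[OF norm_sum sum_mono])
  fix n assume "Re s \<ge> 0"
  from norm_Suc_powr_le_1[OF this, of n] show "norm (\<alpha> n * of_nat (Suc n) powr (- s)) \<le> norm (\<alpha> n)"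
    unfolding norm_mult by (rule mult_left_le) simp
qed

lemma dpoly_pad: "K \<le> K' \<Longrightarrow> dpoly K \<alpha> s = dpoly K' (\<lambda>n. if n < K then \<alpha> n else 0) s"
  unfolding dpoly_def by (rule sum.mono_neutral_cong_left) auto

lemma dpoly_diff: "dpoly K \<alpha> s - dpoly K \<beta> s = dpoly K (\<lambda>n. \<alpha> n - \<beta> n) s"
  by (simp add: dpoly_def sum_subtractf algebra_simps)

lemma dpoly_add: "\<exists>K \<gamma>. \<forall>s. dpoly K1 \<alpha> s + dpoly K2 \<beta> s = dpoly K \<gamma> s"
proof (intro exI[of _ "max K1 K2"] exI[of _ "\<lambda>n. (if n < K1 then \<alpha> n else 0) + (if n < K2 then \<beta> n else 0)"] allI)
  fix s
  show "dpoly K1 \<alpha> s + dpoly K2 \<beta> s =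
    dpoly (max K1 K2) (\<lambda>n. (if n < K1 then \<alpha> n else 0) + (if n < K2 then \<beta> n else 0)) s"
    unfolding dpoly_pad[of K1 "max K1 K2", OF max.cobounded1] dpoly_pad[of K2 "max K1 K2", OF max.cobounded2]
    by (simp add: dpoly_def sum.distrib[symmetric] distrib_right)
qed

lemma dpoly_mult: "\<exists>K \<gamma>. \<forall>s. dpoly K1 \<alpha> s * dpoly K2 \<beta> s = dpoly K \<gamma> s"
proof -
  \<comment> \<open>The product of the frequencies \<open>Suc n\<close> and \<open>Suc m\<close>,
    shifted back to an index.\<close>
  define g where "g = (\<lambda>(n, m). Suc n * Suc m - 1 :: nat)"
  define S where "S = {..<K1} \<times> {..<K2}"
  define \<gamma> where "\<gamma> = (\<lambda>k. \<Sum>x\<in>{x\<in>S. g x = k}. case x of (n,m) \<Rightarrow> \<alpha> n * \<beta> m)"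
  have "dpoly K1 \<alpha> s * dpoly K2 \<beta> s = dpoly (K1 * K2) \<gamma> s" for s
  proof -
    have "dpoly K1 \<alpha> s * dpoly K2 \<beta> s = (\<Sum>(n,m)\<in>S. (\<alpha> n * of_nat (Suc n) powr (- s)) * (\<beta> m * of_nat (Suc m) powr (- s)))"
      unfolding dpoly_def S_def by (simp add: sum_product sum.cartesian_product)
    also have "\<dots> = (\<Sum>x\<in>S. (case x of (n,m) \<Rightarrow> \<alpha> n * \<beta> m) * of_nat (Suc (g x)) powr (- s))"
    proof (rule sum.cong[OF refl], clarify)
      fix n m
      have "(of_nat (Suc (g (n,m))) :: complex) = of_nat (Suc n) * of_nat (Suc m)" unfolding g_def by (simp add: algebra_simps)
      moreover have "(of_nat (Suc n) * of_nat (Suc m) :: complex) powr (- s) = of_nat (Suc n) powr (- s) * of_nat (Suc m) powr (- s)"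
        by (rule powr_times_real) auto
      ultimately show "(\<alpha> n * of_nat (Suc n) powr (- s)) * (\<beta> m * of_nat (Suc m) powr (- s)) =
         \<alpha> n * \<beta> m * of_nat (Suc (g (n,m))) powr (- s)" by (simp add: mult_ac)
    qed
    also have "\<dots> = (\<Sum>k<K1*K2. \<Sum>x\<in>{x\<in>S. g x = k}. (case x of (n,m) \<Rightarrow> \<alpha> n * \<beta> m) * of_nat (Suc (g x)) powr (- s))"
    proof (rule sum.group[symmetric])
      show "g ` S \<subseteq> {..<K1*K2}"
      proof (rule image_subsetI)
        fix x assume "x \<in> S"
        then obtain n m where x: "x = (n, m)" "n < K1" "m < K2" by (auto simp: S_def)
        hence "Suc n * Suc m \<le> K1 * K2" by (intro mult_le_mono) auto
        thus "g x \<in> {..<K1*K2}" by (simp add: g_def x)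
      qed
    qed (auto simp: S_def)
    also have "\<dots> = dpoly (K1 * K2) \<gamma> s"
      unfolding dpoly_def sum_distrib_right \<gamma>_def by (intro sum.cong refl) auto
    finally show ?thesis .
  qed
  thus ?thesis by blast
qed

text \<open>For \<open>\<epsilon> \<ge> 0\<close> these functions form an algebra closed under
  \<open>exp\<close>. With \<open>\<Phi>\<close> it therefore contains
  \<open>n powr (- \<Phi> s)\<close>, and hence Dirichlet polynomials composed with
  \<open>\<Phi>\<close>, without any expansion into coefficients.\<close>

definition dapprox :: "real \<Rightarrow> (complex \<Rightarrow> complex) \<Rightarrow> bool" where
  "dapprox \<epsilon> h \<longleftrightarrow> (\<forall>\<delta>>0. \<exists>K \<alpha>. \<forall>s. Re s \<ge> \<epsilon> \<longrightarrow> norm (h s - dpoly K \<alpha> s) \<le> \<delta>)"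

lemma dapproxD: "dapprox \<epsilon> h \<Longrightarrow> \<delta> > 0 \<Longrightarrow> \<exists>K \<alpha>. \<forall>s. Re s \<ge> \<epsilon> \<longrightarrow> norm (h s - dpoly K \<alpha> s) \<le> \<delta>"
  by (simp add: dapprox_def)

context
  fixes \<epsilon> :: real assumes eps: "\<epsilon> \<ge> 0"
begin

lemma dapprox_bounded:
  assumes "dapprox \<epsilon> h" obtains B where "B > 0" "\<And>s. Re s \<ge> \<epsilon> \<Longrightarrow> norm (h s) \<le> B"
proof -
  obtain K \<alpha> where a: "\<forall>s. Re s \<ge> \<epsilon> \<longrightarrow> norm (h s - dpoly K \<alpha> s) \<le> 1" using dapproxD[OF assms, of 1] by auto
  have "norm (h s) \<le> 1 + (\<Sum>n<K. norm (\<alpha> n))" if "Re s \<ge> \<epsilon>" for s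
    using a[rule_format, OF that] dpoly_bounded[of s K \<alpha>] that eps norm_triangle_sub[of "h s" "dpoly K \<alpha> s"] by linarith
  moreover have "1 + (\<Sum>n<K. norm (\<alpha> n)) > 0" by (rule add_pos_nonneg) (auto intro: sum_nonneg)
  ultimately show ?thesis using that by blast
qed

lemma dapprox_closed:
  assumes "\<And>\<delta>. \<delta> > 0 \<Longrightarrow> \<exists>g. dapprox \<epsilon> g \<and> (\<forall>s. Re s \<ge> \<epsilon> \<longrightarrow> norm (h s - g s) \<le> \<delta>)"
  shows "dapprox \<epsilon> h"
  unfolding dapprox_def
proof (intro allI impI)
  fix \<delta> :: real assume d: "\<delta> > 0"
  obtain g where g: "dapprox \<epsilon> g" "\<forall>s. Re s \<ge> \<epsilon> \<longrightarrow> norm (h s - g s) \<le> \<delta>/2" using assms[of "\<delta>/2"] d by auto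
  obtain K \<alpha> where a: "\<forall>s. Re s \<ge> \<epsilon> \<longrightarrow> norm (g s - dpoly K \<alpha> s) \<le> \<delta>/2" using dapproxD[OF g(1), of "\<delta>/2"] d by auto
  have "norm (h s - dpoly K \<alpha> s) \<le> \<delta>" if "Re s \<ge> \<epsilon>" for s
    using g(2)[rule_format, OF that] a[rule_format, OF that] norm_triangle_ineq[of "h s - g s" "g s - dpoly K \<alpha> s"] by simp
  thus "\<exists>K \<alpha>. \<forall>s. Re s \<ge> \<epsilon> \<longrightarrow> norm (h s - dpoly K \<alpha> s) \<le> \<delta>" by blast
qed

lemma dapprox_dpoly: "dapprox \<epsilon> (dpoly K \<alpha>)"
  unfolding dapprox_def by (auto intro!: exI[of _ K] exI[of _ \<alpha>])

lemma dapprox_const: "dapprox \<epsilon> (\<lambda>_. k)"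
  using dapprox_dpoly[of 1 "\<lambda>_. k"] by (simp add: dpoly_def[abs_def])

lemma dapprox_add:
  assumes f: "dapprox \<epsilon> f" and g: "dapprox \<epsilon> g" shows "dapprox \<epsilon> (\<lambda>s. f s + g s)"
  unfolding dapprox_def
proof (intro allI impI)
  fix \<delta> :: real assume d: "\<delta> > 0"
  obtain K \<alpha> where a: "\<forall>s. Re s \<ge> \<epsilon> \<longrightarrow> norm (f s - dpoly K \<alpha> s) \<le> \<delta>/2" using dapproxD[OF f, of "\<delta>/2"] d by auto
  obtain L \<beta> where b: "\<forall>s. Re s \<ge> \<epsilon> \<longrightarrow> norm (g s - dpoly L \<beta> s) \<le> \<delta>/2" using dapproxD[OF g, of "\<delta>/2"] d by auto
  obtain J \<gamma> where c: "\<forall>s. dpoly K \<alpha> s + dpoly L \<beta> s = dpoly J \<gamma> s" using dpoly_add by blast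
  have "norm (f s + g s - dpoly J \<gamma> s) \<le> \<delta>" if s: "Re s \<ge> \<epsilon>" for s
  proof -
    have "f s + g s - dpoly J \<gamma> s = (f s - dpoly K \<alpha> s) + (g s - dpoly L \<beta> s)"
      unfolding c[rule_format, symmetric] by simp
    hence "norm (f s + g s - dpoly J \<gamma> s) \<le> norm (f s - dpoly K \<alpha> s) + norm (g s - dpoly L \<beta> s)"
      by (simp only: norm_triangle_ineq)
    thus ?thesis using a[rule_format, OF s] b[rule_format, OF s] by linarith
  qed
  thus "\<exists>K \<alpha>. \<forall>s. Re s \<ge> \<epsilon> \<longrightarrow> norm (f s + g s - dpoly K \<alpha> s) \<le> \<delta>" by blast
qed

lemma dapprox_mult:
  assumes f: "dapprox \<epsilon> f" and g: "dapprox \<epsilon> g" shows "dapprox \<epsilon> (\<lambda>s. f s * g s)"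
  unfolding dapprox_def
proof (intro allI impI)
  fix \<delta> :: real assume d: "\<delta> > 0"
  obtain B where B: "B > 0" "\<And>s. Re s \<ge> \<epsilon> \<Longrightarrow> norm (f s) \<le> B" using dapprox_bounded[OF f] by blast
  have "\<delta> / (2 * B) > 0" using d B by simp
  then obtain L \<beta> where b: "\<forall>s. Re s \<ge> \<epsilon> \<longrightarrow> norm (g s - dpoly L \<beta> s) \<le> \<delta> / (2 * B)" using dapproxD[OF g] by blast
  define C where "C = (\<Sum>n<L. norm (\<beta> n)) + 1"
  have C: "C > 0" unfolding C_def by (rule add_nonneg_pos) (auto intro: sum_nonneg)
  have "\<delta> / (2 * C) > 0" using d C by simp
  then obtain K \<alpha> where a: "\<forall>s. Re s \<ge> \<epsilon> \<longrightarrow> norm (f s - dpoly K \<alpha> s) \<le> \<delta> / (2 * C)" using dapproxD[OF f] by blast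
  obtain J \<gamma> where c: "\<forall>s. dpoly K \<alpha> s * dpoly L \<beta> s = dpoly J \<gamma> s" using dpoly_mult by blast
  have "norm (f s * g s - dpoly J \<gamma> s) \<le> \<delta>" if s: "Re s \<ge> \<epsilon>" for s
  proof -
    have "f s * g s - dpoly J \<gamma> s = f s * (g s - dpoly L \<beta> s) + (f s - dpoly K \<alpha> s) * dpoly L \<beta> s"
      unfolding c[rule_format, symmetric] by (simp add: algebra_simps)
    also have "norm \<dots> \<le> norm (f s) * norm (g s - dpoly L \<beta> s) + norm (f s - dpoly K \<alpha> s) * norm (dpoly L \<beta> s)"
      by (rule order_trans[OF norm_triangle_ineq]) (simp add: norm_mult)
    also have "\<dots> \<le> B * (\<delta> / (2 * B)) + \<delta> / (2 * C) * C"
      using a[rule_format, OF s] b[rule_format, OF s] B d C dpoly_bounded[of s L \<beta>] s eps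
      by (intro add_mono mult_mono) (auto simp: C_def)
    also have "\<dots> = \<delta>" using B C by simp
    finally show ?thesis .
  qed
  thus "\<exists>K \<alpha>. \<forall>s. Re s \<ge> \<epsilon> \<longrightarrow> norm (f s * g s - dpoly K \<alpha> s) \<le> \<delta>" by blast
qed

lemma dapprox_sum: "finite I \<Longrightarrow> (\<And>i. i \<in> I \<Longrightarrow> dapprox \<epsilon> (f i)) \<Longrightarrow> dapprox \<epsilon> (\<lambda>s. \<Sum>i\<in>I. f i s)"
  by (induction I rule: finite_induct) (auto intro: dapprox_add dapprox_const)

lemma dapprox_power: "dapprox \<epsilon> f \<Longrightarrow> dapprox \<epsilon> (\<lambda>s. f s ^ n)"
  by (induction n) (auto intro: dapprox_mult dapprox_const)

lemma dapprox_exp: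
  assumes f: "dapprox \<epsilon> f" shows "dapprox \<epsilon> (\<lambda>s. exp (f s))"
proof (rule dapprox_closed)
  fix \<delta> :: real assume d: "\<delta> > 0"
  obtain B where B: "B > 0" "\<And>s. Re s \<ge> \<epsilon> \<Longrightarrow> norm (f s) \<le> B" using dapprox_bounded[OF f] by blast
  have "(\<lambda>n. B ^ n / fact n) \<longlonglongrightarrow> 0" using summable_LIMSEQ_zero[OF summable_exp[of B]] by (simp add: field_simps)
  from tendsto_mult_left[OF this, of "exp B * B"] have "(\<lambda>n. exp B * B * (B ^ n / fact n)) \<longlonglongrightarrow> 0" by simp
  from order_tendstoD(2)[OF this d] obtain n where n: "exp B * B * (B ^ n / fact n) < \<delta>"
    using eventually_happens'[OF sequentially_bot] by blast
  show "\<exists>g. dapprox \<epsilon> g \<and> (\<forall>s. Re s \<ge> \<epsilon> \<longrightarrow> norm (exp (f s) - g s) \<le> \<delta>)"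
  proof (intro exI[of _ "\<lambda>s. \<Sum>k\<le>n. inverse (fact k) * f s ^ k"] conjI allI impI)
    show "dapprox \<epsilon> (\<lambda>s. \<Sum>k\<le>n. inverse (fact k) * f s ^ k)"
      by (intro dapprox_sum dapprox_mult dapprox_const dapprox_power f) auto
    fix s assume s: "Re s \<ge> \<epsilon>"
    have "norm (exp (f s) - (\<Sum>k\<le>n. f s ^ k / fact k)) \<le> exp \<bar>Re (f s)\<bar> * norm (f s) ^ Suc n / fact n"
      by (rule Taylor_exp)
    also have "\<dots> \<le> exp B * B ^ Suc n / fact n"
      using B(2)[OF s] abs_Re_le_cmod[of "f s"] B(1) by (intro divide_right_mono mult_mono power_mono) auto
    also have "\<dots> \<le> \<delta>" using n by simp
    finally show "norm (exp (f s) - (\<Sum>k\<le>n. inverse (fact k) * f s ^ k)) \<le> \<delta>" by (simp add: field_simps)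
  qed
qed

end

lemma dapprox_G0:
  assumes G: "G0 \<Phi> c" and e: "\<epsilon> > 0" shows "dapprox \<epsilon> \<Phi>"
  unfolding dapprox_def
proof (intro allI impI)
  fix \<delta> :: real assume d: "\<delta> > 0"
  have "uniform_limit {s. Re s > \<epsilon>/2} (\<lambda>N s. \<Sum>n<N. c (Suc n) * of_nat (Suc n) powr (- s)) \<Phi> sequentially"
    using G[unfolded G0_def, THEN conjunct1, rule_format, of "\<epsilon>/2"] e by (simp only: half_gt_zero)
  hence "\<forall>\<^sub>F N in sequentially. \<forall>s\<in>{s. Re s > \<epsilon>/2}. dist (\<Sum>n<N. c (Suc n) * of_nat (Suc n) powr (- s)) (\<Phi> s) < \<delta>"
    using d unfolding uniform_limit_iff by blast
  then obtain N where N: "\<forall>s\<in>{s. Re s > \<epsilon>/2}. dist (\<Sum>n<N. c (Suc n) * of_nat (Suc n) powr (- s)) (\<Phi> s) < \<delta>"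
    using eventually_happens'[OF sequentially_bot] by blast
  show "\<exists>K \<alpha>. \<forall>s. Re s \<ge> \<epsilon> \<longrightarrow> norm (\<Phi> s - dpoly K \<alpha> s) \<le> \<delta>"
  proof (intro exI[of _ N] exI[of _ "\<lambda>n. c (Suc n)"] allI impI)
    fix s assume "Re s \<ge> \<epsilon>"
    hence "Re s > \<epsilon>/2" using e by linarith
    thus "norm (\<Phi> s - dpoly N (\<lambda>n. c (Suc n)) s) \<le> \<delta>"
      using N by (force simp: dpoly_def dist_norm norm_minus_commute)
  qed
qed

lemma continuous_dpoly: "continuous_on A (dpoly K \<alpha>)"
  unfolding dpoly_def by (intro continuous_intros) (auto simp del: of_nat_Suc)

text \<open>Off-diagonal terms oscillate with the nonzero frequency
  \<open>ln (Suc m) - ln (Suc n)\<close> and average out like \<open>1 / T\<close>. The constant is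
  uniform on \<open>Re s \<ge> 0\<close> because the coefficients only shrink there.\<close>

lemma dpoly_mean_square:
  obtains C where "C \<ge> 0" "\<And>T s. T > 0 \<Longrightarrow> Re s \<ge> 0 \<Longrightarrow>
    \<bar>avg (\<lambda>t. (norm (dpoly K \<alpha> (s + \<i> * of_real t)))\<^sup>2) T - (\<Sum>n<K. (norm (\<alpha> n) * real (Suc n) powr (- Re s))\<^sup>2)\<bar> \<le> C / T"
proof -
  define \<theta> where "\<theta> = (\<lambda>n m. ln (real (Suc m)) - ln (real (Suc n)))"
  \<comment> \<open>The diagonal terms, with \<open>\<theta> n n = 0\<close>, contribute 0 because
    division by 0 yields 0.\<close>
  define C where "C = (\<Sum>n<K. \<Sum>m<K. norm (\<alpha> n) * norm (\<alpha> m) / \<bar>\<theta> n m\<bar>)"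
  have C: "C \<ge> 0" unfolding C_def by (intro sum_nonneg) auto
  have main: "\<bar>avg (\<lambda>t. (norm (dpoly K \<alpha> (s + \<i> * of_real t)))\<^sup>2) T - (\<Sum>n<K. (norm (\<alpha> n) * real (Suc n) powr (- Re s))\<^sup>2)\<bar> \<le> C / T"
    if T: "T > 0" and s: "Re s \<ge> 0" for T s
  proof -
    define a where "a = (\<lambda>n. \<alpha> n * of_nat (Suc n) powr (- s))"
    have na: "norm (a n) = norm (\<alpha> n) * real (Suc n) powr (- Re s)" for n unfolding a_def norm_mult norm_Suc_powr ..
    have nal: "norm (a n) \<le> norm (\<alpha> n)" for n
      unfolding a_def norm_mult by (rule mult_left_le[OF norm_Suc_powr_le_1[OF s]]) simp
    have dp: "dpoly K \<alpha> (s + \<i> * of_real t) = (\<Sum>n<K. a n * exp (- \<i> * of_real (ln (real (Suc n)) * t)))" for t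
      unfolding dpoly_def a_def
    proof (intro sum.cong refl)
      fix n
      have "(of_nat (Suc n) :: complex) powr (- (s + \<i> * of_real t)) = of_nat (Suc n) powr (- s) * of_nat (Suc n) powr (- \<i> * of_real t)"
        by (simp add: powr_add[symmetric] del: of_nat_Suc)
      also have "(of_nat (Suc n) :: complex) powr (- \<i> * of_real t) = exp (- \<i> * of_real (ln (real (Suc n)) * t))"
        by (simp add: powr_def Ln_of_nat mult_ac del: of_nat_Suc)
      finally show "\<alpha> n * of_nat (Suc n) powr (- (s + \<i> * of_real t)) = \<alpha> n * of_nat (Suc n) powr (- s) * exp (- \<i> * of_real (ln (real (Suc n)) * t))"
        by simp
    qed
    have sq: "of_real ((norm (dpoly K \<alpha> (s + \<i> * of_real t)))\<^sup>2) =
        (\<Sum>n<K. \<Sum>m<K. (a n * cnj (a m)) * exp (\<i> * of_real (\<theta> n m * t)))" for t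
    proof -
      have "of_real ((norm (dpoly K \<alpha> (s + \<i> * of_real t)))\<^sup>2) = dpoly K \<alpha> (s + \<i> * of_real t) * cnj (dpoly K \<alpha> (s + \<i> * of_real t))"
        by (rule complex_norm_square)
      also have "\<dots> = (\<Sum>n<K. \<Sum>m<K. (a n * exp (- \<i> * of_real (ln (real (Suc n)) * t))) * (cnj (a m) * exp (\<i> * of_real (ln (real (Suc m)) * t))))"
        unfolding dp by (simp add: sum_product exp_cnj del: of_nat_Suc)
      also have "\<dots> = (\<Sum>n<K. \<Sum>m<K. (a n * cnj (a m)) * exp (\<i> * of_real (\<theta> n m * t)))"
        by (intro sum.cong refl) (simp add: \<theta>_def exp_add[symmetric] algebra_simps del: of_nat_Suc)
      finally show ?thesis .
    qed
    have ie: "(\<lambda>t. exp (\<i> * of_real (\<theta> n m * t))) integrable_on {-T..T}" for n m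
      by (intro integrable_continuous_real continuous_intros)
    have cdp: "continuous_on {-T..T} (\<lambda>t. dpoly K \<alpha> (s + \<i> * of_real t))"
      by (rule continuous_on_compose2[OF continuous_dpoly[of UNIV]]) (auto intro!: continuous_intros)
    have "of_real (avg (\<lambda>t. (norm (dpoly K \<alpha> (s + \<i> * of_real t)))\<^sup>2) T) =
        cavg (\<lambda>t. of_real ((norm (dpoly K \<alpha> (s + \<i> * of_real t)))\<^sup>2)) T"
    proof -
      have "((\<lambda>t. of_real ((norm (dpoly K \<alpha> (s + \<i> * of_real t)))\<^sup>2) :: complex) has_integral
         of_real (integral {-T..T} (\<lambda>t. (norm (dpoly K \<alpha> (s + \<i> * of_real t)))\<^sup>2))) {-T..T}"
        by (intro has_integral_of_real integrable_integral integrable_continuous_real continuous_intros cdp)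
      thus ?thesis by (simp add: avg_def cavg_def integral_unique)
    qed
    also have "\<dots> = (\<Sum>n<K. \<Sum>m<K. (a n * cnj (a m)) * cavg (\<lambda>t. exp (\<i> * of_real (\<theta> n m * t))) T)"
      unfolding sq cavg_def
      by (simp add: Henstock_Kurzweil_Integration.integral_sum Henstock_Kurzweil_Integration.integrable_sum integrable_on_mult_right ie
           sum_divide_distrib del: of_real_mult)
    finally have A: "of_real (avg (\<lambda>t. (norm (dpoly K \<alpha> (s + \<i> * of_real t)))\<^sup>2) T) =
        (\<Sum>n<K. \<Sum>m<K. (a n * cnj (a m)) * cavg (\<lambda>t. exp (\<i> * of_real (\<theta> n m * t))) T)" .
    have D: "of_real (\<Sum>n<K. (norm (\<alpha> n) * real (Suc n) powr (- Re s))\<^sup>2) = (\<Sum>n<K. \<Sum>m<K. if m = n then a n * cnj (a m) else 0)"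
      by (simp add: na[symmetric] complex_norm_square[symmetric] del: of_nat_Suc)
    have trm: "norm ((a n * cnj (a m)) * cavg (\<lambda>t. exp (\<i> * of_real (\<theta> n m * t))) T - (if m = n then a n * cnj (a m) else 0))
        \<le> norm (\<alpha> n) * norm (\<alpha> m) / \<bar>\<theta> n m\<bar> / T" for n m
    proof (cases "m = n")
      case True
      have "cavg (\<lambda>t. exp (\<i> * of_real (\<theta> n n * t))) T = 1" using T by (simp add: cavg_def \<theta>_def scaleR_conv_of_real)
      thus ?thesis using True T by (simp add: \<theta>_def)
    next
      case False
      hence th: "\<theta> n m \<noteq> 0" by (simp add: \<theta>_def)
      have "norm (a n) * norm (a m) * norm (cavg (\<lambda>t. exp (\<i> * of_real (\<theta> n m * t))) T) \<le> norm (\<alpha> n) * norm (\<alpha> m) * (1 / (T * \<bar>\<theta> n m\<bar>))"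
        by (intro mult_mono nal cavg_exp_le th T) auto
      thus ?thesis using False by (simp add: norm_mult mult_ac)
    qed
    have "\<bar>avg (\<lambda>t. (norm (dpoly K \<alpha> (s + \<i> * of_real t)))\<^sup>2) T - (\<Sum>n<K. (norm (\<alpha> n) * real (Suc n) powr (- Re s))\<^sup>2)\<bar> =
       norm (of_real (avg (\<lambda>t. (norm (dpoly K \<alpha> (s + \<i> * of_real t)))\<^sup>2) T) - of_real (\<Sum>n<K. (norm (\<alpha> n) * real (Suc n) powr (- Re s))\<^sup>2) :: complex)"
      by (simp only: of_real_diff[symmetric] norm_of_real)
    also have "\<dots> = norm (\<Sum>n<K. \<Sum>m<K. (a n * cnj (a m)) * cavg (\<lambda>t. exp (\<i> * of_real (\<theta> n m * t))) T - (if m = n then a n * cnj (a m) else 0))"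
      unfolding A D by (simp only: sum_subtractf)
    also have "\<dots> \<le> (\<Sum>n<K. \<Sum>m<K. norm (\<alpha> n) * norm (\<alpha> m) / \<bar>\<theta> n m\<bar> / T)"
      by (rule order_trans[OF norm_sum sum_mono], rule order_trans[OF norm_sum sum_mono]) (rule trm)
    also have "\<dots> = C / T" by (simp add: C_def sum_divide_distrib)
    finally show ?thesis .
  qed
  show ?thesis by (rule that[OF C main])
qed

text \<open>The mean square over the line is at most \<open>d^2\<close> for every \<open>T\<close>,
  and the error \<open>C / T\<close> disappears in the limit.\<close>

lemma dpoly_coeff_bound:
  assumes s: "\<sigma> \<ge> 0" and d: "\<And>s. Re s = \<sigma> \<Longrightarrow> norm (dpoly K \<alpha> s) \<le> d"
  shows "(\<Sum>n<K. (norm (\<alpha> n) * real (Suc n) powr (- \<sigma>))\<^sup>2) \<le> d\<^sup>2"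
proof -
  obtain C where C: "C \<ge> 0" "\<And>T s. T > 0 \<Longrightarrow> Re s \<ge> 0 \<Longrightarrow>
    \<bar>avg (\<lambda>t. (norm (dpoly K \<alpha> (s + \<i> * of_real t)))\<^sup>2) T - (\<Sum>n<K. (norm (\<alpha> n) * real (Suc n) powr (- Re s))\<^sup>2)\<bar> \<le> C / T"
    by (rule dpoly_mean_square[of K \<alpha>]) (rule that)
  have "(\<Sum>n<K. (norm (\<alpha> n) * real (Suc n) powr (- \<sigma>))\<^sup>2) \<le> d\<^sup>2 + C / T" if T: "T > 0" for T
  proof -
    have cdp: "continuous_on {-T..T} (\<lambda>t. dpoly K \<alpha> (of_real \<sigma> + \<i> * of_real t))"
      by (rule continuous_on_compose2[OF continuous_dpoly[of UNIV]]) (auto intro!: continuous_intros)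
    have "avg (\<lambda>t. (norm (dpoly K \<alpha> (of_real \<sigma> + \<i> * of_real t)))\<^sup>2) T \<le> avg (\<lambda>t. d\<^sup>2) T"
      by (rule avg_mono[OF T]) (auto intro!: integrable_continuous_real continuous_intros cdp power_mono d)
    also have "\<dots> = d\<^sup>2" using T by (simp add: avg_def)
    finally show ?thesis using C(2)[OF T, of "of_real \<sigma>"] s by simp
  qed
  moreover have "((\<lambda>T. d\<^sup>2 + C / T) \<longlongrightarrow> d\<^sup>2) at_top" by real_asymp
  ultimately show ?thesis
    by (intro tendsto_lowerbound[of "\<lambda>T. d\<^sup>2 + C / T" "d\<^sup>2" at_top]) (auto intro: eventually_mono[OF eventually_gt_at_top[of 0]])
qed

text \<open>On \<open>Re s \<ge> 1\<close> the terms are dominated by the product of two square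
  summable sequences, the coefficients and \<open>1 / n\<close>, which gives a tail bound uniform in
  \<open>s\<close>.\<close>

lemma dirichlet_approx:
  assumes b: "h2 b" and d: "\<delta> > 0"
  obtains J0 where "\<And>J s. J \<ge> J0 \<Longrightarrow> Re s \<ge> 1 \<Longrightarrow> norm (dirichlet b s - dpoly J (\<lambda>n. b (Suc n)) s) \<le> \<delta>"
proof -
  define g where "g = (\<lambda>n. norm (b (Suc n)) / real (Suc n))"
  have sb: "summable (\<lambda>n. (norm (b (Suc n)))\<^sup>2)" using b by (simp add: h2_def)
  have sn: "summable (\<lambda>n. (1 / real (Suc n))\<^sup>2)"
    using inverse_squares_sums by (auto simp: sums_iff power_one_over add_ac)
  have sg: "summable g"
  proof (rule summable_comparison_test'[OF summable_add[OF sb sn], of 0])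
    fix n
    have "2 * (norm (b (Suc n)) * (1 / real (Suc n))) \<le> (norm (b (Suc n)))\<^sup>2 + (1 / real (Suc n))\<^sup>2"
      using sum_squares_bound[of "norm (b (Suc n))" "1 / real (Suc n)"] by (simp add: mult_ac)
    moreover have "0 \<le> norm (b (Suc n)) * (1 / real (Suc n))" by simp
    ultimately have "norm (b (Suc n)) * (1 / real (Suc n)) \<le> (norm (b (Suc n)))\<^sup>2 + (1 / real (Suc n))\<^sup>2" by linarith
    hence "g n \<le> (norm (b (Suc n)))\<^sup>2 + (1 / real (Suc n))\<^sup>2" unfolding g_def by simp
    moreover have "g n \<ge> 0" by (simp add: g_def)
    ultimately show "norm (g n) \<le> (norm (b (Suc n)))\<^sup>2 + (1 / real (Suc n))\<^sup>2" by simp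
  qed
  obtain J0 where J0: "\<And>J. J \<ge> J0 \<Longrightarrow> norm (\<Sum>i. g (i + J)) < \<delta>" using suminf_exist_split[OF d sg] by blast
  show ?thesis
  proof (rule that)
    fix J s assume J: "J \<ge> J0" and s: "Re s \<ge> (1::real)"
    define f where "f = (\<lambda>n. b (Suc n) * of_nat (Suc n) powr (- s))"
    have fg: "norm (f n) \<le> g n" for n
    proof -
      have "real (Suc n) powr (- Re s) \<le> real (Suc n) powr (- 1)" using s by (intro powr_mono) auto
      also have "\<dots> = 1 / real (Suc n)" by (simp add: powr_minus_divide del: of_nat_Suc)
      finally have "norm (b (Suc n)) * real (Suc n) powr (- Re s) \<le> norm (b (Suc n)) * (1 / real (Suc n))" by (rule mult_left_mono) simp
      thus ?thesis unfolding f_def g_def norm_mult norm_Suc_powr by simp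
    qed
    have sf: "summable (\<lambda>n. norm (f n))" by (rule summable_comparison_test'[OF sg, of 0]) (use fg in simp)
    have sf': "summable f" by (rule summable_norm_cancel[OF sf])
    have "dirichlet b s - dpoly J (\<lambda>n. b (Suc n)) s = (\<Sum>i. f (i + J))"
      using suminf_minus_initial_segment[OF sf', of J] by (simp add: dirichlet_def dpoly_def f_def)
    also have "norm \<dots> \<le> (\<Sum>i. norm (f (i + J)))"
      by (rule summable_norm) (use sf summable_ignore_initial_segment in blast)
    also have "\<dots> \<le> (\<Sum>i. g (i + J))"
      by (intro suminf_le fg summable_ignore_initial_segment sf sg)
    also have "\<dots> \<le> \<delta>" using J0[OF J] by simp
    finally show "norm (dirichlet b s - dpoly J (\<lambda>n. b (Suc n)) s) \<le> \<delta>" .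
  qed
qed

lemma dpoly_coeff_close:
  assumes s: "\<sigma> \<ge> 0" and d: "\<And>s. Re s = \<sigma> \<Longrightarrow> norm (dpoly K \<alpha> s - dpoly L \<beta> s) \<le> d"
  shows "(\<Sum>n<N. (norm ((if n < K then \<alpha> n else 0) - (if n < L then \<beta> n else 0)) * real (Suc n) powr (- \<sigma>))\<^sup>2) \<le> d\<^sup>2"
proof -
  define M where "M = max N (max K L)"
  have M: "K \<le> M" "L \<le> M" "N \<le> M" by (auto simp: M_def)
  have "(\<Sum>n<N. (norm ((if n < K then \<alpha> n else 0) - (if n < L then \<beta> n else 0)) * real (Suc n) powr (- \<sigma>))\<^sup>2) \<le>
     (\<Sum>n<M. (norm ((if n < K then \<alpha> n else 0) - (if n < L then \<beta> n else 0)) * real (Suc n) powr (- \<sigma>))\<^sup>2)"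
    using M(3) by (intro sum_mono2) auto
  also have "\<dots> \<le> d\<^sup>2"
    by (rule dpoly_coeff_bound[OF s]) (use d in \<open>simp add: dpoly_diff[symmetric] dpoly_pad[OF M(1), symmetric] dpoly_pad[OF M(2), symmetric]\<close>)
  finally show ?thesis .
qed

text \<open>The approximating Dirichlet polynomials are Cauchy in \<open>\<ell>\<^sup>2\<close>, with limit the coefficients \<open>b\<close> seen on \<open>Re s = 1\<close>.\<close>

lemma dapprox_coeff_bound:
  assumes e: "0 < \<epsilon>" "\<epsilon> \<le> 1" and h: "dapprox \<epsilon> h" and b: "h2 b" and eq: "\<And>s. Re s > 1/2 \<Longrightarrow> h s = dirichlet b s"
    and P: "\<And>s. Re s \<ge> \<epsilon> \<Longrightarrow> norm (h s - dpoly K \<alpha> s) \<le> \<delta>" and s: "\<sigma> \<ge> \<epsilon>"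
  shows "sqrt (\<Sum>n<K. (norm (\<alpha> n) * real (Suc n) powr (- \<sigma>))\<^sup>2) \<le> \<delta> + h2norm b"
proof -
  have "0 \<le> \<delta>" using P[of "of_real \<sigma>"] s norm_ge_zero order_trans by (metis Re_complex_of_real)
  define W where "W = (\<lambda>n. real (Suc n) powr (- \<sigma>))"
  have W: "0 \<le> W n" "W n \<le> 1" for n using powr_mono[of "-\<sigma>" 0 "real (Suc n)"] s e by (auto simp: W_def)
  have "\<forall>j. \<exists>K \<alpha>. \<forall>s. Re s \<ge> \<epsilon> \<longrightarrow> norm (h s - dpoly K \<alpha> s) \<le> 1 / real (Suc j)"
    using dapproxD[OF h] by simp
  from choice[OF this] obtain L where "\<forall>j. \<exists>\<alpha>. \<forall>s. Re s \<ge> \<epsilon> \<longrightarrow> norm (h s - dpoly (L j) \<alpha> s) \<le> 1 / real (Suc j)" ..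
  from choice[OF this] obtain \<beta> where L': "\<forall>j. \<forall>s. Re s \<ge> \<epsilon> \<longrightarrow> norm (h s - dpoly (L j) (\<beta> j) s) \<le> 1 / real (Suc j)" ..
  have L: "norm (h s - dpoly (L j) (\<beta> j) s) \<le> 1 / real (Suc j)" if "Re s \<ge> \<epsilon>" for j s using L' that by blast
  define B where "B = (\<lambda>j n. if n < L j then \<beta> j n else 0)"
  \<comment> \<open>On \<open>Re s = 1\<close> the approximants are close to partial sums of
    \<open>dirichlet b\<close>; reading off a single coefficient there costs the factor
    \<open>Suc n\<close>.\<close>
  have Bb: "norm (B j n - b (Suc n)) \<le> real (Suc n) * (1 / real (Suc j))" for j n
  proof (rule field_le_epsilon)
    fix e' :: real assume e': "e' > 0"
    define d where "d = e' / real (Suc n)"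
    have d: "d > 0" using e' by (simp add: d_def)
    obtain J0 where J0: "\<And>J s. J \<ge> J0 \<Longrightarrow> Re s \<ge> 1 \<Longrightarrow> norm (dirichlet b s - dpoly J (\<lambda>n. b (Suc n)) s) \<le> d"
      using dirichlet_approx[OF b d] by blast
    define J where "J = max J0 (Suc n)"
    have J: "J \<ge> J0" "n < J" by (auto simp: J_def)
    have "(\<Sum>m<Suc n. (norm (B j m - (if m < J then b (Suc m) else 0)) * real (Suc m) powr (- 1))\<^sup>2) \<le> (1 / real (Suc j) + d)\<^sup>2"
      unfolding B_def
    proof (rule dpoly_coeff_close)
      fix s :: complex assume s: "Re s = 1"
      have "norm (h s - dpoly (L j) (\<beta> j) s) \<le> 1 / real (Suc j)" by (rule L) (use s e in simp)
      moreover have "norm (h s - dpoly J (\<lambda>n. b (Suc n)) s) \<le> d" using J0[OF J(1), of s] eq[of s] s by simp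
      ultimately show "norm (dpoly (L j) (\<beta> j) s - dpoly J (\<lambda>n. b (Suc n)) s) \<le> 1 / real (Suc j) + d"
        using norm_triangle_ineq4[of "h s - dpoly J (\<lambda>n. b (Suc n)) s" "h s - dpoly (L j) (\<beta> j) s"] by simp
    qed simp
    moreover have "(norm (B j n - (if n < J then b (Suc n) else 0)) * real (Suc n) powr (- 1))\<^sup>2 \<le>
       (\<Sum>m<Suc n. (norm (B j m - (if m < J then b (Suc m) else 0)) * real (Suc m) powr (- 1))\<^sup>2)"
      by (rule member_le_sum) auto
    ultimately have "(norm (B j n - b (Suc n)) * real (Suc n) powr (- 1))\<^sup>2 \<le> (1 / real (Suc j) + d)\<^sup>2"
      using J(2) by simp
    hence "norm (B j n - b (Suc n)) * real (Suc n) powr (- 1) \<le> 1 / real (Suc j) + d"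
      by (rule power2_le_imp_le) (use d in simp)
    hence "norm (B j n - b (Suc n)) / real (Suc n) \<le> 1 / real (Suc j) + d" by (simp add: powr_minus_divide del: of_nat_Suc)
    hence "norm (B j n - b (Suc n)) \<le> real (Suc n) * (1 / real (Suc j) + d)"
      by (simp add: pos_divide_le_eq mult.commute del: of_nat_Suc)
    also have "\<dots> = real (Suc n) * (1 / real (Suc j)) + e'" by (simp add: d_def distrib_left del: of_nat_Suc)
    finally show "norm (B j n - b (Suc n)) \<le> real (Suc n) * (1 / real (Suc j)) + e'" .
  qed
  have lim: "(\<lambda>j. B j n) \<longlonglongrightarrow> b (Suc n)" for n
  proof (rule LIM_zero_cancel, rule Lim_null_comparison[OF always_eventually])
    show "\<forall>j. norm (B j n - b (Suc n)) \<le> real (Suc n) * (1 / real (Suc j))" using Bb by blast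
    show "(\<lambda>j. real (Suc n) * (1 / real (Suc j))) \<longlonglongrightarrow> 0"
      using tendsto_mult_left[OF LIMSEQ_Suc[OF lim_1_over_n], of "real (Suc n)"] by simp
  qed
  \<comment> \<open>At abscissa \<open>\<sigma>\<close> only Dirichlet polynomials are compared.
    Letting \<open>j\<close> tend to infinity in finitely many coefficients brings in
    \<open>b\<close>, whose series may diverge on that line.\<close>
  have "(\<Sum>n<K. (norm (\<alpha> n - b (Suc n)) * W n)\<^sup>2) \<le> \<delta>\<^sup>2"
  proof (rule LIMSEQ_le[of "\<lambda>j. \<Sum>n<K. (norm (\<alpha> n - B j n) * W n)\<^sup>2" _ "\<lambda>j. (\<delta> + 1 / real (Suc j))\<^sup>2"])
    show "(\<lambda>j. \<Sum>n<K. (norm (\<alpha> n - B j n) * W n)\<^sup>2) \<longlonglongrightarrow> (\<Sum>n<K. (norm (\<alpha> n - b (Suc n)) * W n)\<^sup>2)"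
      by (intro tendsto_intros lim)
    have "(\<lambda>j. (\<delta> + 1 / real (Suc j))\<^sup>2) \<longlonglongrightarrow> (\<delta> + 0)\<^sup>2" by (intro tendsto_intros LIMSEQ_Suc[OF lim_1_over_n])
    thus "(\<lambda>j. (\<delta> + 1 / real (Suc j))\<^sup>2) \<longlonglongrightarrow> \<delta>\<^sup>2" by simp
    have "(\<Sum>n<K. (norm (\<alpha> n - B j n) * W n)\<^sup>2) \<le> (\<delta> + 1 / real (Suc j))\<^sup>2" for j
    proof -
      have "(\<Sum>n<K. (norm ((if n < K then \<alpha> n else 0) - (if n < L j then \<beta> j n else 0)) * real (Suc n) powr (- \<sigma>))\<^sup>2) \<le> (\<delta> + 1 / real (Suc j))\<^sup>2"
      proof (rule dpoly_coeff_close)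
        fix s' assume "Re s' = \<sigma>"
        hence "Re s' \<ge> \<epsilon>" using s by simp
        from P[OF this] L[OF this, of j] show "norm (dpoly K \<alpha> s' - dpoly (L j) (\<beta> j) s') \<le> \<delta> + 1 / real (Suc j)"
          using norm_triangle_ineq4[of "h s' - dpoly (L j) (\<beta> j) s'" "h s' - dpoly K \<alpha> s'"] by simp
      qed (use s e in simp)
      thus ?thesis by (simp add: W_def B_def)
    qed
    thus "\<exists>N. \<forall>n\<ge>N. (\<Sum>na<K. (norm (\<alpha> na - B n na) * W na)\<^sup>2) \<le> (\<delta> + 1 / real (Suc n))\<^sup>2" by blast
  qed
  hence 1: "L2_set (\<lambda>n. norm (\<alpha> n - b (Suc n)) * W n) {..<K} \<le> \<delta>"
    unfolding L2_set_def using \<open>0 \<le> \<delta>\<close> real_le_lsqrt by (simp add: real_sqrt_le_iff[of _ "\<delta>\<^sup>2", simplified real_sqrt_abs])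
  have "(\<Sum>n<K. (norm (b (Suc n)) * W n)\<^sup>2) \<le> (\<Sum>n<K. (norm (b (Suc n)))\<^sup>2)"
    using W by (intro sum_mono power_mono mult_left_le) auto
  also have "\<dots> \<le> (\<Sum>n. (norm (b (Suc n)))\<^sup>2)" by (rule sum_le_suminf) (use b in \<open>auto simp: h2_def\<close>)
  finally have 2: "L2_set (\<lambda>n. norm (b (Suc n)) * W n) {..<K} \<le> h2norm b"
    unfolding L2_set_def h2norm_def by (rule real_sqrt_le_mono)
  have "sqrt (\<Sum>n<K. (norm (\<alpha> n) * real (Suc n) powr (- \<sigma>))\<^sup>2) = L2_set (\<lambda>n. norm (\<alpha> n) * W n) {..<K}"
    by (simp add: L2_set_def W_def)
  also have "\<dots> \<le> L2_set (\<lambda>n. norm (\<alpha> n - b (Suc n)) * W n + norm (b (Suc n)) * W n) {..<K}"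
  proof (rule L2_set_mono)
    fix n
    have "norm (\<alpha> n) \<le> norm (\<alpha> n - b (Suc n)) + norm (b (Suc n))" using norm_triangle_ineq[of "\<alpha> n - b (Suc n)" "b (Suc n)"] by simp
    from mult_right_mono[OF this W(1)[of n]]
    show "norm (\<alpha> n) * W n \<le> norm (\<alpha> n - b (Suc n)) * W n + norm (b (Suc n)) * W n" by (simp add: distrib_right)
    show "0 \<le> norm (\<alpha> n) * W n" using W by simp
  qed
  also have "\<dots> \<le> \<delta> + h2norm b" by (rule order_trans[OF L2_set_triangle_ineq add_mono[OF 1 2]])
  finally show ?thesis .
qed

lemma h2norm_nonneg: "h2 b \<Longrightarrow> h2norm b \<ge> 0"
  unfolding h2norm_def h2_def by (intro real_sqrt_ge_zero suminf_nonneg) auto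

text \<open>Carlson's theorem as an inequality. That \<open>T0\<close> does not depend on
  \<open>s\<close> matters because the points of a Jensen circle have different abscissas.\<close>

lemma mean_square_le:
  assumes e: "0 < \<epsilon>" "\<epsilon> \<le> 1" and h: "dapprox \<epsilon> h" and hc: "continuous_on {s. Re s \<ge> \<epsilon>} h"
    and b: "h2 b" and eq: "\<And>s. Re s > 1/2 \<Longrightarrow> h s = dirichlet b s" and \<eta>: "\<eta> > 0"
  obtains T0 where "T0 > 0" "\<And>T s. T \<ge> T0 \<Longrightarrow> Re s \<ge> \<epsilon> \<Longrightarrow>
     avg (\<lambda>t. (norm (h (s + \<i> * of_real t)))\<^sup>2) T \<le> (h2norm b)\<^sup>2 + \<eta>"
proof -
  have e0: "\<epsilon> \<ge> 0" using e by simp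
  obtain B where B: "B > 0" "\<And>s. Re s \<ge> \<epsilon> \<Longrightarrow> norm (h s) \<le> B" using dapprox_bounded[OF e0 h] by blast
  have nb: "h2norm b \<ge> 0" by (rule h2norm_nonneg[OF b])
  \<comment> \<open>The total cost per unit of \<open>\<delta>\<close>: \<open>2 * B + 3\<close> for
    replacing \<open>h\<close> by a polynomial, and \<open>2 * h2norm b + 1\<close> for expanding
    \<open>(\<delta> + h2norm b)^2\<close>.\<close>
  define D where "D = 2 * h2norm b + 2 * B + 4"
  have D: "D > 0" using nb B by (simp add: D_def)
  define \<delta> where "\<delta> = min 1 (\<eta> / (2 * D))"
  have \<delta>: "\<delta> > 0" "\<delta> \<le> 1" "\<delta> * D \<le> \<eta> / 2"
    using \<eta> D by (auto simp: \<delta>_def min_def field_simps)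
  obtain K \<alpha> where P: "\<And>s. Re s \<ge> \<epsilon> \<Longrightarrow> norm (h s - dpoly K \<alpha> s) \<le> \<delta>" using dapproxD[OF h \<delta>(1)] by blast
  obtain C where C: "C \<ge> 0" "\<And>T s. T > 0 \<Longrightarrow> Re s \<ge> 0 \<Longrightarrow>
    \<bar>avg (\<lambda>t. (norm (dpoly K \<alpha> (s + \<i> * of_real t)))\<^sup>2) T - (\<Sum>n<K. (norm (\<alpha> n) * real (Suc n) powr (- Re s))\<^sup>2)\<bar> \<le> C / T"
    by (rule dpoly_mean_square[of K \<alpha>]) (rule that)
  define T0 where "T0 = 2 * C / \<eta> + 1"
  have T0: "T0 > 0" using C \<eta> by (simp add: T0_def add_nonneg_pos)
  show ?thesis
  proof (rule that[OF T0])
    fix T s assume T: "T \<ge> T0" and s: "Re s \<ge> \<epsilon>"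
    have T': "T > 0" using T T0 by linarith
    have st: "Re (s + \<i> * of_real t) \<ge> \<epsilon>" for t using s by simp
    have chs: "continuous_on {-T..T} (\<lambda>t. h (s + \<i> * of_real t))"
      by (rule continuous_on_compose2[OF hc]) (use s in \<open>auto intro!: continuous_intros\<close>)
    have cdp: "continuous_on {-T..T} (\<lambda>t. dpoly K \<alpha> (s + \<i> * of_real t))"
      by (rule continuous_on_compose2[OF continuous_dpoly[of UNIV]]) (auto intro!: continuous_intros)
    have "avg (\<lambda>t. (norm (h (s + \<i> * of_real t)))\<^sup>2) T \<le> avg (\<lambda>t. (norm (dpoly K \<alpha> (s + \<i> * of_real t)))\<^sup>2 + (2 * B + 3) * \<delta>) T"
    proof (rule avg_mono[OF T'])
      fix t
      let ?h = "norm (h (s + \<i> * of_real t))" and ?p = "norm (dpoly K \<alpha> (s + \<i> * of_real t))"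
      have 1: "?h \<le> ?p + \<delta>" using P[OF st, of t] norm_triangle_sub[of "h (s + \<i> * of_real t)" "dpoly K \<alpha> (s + \<i> * of_real t)"] by linarith
      have 2: "?p \<le> B + 1"
        using P[OF st, of t] B(2)[OF st, of t] \<delta>(2) norm_triangle_sub[of "dpoly K \<alpha> (s + \<i> * of_real t)" "h (s + \<i> * of_real t)"]
        by (simp add: norm_minus_commute)
      have "?h\<^sup>2 \<le> (?p + \<delta>)\<^sup>2" using 1 by (intro power_mono) auto
      also have "\<dots> = ?p\<^sup>2 + (2 * ?p + \<delta>) * \<delta>" by (simp add: power2_eq_square algebra_simps)
      also have "\<dots> \<le> ?p\<^sup>2 + (2 * B + 3) * \<delta>" using 2 \<delta> by (intro add_left_mono mult_right_mono) auto
      finally show "?h\<^sup>2 \<le> ?p\<^sup>2 + (2 * B + 3) * \<delta>" .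
    qed (intro integrable_continuous_real continuous_intros chs cdp)+
    also have "\<dots> = avg (\<lambda>t. (norm (dpoly K \<alpha> (s + \<i> * of_real t)))\<^sup>2) T + (2 * B + 3) * \<delta>"
    proof -
      have "integral {-T..T} (\<lambda>t. (norm (dpoly K \<alpha> (s + \<i> * of_real t)))\<^sup>2 + (2 * B + 3) * \<delta>) =
         integral {-T..T} (\<lambda>t. (norm (dpoly K \<alpha> (s + \<i> * of_real t)))\<^sup>2) + integral {-T..T} (\<lambda>t. (2 * B + 3) * \<delta>)"
        by (intro Henstock_Kurzweil_Integration.integral_add integrable_continuous_real continuous_intros cdp)
      thus ?thesis using T' by (simp add: avg_def add_divide_distrib)
    qed
    also have "avg (\<lambda>t. (norm (dpoly K \<alpha> (s + \<i> * of_real t)))\<^sup>2) T \<le> (\<Sum>n<K. (norm (\<alpha> n) * real (Suc n) powr (- Re s))\<^sup>2) + C / T"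
      using C(2)[OF T', of s] s e by (simp add: abs_le_iff)
    also have "(\<Sum>n<K. (norm (\<alpha> n) * real (Suc n) powr (- Re s))\<^sup>2) \<le> (\<delta> + h2norm b)\<^sup>2"
      by (rule sqrt_le_D[OF dapprox_coeff_bound[OF e h b eq P s]])
    also have "(\<delta> + h2norm b)\<^sup>2 + C / T + (2 * B + 3) * \<delta> \<le> (h2norm b)\<^sup>2 + \<eta>"
    proof -
      have "(\<delta> + h2norm b)\<^sup>2 = (h2norm b)\<^sup>2 + (2 * h2norm b + \<delta>) * \<delta>" by (simp add: power2_eq_square algebra_simps)
      also have "\<dots> \<le> (h2norm b)\<^sup>2 + (2 * h2norm b + 1) * \<delta>" using \<delta> by (intro add_left_mono mult_right_mono) auto
      finally have "(\<delta> + h2norm b)\<^sup>2 + (2 * B + 3) * \<delta> \<le> (h2norm b)\<^sup>2 + \<delta> * D" by (simp add: D_def algebra_simps)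
      moreover have "C / T \<le> \<eta> / 2"
      proof -
        have "2 * C / \<eta> \<le> T" using T by (simp add: T0_def)
        thus ?thesis using T' \<eta> by (simp add: field_simps)
      qed
      ultimately show ?thesis using \<delta>(3) by linarith
    qed
    finally show "avg (\<lambda>t. (norm (h (s + \<i> * of_real t)))\<^sup>2) T \<le> (h2norm b)\<^sup>2 + \<eta>" by simp
  qed
qed

section \<open>Cayley maps and Jensen's inequality in the right half plane\<close>

definition mob :: "real \<Rightarrow> complex \<Rightarrow> complex" where "mob p z = of_real p * (1 + z) / (1 - z)"

definition mobinv :: "real \<Rightarrow> complex \<Rightarrow> complex" where "mobinv p s = (s - of_real p) / (s + of_real p)"

lemma Re_mob: "z \<noteq> 1 \<Longrightarrow> Re (mob p z) = p * (1 - (norm z)\<^sup>2) / (norm (1 - z))\<^sup>2"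
proof -
  assume "z \<noteq> 1"
  have "mob p z = of_real p * (1 + z) * cnj (1 - z) / of_real ((norm (1 - z))\<^sup>2)"
    unfolding mob_def by (subst complex_div_cnj) simp
  also have "Re \<dots> = Re (of_real p * (1 + z) * cnj (1 - z)) / (norm (1 - z))\<^sup>2" by (rule Re_divide_of_real)
  also have "Re (of_real p * (1 + z) * cnj (1 - z)) = p * (1 - (norm z)\<^sup>2)"
    unfolding cmod_power2 by (simp add: algebra_simps power2_eq_square)
  finally show ?thesis .
qed

lemma Re_mob_pos: "p > 0 \<Longrightarrow> norm z < 1 \<Longrightarrow> Re (mob p z) > 0"
proof -
  assume p: "p > 0" and z: "norm z < 1"
  have "z \<noteq> 1" using z by auto
  moreover have "(norm z)\<^sup>2 < 1" using z by (simp add: power_less_one_iff abs_square_less_1)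
  ultimately show ?thesis using p by (simp add: Re_mob)
qed

text \<open>The extreme point is \<open>z = - r\<close>. The bound keeps the image of the circle in
  a closed half plane inside \<open>Re s > 0\<close>, where uniform approximation by Dirichlet
  polynomials is available.\<close>

lemma Re_mob_ge:
  assumes p: "p > 0" and r: "norm z = r" "r < 1" shows "Re (mob p z) \<ge> p * (1 - r) / (1 + r)"
proof -
  have r0: "r \<ge> 0" using r by auto
  have z: "z \<noteq> 1" using r by auto
  have "norm (1 - z) \<le> 1 + r" using norm_triangle_ineq4[of 1 z] r by simp
  hence "(norm (1 - z))\<^sup>2 \<le> (1 + r)\<^sup>2" by (intro power_mono) auto
  moreover have "0 \<le> p * (1 - r\<^sup>2)" using p r r0 by (simp add: power_le_one)
  moreover have "norm (1 - z) > 0" using z by simp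
  ultimately have "p * (1 - r\<^sup>2) / (1 + r)\<^sup>2 \<le> p * (1 - r\<^sup>2) / (norm (1 - z))\<^sup>2"
    using r0 by (intro divide_left_mono mult_pos_pos) auto
  moreover have "p * (1 - r\<^sup>2) / (1 + r)\<^sup>2 = p * (1 - r) / (1 + r)"
  proof -
    have "p * (1 - r\<^sup>2) / (1 + r)\<^sup>2 = (p * (1 - r)) * (1 + r) / ((1 + r) * (1 + r))"
      by (simp add: power2_eq_square algebra_simps)
    also have "\<dots> = p * (1 - r) / (1 + r)" by (rule mult_divide_mult_cancel_right) (use r0 in simp)
    finally show ?thesis .
  qed
  ultimately show ?thesis using z r by (simp add: Re_mob)
qed

lemma mob_mobinv: "p > 0 \<Longrightarrow> Re s > 0 \<Longrightarrow> mob p (mobinv p s) = s"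
proof -
  assume p: "p > 0" and s: "Re s > 0"
  have n: "s + of_real p \<noteq> 0" using p s by (auto simp: complex_eq_iff)
  have "1 - mobinv p s = 2 * of_real p / (s + of_real p)" "1 + mobinv p s = 2 * s / (s + of_real p)"
    using n by (simp_all add: mobinv_def field_simps)
  thus ?thesis using n p by (simp add: mob_def)
qed

lemma holomorphic_mob: "mob p holomorphic_on ball 0 1"
  unfolding mob_def[abs_def] by (intro holomorphic_intros) auto

lemma continuous_mob_circle: "0 \<le> r \<Longrightarrow> r < 1 \<Longrightarrow> continuous_on A (\<lambda>t. mob p (of_real r * cis (2 * pi * t)))"
  by (rule continuous_on_compose2[OF holomorphic_on_imp_continuous_on[OF holomorphic_mob]])
     (auto intro!: continuous_intros simp: norm_mult)

lemma jensen_half_plane: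
  assumes k: "k holomorphic_on {s. Re s > 0}" and p: "p > 0" and r: "0 < r" "r < 1" and fin: "finite S"
    and S: "\<And>s. s \<in> S \<Longrightarrow> k s = 0 \<and> Re s > 0 \<and> s \<noteq> of_real p + \<i> * of_real \<tau> \<and> norm (mobinv p (s - \<i> * of_real \<tau>)) < r"
    and kp: "k (of_real p + \<i> * of_real \<tau>) \<noteq> 0"
    and M: "integral {0..1} (\<lambda>t. norm (k (mob p (of_real r * cis (2 * pi * t)) + \<i> * of_real \<tau>))) \<le> M"
  shows "(\<Sum>s\<in>S. ln (r / norm (mobinv p (s - \<i> * of_real \<tau>)))) \<le> ln M - ln (norm (k (of_real p + \<i> * of_real \<tau>)))"
proof -
  define g where "g = (\<lambda>s. mobinv p (s - \<i> * of_real \<tau>))"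
  define q where "q = (\<lambda>z. k (mob p z + \<i> * of_real \<tau>))"
  have inv: "mob p (g s) + \<i> * of_real \<tau> = s" if "s \<in> S" for s
    using mob_mobinv[OF p, of "s - \<i> * of_real \<tau>"] S[OF that] by (simp add: g_def)
  have inj: "inj_on g S" using inv by (metis inj_onI)
  have gn: "g s \<noteq> 0" if "s \<in> S" for s
  proof
    assume "g s = 0"
    hence "s = mob p 0 + \<i> * of_real \<tau>" using inv[OF that] by simp
    thus False using S[OF that] by (simp add: mob_def)
  qed
  have q0: "q 0 = k (of_real p + \<i> * of_real \<tau>)" by (simp add: q_def mob_def)
  have "norm (q 0) * (\<Prod>z\<in>g ` S. r / norm z) \<le> integral {0..1} (\<lambda>t. norm (q (of_real r * cis (2*pi*t))))"
  proof (rule jensen_prod[where R = 1])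
    show "q holomorphic_on ball 0 1"
      unfolding q_def
      by (rule holomorphic_on_compose_gen[OF _ k, unfolded o_def])
         (use Re_mob_pos[OF p] in \<open>auto intro!: holomorphic_intros holomorphic_mob\<close>)
    show "g ` S \<subseteq> ball 0 r - {0}" using S gn by (auto simp: g_def)
    show "q z = 0" if "z \<in> g ` S" for z using that inv S by (auto simp: q_def)
  qed (use r fin in auto)
  also have "\<dots> \<le> M" using M by (simp add: q_def)
  also have "(\<Prod>z\<in>g ` S. r / norm z) = (\<Prod>s\<in>S. r / norm (g s))" using inj by (simp add: prod.reindex)
  finally have le: "norm (q 0) * (\<Prod>s\<in>S. r / norm (g s)) \<le> M" .
  have pos: "r / norm (g s) > 0" if "s \<in> S" for s using gn[OF that] r by simp
  have P: "(\<Prod>s\<in>S. r / norm (g s)) > 0" using pos by (rule prod_pos)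
  have n0: "norm (q 0) > 0" using kp by (simp add: q0)
  have "ln (norm (q 0)) + (\<Sum>s\<in>S. ln (r / norm (g s))) = ln (norm (q 0) * (\<Prod>s\<in>S. r / norm (g s)))"
    unfolding ln_mult_pos[OF n0 P] using ln_prod[OF fin, of "\<lambda>s. r / norm (g s)"] pos by (metis less_numeral_extra(3))
  also have "\<dots> \<le> ln M" using le n0 P by (intro ln_mono) (auto intro: mult_pos_pos)
  finally show ?thesis by (simp add: g_def q0)
qed

text \<open>The square of \<open>norm (mobinv p s)\<close> is \<open>1 - 4 * p * Re s / D\<close>,
  where \<open>D\<close> is the square of \<open>norm (s + p)\<close> and is at most
  \<open>4 * p^2 + 1\<close> in the window. So each zero enters Jensen's inequality with at least a
  multiple of \<open>Re s\<close>, its weight in the counting function.\<close>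

lemma ln_norm_mobinv:
  assumes p: "p > 0" and s: "0 < Re s" "Re s < p" "\<bar>Im s\<bar> \<le> 1"
  shows "mobinv p s \<noteq> 0" "ln (norm (mobinv p s)) \<le> - (2 * p / (4 * p\<^sup>2 + 1)) * Re s"
proof -
  have "s \<noteq> of_real p" using s by auto
  moreover have d: "s + of_real p \<noteq> 0" using s p by (auto simp: complex_eq_iff)
  ultimately show nz: "mobinv p s \<noteq> 0" by (simp add: mobinv_def)
  define D where "D = (Re s + p)\<^sup>2 + (Im s)\<^sup>2"
  have Dpos: "D > 0" using s p by (auto simp: D_def intro!: add_pos_nonneg)
  have Dle: "D \<le> 4 * p\<^sup>2 + 1"
  proof -
    have "(Re s + p)\<^sup>2 \<le> (2 * p)\<^sup>2" using s by (intro power_mono) auto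
    moreover have "(Im s)\<^sup>2 \<le> 1" using s by (simp add: abs_square_le_1)
    ultimately show ?thesis by (simp add: D_def power_mult_distrib)
  qed
  have "(norm (mobinv p s))\<^sup>2 = ((Re s - p)\<^sup>2 + (Im s)\<^sup>2) / D"
    by (simp add: mobinv_def norm_divide power_divide cmod_power2 D_def)
  also have "(Re s - p)\<^sup>2 + (Im s)\<^sup>2 = D - 4 * p * Re s" by (simp add: D_def power2_eq_square algebra_simps)
  also have "(D - 4 * p * Re s) / D = 1 - 4 * p * Re s / D" using Dpos by (simp add: diff_divide_distrib)
  finally have sq: "(norm (mobinv p s))\<^sup>2 = 1 - 4 * p * Re s / D" .
  have "4 * p * Re s / (4 * p\<^sup>2 + 1) \<le> 4 * p * Re s / D" using Dle Dpos s p by (intro divide_left_mono mult_pos_pos) auto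
  hence "(norm (mobinv p s))\<^sup>2 - 1 \<le> - (4 * p * Re s / (4 * p\<^sup>2 + 1))" using sq by linarith
  moreover have "ln ((norm (mobinv p s))\<^sup>2) \<le> (norm (mobinv p s))\<^sup>2 - 1" using nz by (intro ln_le_minus_one) simp
  moreover have "ln ((norm (mobinv p s))\<^sup>2) = 2 * ln (norm (mobinv p s))" using nz by (simp add: ln_realpow)
  ultimately show "ln (norm (mobinv p s)) \<le> - (2 * p / (4 * p\<^sup>2 + 1)) * Re s" by simp
qed

text \<open>The radius \<open>r\<close> costs \<open>\<kappa> * \<sigma> / 2\<close> in each term,
  at most half of the gain \<open>\<kappa> * Re s\<close> because \<open>Re s > \<sigma>\<close>; in
  particular all counted zeros lie strictly inside the circle. It does not depend on
  \<open>\<tau>\<close>, so the inequality can be averaged over vertical translations.\<close>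

lemma zero_count_jensen:
  assumes G: "G0 \<Phi> c" and \<sigma>: "\<sigma> > 0" and w: "w \<noteq> c 1" and p: "p > 0"
    and k: "k holomorphic_on {s. Re s > 0}" and kz: "\<And>s. Re s > 0 \<Longrightarrow> \<Phi> s = w \<Longrightarrow> k s = 0 \<and> Re s < p"
    and \<kappa>: "\<kappa> = 2 * p / (4 * p\<^sup>2 + 1)" and r: "r = exp (- \<kappa> * \<sigma> / 2)"
    and kp: "k (of_real p + \<i> * of_real \<tau>) \<noteq> 0"
    and M: "integral {0..1} (\<lambda>t. norm (k (mob p (of_real r * cis (2 * pi * t)) + \<i> * of_real \<tau>))) \<le> M"
  shows "\<kappa> / 2 * zero_count c w \<sigma> (flow \<tau>) \<le> ln M - ln (norm (k (of_real p + \<i> * of_real \<tau>)))"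
proof -
  define Z where "Z = box_zeros \<Phi> w \<sigma> (\<bar>\<tau>\<bar> + 1)"
  define S where "S = {s \<in> Z. \<bar>Im s - \<tau>\<bar> < 1}"
  have finZ: "finite Z" unfolding Z_def by (rule finite_box_zeros[OF G \<sigma> w])
  have \<kappa>0: "\<kappa> > 0" unfolding \<kappa> using p by (intro divide_pos_pos) (auto intro: add_nonneg_pos)
  have r01: "0 < r" "r < 1" using \<kappa>0 \<sigma> by (auto simp: r)
  have SS: "Re s > \<sigma>" "Re s < p" "k s = 0" "\<bar>Im s - \<tau>\<bar> < 1" if "s \<in> S" for s
    using that kz[of s] \<sigma> by (auto simp: S_def Z_def box_zeros_def)
  have lnm: "mobinv p (s - \<i> * of_real \<tau>) \<noteq> 0" "ln (norm (mobinv p (s - \<i> * of_real \<tau>))) \<le> - \<kappa> * Re s" if "s \<in> S" for s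
    using ln_norm_mobinv[OF p, of "s - \<i> * of_real \<tau>"] SS[OF that] \<sigma> by (auto simp: \<kappa>)
  have half: "\<kappa> / 2 * Re s \<le> ln (r / norm (mobinv p (s - \<i> * of_real \<tau>)))" if s: "s \<in> S" for s
  proof -
    have "ln (r / norm (mobinv p (s - \<i> * of_real \<tau>))) = - \<kappa> * \<sigma> / 2 - ln (norm (mobinv p (s - \<i> * of_real \<tau>)))"
      using lnm(1)[OF s] r01 by (subst ln_div) (auto simp: r)
    moreover have "\<kappa> * \<sigma> \<le> \<kappa> * Re s" using SS(1)[OF s] \<kappa>0 by simp
    ultimately show ?thesis using lnm(2)[OF s] by simp
  qed
  have "zero_count c w \<sigma> (flow \<tau>) = (\<Sum>s\<in>Z. Re s * tent (Im s - \<tau>))"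
    unfolding Z_def by (rule zero_count_flow[OF G \<sigma> w order_refl])
  also have "\<dots> = (\<Sum>s\<in>S. Re s * tent (Im s - \<tau>))"
    by (rule sum.mono_neutral_right[OF finZ]) (auto simp: S_def intro!: tent_eq_0)
  also have "\<dots> \<le> (\<Sum>s\<in>S. Re s)"
    using SS(1) \<sigma> tent_le_1 by (intro sum_mono mult_left_le) (auto intro: less_imp_le less_trans)
  finally have "\<kappa> / 2 * zero_count c w \<sigma> (flow \<tau>) \<le> \<kappa> / 2 * (\<Sum>s\<in>S. Re s)" using \<kappa>0 by (intro mult_left_mono) auto
  also have "\<dots> = (\<Sum>s\<in>S. \<kappa> / 2 * Re s)" by (simp add: sum_distrib_left)
  also have "\<dots> \<le> (\<Sum>s\<in>S. ln (r / norm (mobinv p (s - \<i> * of_real \<tau>))))" by (rule sum_mono[OF half])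
  also have "\<dots> \<le> ln M - ln (norm (k (of_real p + \<i> * of_real \<tau>)))"
  proof (rule jensen_half_plane[OF k p r01 _ _ kp M])
    show "finite S" using finZ by (simp add: S_def)
    fix s assume s: "s \<in> S"
    have "0 < \<kappa> / 2 * Re s" using \<kappa>0 SS(1)[OF s] \<sigma> by simp
    hence "0 < ln (r / norm (mobinv p (s - \<i> * of_real \<tau>)))" using half[OF s] by linarith
    hence "1 < r / norm (mobinv p (s - \<i> * of_real \<tau>))" using lnm(1)[OF s] r01 by (subst (asm) ln_gt_zero_iff) auto
    hence "norm (mobinv p (s - \<i> * of_real \<tau>)) < r" using lnm(1)[OF s] by (simp add: less_divide_eq)
    thus "k s = 0 \<and> Re s > 0 \<and> s \<noteq> of_real p + \<i> * of_real \<tau> \<and> norm (mobinv p (s - \<i> * of_real \<tau>)) < r"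
      using SS[OF s] \<sigma> by auto
  qed
  finally show ?thesis .
qed

section \<open>Bounds for the counting function\<close>

lemma G0_holomorphic:
  assumes G: "G0 \<Phi> c" shows "\<Phi> holomorphic_on {s. Re s > 0}"
proof (rule holomorphic_uniform_sequence)
  show "open {s. Re s > 0}" by (rule open_halfspace_Re_gt)
  show "(\<lambda>s. \<Sum>n<N. c (Suc n) * of_nat (Suc n) powr (- s)) holomorphic_on {s. Re s > 0}" for N
    by (intro holomorphic_intros) (auto simp del: of_nat_Suc)
  fix x assume "x \<in> {s. Re s > 0}"
  hence x: "Re x > 0" by simp
  have "cball x (Re x / 2) \<subseteq> {s. Re s > Re x / 3}"
  proof
    fix s assume "s \<in> cball x (Re x / 2)"
    hence "Re x - Re s \<le> Re x / 2" using abs_Re_le_cmod[of "x - s"] by (simp add: dist_norm)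
    thus "s \<in> {s. Re s > Re x / 3}" using x by simp
  qed
  moreover have "{s. Re s > Re x / 3} \<subseteq> {s. Re s > 0}" using x by auto
  moreover have "uniform_limit {s. Re s > Re x / 3} (\<lambda>N s. \<Sum>n<N. c (Suc n) * of_nat (Suc n) powr (- s)) \<Phi> sequentially"
    using G[unfolded G0_def, THEN conjunct1, rule_format, of "Re x / 3"] x by simp
  ultimately show "\<exists>d>0. cball x d \<subseteq> {s. Re s > 0} \<and>
      uniform_limit (cball x d) (\<lambda>N s. \<Sum>n<N. c (Suc n) * of_nat (Suc n) powr (- s)) \<Phi> sequentially"
    using x by (intro exI[of _ "Re x / 2"]) (auto intro: uniform_limit_on_subset)
qed

lemma avg_limit_le:
  assumes i: "\<And>T. g integrable_on {-T..T}" and b: "\<And>t. g t \<le> K" and L: "(avg g \<longlongrightarrow> L) at_top"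
  shows "L \<le> K"
proof (rule tendsto_upperbound[OF L])
  show "\<forall>\<^sub>F T in at_top. avg g T \<le> K"
    using eventually_gt_at_top[of 0]
  proof eventually_elim
    fix T :: real assume T: "0 < T"
    have "avg g T \<le> avg (\<lambda>_. K) T" by (rule avg_mono[OF T i _ b]) auto
    also have "\<dots> = K" using T by (simp add: avg_def)
    finally show "avg g T \<le> K" .
  qed
qed simp

text \<open>\<open>1 - cnj w\<close> is the mirror image of \<open>w\<close> in the line of real
  part 1/2, and a point on the same side as \<open>w\<close> is closer to \<open>w\<close>.\<close>

lemma norm_reflect_le:
  assumes "Re u \<ge> 1/2" "Re w \<ge> 1/2"
  shows "norm (u - w) \<le> norm (u + cnj w - 1)"
proof (rule power2_le_imp_le)
  have "(norm (u + cnj w - 1))\<^sup>2 - (norm (u - w))\<^sup>2 = 4 * (Re u - 1/2) * (Re w - 1/2)"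
    unfolding cmod_power2 by (simp add: power2_eq_square algebra_simps)
  moreover have "0 \<le> 4 * (Re u - 1/2) * (Re w - 1/2)" using assms by simp
  ultimately show "(norm (u - w))\<^sup>2 \<le> (norm (u + cnj w - 1))\<^sup>2" by linarith
qed simp

text \<open>The base point is so far to the right that \<open>\<Phi>\<close> is within
  \<open>\<delta>/2\<close> of \<open>c 1\<close> there, hence at distance at least
  \<open>\<delta>/2\<close> from every admissible \<open>w\<close>; so the constants are uniform in
  \<open>w\<close>. Since \<open>norm (k s) \<le> 1\<close>, only the base point contributes, and
  there \<open>- ln (norm k)\<close> is at most \<open>2 * (Re w - 1/2)\<close> divided by
  \<open>\<delta>/2\<close>.\<close>

lemma mean_counting_linear_bound:
  assumes G: "G0 \<Phi> c" and d: "\<delta> > 0"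
  obtains C where "C > 0" "\<And>w. Re w > 1/2 \<Longrightarrow> w \<notin> ball (c 1) \<delta> \<Longrightarrow> mean_counting \<Phi> w \<le> C * (Re w - 1/2)"
proof -
  obtain p where p: "p > 0" "\<And>s. Re s \<ge> p \<Longrightarrow> norm (\<Phi> s - c 1) < \<delta>/2"
    using zeros_Re_bounded[OF G, of "\<delta>/2"] d by auto
  define \<kappa> where "\<kappa> = 2 * p / (4 * p\<^sup>2 + 1)"
  have \<kappa>0: "\<kappa> > 0" unfolding \<kappa>_def using p by (intro divide_pos_pos) (auto intro: add_nonneg_pos)
  \<comment> \<open>The time average is at most \<open>8 / (\<delta> * \<kappa>)\<close> times
    \<open>Re w - 1/2\<close>, and passing to the mean counting function multiplies by
    \<open>2 * pi\<close>.\<close>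
  define C where "C = 16 * pi / (\<delta> * \<kappa>)"
  have C: "C > 0" using d \<kappa>0 by (simp add: C_def)
  show ?thesis
  proof (rule that[OF C])
    fix w assume w: "Re w > 1/2" "w \<notin> ball (c 1) \<delta>"
    define k where "k = (\<lambda>s. (\<Phi> s - w) / (\<Phi> s + cnj w - 1))"
    have wc: "w \<noteq> c 1" using w d by auto
    have P: "Re (\<Phi> s) > 1/2" if "Re s > 0" for s using G that by (simp add: G0_def)
    have nz: "\<Phi> s + cnj w - 1 \<noteq> 0" if "Re s > 0" for s using P[OF that] w by (auto simp: complex_eq_iff)
    have kh: "k holomorphic_on {s. Re s > 0}"
      unfolding k_def using nz by (intro holomorphic_intros G0_holomorphic[OF G]) auto
    have kl: "norm (k s) \<le> 1" if "Re s > 0" for s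
      using norm_reflect_le[of "\<Phi> s" w] P[OF that] w nz[OF that] by (simp add: k_def norm_divide)
    have far: "norm (\<Phi> s - w) \<ge> \<delta>/2" if "Re s \<ge> p" for s
      using p(2)[OF that] w(2) norm_triangle_ineq4[of "\<Phi> s - w" "\<Phi> s - c 1"]
      by (simp add: dist_norm norm_minus_commute)
    have zc: "zero_count c w \<sigma> (flow \<tau>) \<le> 8 * (Re w - 1/2) / (\<delta> * \<kappa>)" if \<sigma>: "\<sigma> > 0" for \<sigma> \<tau>
    proof -
      define r where "r = exp (- \<kappa> * \<sigma> / 2)"
      have r: "0 < r" "r < 1" using \<kappa>0 \<sigma> by (auto simp: r_def)
      define s0 where "s0 = of_real p + \<i> * of_real \<tau>"
      have s0: "Re s0 = p" by (simp add: s0_def)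
      have f0: "norm (\<Phi> s0 - w) \<ge> \<delta>/2" by (rule far) (simp add: s0)
      have n0: "\<Phi> s0 + cnj w - 1 \<noteq> 0" by (rule nz) (simp add: s0 p)
      have k0: "k s0 \<noteq> 0" using f0 n0 d by (auto simp: k_def)
      have mp: "Re (mob p (of_real r * cis (2 * pi * t)) + \<i> * of_real \<tau>) > 0" for t
        using Re_mob_pos[of p "of_real r * cis (2 * pi * t)"] p r by (simp add: norm_mult)
      have "\<kappa> / 2 * zero_count c w \<sigma> (flow \<tau>) \<le> ln 1 - ln (norm (k s0))"
        unfolding s0_def
      proof (rule zero_count_jensen[OF G \<sigma> wc p(1) kh _ \<kappa>_def r_def])
        show "k (of_real p + \<i> * of_real \<tau>) \<noteq> 0" using k0 by (simp add: s0_def)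
        show "k s = 0 \<and> Re s < p" if "Re s > 0" "\<Phi> s = w" for s
          using far[of s] that d by (force simp: k_def)
        have "continuous_on {0..1} (\<lambda>t. k (mob p (of_real r * cis (2 * pi * t)) + \<i> * of_real \<tau>))"
          by (rule continuous_on_compose2[OF holomorphic_on_imp_continuous_on[OF kh]])
             (use r mp in \<open>auto intro!: continuous_intros continuous_mob_circle\<close>)
        hence "integral {0..1} (\<lambda>t. norm (k (mob p (of_real r * cis (2 * pi * t)) + \<i> * of_real \<tau>))) \<le> integral {0..1} (\<lambda>_::real. 1)"
          by (intro integral_le integrable_continuous_real continuous_intros kl mp)
        thus "integral {0..1} (\<lambda>t. norm (k (mob p (of_real r * cis (2 * pi * t)) + \<i> * of_real \<tau>))) \<le> 1" by simp
      qed
      also have "\<dots> = ln (norm (\<Phi> s0 + cnj w - 1) / norm (\<Phi> s0 - w))"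
        using f0 n0 d by (auto simp: k_def norm_divide ln_div)
      also have "\<dots> \<le> norm (\<Phi> s0 + cnj w - 1) / norm (\<Phi> s0 - w) - 1"
        using f0 n0 d by (intro ln_le_minus_one divide_pos_pos) auto
      also have "\<dots> = (norm (\<Phi> s0 + cnj w - 1) - norm (\<Phi> s0 - w)) / norm (\<Phi> s0 - w)"
        using f0 d by (auto simp: diff_divide_distrib)
      also have "\<dots> \<le> 2 * (Re w - 1/2) / (\<delta>/2)"
      proof (rule frac_le)
        have "\<Phi> s0 + cnj w - 1 = (\<Phi> s0 - w) + of_real (2 * (Re w - 1/2))" by (simp add: complex_eq_iff)
        hence "norm (\<Phi> s0 + cnj w - 1) \<le> norm (\<Phi> s0 - w) + norm (of_real (2 * (Re w - 1/2)) :: complex)"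
          by (simp only: norm_triangle_ineq)
        also have "norm (of_real (2 * (Re w - 1/2)) :: complex) = 2 * (Re w - 1/2)" unfolding norm_of_real using w by simp
        finally show "norm (\<Phi> s0 + cnj w - 1) - norm (\<Phi> s0 - w) \<le> 2 * (Re w - 1/2)" by simp
      qed (use f0 w d in auto)
      finally show ?thesis using \<kappa>0 d by (simp add: field_simps)
    qed
    show "mean_counting \<Phi> w \<le> C * (Re w - 1/2)"
    proof (rule mean_counting_bounds(2)[OF G wc])
      fix \<sigma> L :: real assume \<sigma>: "\<sigma> > 0" and L: "(avg (\<lambda>t. zero_count c w \<sigma> (flow t)) \<longlongrightarrow> L) at_top"
      have "L \<le> 8 * (Re w - 1/2) / (\<delta> * \<kappa>)" by (rule avg_limit_le[OF integrable_zero_count(1)[OF G \<sigma> wc] zc[OF \<sigma>] L])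
      hence "2 * pi * L \<le> 2 * pi * (8 * (Re w - 1/2) / (\<delta> * \<kappa>))" by (intro mult_left_mono) auto
      thus "2 * pi * L \<le> C * (Re w - 1/2)" by (simp add: C_def field_simps)
    qed
  qed
qed

section \<open>Square summable Dirichlet series on Re s >= 1\<close>

lemma h2_diff: "h2 a \<Longrightarrow> h2 b \<Longrightarrow> h2 (\<lambda>n. a n - b n)"
  unfolding h2_def
proof -
  assume a: "summable (\<lambda>n. (norm (a (Suc n)))\<^sup>2)" and b: "summable (\<lambda>n. (norm (b (Suc n)))\<^sup>2)"
  show "summable (\<lambda>n. (norm (a (Suc n) - b (Suc n)))\<^sup>2)"
  proof (rule summable_comparison_test'[OF summable_mult[OF summable_add[OF a b], of 2], of 0])
    fix n
    have "(norm (a (Suc n) - b (Suc n)))\<^sup>2 \<le> (norm (a (Suc n)) + norm (b (Suc n)))\<^sup>2"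
      by (intro power_mono norm_triangle_ineq4) auto
    also have "\<dots> \<le> 2 * ((norm (a (Suc n)))\<^sup>2 + (norm (b (Suc n)))\<^sup>2)"
      using sum_squares_bound[of "norm (a (Suc n))" "norm (b (Suc n))"] by (simp add: power2_sum)
    finally show "norm ((norm (a (Suc n) - b (Suc n)))\<^sup>2) \<le> 2 * ((norm (a (Suc n)))\<^sup>2 + (norm (b (Suc n)))\<^sup>2)" by simp
  qed
qed

lemma sum_inverse_squares_le: "(\<Sum>n<J. (1 / real (Suc n))\<^sup>2) \<le> 2"
proof -
  have "(\<Sum>n<Suc J. (1 / real (Suc n))\<^sup>2) \<le> 2 - 1 / real (Suc J)" for J
  proof (induction J)
    case (Suc J)
    define x where "x = real (Suc J)"
    have x: "x > 0" "real (Suc (Suc J)) = x + 1" by (auto simp: x_def)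
    have "(1 / (x + 1)) * (1 / (x + 1)) \<le> (1 / x) * (1 / (x + 1))"
      by (rule mult_right_mono) (use x in \<open>auto intro!: divide_left_mono\<close>)
    also have "\<dots> = 1 / x - 1 / (x + 1)" using x by (simp add: field_simps)
    finally have "(1 / real (Suc (Suc J)))\<^sup>2 \<le> 1 / real (Suc J) - 1 / real (Suc (Suc J))"
      unfolding x(2) power2_eq_square by (simp add: x_def)
    thus ?case using Suc by simp
  qed simp
  moreover have "(\<Sum>n<J. (1 / real (Suc n))\<^sup>2) \<le> (\<Sum>n<Suc J. (1 / real (Suc n))\<^sup>2)" by simp
  ultimately show ?thesis by (smt (verit) divide_nonneg_nonneg of_nat_0_le_iff)
qed

lemma norm_dpoly_le:
  assumes "h2 b" "Re s \<ge> 1" shows "norm (dpoly J (\<lambda>n. b (Suc n)) s) \<le> sqrt 2 * h2norm b"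
proof -
  have "norm (dpoly J (\<lambda>n. b (Suc n)) s) \<le> (\<Sum>n<J. \<bar>norm (b (Suc n))\<bar> * \<bar>1 / real (Suc n)\<bar>)"
    unfolding dpoly_def
  proof (rule order_trans[OF norm_sum sum_mono])
    fix n
    have "real (Suc n) powr (- Re s) \<le> real (Suc n) powr (- 1)" using assms by (intro powr_mono) auto
    also have "\<dots> = 1 / real (Suc n)" by (simp add: powr_minus_divide del: of_nat_Suc)
    finally have "norm (b (Suc n)) * real (Suc n) powr (- Re s) \<le> norm (b (Suc n)) * (1 / real (Suc n))"
      by (rule mult_left_mono) simp
    thus "norm (b (Suc n) * of_nat (Suc n) powr (- s)) \<le> \<bar>norm (b (Suc n))\<bar> * \<bar>1 / real (Suc n)\<bar>"
      unfolding norm_mult norm_Suc_powr by (simp del: of_nat_Suc)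
  qed
  also have "\<dots> \<le> L2_set (\<lambda>n. norm (b (Suc n))) {..<J} * L2_set (\<lambda>n. 1 / real (Suc n)) {..<J}"
    by (rule L2_set_mult_ineq)
  also have "\<dots> \<le> h2norm b * sqrt 2"
  proof (rule mult_mono)
    show "L2_set (\<lambda>n. norm (b (Suc n))) {..<J} \<le> h2norm b"
      unfolding L2_set_def h2norm_def by (intro real_sqrt_le_mono sum_le_suminf) (use assms in \<open>auto simp: h2_def\<close>)
    show "L2_set (\<lambda>n. 1 / real (Suc n)) {..<J} \<le> sqrt 2"
      unfolding L2_set_def by (rule real_sqrt_le_mono[OF sum_inverse_squares_le])
  qed (use h2norm_nonneg[OF assms(1)] in \<open>auto simp: L2_set_nonneg\<close>)
  finally show ?thesis by (simp add: mult.commute)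
qed

lemma norm_dirichlet_diff_le:
  assumes b: "h2 b" and g: "h2 g" and s: "Re s \<ge> 1"
  shows "norm (dirichlet b s - dirichlet g s) \<le> sqrt 2 * h2norm (\<lambda>n. b n - g n)"
proof (rule field_le_epsilon)
  fix e :: real assume e: "e > 0"
  hence e2: "e/2 > 0" by simp
  obtain J1 where J1: "\<And>J s. J \<ge> J1 \<Longrightarrow> Re s \<ge> 1 \<Longrightarrow> norm (dirichlet b s - dpoly J (\<lambda>n. b (Suc n)) s) \<le> e/2"
    using dirichlet_approx[OF b e2] by blast
  obtain J2 where J2: "\<And>J s. J \<ge> J2 \<Longrightarrow> Re s \<ge> 1 \<Longrightarrow> norm (dirichlet g s - dpoly J (\<lambda>n. g (Suc n)) s) \<le> e/2"
    using dirichlet_approx[OF g e2] by blast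
  define J where "J = max J1 J2"
  let ?x = "dirichlet b s - dpoly J (\<lambda>n. b (Suc n)) s" and ?y = "dirichlet g s - dpoly J (\<lambda>n. g (Suc n)) s"
  let ?z = "dpoly J (\<lambda>n. b (Suc n) - g (Suc n)) s"
  have "dirichlet b s - dirichlet g s = ?x - ?y + ?z" by (simp add: dpoly_diff[symmetric])
  hence "norm (dirichlet b s - dirichlet g s) \<le> norm (?x - ?y) + norm ?z" by (simp only: norm_triangle_ineq)
  moreover have "norm (?x - ?y) \<le> norm ?x + norm ?y" by (rule norm_triangle_ineq4)
  moreover have "norm ?x \<le> e/2" "norm ?y \<le> e/2" using J1[of J s] J2[of J s] s by (auto simp: J_def)
  moreover have "norm ?z \<le> sqrt 2 * h2norm (\<lambda>n. b n - g n)"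
    using norm_dpoly_le[OF h2_diff[OF b g] s, of J] by simp
  ultimately show "norm (dirichlet b s - dirichlet g s) \<le> sqrt 2 * h2norm (\<lambda>n. b n - g n) + e" by linarith
qed

lemma norm_dirichlet_le:
  assumes "h2 b" "Re s \<ge> 1" shows "norm (dirichlet b s) \<le> sqrt 2 * h2norm b"
  using norm_dirichlet_diff_le[OF assms(1) _ assms(2), of "\<lambda>_. 0"] by (simp add: h2_def dirichlet_def)

lemma dirichlet_zero_imp_coeff_zero:
  assumes g: "h2 g" and z: "\<And>s. Re s \<ge> 1 \<Longrightarrow> dirichlet g s = 0"
  shows "g (Suc n) = 0"
proof -
  have "norm (g (Suc n)) / real (Suc n) \<le> 0"
  proof (rule field_le_epsilon)
    fix d :: real assume d: "d > 0"
    obtain J0 where J0: "\<And>J s. J \<ge> J0 \<Longrightarrow> Re s \<ge> 1 \<Longrightarrow> norm (dirichlet g s - dpoly J (\<lambda>n. g (Suc n)) s) \<le> d"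
      using dirichlet_approx[OF g d] by blast
    define J where "J = max J0 (Suc n)"
    have J: "J \<ge> J0" "n < J" by (auto simp: J_def)
    have "(\<Sum>n<J. (norm (g (Suc n)) * real (Suc n) powr (- 1))\<^sup>2) \<le> d\<^sup>2"
      by (rule dpoly_coeff_bound) (use J0[OF J(1)] z in auto)
    moreover have "(norm (g (Suc n)) * real (Suc n) powr (- 1))\<^sup>2 \<le> (\<Sum>n<J. (norm (g (Suc n)) * real (Suc n) powr (- 1))\<^sup>2)"
      by (rule member_le_sum) (use J in auto)
    ultimately have "(norm (g (Suc n)) * real (Suc n) powr (- 1))\<^sup>2 \<le> d\<^sup>2" by linarith
    hence "norm (g (Suc n)) * real (Suc n) powr (- 1) \<le> d" by (rule power2_le_imp_le) (use d in simp)
    thus "norm (g (Suc n)) / real (Suc n) \<le> 0 + d" by (simp add: powr_minus_divide del: of_nat_Suc)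
  qed
  thus ?thesis by (simp add: divide_le_0_iff del: of_nat_Suc)
qed

section \<open>The bound obtained from one test function\<close>

lemma dpoly_has_derivative:
  "(dpoly K \<alpha> has_field_derivative dpoly K (\<lambda>n. - of_real (ln (real (Suc n))) * \<alpha> n) z) (at z)"
proof -
  have "((\<lambda>s. \<alpha> n * of_nat (Suc n) powr (- s)) has_field_derivative
     (- of_real (ln (real (Suc n))) * \<alpha> n) * of_nat (Suc n) powr (- z)) (at z)" for n
  proof -
    have "((\<lambda>s. of_nat (Suc n) powr (- s)) has_field_derivative (Ln (of_nat (Suc n)) * of_nat (Suc n) powr (- z)) * (- 1)) (at z)"
      by (rule DERIV_chain2[OF has_field_derivative_powr_right])
         (auto intro!: derivative_eq_intros simp del: of_nat_Suc)
    from DERIV_cmult[OF this, of "\<alpha> n"] show ?thesis by (simp add: Ln_of_nat mult_ac del: of_nat_Suc)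
  qed
  thus ?thesis unfolding dpoly_def[abs_def] by (intro DERIV_sum)
qed

lemma dirichlet_finite: "(\<And>n. n > K \<Longrightarrow> a n = 0) \<Longrightarrow> dirichlet a s = dpoly K (\<lambda>n. a (Suc n)) s"
  unfolding dirichlet_def dpoly_def by (rule suminf_finite) auto

lemma deriv_dirichlet_finite:
  assumes "\<And>n. n > K \<Longrightarrow> a n = 0"
  shows "deriv (dirichlet a) z = dpoly K (\<lambda>n. - of_real (ln (real (Suc n))) * a (Suc n)) z"
proof -
  have "dirichlet a = dpoly K (\<lambda>n. a (Suc n))" using dirichlet_finite[OF assms] by auto
  thus ?thesis using DERIV_imp_deriv[OF dpoly_has_derivative] by simp
qed

lemma dapprox_dpoly_compose:
  assumes G: "G0 \<Phi> c" and e: "\<epsilon> > 0" shows "dapprox \<epsilon> (\<lambda>s. dpoly K \<gamma> (\<Phi> s))"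
proof -
  have e0: "\<epsilon> \<ge> 0" using e by simp
  have "(\<lambda>s. dpoly K \<gamma> (\<Phi> s)) = (\<lambda>s. \<Sum>n<K. \<gamma> n * exp (- of_real (ln (real (Suc n))) * \<Phi> s))"
    by (auto simp: dpoly_def powr_def Ln_of_nat mult_ac fun_eq_iff simp del: of_nat_Suc)
  moreover have "dapprox \<epsilon> (\<lambda>s. \<Sum>n<K. \<gamma> n * exp (- of_real (ln (real (Suc n))) * \<Phi> s))"
    by (intro dapprox_sum[OF e0] dapprox_mult[OF e0] dapprox_exp[OF e0] dapprox_const[OF e0] dapprox_G0[OF G e]) auto
  ultimately show ?thesis by simp
qed

text \<open>At the base points of real part 1 the square of \<open>norm (E s)\<close> is at most
  \<open>2 * \<beta> \<le> 1/2\<close>, so \<open>- ln (norm (k s)) \<le> 4 * \<beta>\<close>. On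
  the circle \<open>ln (1 + I \<tau>) \<le> I \<tau>\<close>, and the averages of \<open>I\<close>
  are asymptotically at most \<open>\<beta>\<close>. With \<open>\<kappa> = 2/5\<close> this yields
  \<open>25 * \<beta>\<close> for the time average and \<open>50 * pi * \<beta>\<close> after
  normalisation.\<close>

lemma mean_counting_test_bound:
  assumes G: "G0 \<Phi> c" and w: "Re w > 1/2" "w \<noteq> c 1"
    and a: "\<And>n. n > K \<Longrightarrow> a n = 0" and ab: "DPhi_image \<Phi> a b"
    and g0: "deriv (dirichlet a) w \<noteq> 0" and \<beta>: "\<beta> = (h2norm b / norm (deriv (dirichlet a) w))\<^sup>2" "\<beta> \<le> 1/4"
  shows "0 \<le> mean_counting \<Phi> w" "mean_counting \<Phi> w \<le> 50 * pi * \<beta>"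
proof -
  define \<gamma> where "\<gamma> = (\<lambda>n. - of_real (ln (real (Suc n))) * a (Suc n))"
  define h where "h = (\<lambda>s. dpoly K \<gamma> (\<Phi> s))"
  define q where "q = deriv (dirichlet a) w"
  have q0: "q \<noteq> 0" using g0 by (simp add: q_def)
  have dd: "deriv (dirichlet a) z = dpoly K \<gamma> z" for z unfolding \<gamma>_def by (rule deriv_dirichlet_finite[OF a])
  have b: "h2 b" using ab by (simp add: DPhi_image_def)
  have hb: "h s = dirichlet b s" if "Re s > 1/2" for s using ab that by (simp add: DPhi_image_def h_def dd)
  define E where "E = (\<lambda>s. h s / q)"
  define k where "k = (\<lambda>s. 1 - (E s)\<^sup>2)"
  have hh: "h holomorphic_on {s. Re s > 0}"
    unfolding h_def dpoly_def by (intro holomorphic_intros G0_holomorphic[OF G]) (auto simp del: of_nat_Suc)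
  have Eh: "E holomorphic_on {s. Re s > 0}" unfolding E_def using q0 by (intro holomorphic_intros hh) auto
  have kh: "k holomorphic_on {s. Re s > 0}" unfolding k_def by (intro holomorphic_intros Eh)
  have \<beta>0: "\<beta> \<ge> 0" by (simp add: \<beta>(1))
  have Efar: "(norm (E s))\<^sup>2 \<le> 2 * \<beta>" if "Re s \<ge> 1" for s
  proof -
    have "norm (h s) \<le> sqrt 2 * h2norm b" using norm_dirichlet_le[OF b that] hb[of s] that by simp
    hence "norm (E s) \<le> sqrt 2 * (h2norm b / norm q)" by (simp add: E_def norm_divide divide_right_mono)
    hence "(norm (E s))\<^sup>2 \<le> (sqrt 2 * (h2norm b / norm q))\<^sup>2" by (intro power_mono) auto
    also have "\<dots> = 2 * \<beta>" unfolding power_mult_distrib by (simp add: \<beta>(1) q_def)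
    finally show ?thesis .
  qed
  have klow: "norm (k s) \<ge> 1 - (norm (E s))\<^sup>2" for s
    using norm_triangle_ineq2[of 1 "(E s)\<^sup>2"] by (simp add: k_def norm_power)
  have kup: "norm (k s) \<le> 1 + (norm (E s))\<^sup>2" for s
    using norm_triangle_ineq4[of 1 "(E s)\<^sup>2"] by (simp add: k_def norm_power)
  have kfar: "- ln (norm (k s)) \<le> 4 * \<beta>" "norm (k s) > 0" if "Re s \<ge> 1" for s
  proof -
    define x where "x = (norm (E s))\<^sup>2"
    have x: "0 \<le> x" "x \<le> 2 * \<beta>" "x \<le> 1/2" using Efar[OF that] \<beta>(2) by (auto simp: x_def)
    have "- x - 2 * x\<^sup>2 \<le> ln (1 - x)" by (rule ln_one_minus_pos_lower_bound) (use x in auto)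
    moreover have "x\<^sup>2 \<le> x * (1/2)" unfolding power2_eq_square using x by (intro mult_left_mono) auto
    moreover have "ln (1 - x) \<le> ln (norm (k s))" using klow[of s] x by (intro ln_mono) (auto simp: x_def)
    ultimately show "- ln (norm (k s)) \<le> 4 * \<beta>" using x by linarith
    show "norm (k s) > 0" using klow[of s] x unfolding x_def by linarith
  qed
  have bd: "2 * pi * L \<le> 50 * pi * \<beta>"
    if \<sigma>: "\<sigma> > 0" and L: "(avg (\<lambda>t. zero_count c w \<sigma> (flow t)) \<longlongrightarrow> L) at_top" for \<sigma> L
  proof -
    define \<kappa> :: real where "\<kappa> = 2 * 1 / (4 * 1\<^sup>2 + 1)"
    define r where "r = exp (- \<kappa> * \<sigma> / 2)"
    have r: "0 < r" "r < 1" using \<sigma> by (auto simp: r_def \<kappa>_def)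
    define m where "m = (\<lambda>t. mob 1 (of_real r * cis (2 * pi * t)))"
    define e where "e = (1 - r) / (1 + r)"
    have e: "0 < e" "e \<le> 1" using r by (auto simp: e_def field_simps)
    have mre: "Re (m t) \<ge> e" for t
      using Re_mob_ge[of 1 "of_real r * cis (2 * pi * t)" r] r by (simp add: m_def e_def norm_mult)
    have mp: "Re (m t + \<i> * of_real \<tau>) > 0" for t \<tau> using mre[of t] e by simp
    have mc: "continuous_on A m" for A unfolding m_def using r by (intro continuous_mob_circle) auto
    define F where "F = (\<lambda>\<tau> t. (norm (E (m t + \<i> * of_real \<tau>)))\<^sup>2)"
    have Fc: "continuous_on A (\<lambda>x. F (fst x) (snd x))" for A
      unfolding F_def
      by (intro continuous_intros continuous_on_compose2[OF holomorphic_on_imp_continuous_on[OF Eh]]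
          continuous_on_compose2[OF mc[of UNIV]]) (use mp in auto)
    have Fct: "continuous_on A (F \<tau>)" for \<tau> A
      using continuous_on_compose2[OF Fc[of UNIV], of A "\<lambda>t. (\<tau>, t)"]
        continuous_on_Pair[OF continuous_on_const continuous_on_id, of A \<tau>] by simp
    have Fc\<tau>: "continuous_on A (\<lambda>\<tau>. F \<tau> t)" for t A
      using continuous_on_compose2[OF Fc[of UNIV], of A "\<lambda>\<tau>. (\<tau>, t)"]
        continuous_on_Pair[OF continuous_on_id continuous_on_const, of A t] by simp
    define I where "I = (\<lambda>\<tau>. integral {0..1} (F \<tau>))"
    have zc: "zero_count c w \<sigma> (flow \<tau>) \<le> 5 * I \<tau> + 20 * \<beta>" for \<tau>
    proof -
      have I0: "I \<tau> \<ge> 0" unfolding I_def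
        by (rule Henstock_Kurzweil_Integration.integral_nonneg[OF integrable_continuous_real[OF Fct]]) (simp add: F_def)
      have "\<kappa> / 2 * zero_count c w \<sigma> (flow \<tau>) \<le> ln (1 + I \<tau>) - ln (norm (k (of_real 1 + \<i> * of_real \<tau>)))"
      proof (rule zero_count_jensen[OF G \<sigma> w(2) zero_less_one kh _ \<kappa>_def r_def])
        show "k s = 0 \<and> Re s < 1" if "Re s > 0" "\<Phi> s = w" for s
        proof
          show "k s = 0" using that q0 by (simp add: k_def E_def h_def q_def dd)
          thus "Re s < 1" using kfar(2)[of s] by (cases "Re s \<ge> 1") auto
        qed
        show "k (of_real 1 + \<i> * of_real \<tau>) \<noteq> 0" using kfar(2)[of "of_real 1 + \<i> * of_real \<tau>"] by auto
        have "continuous_on {0..1} (\<lambda>t. k (m t + \<i> * of_real \<tau>))"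
          by (rule continuous_on_compose2[OF holomorphic_on_imp_continuous_on[OF kh]])
             (use mp in \<open>auto intro!: continuous_intros mc\<close>)
        hence "integral {0..1} (\<lambda>t. norm (k (m t + \<i> * of_real \<tau>))) \<le> integral {0..1} (\<lambda>t. 1 + F \<tau> t)"
          unfolding F_def by (intro integral_le integrable_continuous_real continuous_intros kup Fct[unfolded F_def])
        also have "\<dots> = 1 + I \<tau>"
          unfolding I_def by (subst Henstock_Kurzweil_Integration.integral_add) (auto intro!: integrable_continuous_real Fct)
        finally show "integral {0..1} (\<lambda>t. norm (k (mob 1 (of_real r * cis (2 * pi * t)) + \<i> * of_real \<tau>))) \<le> 1 + I \<tau>"
          by (simp add: m_def)
      qed
      also have "ln (1 + I \<tau>) \<le> I \<tau>" by (rule ln_add_one_self_le_self[OF I0])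
      also have "I \<tau> - ln (norm (k (of_real 1 + \<i> * of_real \<tau>))) \<le> I \<tau> + 4 * \<beta>"
        using kfar(1)[of "of_real 1 + \<i> * of_real \<tau>"] by simp
      finally show ?thesis by (simp add: \<kappa>_def)
    qed
    have Ic: "continuous_on A I" for A
    proof -
      have "continuous_on UNIV I"
        unfolding I_def box_real[symmetric]
        by (rule integral_continuous_on_param) (use Fc[of "UNIV \<times> cbox 0 1"] in \<open>simp add: case_prod_unfold\<close>)
      thus ?thesis by (rule continuous_on_subset) auto
    qed
    have "L \<le> 25 * \<beta>"
    proof (rule field_le_epsilon)
      fix \<eta> :: real assume \<eta>: "\<eta> > 0"
      \<comment> \<open>Scaled so that the error is \<open>\<eta>\<close> after division by the
        square of \<open>norm q\<close> and multiplication by 5.\<close>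
      define \<zeta> where "\<zeta> = \<eta> * (norm q)\<^sup>2 / 5"
      have \<zeta>: "\<zeta> > 0" using \<eta> q0 by (simp add: \<zeta>_def)
      have hc: "continuous_on {s. Re s \<ge> e} h"
        by (rule continuous_on_subset[OF holomorphic_on_imp_continuous_on[OF hh]]) (use e in auto)
      have da: "dapprox e h" unfolding h_def by (rule dapprox_dpoly_compose[OF G e(1)])
      obtain T0 where T0: "T0 > 0" "\<And>T s. T \<ge> T0 \<Longrightarrow> Re s \<ge> e \<Longrightarrow>
         avg (\<lambda>t. (norm (h (s + \<i> * of_real t)))\<^sup>2) T \<le> (h2norm b)\<^sup>2 + \<zeta>"
        using mean_square_le[OF e da hc b hb \<zeta>] by blast
      have "avg (\<lambda>t. zero_count c w \<sigma> (flow t)) T \<le> 25 * \<beta> + \<eta>" if T: "T \<ge> T0" for T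
      proof -
        have T': "T > 0" using T T0(1) by linarith
        have Fa: "integral {-T..T} (\<lambda>\<tau>. F \<tau> t) \<le> 2 * T * (\<beta> + \<eta>/5)" for t
        proof -
          have "integral {-T..T} (\<lambda>\<tau>. F \<tau> t) = integral {-T..T} (\<lambda>\<tau>. (norm (h (m t + \<i> * of_real \<tau>)))\<^sup>2 / (norm q)\<^sup>2)"
            by (simp add: F_def E_def norm_divide power_divide)
          also have "\<dots> = 2 * T * avg (\<lambda>\<tau>. (norm (h (m t + \<i> * of_real \<tau>)))\<^sup>2) T / (norm q)\<^sup>2"
            using T' by (simp add: avg_def)
          also have "\<dots> \<le> 2 * T * ((h2norm b)\<^sup>2 + \<zeta>) / (norm q)\<^sup>2"
            using T' by (intro divide_right_mono mult_left_mono T0(2)[OF T mre]) auto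
          also have "\<dots> = 2 * T * (\<beta> + \<eta>/5)" using q0 by (simp add: \<beta>(1) q_def[symmetric] power_divide \<zeta>_def field_simps)
          finally show ?thesis .
        qed
        \<comment> \<open>For fixed \<open>t\<close> the translates of \<open>m t\<close> run along
          one vertical line in \<open>Re s \<ge> e\<close>; averaging over \<open>\<tau>\<close>
          first is what brings in the mean square bound.\<close>
        have "integral {-T..T} I = integral {0..1} (\<lambda>t. integral {-T..T} (\<lambda>\<tau>. F \<tau> t))"
          unfolding I_def using integral_swap_continuous[of "-T" 0 T 1 F] Fc by (simp add: case_prod_unfold)
        also have "\<dots> \<le> integral {0..1} (\<lambda>_::real. 2 * T * (\<beta> + \<eta>/5))"
        proof (rule integral_le)
          have "continuous_on UNIV (\<lambda>t. integral (cbox (-T) T) (\<lambda>\<tau>. F \<tau> t))"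
          proof (rule integral_continuous_on_param)
            have "continuous_on UNIV (\<lambda>x. F (fst (prod.swap x)) (snd (prod.swap x)))"
              by (rule continuous_on_compose2[OF Fc[of UNIV]]) (auto intro!: continuous_intros continuous_on_swap)
            thus "continuous_on (UNIV \<times> cbox (-T) T) (\<lambda>(t, \<tau>). F \<tau> t)"
              by (auto simp: case_prod_unfold intro: continuous_on_subset)
          qed
          thus "(\<lambda>t. integral {-T..T} (\<lambda>\<tau>. F \<tau> t)) integrable_on {0..1}"
            by (intro integrable_continuous_real) (auto intro: continuous_on_subset)
        qed (use Fa in auto)
        also have "\<dots> = 2 * T * (\<beta> + \<eta>/5)" by simp
        finally have aI: "integral {-T..T} I \<le> 2 * T * (\<beta> + \<eta>/5)" .
        have "avg (\<lambda>t. zero_count c w \<sigma> (flow t)) T \<le> avg (\<lambda>\<tau>. 5 * I \<tau> + 20 * \<beta>) T"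
          by (rule avg_mono[OF T' integrable_zero_count(1)[OF G \<sigma> w(2)] _ zc])
             (intro integrable_continuous_real continuous_intros Ic)
        also have "\<dots> = (5 * integral {-T..T} I + 2 * T * (20 * \<beta>)) / (2 * T)"
        proof -
          have "integral {-T..T} (\<lambda>\<tau>. 5 * I \<tau> + 20 * \<beta>) = integral {-T..T} (\<lambda>\<tau>. 5 * I \<tau>) + integral {-T..T} (\<lambda>\<tau>. 20 * \<beta>)"
            by (intro Henstock_Kurzweil_Integration.integral_add integrable_continuous_real continuous_intros Ic)
          thus ?thesis using T' by (simp add: avg_def)
        qed
        also have "\<dots> \<le> (5 * (2 * T * (\<beta> + \<eta>/5)) + 2 * T * (20 * \<beta>)) / (2 * T)"
          using aI T' by (intro divide_right_mono add_right_mono mult_left_mono) auto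
        also have "\<dots> = 25 * \<beta> + \<eta>" using T' by (simp add: field_simps)
        finally show ?thesis .
      qed
      thus "L \<le> 25 * \<beta> + \<eta>"
        by (intro tendsto_upperbound[OF L]) (auto intro: eventually_mono[OF eventually_ge_at_top[of T0]])
    qed
    hence "2 * pi * L \<le> 2 * pi * (25 * \<beta>)" by (intro mult_left_mono) auto
    thus ?thesis by simp
  qed
  show "0 \<le> mean_counting \<Phi> w" by (rule mean_counting_bounds(1)[OF G w(2) bd])
  show "mean_counting \<Phi> w \<le> 50 * pi * \<beta>" by (rule mean_counting_bounds(2)[OF G w(2) bd])
qed

section \<open>Test functions\<close>

definition test_start :: "complex \<Rightarrow> nat" where
  "test_start w = nat \<lfloor>exp (1 / (Re w - 1/2))\<rfloor>"

definition test_mass :: "complex \<Rightarrow> real" where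
  "test_mass w = (\<Sum>n\<in>{test_start w..<(test_start w)\<^sup>2}. real n powr (- 2 * Re w))"

text \<open>A normalised block of the reproducing kernel at \<open>w\<close>. The frequencies run from \<open>N\<close> to \<open>N\<^sup>2\<close> with
  \<open>ln N\<close> about \<open>1 / (Re w - 1/2)\<close>: on this range \<open>n powr (1 - 2 * Re w)\<close> is bounded below, and \<open>ln n\<close> is
  large enough for the derivative at \<open>w\<close> to have the maximal order \<open>(Re w - 1/2) powr (-3/2)\<close>.\<close>

definition test_coeff :: "complex \<Rightarrow> nat \<Rightarrow> complex" where
  "test_coeff w n = (if n \<in> {test_start w..<(test_start w)\<^sup>2}
     then of_nat n powr (- cnj w) / of_real (sqrt (test_mass w)) else 0)"

lemma sum_inverse_ge_ln:
  assumes "1 \<le> m" "m \<le> n" shows "ln (real n) - ln (real m) \<le> (\<Sum>k\<in>{m..<n}. 1 / real k)"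
  using assms(2)
proof (induction n rule: dec_induct)
  case (step n)
  have n: "real n > 0" using step assms(1) by simp
  have "ln (real (Suc n)) - ln (real n) = ln (real (Suc n) / real n)" using n by (simp add: ln_div)
  also have "real (Suc n) / real n = 1 + 1 / real n" using n by (simp add: field_simps)
  also have "ln (1 + 1 / real n) \<le> 1 / real n" by (rule ln_add_one_self_le_self) simp
  finally show ?case using step by simp
qed simp

context
  fixes w :: complex
  assumes w: "1/2 < Re w" "Re w \<le> 1"
begin

text \<open>With \<open>y = exp (1 / (2 * r))\<close>, which is at least 2, the floor of
  \<open>y * y\<close> is still at least \<open>y\<close>; rounding down therefore costs at most a
  factor 2 in the logarithm.\<close>

lemma test_start_bounds:
  "1 / (2 * (Re w - 1/2)) \<le> ln (real (test_start w))" "real (test_start w) \<le> exp (1 / (Re w - 1/2))"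
  "test_start w \<ge> 2" "1 \<le> ln (real (test_start w))"
proof -
  define r where "r = Re w - 1/2"
  have r: "0 < r" "r \<le> 1/2" using w by (auto simp: r_def)
  define y where "y = exp (1 / (2 * r))"
  have r1: "1 \<le> 1 / (2 * r)" using r by simp
  have y2: "y \<ge> 2" using exp_ge_add_one_self[of "1 / (2 * r)"] r1 unfolding y_def by linarith
  have yy: "exp (1 / r) = y * y" unfolding y_def exp_add[symmetric] using r by (simp add: field_simps)
  have fl: "real (test_start w) = of_int \<lfloor>y * y\<rfloor>"
    unfolding test_start_def r_def[symmetric] yy using y2 by simp
  show "real (test_start w) \<le> exp (1 / (Re w - 1/2))" unfolding fl r_def[symmetric] yy by simp
  have "y * 2 \<le> y * y" using y2 by (intro mult_left_mono) auto
  hence "y \<le> y * y - 1" using y2 by linarith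
  hence ge: "y \<le> real (test_start w)" unfolding fl using floor_correct[of "y * y"] by linarith
  thus "test_start w \<ge> 2" using y2 by linarith
  have "1 / (2 * r) = ln y" by (simp add: y_def)
  also have "\<dots> \<le> ln (real (test_start w))" using ge y2 by (intro ln_mono) auto
  finally show 1: "1 / (2 * (Re w - 1/2)) \<le> ln (real (test_start w))" by (simp add: r_def)
  show "1 \<le> ln (real (test_start w))" using 1 r1 by (simp add: r_def)
qed

text \<open>With \<open>r = Re w - 1/2\<close>, the bounds \<open>n \<le> N^2\<close> and
  \<open>ln N \<le> 1 / r\<close> give \<open>n powr (- 2 * r) \<ge> exp (- 4)\<close> on the block,
  and the harmonic sum from \<open>N\<close> to \<open>N^2\<close> is at least
  \<open>ln N\<close>.\<close>

lemma test_mass_ge: "exp (- 4) * ln (real (test_start w)) \<le> test_mass w"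
proof -
  define r where "r = Re w - 1/2"
  have r: "0 < r" using w by (auto simp: r_def)
  define N where "N = test_start w"
  have N: "N \<ge> 2" "N \<le> N\<^sup>2" "ln (real N) \<le> 1 / r"
    using test_start_bounds ln_mono[of "real N" "exp (1 / r)"] by (auto simp: N_def r_def power2_eq_square)
  have "exp (- 4) * ln (real N) = exp (- 4) * (ln (real (N\<^sup>2)) - ln (real N))"
    using N by (simp add: ln_realpow)
  also have "\<dots> \<le> exp (- 4) * (\<Sum>n\<in>{N..<N\<^sup>2}. 1 / real n)"
    using N by (intro mult_left_mono sum_inverse_ge_ln) auto
  also have "\<dots> = (\<Sum>n\<in>{N..<N\<^sup>2}. exp (- 4) * (1 / real n))" by (rule sum_distrib_left)
  also have "\<dots> \<le> (\<Sum>n\<in>{N..<N\<^sup>2}. real n powr (- 2 * Re w))"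
  proof (rule sum_mono)
    fix n assume n: "n \<in> {N..<N\<^sup>2}"
    hence n0: "real n > 0" using N by auto
    have "ln (real n) \<le> ln (real (N\<^sup>2))" using n n0 by (intro ln_mono) (auto simp del: of_nat_power)
    also have "\<dots> \<le> 2 / r" using N by (simp add: ln_realpow)
    finally have "r * ln (real n) \<le> 2" using r by (simp add: field_simps)
    hence "exp (- 4) \<le> exp (- 2 * r * ln (real n))" by simp
    also have "\<dots> = real n powr (- 2 * r)" using n0 by (simp add: powr_def)
    finally have "exp (- 4) * (1 / real n) \<le> real n powr (- 2 * r) * (1 / real n)" by (rule mult_right_mono) simp
    also have "\<dots> = real n powr (- 2 * r) * real n powr (- 1)" using n0 by (simp add: powr_minus_divide)
    also have "\<dots> = real n powr (- 2 * Re w)" unfolding powr_add[symmetric] by (rule arg_cong[where f = "\<lambda>y. real n powr y"]) (simp add: r_def)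
    finally show "exp (- 4) * (1 / real n) \<le> real n powr (- 2 * Re w)" .
  qed
  finally show ?thesis by (simp add: N_def test_mass_def)
qed

lemma test_mass_bounds: "exp (- 4) \<le> test_mass w" "0 < test_mass w" "exp (- 2) \<le> sqrt (test_mass w)"
proof -
  have "exp (- 4) * 1 \<le> exp (- 4) * ln (real (test_start w))" using test_start_bounds by (intro mult_left_mono) auto
  thus 1: "exp (- 4) \<le> test_mass w" using test_mass_ge by linarith
  thus "0 < test_mass w" using exp_gt_zero[of "-4"] by linarith
  have "(exp (- 2) :: real)\<^sup>2 = exp (- 4)" by (simp add: exp_double[symmetric])
  thus "exp (- 2) \<le> sqrt (test_mass w)" using 1 by (intro real_le_rsqrt) simp
qed

lemma sum_test_range:
  fixes f :: "nat \<Rightarrow> 'a::comm_monoid_add"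
  shows "(\<Sum>n<(test_start w)\<^sup>2. if Suc n \<in> {test_start w..<(test_start w)\<^sup>2} then f (Suc n) else 0) =
    (\<Sum>n\<in>{test_start w..<(test_start w)\<^sup>2}. f n)"
proof -
  have "(\<Sum>n<(test_start w)\<^sup>2. if Suc n \<in> {test_start w..<(test_start w)\<^sup>2} then f (Suc n) else 0) =
     (\<Sum>n\<in>{n. Suc n \<in> {test_start w..<(test_start w)\<^sup>2}}. f (Suc n))"
    by (intro sum.mono_neutral_cong_right) auto
  also have "\<dots> = (\<Sum>n\<in>{test_start w..<(test_start w)\<^sup>2}. f n)"
    by (rule sum.reindex_bij_witness[of _ "\<lambda>n. n - 1" Suc]) (use test_start_bounds(3) in auto)
  finally show ?thesis .
qed

lemma test_coeff_zero: "n > (test_start w)\<^sup>2 \<Longrightarrow> test_coeff w n = 0"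
  by (simp add: test_coeff_def)

lemma test_coeff_h2: "h2 (test_coeff w)" "h2norm (test_coeff w) = 1"
proof -
  define N where "N = test_start w"
  have z: "(norm (test_coeff w (Suc n)))\<^sup>2 = 0" if "n \<notin> {..<N\<^sup>2}" for n using that test_coeff_zero[of "Suc n"] by (simp add: N_def)
  show "h2 (test_coeff w)" unfolding h2_def by (rule summable_finite[of "{..<N\<^sup>2}"]) (use z in auto)
  have "(\<Sum>n. (norm (test_coeff w (Suc n)))\<^sup>2) = (\<Sum>n<N\<^sup>2. (norm (test_coeff w (Suc n)))\<^sup>2)"
    by (rule suminf_finite) (use z in auto)
  also have "\<dots> = (\<Sum>n<N\<^sup>2. if Suc n \<in> {N..<N\<^sup>2} then real (Suc n) powr (- 2 * Re w) / test_mass w else 0)"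
  proof (rule sum.cong[OF refl])
    fix n
    have "(real (Suc n) powr (- Re w))\<^sup>2 = real (Suc n) powr (- 2 * Re w)"
      unfolding power2_eq_square powr_add[symmetric] by simp
    thus "(norm (test_coeff w (Suc n)))\<^sup>2 = (if Suc n \<in> {N..<N\<^sup>2} then real (Suc n) powr (- 2 * Re w) / test_mass w else 0)"
      using test_mass_bounds(2)
      by (simp add: test_coeff_def N_def norm_divide norm_Suc_powr power_divide del: of_nat_Suc)
  qed
  also have "\<dots> = (\<Sum>n\<in>{N..<N\<^sup>2}. real n powr (- 2 * Re w) / test_mass w)"
    unfolding N_def by (rule sum_test_range)
  also have "\<dots> = 1" using test_mass_bounds(2) unfolding test_mass_def N_def by (simp add: sum_divide_distrib[symmetric])
  finally show "h2norm (test_coeff w) = 1" by (simp add: h2norm_def)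
qed

lemma deriv_test:
  "deriv (dirichlet (test_coeff w)) z = (\<Sum>n\<in>{test_start w..<(test_start w)\<^sup>2}.
     - of_real (ln (real n)) * (of_nat n powr (- cnj w) / of_real (sqrt (test_mass w))) * of_nat n powr (- z))"
proof -
  have "deriv (dirichlet (test_coeff w)) z = dpoly ((test_start w)\<^sup>2) (\<lambda>n. - of_real (ln (real (Suc n))) * test_coeff w (Suc n)) z"
    by (rule deriv_dirichlet_finite[OF test_coeff_zero])
  also have "\<dots> = (\<Sum>n<(test_start w)\<^sup>2. if Suc n \<in> {test_start w..<(test_start w)\<^sup>2} then
     - of_real (ln (real (Suc n))) * (of_nat (Suc n) powr (- cnj w) / of_real (sqrt (test_mass w))) * of_nat (Suc n) powr (- z) else 0)"
    unfolding dpoly_def by (intro sum.cong refl) (simp add: test_coeff_def del: of_nat_Suc)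
  also have "\<dots> = (\<Sum>n\<in>{test_start w..<(test_start w)\<^sup>2}.
     - of_real (ln (real n)) * (of_nat n powr (- cnj w) / of_real (sqrt (test_mass w))) * of_nat n powr (- z))"
    by (rule sum_test_range[where f = "\<lambda>n. - of_real (ln (real n)) * (of_nat n powr (- cnj w) / of_real (sqrt (test_mass w))) * of_nat n powr (- z)"])
  finally show ?thesis .
qed

text \<open>At \<open>w\<close> all terms of the derivative have the same sign, so its modulus is at
  least \<open>ln N * sqrt (test_mass w)\<close>. The 8 is the cube of the 2 in
  \<open>1 / (2 * r) \<le> ln N\<close>, and \<open>exp 4\<close> comes from
  \<open>test_mass_ge\<close>.\<close>

lemma norm_deriv_test_ge: "1 \<le> 8 * exp 4 * (Re w - 1/2) ^ 3 * (norm (deriv (dirichlet (test_coeff w)) w))\<^sup>2"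
proof -
  define N where "N = test_start w"
  define r where "r = Re w - 1/2"
  have r: "0 < r" using w by (auto simp: r_def)
  have m0: "test_mass w > 0" by (rule test_mass_bounds)
  have "- deriv (dirichlet (test_coeff w)) w = of_real (\<Sum>n\<in>{N..<N\<^sup>2}. ln (real n) * real n powr (- 2 * Re w) / sqrt (test_mass w))"
    unfolding deriv_test N_def[symmetric] of_real_sum sum_negf[symmetric]
  proof (rule sum.cong[OF refl])
    fix n
    have "(of_nat n :: complex) powr (- cnj w) * of_nat n powr (- w) = of_nat n powr (of_real (- 2 * Re w))"
      unfolding powr_add[symmetric] by (rule arg_cong[where f = "\<lambda>x. _ powr x"]) (simp add: complex_eq_iff)
    also have "\<dots> = of_real (real n powr (- 2 * Re w))"
      using powr_of_real[of "real n" "- 2 * Re w"] by (simp only: of_real_of_nat_eq of_nat_0_le_iff)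
    finally have pw: "(of_nat n :: complex) powr (- cnj w) * of_nat n powr (- w) = of_real (real n powr (- 2 * Re w))" .
    have "- (- of_real (ln (real n)) * (of_nat n powr (- cnj w) / of_real (sqrt (test_mass w))) * of_nat n powr (- w)) =
        of_real (ln (real n)) * ((of_nat n :: complex) powr (- cnj w) * of_nat n powr (- w)) / of_real (sqrt (test_mass w))"
      by (simp add: mult.assoc)
    thus "- (- of_real (ln (real n)) * (of_nat n powr (- cnj w) / of_real (sqrt (test_mass w))) * of_nat n powr (- w)) =
        of_real (ln (real n) * real n powr (- 2 * Re w) / sqrt (test_mass w))"
      unfolding pw by (simp only: of_real_mult of_real_divide)
  qed
  hence "norm (- deriv (dirichlet (test_coeff w)) w) =
      \<bar>\<Sum>n\<in>{N..<N\<^sup>2}. ln (real n) * real n powr (- 2 * Re w) / sqrt (test_mass w)\<bar>" by (simp only: norm_of_real)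
  also have "\<dots> \<ge> (\<Sum>n\<in>{N..<N\<^sup>2}. ln (real N) * real n powr (- 2 * Re w) / sqrt (test_mass w))"
    by (rule order_trans[OF sum_mono abs_ge_self], intro divide_right_mono mult_right_mono)
       (use test_start_bounds(3) m0 in \<open>auto simp: N_def\<close>)
  also have "(\<Sum>n\<in>{N..<N\<^sup>2}. ln (real N) * real n powr (- 2 * Re w) / sqrt (test_mass w)) = ln (real N) * sqrt (test_mass w)"
    unfolding sum_divide_distrib[symmetric] sum_distrib_left[symmetric] N_def test_mass_def[symmetric]
    using m0 by (simp add: real_div_sqrt flip: times_divide_eq_right)
  finally have ge: "ln (real N) * sqrt (test_mass w) \<le> norm (deriv (dirichlet (test_coeff w)) w)" by simp
  have l: "1 / (2 * r) \<le> ln (real N)" "ln (real N) > 0" using test_start_bounds by (auto simp: r_def N_def)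
  have "1 = 8 * r ^ 3 * (1 / (2 * r)) ^ 3" using r by (simp add: power_divide power_mult_distrib)
  also have "\<dots> \<le> 8 * r ^ 3 * ln (real N) ^ 3" using r l by (intro mult_left_mono power_mono) auto
  also have "\<dots> = 8 * exp 4 * r ^ 3 * ((ln (real N))\<^sup>2 * (exp (- 4) * ln (real N)))"
    by (simp add: exp_minus field_simps power2_eq_square power3_eq_cube)
  also have "\<dots> \<le> 8 * exp 4 * r ^ 3 * ((ln (real N))\<^sup>2 * test_mass w)"
    using r test_mass_ge by (intro mult_left_mono) (auto simp: N_def)
  also have "\<dots> = 8 * exp 4 * r ^ 3 * (ln (real N) * sqrt (test_mass w))\<^sup>2" using m0 by (simp add: power_mult_distrib)
  also have "\<dots> \<le> 8 * exp 4 * r ^ 3 * (norm (deriv (dirichlet (test_coeff w)) w))\<^sup>2"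
    using r l m0 ge by (intro mult_left_mono power_mono) auto
  finally show ?thesis by (simp add: r_def)
qed

text \<open>The normalising factor is at most \<open>exp 2\<close>, so at a fixed distance from the
  line of real part 1/2 the derivative is dominated by a block of one fixed convergent
  series.\<close>

lemma norm_deriv_test_le:
  assumes z: "Re z \<ge> 1/2 + x"
  shows "norm (deriv (dirichlet (test_coeff w)) z) \<le>
    exp 2 * (\<Sum>n\<in>{test_start w..<(test_start w)\<^sup>2}. ln (real n) * real n powr (- 1 - x))"
  unfolding deriv_test sum_distrib_left
proof (rule order_trans[OF norm_sum sum_mono])
  fix n assume n: "n \<in> {test_start w..<(test_start w)\<^sup>2}"
  hence n1: "n \<ge> 1" "real n \<ge> 1" using test_start_bounds(3) by auto
  have np: "norm (of_nat n powr (- s) :: complex) = real n powr (- Re s)" for s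
    using norm_powr_real_powr[of "of_nat n" "- s"] by simp
  have s: "1 / sqrt (test_mass w) \<le> exp 2"
  proof -
    have "1 / sqrt (test_mass w) \<le> 1 / exp (- 2)" using test_mass_bounds(3) test_mass_bounds(2) by (intro divide_left_mono) auto
    also have "1 / exp (- 2 :: real) = exp 2" by (simp add: exp_minus field_simps)
    finally show ?thesis .
  qed
  have "norm (- of_real (ln (real n)) * (of_nat n powr (- cnj w) / of_real (sqrt (test_mass w))) * of_nat n powr (- z) :: complex) =
     (1 / sqrt (test_mass w)) * (ln (real n) * (real n powr (- Re w) * real n powr (- Re z)))"
    using n1 test_mass_bounds(2) by (simp add: norm_mult norm_divide np)
  also have "\<dots> \<le> exp 2 * (ln (real n) * (real n powr (- 1/2) * real n powr (- 1/2 - x)))"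
    using s n1 w z by (intro mult_mono mult_nonneg_nonneg powr_mono) auto
  also have "real n powr (- 1/2) * real n powr (- 1/2 - x) = real n powr (- 1 - x)"
    unfolding powr_add[symmetric] by simp
  finally show "norm (- of_real (ln (real n)) * (of_nat n powr (- cnj w) / of_real (sqrt (test_mass w))) * of_nat n powr (- z) :: complex)
    \<le> exp 2 * (ln (real n) * real n powr (- 1 - x))" .
qed

end

section \<open>Weak convergence of the test functions and the compact case\<close>

lemma summable_ln_powr:
  assumes x: "x > 0" shows "summable (\<lambda>n. ln (real n) * real n powr (- 1 - x))"
proof (rule summable_comparison_test'[of "\<lambda>n. (2 / x) * real n powr (- 1 - x/2)" 1])
  show "summable (\<lambda>n. (2 / x) * real n powr (- 1 - x/2))" using x by (intro summable_mult) (simp add: summable_real_powr_iff)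
  fix n :: nat assume n: "n \<ge> 1"
  have "(x/2) * ln (real n) = ln (real n powr (x/2))" using n by (simp add: ln_powr)
  also have "\<dots> \<le> real n powr (x/2)" using n by (intro order_trans[OF ln_le_minus_one]) auto
  finally have "ln (real n) \<le> (2 / x) * real n powr (x/2)" using x by (simp add: field_simps)
  hence "ln (real n) * real n powr (- 1 - x) \<le> (2 / x) * real n powr (x/2) * real n powr (- 1 - x)" by (intro mult_right_mono) auto
  also have "(2 / x) * real n powr (x/2) * real n powr (- 1 - x) = (2 / x) * real n powr (- 1 - x/2)"
    unfolding mult.assoc powr_add[symmetric] by (rule arg_cong[where f = "\<lambda>y. 2 / x * real n powr y"]) simp
  finally show "norm (ln (real n) * real n powr (- 1 - x)) \<le> (2 / x) * real n powr (- 1 - x/2)" using n by simp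
qed

text \<open>The block starts at \<open>test_start w\<close>, which tends to infinity as
  \<open>Re w\<close> tends to 1/2, so its sum is a late section of a convergent series. This is the
  form of weak convergence to 0 that compactness exploits.\<close>

lemma deriv_test_small:
  assumes x: "x > 0" and e: "e > 0"
  obtains \<eta> where "\<eta> > 0" "\<And>w z. 1/2 < Re w \<Longrightarrow> Re w < 1/2 + \<eta> \<Longrightarrow> Re z \<ge> 1/2 + x \<Longrightarrow>
    norm (deriv (dirichlet (test_coeff w)) z) \<le> e"
proof -
  have e2: "e / exp 2 > 0" using e by simp
  obtain N0 where N0: "\<forall>m\<ge>N0. \<forall>n. norm (\<Sum>n\<in>{m..<n}. ln (real n) * real n powr (- 1 - x)) < e / exp 2"
    using summable_ln_powr[OF x, unfolded summable_Cauchy] e2 by blast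
  \<comment> \<open>Small enough for the lower bound in \<open>test_start_bounds\<close> to give
    \<open>ln (test_start w) \<ge> N0 + 1\<close>.\<close>
  define \<eta> where "\<eta> = 1 / (2 * (real N0 + 1))"
  have \<eta>: "\<eta> > 0" "\<eta> \<le> 1/2" by (auto simp: \<eta>_def field_simps)
  show ?thesis
  proof (rule that[OF \<eta>(1)])
    fix w z assume w: "1/2 < Re w" "Re w < 1/2 + \<eta>" and z: "Re z \<ge> 1/2 + x"
    have w1: "Re w \<le> 1" using w \<eta> by linarith
    have "real N0 + 1 = 1 / (2 * \<eta>)" by (simp add: \<eta>_def)
    also have "\<dots> \<le> 1 / (2 * (Re w - 1/2))" using w \<eta> by (intro divide_left_mono mult_pos_pos) auto
    also have "\<dots> \<le> ln (real (test_start w))" by (rule test_start_bounds(1)[OF w(1) w1])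
    also have "\<dots> \<le> real (test_start w)" using test_start_bounds(3)[OF w(1) w1] by (intro order_trans[OF ln_le_minus_one]) auto
    finally have "test_start w \<ge> N0" by linarith
    hence "norm (\<Sum>n\<in>{test_start w..<(test_start w)\<^sup>2}. ln (real n) * real n powr (- 1 - x)) < e / exp 2" using N0 by blast
    hence "(\<Sum>n\<in>{test_start w..<(test_start w)\<^sup>2}. ln (real n) * real n powr (- 1 - x)) \<le> e / exp 2" by simp
    hence "exp 2 * (\<Sum>n\<in>{test_start w..<(test_start w)\<^sup>2}. ln (real n) * real n powr (- 1 - x)) \<le> e"
      by (simp add: pos_le_divide_eq mult.commute)
    thus "norm (deriv (dirichlet (test_coeff w)) z) \<le> e" using norm_deriv_test_le[OF w(1) w1 z] by linarith
  qed
qed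

text \<open>\<open>32 = 4 * 8\<close> turns the smallness assumption into
  \<open>\<beta> \<le> 1/4\<close>, and \<open>400 = 50 * 8\<close>; the 8 is that of
  \<open>norm_deriv_test_ge\<close>.\<close>

lemma mean_counting_cubic_bound:
  assumes G: "G0 \<Phi> c" and w: "1/2 < Re w" "Re w \<le> 1" "w \<noteq> c 1" and b: "DPhi_image \<Phi> (test_coeff w) b"
    and small: "32 * exp 4 * (Re w - 1/2) ^ 3 * (h2norm b)\<^sup>2 \<le> 1"
  shows "0 \<le> mean_counting \<Phi> w" "mean_counting \<Phi> w \<le> 400 * pi * exp 4 * (h2norm b)\<^sup>2 * (Re w - 1/2) ^ 3"
proof -
  define r where "r = Re w - 1/2"
  define q where "q = norm (deriv (dirichlet (test_coeff w)) w)"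
  define \<beta> where "\<beta> = (h2norm b / q)\<^sup>2"
  have ge: "1 \<le> 8 * exp 4 * r ^ 3 * q\<^sup>2" unfolding r_def q_def by (rule norm_deriv_test_ge[OF w(1,2)])
  have q: "q \<noteq> 0" using ge by auto
  have "1 / q\<^sup>2 \<le> 8 * exp 4 * r ^ 3" using ge q by (simp add: divide_le_eq)
  from mult_right_mono[OF this, of "(h2norm b)\<^sup>2"]
  have \<beta>: "\<beta> \<le> 8 * exp 4 * r ^ 3 * (h2norm b)\<^sup>2" by (simp add: \<beta>_def power_divide)
  have \<beta>4: "\<beta> \<le> 1/4" using \<beta> small unfolding r_def by linarith
  have q': "deriv (dirichlet (test_coeff w)) w \<noteq> 0" using q by (simp add: q_def)
  note B = mean_counting_test_bound[OF G w(1,3) test_coeff_zero[OF w(1,2)] b q' \<beta>_def[unfolded q_def] \<beta>4]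
  show "0 \<le> mean_counting \<Phi> w" by (rule B(1))
  have "mean_counting \<Phi> w \<le> 50 * pi * \<beta>" by (rule B(2))
  also have "\<dots> \<le> 50 * pi * (8 * exp 4 * r ^ 3 * (h2norm b)\<^sup>2)" using \<beta> by (intro mult_left_mono) auto
  finally show "mean_counting \<Phi> w \<le> 400 * pi * exp 4 * (h2norm b)\<^sup>2 * (Re w - 1/2) ^ 3" by (simp add: r_def mult_ac)
qed

text \<open>Along counterexamples with \<open>Re w\<close> tending to 1/2, a subsequence of the
  images converges in norm to some \<open>g\<close>. Norm convergence implies pointwise convergence
  on \<open>Re s \<ge> 1\<close>, where the images tend to 0 because \<open>\<Phi> s\<close> is a
  fixed point of real part above 1/2. So the coefficients of \<open>g\<close> vanish, although all
  norms exceed \<open>e\<close>.\<close>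

lemma compact_image_small:
  assumes G: "G0 \<Phi> c" and K: "DPhi_compact \<Phi>" and e: "e > 0"
  obtains \<eta> where "\<eta> > 0" "\<And>w. 1/2 < Re w \<Longrightarrow> Re w < 1/2 + \<eta> \<Longrightarrow>
    \<exists>b. DPhi_image \<Phi> (test_coeff w) b \<and> h2norm b \<le> e"
proof (rule ccontr)
  note obt = that
  assume nt: "\<not> thesis"
  have neg: "\<exists>w. 1/2 < Re w \<and> Re w < 1/2 + \<eta> \<and> (\<forall>b. DPhi_image \<Phi> (test_coeff w) b \<longrightarrow> \<not> h2norm b \<le> e)" if "\<eta> > 0" for \<eta>
    using that obt[of \<eta>] nt by blast
  \<comment> \<open>The shift by 2 ensures \<open>Re (w k) \<le> 1\<close>, the range in which the
    test functions are studied.\<close>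
  have "\<forall>k. \<exists>w. 1/2 < Re w \<and> Re w < 1/2 + 1 / real (k + 2) \<and> (\<forall>b. DPhi_image \<Phi> (test_coeff w) b \<longrightarrow> \<not> h2norm b \<le> e)"
    by (intro allI neg) simp
  from choice[OF this] obtain w where w: "\<forall>k. 1/2 < Re (w k) \<and> Re (w k) < 1/2 + 1 / real (k + 2) \<and>
    (\<forall>b. DPhi_image \<Phi> (test_coeff (w k)) b \<longrightarrow> \<not> h2norm b \<le> e)" ..
  have w1: "1/2 < Re (w k)" "Re (w k) \<le> 1" for k
  proof -
    have "1 / real (k + 2) \<le> 1/2" by (simp add: field_simps)
    moreover have "1/2 < Re (w k)" "Re (w k) < 1/2 + 1 / real (k + 2)" using w by auto
    ultimately show "1/2 < Re (w k)" "Re (w k) \<le> 1" by linarith+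
  qed
  obtain C where C: "\<forall>a. h2 a \<longrightarrow> (\<exists>b. DPhi_image \<Phi> a b \<and> h2norm b \<le> C * h2norm a)"
    using K unfolding DPhi_compact_def DPhi_bounded_def by blast
  have "\<forall>k. \<exists>b. DPhi_image \<Phi> (test_coeff (w k)) b" using C test_coeff_h2(1)[OF w1] by blast
  from choice[OF this] obtain B where B: "\<forall>k. DPhi_image \<Phi> (test_coeff (w k)) (B k)" ..
  have big: "h2norm (B k) > e" for k using w B by (meson not_le)
  have "\<forall>k. h2 (test_coeff (w k)) \<and> h2norm (test_coeff (w k)) \<le> 1 \<and> DPhi_image \<Phi> (test_coeff (w k)) (B k)"
    using test_coeff_h2[OF w1] B by simp
  with K[unfolded DPhi_compact_def, THEN conjunct2, rule_format, of "\<lambda>k. test_coeff (w k)" B]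
  obtain r g where r: "strict_mono r" and g: "h2 g" and lim: "(\<lambda>k. h2norm (\<lambda>n. B (r k) n - g n)) \<longlonglongrightarrow> 0" by blast
  have h2B: "h2 (B k)" for k using B by (simp add: DPhi_image_def)
  have "dirichlet g s = 0" if s: "Re s \<ge> 1" for s
  proof (rule LIMSEQ_unique)
    show "(\<lambda>k. dirichlet (B (r k)) s) \<longlonglongrightarrow> dirichlet g s"
    proof (rule LIM_zero_cancel, rule Lim_null_comparison[OF always_eventually])
      show "\<forall>k. norm (dirichlet (B (r k)) s - dirichlet g s) \<le> sqrt 2 * h2norm (\<lambda>n. B (r k) n - g n)"
        using norm_dirichlet_diff_le[OF h2B g s] by blast
      show "(\<lambda>k. sqrt 2 * h2norm (\<lambda>n. B (r k) n - g n)) \<longlonglongrightarrow> 0" using tendsto_mult_left[OF lim, of "sqrt 2"] by simp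
    qed
    define x where "x = Re (\<Phi> s) - 1/2"
    have x: "x > 0" using G s by (simp add: x_def G0_def)
    show "(\<lambda>k. dirichlet (B (r k)) s) \<longlonglongrightarrow> 0"
    proof (rule LIMSEQ_I)
      fix d :: real assume d: "d > 0"
      hence d2: "d / 2 > 0" by simp
      obtain \<eta> where \<eta>: "\<eta> > 0" "\<And>w z. 1/2 < Re w \<Longrightarrow> Re w < 1/2 + \<eta> \<Longrightarrow> Re z \<ge> 1/2 + x \<Longrightarrow>
        norm (deriv (dirichlet (test_coeff w)) z) \<le> d / 2" using deriv_test_small[OF x d2] by blast
      obtain k0 where k0: "1 / real (Suc k0) < \<eta>" using nat_approx_posE[OF \<eta>(1)] by blast
      have "norm (dirichlet (B (r k)) s - 0) < d" if k: "k \<ge> k0" for k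
      proof -
        have "k0 \<le> r k" using seq_suble[OF r, of k] k by linarith
        hence "1 / real (r k + 2) \<le> 1 / real (Suc k0)" by (intro divide_left_mono) auto
        moreover have "Re (w (r k)) < 1/2 + 1 / real (r k + 2)" using w by blast
        ultimately have "Re (w (r k)) < 1/2 + \<eta>" using k0 by linarith
        from \<eta>(2)[OF w1(1) this, of "\<Phi> s"] have "norm (deriv (dirichlet (test_coeff (w (r k)))) (\<Phi> s)) \<le> d / 2" by (simp add: x_def)
        moreover have "dirichlet (B (r k)) s = deriv (dirichlet (test_coeff (w (r k)))) (\<Phi> s)"
          using B s by (simp add: DPhi_image_def)
        ultimately show ?thesis using d by simp
      qed
      thus "\<exists>no. \<forall>k\<ge>no. norm (dirichlet (B (r k)) s - 0) < d" by blast
    qed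
  qed
  hence "g (Suc n) = 0" for n by (rule dirichlet_zero_imp_coeff_zero[OF g])
  hence "(\<lambda>k. h2norm (B (r k))) \<longlonglongrightarrow> 0" using lim by (simp add: h2norm_def)
  from order_tendstoD(2)[OF this e] obtain k where "h2norm (B (r k)) < e"
    using eventually_happens'[OF sequentially_bot] by blast
  thus False using big[of "r k"] by simp
qed

theorem theorem2p3:
  fixes \<Phi> :: "complex \<Rightarrow> complex" and c :: "nat \<Rightarrow> complex"
  assumes "G0 \<Phi> c"
    and "DPhi_bounded \<Phi>"
  shows "(\<forall>\<delta>>0. \<exists>C. \<forall>w. Re w > 1/2 \<and> w \<notin> ball (c 1) \<delta> \<longrightarrow>
            mean_counting \<Phi> w / (Re w - 1/2) ^ 3 < C) \<and>
         (DPhi_compact \<Phi> \<longrightarrow>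
            (\<forall>\<epsilon>>0. \<exists>\<eta>>0. \<forall>w. 1/2 < Re w \<and> Re w < 1/2 + \<eta> \<and> w \<noteq> c 1 \<longrightarrow>
               \<bar>mean_counting \<Phi> w / (Re w - 1/2) ^ 3\<bar> < \<epsilon>))"
proof (intro conjI impI allI)
  note G = assms(1)
  fix \<delta> :: real assume d: "\<delta> > 0"
  obtain C where C: "\<forall>a. h2 a \<longrightarrow> (\<exists>b. DPhi_image \<Phi> a b \<and> h2norm b \<le> C * h2norm a)"
    using assms(2) unfolding DPhi_bounded_def by blast
  obtain C1 where C1: "C1 > 0" "\<And>w. Re w > 1/2 \<Longrightarrow> w \<notin> ball (c 1) \<delta> \<Longrightarrow> mean_counting \<Phi> w \<le> C1 * (Re w - 1/2)"
    using mean_counting_linear_bound[OF G d] by blast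
  \<comment> \<open>Chosen so that \<open>Re w - 1/2 \<le> 1 / D\<close> implies the smallness
    condition of \<open>mean_counting_cubic_bound\<close>. The summand 1 gives
    \<open>D \<ge> 2\<close>, hence \<open>r0 \<le> 1/2\<close> and
    \<open>Re w \<le> 1\<close>.\<close>
  define D where "D = 32 * exp 4 * (C\<^sup>2 + 1)"
  have D: "D \<ge> 2"
  proof -
    have "1 * 1 \<le> exp 4 * (C\<^sup>2 + 1)" by (intro mult_mono) auto
    thus ?thesis by (simp add: D_def)
  qed
  define r0 where "r0 = 1 / D"
  have r0: "r0 > 0" "r0 \<le> 1/2" using D by (auto simp: r0_def field_simps)
  have main: "mean_counting \<Phi> w / (Re w - 1/2) ^ 3 \<le> 400 * pi * exp 4 * C\<^sup>2 + C1 / r0\<^sup>2"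
    if w: "Re w > 1/2" "w \<notin> ball (c 1) \<delta>" for w
  proof (cases "Re w - 1/2 \<le> r0")
    case True
    define r where "r = Re w - 1/2"
    have r: "0 < r" "r \<le> r0" "r \<le> 1" using w True r0 by (auto simp: r_def)
    have w1: "Re w \<le> 1" "w \<noteq> c 1" using True r0 w d by auto
    obtain b where b: "DPhi_image \<Phi> (test_coeff w) b" "h2norm b \<le> C"
      using C test_coeff_h2[OF w(1) w1(1)] by fastforce
    have "h2norm b \<ge> 0" using b by (intro h2norm_nonneg) (simp add: DPhi_image_def)
    hence bC: "(h2norm b)\<^sup>2 \<le> C\<^sup>2" using b by (intro power_mono) auto
    have "32 * exp 4 * r ^ 3 * (h2norm b)\<^sup>2 \<le> 32 * exp 4 * r0 * (C\<^sup>2 + 1)"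
    proof (intro mult_mono mult_nonneg_nonneg)
      have "r * r\<^sup>2 \<le> r0 * 1" using r by (intro mult_mono) (auto simp: power_le_one)
      thus "r ^ 3 \<le> r0" by (simp add: power3_eq_cube power2_eq_square mult.assoc)
    qed (use bC r r0 in auto)
    also have "\<dots> = r0 * D" by (simp add: D_def)
    also have "\<dots> = 1" using D by (simp add: r0_def)
    finally have small: "32 * exp 4 * (Re w - 1/2) ^ 3 * (h2norm b)\<^sup>2 \<le> 1" by (simp add: r_def)
    have "mean_counting \<Phi> w \<le> 400 * pi * exp 4 * (h2norm b)\<^sup>2 * r ^ 3"
      unfolding r_def by (rule mean_counting_cubic_bound(2)[OF G w(1) w1 b(1) small])
    also have "\<dots> \<le> 400 * pi * exp 4 * C\<^sup>2 * r ^ 3" using bC r by (intro mult_right_mono mult_left_mono) auto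
    finally have "mean_counting \<Phi> w / r ^ 3 \<le> 400 * pi * exp 4 * C\<^sup>2" using r by (simp add: divide_le_eq)
    moreover have "0 \<le> C1 / r0\<^sup>2" using C1 by simp
    ultimately show ?thesis unfolding r_def by linarith
  next
    case False
    define r where "r = Re w - 1/2"
    have r: "r > r0" "r > 0" using False r0 by (auto simp: r_def)
    \<comment> \<open>Here \<open>r\<close> exceeds the fixed number \<open>r0\<close>, so the
      linear bound divided by \<open>r ^ 3\<close> stays bounded.\<close>
    have "mean_counting \<Phi> w / r ^ 3 \<le> C1 * r / r ^ 3" using C1(2)[OF w] r by (intro divide_right_mono) (auto simp: r_def)
    also have "\<dots> = C1 / r\<^sup>2" using r by (simp add: power3_eq_cube power2_eq_square)
    also have "\<dots> \<le> C1 / r0\<^sup>2" using C1 r r0 by (intro divide_left_mono power_mono) auto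
    finally have "mean_counting \<Phi> w / r ^ 3 \<le> C1 / r0\<^sup>2" .
    moreover have "0 \<le> 400 * pi * exp 4 * C\<^sup>2" by simp
    ultimately show ?thesis unfolding r_def by linarith
  qed
  show "\<exists>C. \<forall>w. Re w > 1/2 \<and> w \<notin> ball (c 1) \<delta> \<longrightarrow> mean_counting \<Phi> w / (Re w - 1/2) ^ 3 < C"
    using main by (intro exI[of _ "400 * pi * exp 4 * C\<^sup>2 + C1 / r0\<^sup>2 + 1"]) (use main in \<open>fastforce simp del: mem_ball\<close>)
next
  note G = assms(1)
  fix \<epsilon> :: real assume K: "DPhi_compact \<Phi>" and \<epsilon>: "\<epsilon> > 0"
  \<comment> \<open>The first entry secures the smallness condition when
    \<open>Re w \<le> 1\<close>; the second makes the cubic bound \<open>\<epsilon> / 2\<close>,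
    which leaves room for the strict inequality.\<close>
  define e where "e = sqrt (min (1 / (32 * exp 4)) (\<epsilon> / (800 * pi * exp 4)))"
  have e: "e > 0" using \<epsilon> by (simp add: e_def)
  have e2: "e\<^sup>2 \<le> 1 / (32 * exp 4)" "e\<^sup>2 \<le> \<epsilon> / (800 * pi * exp 4)" using \<epsilon> by (auto simp: e_def)
  obtain \<eta> where \<eta>: "\<eta> > 0" "\<And>w. 1/2 < Re w \<Longrightarrow> Re w < 1/2 + \<eta> \<Longrightarrow>
    \<exists>b. DPhi_image \<Phi> (test_coeff w) b \<and> h2norm b \<le> e" using compact_image_small[OF G K e] by blast
  have "\<bar>mean_counting \<Phi> w / (Re w - 1/2) ^ 3\<bar> < \<epsilon>"
    if w: "1/2 < Re w" "Re w < 1/2 + min \<eta> (1/2)" "w \<noteq> c 1" for w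
  proof -
    define r where "r = Re w - 1/2"
    have r: "0 < r" "r \<le> 1" "Re w \<le> 1" "Re w < 1/2 + \<eta>" using w by (auto simp: r_def)
    obtain b where b: "DPhi_image \<Phi> (test_coeff w) b" "h2norm b \<le> e" using \<eta>(2)[OF w(1) r(4)] by blast
    have "h2norm b \<ge> 0" using b by (intro h2norm_nonneg) (simp add: DPhi_image_def)
    hence be: "(h2norm b)\<^sup>2 \<le> e\<^sup>2" using b by (intro power_mono) auto
    have "32 * exp 4 * r ^ 3 * (h2norm b)\<^sup>2 \<le> 32 * exp 4 * 1 * (1 / (32 * exp 4))"
      using be e2(1) r by (intro mult_mono) (auto simp: power_le_one)
    hence small: "32 * exp 4 * (Re w - 1/2) ^ 3 * (h2norm b)\<^sup>2 \<le> 1" by (simp add: r_def)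
    note B = mean_counting_cubic_bound[OF G w(1) r(3) w(3) b(1) small]
    have "mean_counting \<Phi> w \<le> 400 * pi * exp 4 * (\<epsilon> / (800 * pi * exp 4)) * r ^ 3"
      using be e2(2) r by (intro order_trans[OF B(2)[folded r_def]] mult_right_mono mult_left_mono) auto
    also have "400 * pi * exp 4 * (\<epsilon> / (800 * pi * exp 4)) = \<epsilon> / 2" by simp
    finally have "mean_counting \<Phi> w / r ^ 3 \<le> \<epsilon> / 2" using r by (simp add: divide_le_eq)
    moreover have "0 \<le> mean_counting \<Phi> w / r ^ 3" using B(1) r by simp
    ultimately show ?thesis using \<epsilon> unfolding r_def by linarith
  qed
  thus "\<exists>\<eta>>0. \<forall>w. 1/2 < Re w \<and> Re w < 1/2 + \<eta> \<and> w \<noteq> c 1 \<longrightarrow> \<bar>mean_counting \<Phi> w / (Re w - 1/2) ^ 3\<bar> < \<epsilon>"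
    using \<eta>(1) by (intro exI[of _ "min \<eta> (1/2)"]) auto
qed

end
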